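(* Let $E$ be a Lie conformal algebroid over the differential algebra $A$ and let $M$ be a module over $E$. (1) There is an action of $\mathbb F[\partial]$ on the spaces $\widetilde C^k(E,M)$ of basic cochains, $k\ge0$, given by $$(\partial\widetilde\varphi)_{\lambda_1,\dots,\lambda_k}(u_1,\dots,u_k)=(\lambda_1+\dots+\lambda_k+\partial)\,\widetilde\varphi_{\lambda_1,\dots,\lambda_k}(u_1,\dots,u_k),$$ which commutes with the differential: $\widetilde d\circ\partial=\partial\circ\widetilde d$. Hence there is an induced complex $(\overline C^\bullet(E,M),\overline d)$, where $\overline C^k(E,M)=\widetilde C^k(E,M)/\partial\widetilde C^k(E,M)$, $k\ge0$, and $\overline d$ is induced by $\widetilde d$. (2) There is a natural morphism of complexes $p_*:(\widetilde C^\bullet(E,M),\widetilde d)\to(C^\bullet(E,M),d)$ defined by $p_*(\widetilde\varphi)=p\circ\widetilde\varphi$, where $p:M[\lambda_1,\dots,\lambda_k]\to M[\lambda_1,\dots,\lambda_k]/\langle\partial+\lambda_1+\dots+\lambda_k\rangle$ is the canonical quotient map, and the kernel of $p_*$ is $\partial\widetilde C^\bullet(E,M)$. Hence there is an induced injective morphism of complexes $$p_*:(\overline C^\bullet(E,M),\overline d)\to(C^\bullet(E,M),d),$$ which is surjective provided that $E$ is free as a left $A[\partial]$-module.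
   Context: Everything is over a field $\mathbb F$ of characteristic $0$. A differential algebra $A$ is a commutative associative unital algebra with a derivation $\partial$; $A[\partial]$ is the associative algebra of differential operators $a(\partial)=\sum_i a_i\partial^i$ (product = composition), with symbol $a(x)=\sum_ia_ix^i$ and adjoint symbol $a^*(\lambda)=\sum_i(-\lambda-\partial)^i(a_i)\in A[\lambda]$. Substitution convention: in an expression containing a factor $\big(\big|_{x=\partial}f\big)$, expand the whole expression in powers of the commuting indeterminate $x$ and replace each $x^n$ by $\partial^n$ acting only on what is inside that parenthesis (on coefficients, if $f$ is a polynomial). E.g. $a(\lambda+x)\big(\big|_{x=\partial}b\big)c=c\sum_ia_i(\lambda+\partial)^i(b)$. For $\theta_\lambda$ linear, $\theta_\lambda(a(x))=\sum_i\theta_\lambda(a_i)x^i$. $\mathrm{CDer}(A)$ is the space of linear maps $\phi_\lambda:A\to A[\lambda]$ with $\phi_\lambda(\partial a)=(\partial+\lambda)\phi_\lambda(a)$ and $\phi_\lambda(ab)=\phi_\lambda(a)b+a\phi_\lambda(b)$; it is a left $A[\partial]$-module by $(a(\partial)\phi)_\lambda=\big(\big|_{x=\partial}a^*(\lambda)\big)\phi_{\lambda+x}$. A Lie conformal algebra (LCA) is an $\mathbb F[\partial]$-module $E$ with a bilinear $\lambda$-bracket $[\cdot_\lambda\cdot]:E\otimes E\to E[\lambda]$ with: $[\partial u_\lambda v]=-\lambda[u_\lambda v]$, $[u_\lambda\partial v]=(\partial+\lambda)[u_\lambda v]$; $[v_\lambda u]=-\big(\big|_{x=\partial}[u_{-\lambda-x}v]\big)$;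 $[u_\lambda[v_\mu w]]-[v_\mu[u_\lambda w]]=[[u_\lambda v]_{\lambda+\mu}w]$. A Lie conformal algebroid (LCAd) over $A$ is a left $A[\partial]$-module $E$ with a left $A[\partial]$-module homomorphism $\theta:E\to\mathrm{CDer}(A)$ (anchor) and an LCA $\lambda$-bracket such that (i) $[u_\lambda a(\partial)v]=a(\lambda+x)\big(\big|_{x=\partial}[u_\lambda v]\big)+\theta(u)_\lambda(a(x))\big(\big|_{x=\partial}v\big)$, and (ii) $\theta([u_\lambda v])_\mu(a)=\theta(u)_\lambda(\theta(v)_{\mu-\lambda}(a))-\theta(v)_{\mu-\lambda}(\theta(u)_\lambda(a))$. A module over the LCAd $E$ is a left $A[\partial]$-module $M$ with a bilinear $\lambda$-action $E\times M\to M[\lambda]$, $(u,m)\mapsto u_\lambda m$, such that (i) $u_\lambda(a(\partial)m)=a(\lambda+x)\big(\big|_{x=\partial}u_\lambda m\big)+\theta(u)_\lambda(a(x))\big(\big|_{x=\partial}m\big)$; (ii) $(a(\partial)u)_\lambda m=\big(\big|_{x=\partial}a^*(\lambda)\big)(u_{\lambda+x}m)$; (iii) $[u_\lambda v]_\mu m=u_\lambda(v_{\mu-\lambda}m)-v_{\mu-\lambda}(u_\lambda m)$. The space of basic $k$-cochains $\widetilde C^k(E,M)$, $k\ge0$, is the space of linear maps $\widetilde\varphi_{\lambda_1,\dots,\lambda_k}:E^{\otimes k}\to M[\lambda_1,\dots,\lambda_k]$ (so $\widetilde C^0(E,M)=M$) such that $\widetilde\varphi_{\lambda_1,\dots,\lambda_k}(a_1(\partial)u_1,\dots,a_k(\partial)u_k)=\big(\big|_{x_1=\partial}a_1^*(\lambda_1)\big)\cdots\big(\big|_{x_k=\partial}a_k^*(\lambda_k)\big)\widetilde\varphi_{\lambda_1+x_1,\dots,\lambda_k+x_k}(u_1,\dots,u_k)$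 for $a_i(\partial)\in A[\partial]$, and $\widetilde\varphi_{\lambda_1,\dots,\lambda_k}(u_1,\dots,u_k)=\mathrm{sign}(\pi)\,\widetilde\varphi_{\lambda_{\pi(1)},\dots,\lambda_{\pi(k)}}(u_{\pi(1)},\dots,u_{\pi(k)})$ for all $\pi\in S_k$. $C^k(E,M)$ is defined in the same way, but with maps valued in $M[\lambda_1,\dots,\lambda_k]/\langle\partial+\lambda_1+\dots+\lambda_k\rangle$ (quotient by the image of the operator $\partial+\lambda_1+\dots+\lambda_k$; $C^0(E,M)=M/\partial M$) and the conditions understood in this quotient. Both differentials $\widetilde d:\widetilde C^k\to\widetilde C^{k+1}$ and $d:C^k\to C^{k+1}$ are given by $$(d\varphi)_{\lambda_1,\dots,\lambda_{k+1}}(u_1,\dots,u_{k+1})=\sum_{i}(-1)^{i+1}{u_i}_{\lambda_i}\big(\varphi_{\lambda_1,\overset{i}{\check\dots},\lambda_{k+1}}(u_1,\overset{i}{\check\dots},u_{k+1})\big)+\sum_{i<j}(-1)^{i+j}\varphi_{\lambda_i+\lambda_j,\lambda_1,\overset{i}{\check\dots}\overset{j}{\check\dots},\lambda_{k+1}}\big([{u_i}_{\lambda_i}u_j],u_1,\overset{i}{\check\dots}\overset{j}{\check\dots},u_{k+1}\big),$$ where $\overset{i}{\check\dots}$ means the $i$-th entry is omitted; both are well defined and square to zero. *)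

theory Defs
  imports
    "HOL-Computational_Algebra.Polynomial"
    "HOL-Library.Poly_Mapping"
    "HOL-Combinatorics.Permutations"
    "HOL-Algebra.Module"
    "HOL-Algebra.AbelCoset"
begin

section \<open>Differential algebras and differential operators\<close>

locale differential_algebra = vector_space sA
  for sA :: "'f::field_char_0 \<Rightarrow> 'a::comm_ring_1 \<Rightarrow> 'a" +
  fixes dA :: "'a \<Rightarrow> 'a"
  assumes scale_mult: "sA c (a * b) = sA c a * b"
    and deriv_add: "dA (a + b) = dA a + dA b"
    and deriv_scale: "dA (sA c a) = sA c (dA a)"
    and deriv_mult: "dA (a * b) = dA a * b + a * dA b"

text \<open>
  The type \<open>'v poly\<close> is used for \<open>V[\<lambda>]\<close>, with \<open>V\<close> only an abelian group: \<open>pCons 0\<close> is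
  multiplication by \<open>\<lambda>\<close>, and an additive map of \<open>V\<close> acts on coefficients by \<open>map_poly\<close>.
  The next operator is \<open>\<lambda> + \<partial>\<close> on \<open>V[\<lambda>]\<close>.
\<close>

definition lambda_plus :: "('v::ab_group_add \<Rightarrow> 'v) \<Rightarrow> 'v poly \<Rightarrow> 'v poly" where
  "lambda_plus d q = pCons 0 q + map_poly d q"

text \<open>
  \<open>p(\<lambda>) \<mapsto> \<Sum>\<^sub>n (-\<lambda>-\<partial>)\<^sup>n p\<^sub>n\<close>. For \<open>V = A\<close> this sends the symbol \<open>a(x)\<close> to \<open>a\<^sup>*(\<lambda>)\<close>; for \<open>V = E\<close>
  it sends \<open>[u\<^sub>\<lambda> v]\<close> to \<open>|\<^sub>x\<^sub>=\<^sub>\<partial> [u\<^bsub>-\<lambda>-x\<^esub> v]\<close>.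
\<close>

definition adjoint_symbol :: "('v::ab_group_add \<Rightarrow> 'v) \<Rightarrow> 'v poly \<Rightarrow> 'v poly" where
  "adjoint_symbol d p = (\<Sum>n\<le>degree p. ((\<lambda>q. - lambda_plus d q) ^^ n) [:coeff p n:])"

text \<open>
  \<open>A[\<partial>]\<close> is represented by symbols in \<open>'a poly\<close>. Since \<open>\<partial> \<circ> b\<partial>\<^sup>j = b\<partial>\<^bsup>j+1\<^esup> + \<partial>(b)\<partial>\<^sup>j\<close>, left
  multiplication by \<open>\<partial>\<close> is \<open>lambda_plus dA\<close> on symbols, and the composition product
  is the following (it is not the product of \<open>'a poly\<close>).
\<close>

definition dop_mult :: "('a::comm_ring_1 \<Rightarrow> 'a) \<Rightarrow> 'a poly \<Rightarrow> 'a poly \<Rightarrow> 'a poly" where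
  "dop_mult dA p q = (\<Sum>i\<le>degree p. Polynomial.smult (coeff p i) ((lambda_plus dA ^^ i) q))"

locale dop_module =
  fixes dA :: "'a::comm_ring_1 \<Rightarrow> 'a"
    and act :: "'a poly \<Rightarrow> 'v::ab_group_add \<Rightarrow> 'v"
  assumes act_add_left: "act (p + q) v = act p v + act q v"
    and act_add_right: "act p (v + w) = act p v + act p w"
    and act_mult: "act (dop_mult dA p q) v = act p (act q v)"
    and act_one: "act 1 v = v"

definition dact :: "('a::comm_ring_1 poly \<Rightarrow> 'v \<Rightarrow> 'v) \<Rightarrow> 'v \<Rightarrow> 'v" where
  "dact act = act [:0, 1:]"

definition fact_scale :: "('f \<Rightarrow> 'a::comm_ring_1 \<Rightarrow> 'a) \<Rightarrow> ('a poly \<Rightarrow> 'v \<Rightarrow> 'v) \<Rightarrow> 'f \<Rightarrow> 'v \<Rightarrow> 'v" where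
  "fact_scale sA act c = act [:sA c 1:]"

definition free_dop_module :: "('a::comm_ring_1 poly \<Rightarrow> 'v::ab_group_add \<Rightarrow> 'v) \<Rightarrow> bool" where
  "free_dop_module act \<longleftrightarrow>
     (\<exists>B. \<forall>v. \<exists>!c :: 'v \<Rightarrow>\<^sub>0 'a poly.
        Poly_Mapping.keys c \<subseteq> B \<and>
        v = (\<Sum>b\<in>Poly_Mapping.keys c. act (Poly_Mapping.lookup c b) b))"


section \<open>Conformal derivations\<close>

text \<open>
  \<open>(|\<^sub>x\<^sub>=\<^sub>\<partial> a\<^sup>*(\<lambda>)) p(\<lambda>+x) = \<Sum>\<^sub>n (\<lambda>+\<partial>)\<^sup>n(a\<^sup>*(\<lambda>)) p\<^sub>n\<close> for \<open>p \<in> V[\<lambda>]\<close>, where \<open>sc\<close> is the action of \<open>A\<close>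
  on \<open>V\<close>.
\<close>

definition twist ::
  "('a::comm_ring_1 \<Rightarrow> 'a) \<Rightarrow> ('a \<Rightarrow> 'v \<Rightarrow> 'v::ab_group_add) \<Rightarrow> 'a poly \<Rightarrow> 'v poly \<Rightarrow> 'v poly" where
  "twist dA sc a p =
     (\<Sum>n\<le>degree p. map_poly (\<lambda>b. sc b (coeff p n)) ((lambda_plus dA ^^ n) (adjoint_symbol dA a)))"

definition CDer :: "('f \<Rightarrow> 'a::comm_ring_1 \<Rightarrow> 'a) \<Rightarrow> ('a \<Rightarrow> 'a) \<Rightarrow> ('a \<Rightarrow> 'a poly) set" where
  "CDer sA dA =
     {\<phi>. (\<forall>a b. \<phi> (a + b) = \<phi> a + \<phi> b) \<and>
         (\<forall>c a. \<phi> (sA c a) = map_poly (sA c) (\<phi> a)) \<and>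
         (\<forall>a. \<phi> (dA a) = lambda_plus dA (\<phi> a)) \<and>
         (\<forall>a b. \<phi> (a * b) = Polynomial.smult b (\<phi> a) + Polynomial.smult a (\<phi> b))}"

text \<open>
  \<open>a(\<lambda>+x) (|\<^sub>x\<^sub>=\<^sub>\<partial> p) + \<theta>\<^sub>\<lambda>(a(x)) (|\<^sub>x\<^sub>=\<^sub>\<partial> v)\<close> for \<open>p \<in> V[\<lambda>]\<close>, \<open>v \<in> V\<close>: the common right-hand side of
  axiom (i) for algebroids and for their modules.
\<close>

definition anchor_rule ::
  "('a::comm_ring_1 poly \<Rightarrow> 'v \<Rightarrow> 'v::ab_group_add) \<Rightarrow> ('a \<Rightarrow> 'a poly) \<Rightarrow>
   'a poly \<Rightarrow> 'v poly \<Rightarrow> 'v \<Rightarrow> 'v poly" where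
  "anchor_rule act \<theta> a p v =
     (\<Sum>i\<le>degree a. map_poly (act [:coeff a i:]) ((lambda_plus (dact act) ^^ i) p)) +
     (\<Sum>i\<le>degree a. map_poly (\<lambda>b. act [:b:] ((dact act ^^ i) v)) (\<theta> (coeff a i)))"


section \<open>Polynomials in several variables\<close>

text \<open>
  Polynomials in \<open>\<lambda>\<^sub>1, \<lambda>\<^sub>2, \<dots>\<close> with coefficients in an abelian group. Variables are numbered
  from 0, so \<open>\<lambda>\<^sub>i\<close> is number \<open>i - 1\<close>.
\<close>

type_synonym 'v mpoly = "(nat \<Rightarrow>\<^sub>0 nat) \<Rightarrow>\<^sub>0 'v"

abbreviation const_mpoly :: "'v::zero \<Rightarrow> 'v mpoly" where
  "const_mpoly \<equiv> Poly_Mapping.single 0"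

definition mmult :: "(nat \<Rightarrow>\<^sub>0 nat) \<Rightarrow> 'v::ab_group_add mpoly \<Rightarrow> 'v mpoly" where
  "mmult m q = (\<Sum>l\<in>Poly_Mapping.keys q. Poly_Mapping.single (m + l) (Poly_Mapping.lookup q l))"

text \<open>Multiplication by the \<open>i\<close>-th variable.\<close>

definition lam :: "nat \<Rightarrow> 'v::ab_group_add mpoly \<Rightarrow> 'v mpoly" where
  "lam i = mmult (Poly_Mapping.single i 1)"

text \<open>
  Expressions are substituted for variables by means of the operators of multiplication by
  them: \<open>subst1 p T\<close> is \<open>p(T)\<close>, and \<open>subst_mpoly [T\<^sub>0, \<dots>, T\<^bsub>k-1\<^esub>] q\<close> is \<open>q(T\<^sub>0, \<dots>, T\<^bsub>k-1\<^esub>)\<close>.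
\<close>

definition subst1 :: "'v::ab_group_add poly \<Rightarrow> ('v mpoly \<Rightarrow> 'v mpoly) \<Rightarrow> 'v mpoly" where
  "subst1 p T = (\<Sum>n\<le>degree p. (T ^^ n) (const_mpoly (coeff p n)))"

definition subst_mpoly :: "('v::ab_group_add mpoly \<Rightarrow> 'v mpoly) list \<Rightarrow> 'v mpoly \<Rightarrow> 'v mpoly" where
  "subst_mpoly Ts q =
     (\<Sum>m\<in>Poly_Mapping.keys q.
        foldr (\<lambda>i. (Ts ! i) ^^ Poly_Mapping.lookup m i) [0..<length Ts]
          (const_mpoly (Poly_Mapping.lookup q m)))"

text \<open>
  For \<open>f\<^sub>\<nu> : V \<rightarrow> W[\<nu>]\<close>, the value \<open>f\<^sub>T(q)\<close>: \<open>f\<^sub>\<nu>\<close> is applied to the coefficients of \<open>q\<close> and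
  \<open>\<nu>\<close> is replaced by \<open>T\<close>.
\<close>

definition lambda_apply ::
  "('v::zero \<Rightarrow> 'w::ab_group_add poly) \<Rightarrow> ('w mpoly \<Rightarrow> 'w mpoly) \<Rightarrow> 'v mpoly \<Rightarrow> 'w mpoly" where
  "lambda_apply f T q =
     (\<Sum>m\<in>Poly_Mapping.keys q. mmult m (subst1 (f (Poly_Mapping.lookup q m)) T))"


section \<open>Lie conformal algebras, Lie conformal algebroids and their modules\<close>

text \<open>In the two-variable axioms, \<open>\<lambda>\<close> is variable 0 and \<open>\<mu>\<close> is variable 1.\<close>

locale lie_conformal_algebra = Modules.module sE
  for sE :: "'f::field_char_0 poly \<Rightarrow> 'e::ab_group_add \<Rightarrow> 'e" +
  fixes br :: "'e \<Rightarrow> 'e \<Rightarrow> 'e poly"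
  assumes br_add_left: "br (u + v) w = br u w + br v w"
    and br_add_right: "br u (v + w) = br u v + br u w"
    and br_scale_left: "br (sE [:c:] u) v = map_poly (sE [:c:]) (br u v)"
    and br_scale_right: "br u (sE [:c:] v) = map_poly (sE [:c:]) (br u v)"
    and sesqui_left: "br (sE [:0, 1:] u) v = - pCons 0 (br u v)"
    and sesqui_right: "br u (sE [:0, 1:] v) = lambda_plus (sE [:0, 1:]) (br u v)"
    and skew: "br v u = - adjoint_symbol (sE [:0, 1:]) (br u v)"
    and jacobi:
      "lambda_apply (br u) (lam 0) (subst1 (br v w) (lam 1)) -
       lambda_apply (br v) (lam 1) (subst1 (br u w) (lam 0)) =
       lambda_apply (\<lambda>z. br z w) (\<lambda>q. lam 0 q + lam 1 q) (subst1 (br u v) (lam 0))"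

locale lie_conformal_algebroid =
  A: differential_algebra sA dA +
  E: dop_module dA actE +
  conformal: lie_conformal_algebra "\<lambda>p. actE (map_poly (\<lambda>c. sA c 1) p)" br
  for sA :: "'f::field_char_0 \<Rightarrow> 'a::comm_ring_1 \<Rightarrow> 'a"
    and dA :: "'a \<Rightarrow> 'a"
    and actE :: "'a poly \<Rightarrow> 'e::ab_group_add \<Rightarrow> 'e"
    and br :: "'e \<Rightarrow> 'e \<Rightarrow> 'e poly" +
  fixes anchor :: "'e \<Rightarrow> 'a \<Rightarrow> 'a poly"
  assumes anchor_CDer: "anchor u \<in> CDer sA dA"
    and anchor_add: "anchor (u + v) b = anchor u b + anchor v b"
    and anchor_act: "anchor (actE a u) b = twist dA (*) a (anchor u b)"
    and br_act_right: "br u (actE a v) = anchor_rule actE (anchor u) a (br u v) v"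
    and anchor_br:
      "lambda_apply (\<lambda>w. anchor w b) (lam 1) (subst1 (br u v) (lam 0)) =
       lambda_apply (anchor u) (lam 0) (subst1 (anchor v b) (\<lambda>q. lam 1 q - lam 0 q)) -
       lambda_apply (anchor v) (\<lambda>q. lam 1 q - lam 0 q) (subst1 (anchor u b) (lam 0))"

locale lie_conformal_algebroid_module =
  lie_conformal_algebroid sA dA actE br anchor +
  M: dop_module dA actM
  for sA :: "'f::field_char_0 \<Rightarrow> 'a::comm_ring_1 \<Rightarrow> 'a"
    and dA :: "'a \<Rightarrow> 'a"
    and actE :: "'a poly \<Rightarrow> 'e::ab_group_add \<Rightarrow> 'e"
    and br :: "'e \<Rightarrow> 'e \<Rightarrow> 'e poly"
    and anchor :: "'e \<Rightarrow> 'a \<Rightarrow> 'a poly"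
    and actM :: "'a poly \<Rightarrow> 'm::ab_group_add \<Rightarrow> 'm" +
  fixes lact :: "'e \<Rightarrow> 'm \<Rightarrow> 'm poly"
  assumes lact_add_left: "lact (u + v) m = lact u m + lact v m"
    and lact_add_right: "lact u (m + n) = lact u m + lact u n"
    and lact_scale_left:
      "lact (fact_scale sA actE c u) m = map_poly (fact_scale sA actM c) (lact u m)"
    and lact_scale_right:
      "lact u (fact_scale sA actM c m) = map_poly (fact_scale sA actM c) (lact u m)"
    and lact_act_right: "lact u (actM a m) = anchor_rule actM (anchor u) a (lact u m) m"
    and lact_act_left: "lact (actE a u) m = twist dA (\<lambda>b. actM [:b:]) a (lact u m)"
    and lact_br:
      "lambda_apply (\<lambda>w. lact w m) (lam 1) (subst1 (br u v) (lam 0)) =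
       lambda_apply (lact u) (lam 0) (subst1 (lact v m) (\<lambda>q. lam 1 q - lam 0 q)) -
       lambda_apply (lact v) (\<lambda>q. lam 1 q - lam 0 q) (subst1 (lact u m) (lam 0))"


section \<open>Modules with carriers, quotients and complexes\<close>

definition ring_of_class :: "'r::comm_ring_1 ring" where
  "ring_of_class = \<lparr>carrier = UNIV, monoid.mult = (*), one = 1, ring.zero = 0, add = (+)\<rparr>"

text \<open>
  Records of type \<open>('s, 'v) module\<close> have multiplicative fields that play no role for modules;
  they are left \<open>undefined\<close>.
\<close>

definition fun_module :: "('x \<Rightarrow> 'v) set \<Rightarrow> ('s, 'v) module \<Rightarrow> ('s, 'x \<Rightarrow> 'v) module" where
  "fun_module S V =
     \<lparr>carrier = S, monoid.mult = undefined, one = undefined,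
      ring.zero = (\<lambda>_. \<zero>\<^bsub>V\<^esub>), add = (\<lambda>f g x. f x \<oplus>\<^bsub>V\<^esub> g x), smult = (\<lambda>c f x. c \<odot>\<^bsub>V\<^esub> f x)\<rparr>"

definition quotient_module :: "('s, 'v) module \<Rightarrow> 'v set \<Rightarrow> ('s, 'v set) module" where
  "quotient_module V N =
     \<lparr>carrier = a_rcosets\<^bsub>V\<^esub> N, monoid.mult = undefined, one = undefined,
      ring.zero = N, add = set_add V, smult = (\<lambda>c X. \<Union>x\<in>X. N +>\<^bsub>V\<^esub> (c \<odot>\<^bsub>V\<^esub> x))\<rparr>"

text \<open>The map induced by \<open>f\<close> from cosets to cosets of \<open>N\<close>; the union is that of a single coset
  whenever \<open>f\<close> is well defined on cosets.\<close>

definition coset_map :: "('s, 'w) module \<Rightarrow> 'w set \<Rightarrow> ('v \<Rightarrow> 'w) \<Rightarrow> 'v set \<Rightarrow> 'w set" where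
  "coset_map W N f X = (\<Union>x\<in>X. N +>\<^bsub>W\<^esub> f x)"

text \<open>The F[\<partial>]-module structure on \<open>V\<close> in which \<open>\<partial>\<close> acts by \<open>T\<close>.\<close>

definition poly_module :: "('f::comm_ring_1, 'v) module \<Rightarrow> ('v \<Rightarrow> 'v) \<Rightarrow> ('f poly, 'v) module" where
  "poly_module V T =
     \<lparr>carrier = carrier V, monoid.mult = undefined, one = undefined,
      ring.zero = \<zero>\<^bsub>V\<^esub>, add = (\<oplus>\<^bsub>V\<^esub>),
      smult = (\<lambda>p x. \<Oplus>\<^bsub>V\<^esub>i\<in>{..degree p}. coeff p i \<odot>\<^bsub>V\<^esub> (T ^^ i) x)\<rparr>"

definition linear_between ::
  "'s ring \<Rightarrow> ('s, 'v) module \<Rightarrow> ('s, 'w) module \<Rightarrow> ('v \<Rightarrow> 'w) \<Rightarrow> bool" where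
  "linear_between R V W f \<longleftrightarrow>
     f \<in> carrier V \<rightarrow> carrier W \<and>
     (\<forall>x\<in>carrier V. \<forall>y\<in>carrier V. f (x \<oplus>\<^bsub>V\<^esub> y) = f x \<oplus>\<^bsub>W\<^esub> f y) \<and>
     (\<forall>c\<in>carrier R. \<forall>x\<in>carrier V. f (c \<odot>\<^bsub>V\<^esub> x) = c \<odot>\<^bsub>W\<^esub> f x)"

definition cochain_complex ::
  "'s ring \<Rightarrow> (nat \<Rightarrow> ('s, 'v) module) \<Rightarrow> (nat \<Rightarrow> 'v \<Rightarrow> 'v) \<Rightarrow> bool" where
  "cochain_complex R C d \<longleftrightarrow>
     (\<forall>k. Module.module R (C k) \<and> linear_between R (C k) (C (Suc k)) (d k) \<and>
        (\<forall>x\<in>carrier (C k). d (Suc k) (d k x) = \<zero>\<^bsub>C (Suc (Suc k))\<^esub>))"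

definition complex_morphism ::
  "'s ring \<Rightarrow> (nat \<Rightarrow> ('s, 'v) module) \<Rightarrow> (nat \<Rightarrow> 'v \<Rightarrow> 'v) \<Rightarrow>
   (nat \<Rightarrow> ('s, 'w) module) \<Rightarrow> (nat \<Rightarrow> 'w \<Rightarrow> 'w) \<Rightarrow> (nat \<Rightarrow> 'v \<Rightarrow> 'w) \<Rightarrow> bool" where
  "complex_morphism R C d C' d' f \<longleftrightarrow>
     cochain_complex R C d \<and> cochain_complex R C' d' \<and>
     (\<forall>k. linear_between R (C k) (C' k) (f k) \<and>
        (\<forall>x\<in>carrier (C k). f (Suc k) (d k x) = d' k (f k x)))"


section \<open>Cochains\<close>

definition lambda_polys ::
  "('f \<Rightarrow> 'a::comm_ring_1 \<Rightarrow> 'a) \<Rightarrow> ('a poly \<Rightarrow> 'm::ab_group_add \<Rightarrow> 'm) \<Rightarrow> nat \<Rightarrow> ('f, 'm mpoly) module"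
where
  "lambda_polys sA actM k =
     \<lparr>carrier = {q. \<forall>m\<in>Poly_Mapping.keys q. Poly_Mapping.keys m \<subseteq> {..<k}},
      monoid.mult = undefined, one = undefined,
      ring.zero = 0, add = (+), smult = (\<lambda>c. Poly_Mapping.map (fact_scale sA actM c))\<rparr>"

text \<open>The operator \<open>\<lambda>\<^sub>1 + \<dots> + \<lambda>\<^sub>k + \<partial>\<close>.\<close>

definition total_deriv ::
  "('a::comm_ring_1 poly \<Rightarrow> 'm::ab_group_add \<Rightarrow> 'm) \<Rightarrow> nat \<Rightarrow> 'm mpoly \<Rightarrow> 'm mpoly" where
  "total_deriv actM k q = (\<Sum>i<k. lam i q) + Poly_Mapping.map (dact actM) q"

definition total_deriv_image ::
  "('f \<Rightarrow> 'a::comm_ring_1 \<Rightarrow> 'a) \<Rightarrow> ('a poly \<Rightarrow> 'm::ab_group_add \<Rightarrow> 'm) \<Rightarrow> nat \<Rightarrow> 'm mpoly set" where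
  "total_deriv_image sA actM k = total_deriv actM k ` carrier (lambda_polys sA actM k)"

text \<open>
  \<open>(|\<^bsub>x1=\<partial>\<^esub> a\<^sub>1\<^sup>*(\<lambda>\<^sub>1)) \<cdots> (|\<^bsub>xk=\<partial>\<^esub> a\<^sub>k\<^sup>*(\<lambda>\<^sub>k)) q(\<lambda>\<^sub>1 + x1, \<dots>, \<lambda>\<^sub>k + xk)\<close>. The coefficient of a
  monomial of \<open>q\<close> is acted on by the product in \<open>A[\<lambda>\<^sub>1, \<dots>, \<lambda>\<^sub>k]\<close> of the \<open>(\<lambda>\<^sub>i + \<partial>)\<^sup>n a\<^sub>i\<^sup>*(\<lambda>\<^sub>i)\<close>, where
  \<open>n\<close> is the exponent of \<open>\<lambda>\<^sub>i\<close> in the monomial.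
\<close>

definition multi_twist ::
  "('a::comm_ring_1 \<Rightarrow> 'a) \<Rightarrow> ('a poly \<Rightarrow> 'm::ab_group_add \<Rightarrow> 'm) \<Rightarrow> 'a poly list \<Rightarrow>
   'm mpoly \<Rightarrow> 'm mpoly" where
  "multi_twist dA actM as q =
     (\<Sum>m\<in>Poly_Mapping.keys q.
        Poly_Mapping.map (\<lambda>b. actM [:b:] (Poly_Mapping.lookup q m))
          (\<Prod>i<length as.
             subst1 ((lambda_plus dA ^^ Poly_Mapping.lookup m i) (adjoint_symbol dA (as ! i)))
               (lam i)))"

text \<open>\<open>sign(\<pi>) q(\<lambda>\<^bsub>\<pi>(1)\<^esub>, \<dots>, \<lambda>\<^bsub>\<pi>(k)\<^esub>)\<close>\<close>

definition signed_perm :: "nat \<Rightarrow> (nat \<Rightarrow> nat) \<Rightarrow> 'm::ab_group_add mpoly \<Rightarrow> 'm mpoly" where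
  "signed_perm k \<pi> q =
     (let r = subst_mpoly (map (\<lambda>i. lam (\<pi> i)) [0..<k]) q in if sign \<pi> = 1 then r else - r)"

text \<open>
  Basic and reduced cochains obey the same conditions, with values in \<open>V = M[\<lambda>\<^sub>1, \<dots>, \<lambda>\<^sub>k]\<close> or
  in a quotient \<open>V\<close> of it; \<open>L\<close> turns operators on \<open>M[\<lambda>\<^sub>1, \<dots>, \<lambda>\<^sub>k]\<close> into operators on \<open>V\<close>.
  A \<open>k\<close>-cochain is a function on lists, set to zero on lists whose length is not \<open>k\<close> so that
  equality of cochains is equality of functions.
\<close>

definition cochain_set ::
  "('f \<Rightarrow> 'a::comm_ring_1 \<Rightarrow> 'a) \<Rightarrow> ('a \<Rightarrow> 'a) \<Rightarrow>
   ('a poly \<Rightarrow> 'e::ab_group_add \<Rightarrow> 'e) \<Rightarrow> ('a poly \<Rightarrow> 'm::ab_group_add \<Rightarrow> 'm) \<Rightarrow>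
   ('f, 'v) module \<Rightarrow> (('m mpoly \<Rightarrow> 'm mpoly) \<Rightarrow> 'v \<Rightarrow> 'v) \<Rightarrow> nat \<Rightarrow> ('e list \<Rightarrow> 'v) set" where
  "cochain_set sA dA actE actM V L k =
     {\<phi>. (\<forall>us. length us \<noteq> k \<longrightarrow> \<phi> us = \<zero>\<^bsub>V\<^esub>) \<and>
         (\<forall>us. length us = k \<longrightarrow> \<phi> us \<in> carrier V) \<and>
         (\<forall>us i u v. length us = k \<and> i < k \<longrightarrow>
            \<phi> (us[i := u + v]) = \<phi> (us[i := u]) \<oplus>\<^bsub>V\<^esub> \<phi> (us[i := v])) \<and>
         (\<forall>us i c u. length us = k \<and> i < k \<longrightarrow>
            \<phi> (us[i := fact_scale sA actE c u]) = c \<odot>\<^bsub>V\<^esub> \<phi> (us[i := u])) \<and>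
         (\<forall>as us. length as = k \<and> length us = k \<longrightarrow>
            \<phi> (map2 actE as us) = L (multi_twist dA actM as) (\<phi> us)) \<and>
         (\<forall>\<pi> us. \<pi> permutes {..<k} \<and> length us = k \<longrightarrow>
            \<phi> us = L (signed_perm k \<pi>) (\<phi> (map (\<lambda>i. us ! \<pi> i) [0..<k])))}"

definition basic_cochains ::
  "('f \<Rightarrow> 'a::comm_ring_1 \<Rightarrow> 'a) \<Rightarrow> ('a \<Rightarrow> 'a) \<Rightarrow>
   ('a poly \<Rightarrow> 'e::ab_group_add \<Rightarrow> 'e) \<Rightarrow> ('a poly \<Rightarrow> 'm::ab_group_add \<Rightarrow> 'm) \<Rightarrow>
   nat \<Rightarrow> ('f, 'e list \<Rightarrow> 'm mpoly) module" where
  "basic_cochains sA dA actE actM k =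
     fun_module (cochain_set sA dA actE actM (lambda_polys sA actM k) (\<lambda>T. T) k)
       (lambda_polys sA actM k)"

definition reduced_polys ::
  "('f \<Rightarrow> 'a::comm_ring_1 \<Rightarrow> 'a) \<Rightarrow> ('a poly \<Rightarrow> 'm::ab_group_add \<Rightarrow> 'm) \<Rightarrow>
   nat \<Rightarrow> ('f, 'm mpoly set) module" where
  "reduced_polys sA actM k =
     quotient_module (lambda_polys sA actM k) (total_deriv_image sA actM k)"

definition reduced_class ::
  "('f \<Rightarrow> 'a::comm_ring_1 \<Rightarrow> 'a) \<Rightarrow> ('a poly \<Rightarrow> 'm::ab_group_add \<Rightarrow> 'm) \<Rightarrow>
   nat \<Rightarrow> 'm mpoly \<Rightarrow> 'm mpoly set" where
  "reduced_class sA actM k q = total_deriv_image sA actM k +>\<^bsub>lambda_polys sA actM k\<^esub> q"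

definition reduced_cochains ::
  "('f \<Rightarrow> 'a::comm_ring_1 \<Rightarrow> 'a) \<Rightarrow> ('a \<Rightarrow> 'a) \<Rightarrow>
   ('a poly \<Rightarrow> 'e::ab_group_add \<Rightarrow> 'e) \<Rightarrow> ('a poly \<Rightarrow> 'm::ab_group_add \<Rightarrow> 'm) \<Rightarrow>
   nat \<Rightarrow> ('f, 'e list \<Rightarrow> 'm mpoly set) module" where
  "reduced_cochains sA dA actE actM k =
     fun_module
       (cochain_set sA dA actE actM (reduced_polys sA actM k)
          (coset_map (lambda_polys sA actM k) (total_deriv_image sA actM k)) k)
       (reduced_polys sA actM k)"


section \<open>Differentials and comparison maps\<close>

text \<open>
  The formula for the differential. Indices start at 0, which does not change the signs
  \<open>(-1)\<^bsup>i+j\<^esup>\<close>, and turns \<open>(-1)\<^bsup>i+1\<^esup>\<close> into \<open>(-1)\<^sup>i\<close>; a sign is an iterate of negation. In the second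
  sum \<open>\<phi>([u\<^sub>i \<^sub>\<lambda> u\<^sub>j], \<dots>)\<close> is expanded in powers of \<open>\<lambda> = \<lambda>\<^sub>i\<close>.
\<close>

definition differential_formula ::
  "('e::ab_group_add \<Rightarrow> 'e \<Rightarrow> 'e poly) \<Rightarrow> ('e \<Rightarrow> 'm::ab_group_add \<Rightarrow> 'm poly) \<Rightarrow>
   ('e list \<Rightarrow> 'm mpoly) \<Rightarrow> 'e list \<Rightarrow> 'm mpoly" where
  "differential_formula br lact \<phi> us =
     (let vars = map lam [0..<length us] in
      (\<Sum>i<length us. (uminus ^^ i)
         (lambda_apply (lact (us ! i)) (lam i)
            (subst_mpoly (nths vars (- {i})) (\<phi> (nths us (- {i})))))) +
      (\<Sum>(i, j)\<in>{(i, j). i < j \<and> j < length us}. (uminus ^^ (i + j))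
         (\<Sum>n\<le>degree (br (us ! i) (us ! j)). (lam i ^^ n)
            (subst_mpoly ((\<lambda>q. lam i q + lam j q) # nths vars (- {i, j}))
               (\<phi> (coeff (br (us ! i) (us ! j)) n # nths us (- {i, j})))))))"

definition basic_differential ::
  "('e::ab_group_add \<Rightarrow> 'e \<Rightarrow> 'e poly) \<Rightarrow> ('e \<Rightarrow> 'm::ab_group_add \<Rightarrow> 'm poly) \<Rightarrow>
   nat \<Rightarrow> ('e list \<Rightarrow> 'm mpoly) \<Rightarrow> 'e list \<Rightarrow> 'm mpoly" where
  "basic_differential br lact k = differential_formula br lact"

text \<open>\<open>(\<partial>\<phi>)(us) = (\<lambda>\<^sub>1 + \<dots> + \<lambda>\<^sub>k + \<partial>) \<phi>(us)\<close>\<close>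

definition cochain_deriv ::
  "('a::comm_ring_1 poly \<Rightarrow> 'm::ab_group_add \<Rightarrow> 'm) \<Rightarrow>
   nat \<Rightarrow> ('e list \<Rightarrow> 'm mpoly) \<Rightarrow> 'e list \<Rightarrow> 'm mpoly" where
  "cochain_deriv actM k \<phi> us = total_deriv actM k (\<phi> us)"

definition reduced_projection ::
  "('f \<Rightarrow> 'a::comm_ring_1 \<Rightarrow> 'a) \<Rightarrow> ('a poly \<Rightarrow> 'm::ab_group_add \<Rightarrow> 'm) \<Rightarrow>
   nat \<Rightarrow> ('e list \<Rightarrow> 'm mpoly) \<Rightarrow> 'e list \<Rightarrow> 'm mpoly set" where
  "reduced_projection sA actM k \<phi> = reduced_class sA actM k \<circ> \<phi>"

text \<open>
  The same formula on \<open>C\<^sup>k\<close>: it is evaluated on the functions \<open>\<psi>\<close> that represent \<open>\<phi>\<close> value by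
  value (they need not be cochains), and all classes obtained are united, so the value is a
  class exactly when the differential does not depend on the representatives.
\<close>

definition reduced_differential ::
  "('f \<Rightarrow> 'a::comm_ring_1 \<Rightarrow> 'a) \<Rightarrow> ('a poly \<Rightarrow> 'm::ab_group_add \<Rightarrow> 'm) \<Rightarrow>
   ('e::ab_group_add \<Rightarrow> 'e \<Rightarrow> 'e poly) \<Rightarrow> ('e \<Rightarrow> 'm \<Rightarrow> 'm poly) \<Rightarrow>
   nat \<Rightarrow> ('e list \<Rightarrow> 'm mpoly set) \<Rightarrow> 'e list \<Rightarrow> 'm mpoly set" where
  "reduced_differential sA actM br lact k \<phi> us =
     (\<Union>\<psi>\<in>{\<psi>. reduced_projection sA actM k \<psi> = \<phi> \<and> (\<forall>vs. length vs \<noteq> k \<longrightarrow> \<psi> vs = 0)}.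
        reduced_class sA actM (Suc k) (differential_formula br lact \<psi> us))"

definition basic_deriv_image ::
  "('f \<Rightarrow> 'a::comm_ring_1 \<Rightarrow> 'a) \<Rightarrow> ('a \<Rightarrow> 'a) \<Rightarrow>
   ('a poly \<Rightarrow> 'e::ab_group_add \<Rightarrow> 'e) \<Rightarrow> ('a poly \<Rightarrow> 'm::ab_group_add \<Rightarrow> 'm) \<Rightarrow>
   nat \<Rightarrow> ('e list \<Rightarrow> 'm mpoly) set" where
  "basic_deriv_image sA dA actE actM k =
     cochain_deriv actM k ` carrier (basic_cochains sA dA actE actM k)"

definition quotient_cochains ::
  "('f \<Rightarrow> 'a::comm_ring_1 \<Rightarrow> 'a) \<Rightarrow> ('a \<Rightarrow> 'a) \<Rightarrow>
   ('a poly \<Rightarrow> 'e::ab_group_add \<Rightarrow> 'e) \<Rightarrow> ('a poly \<Rightarrow> 'm::ab_group_add \<Rightarrow> 'm) \<Rightarrow>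
   nat \<Rightarrow> ('f, ('e list \<Rightarrow> 'm mpoly) set) module" where
  "quotient_cochains sA dA actE actM k =
     quotient_module (basic_cochains sA dA actE actM k) (basic_deriv_image sA dA actE actM k)"

definition quotient_class ::
  "('f \<Rightarrow> 'a::comm_ring_1 \<Rightarrow> 'a) \<Rightarrow> ('a \<Rightarrow> 'a) \<Rightarrow>
   ('a poly \<Rightarrow> 'e::ab_group_add \<Rightarrow> 'e) \<Rightarrow> ('a poly \<Rightarrow> 'm::ab_group_add \<Rightarrow> 'm) \<Rightarrow>
   nat \<Rightarrow> ('e list \<Rightarrow> 'm mpoly) \<Rightarrow> ('e list \<Rightarrow> 'm mpoly) set" where
  "quotient_class sA dA actE actM k \<phi> =
     basic_deriv_image sA dA actE actM k +>\<^bsub>basic_cochains sA dA actE actM k\<^esub> \<phi>"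

definition quotient_differential ::
  "('f \<Rightarrow> 'a::comm_ring_1 \<Rightarrow> 'a) \<Rightarrow> ('a \<Rightarrow> 'a) \<Rightarrow>
   ('a poly \<Rightarrow> 'e::ab_group_add \<Rightarrow> 'e) \<Rightarrow> ('a poly \<Rightarrow> 'm::ab_group_add \<Rightarrow> 'm) \<Rightarrow>
   ('e \<Rightarrow> 'e \<Rightarrow> 'e poly) \<Rightarrow> ('e \<Rightarrow> 'm \<Rightarrow> 'm poly) \<Rightarrow>
   nat \<Rightarrow> ('e list \<Rightarrow> 'm mpoly) set \<Rightarrow> ('e list \<Rightarrow> 'm mpoly) set" where
  "quotient_differential sA dA actE actM br lact k =
     coset_map (basic_cochains sA dA actE actM (Suc k)) (basic_deriv_image sA dA actE actM (Suc k))
       (basic_differential br lact k)"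

definition induced_projection ::
  "('f \<Rightarrow> 'a::comm_ring_1 \<Rightarrow> 'a) \<Rightarrow> ('a poly \<Rightarrow> 'm::ab_group_add \<Rightarrow> 'm) \<Rightarrow>
   nat \<Rightarrow> ('e list \<Rightarrow> 'm mpoly) set \<Rightarrow> 'e list \<Rightarrow> 'm mpoly set" where
  "induced_projection sA actM k X = the_elem (reduced_projection sA actM k ` X)"

end

(*
  A cochain is evaluated at points: pairs (p, U) of an integer polynomial p in the variables
  lambda and a polynomial U with coefficients in E, where p is substituted for the lambda of the
  argument U. With the bracket [(p, U), (q, V)] = (p + q, [U_p V]) the points form a Leibniz
  algebra graded by p, skew-symmetric up to pairs (p, (p + partial) U), on which cochains vanish. A
  cochain becomes an alternating multilinear function of points, and the differential becomes the
  Chevalley-Eilenberg (Loday) differential, which is determined by Cartan's formula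
  d i_x + i_x d = L_x; its properties, d^2 = 0 among them, follow by induction on the number of
  arguments. Basic and reduced cochains differ only in that, for the latter, everything holds
  modulo the image of p_1 + ... + p_k + partial at arguments of degrees p_1, ..., p_k.

  The operator lambda_1 + ... + lambda_k + partial is injective for k >= 1 (compare the terms of
  highest degree), so that if its multiple by a function is a cochain, then so is the function;
  hence the kernel of p_*. For k = 0 there is nothing to prove. If E is free, representatives of a
  reduced cochain are made compatible with A[partial] in one argument after the other, by
  prescribing them on a basis, and averaging over the symmetric group makes the result
  alternating.
*)

theory Submission
  imports Defs
begin

section \<open>The Loday complex of a graded Leibniz algebra\<close>

text \<open>The cochain condition for \<open>a(d)\<close> couples the indeterminates to the
  derivation of A: the x in lambda + x becomes d acting on a. Here x is a fresh variable
  \<open>X t\<close>. The condition then compares the values at the points (p, a U) and (p +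
  \<open>X t\<close>, U), the second followed by the operator \<open>Sop t\<close>, which turns
  powers of \<open>X t\<close> into derivatives of a. The price is that the two points have
  different degrees, and that the action of a point of degree q shifts \<open>X t\<close> by q in
  the anchor term. So this rule is not inherited by the differential alone; it is carried along with
  naturality under the shift and restricted to arguments that avoid \<open>X t\<close>. Degrees are
  integer polynomials because polynomials over any abelian group form a module over them; linearity
  over the base field is recovered as the case a = c 1, where da = 0. Cartan's recursion opens only
  the first argument. A condition on some slot passes through it if another argument stands in
  front; if the slot itself comes first, alternation moves it back by one place. Hence every such
  condition is treated together with alternation.\<close>

text \<open>
  Identities in weight \<open>s\<close> hold modulo \<open>N s\<close>. The bracket need not be skew-symmetric: this is only
  demanded of the cochains, in the form \<open>skew_killing\<close>, when they are to be alternating.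
\<close>

locale loday_complex =
  fixes br :: "'l \<Rightarrow> 'l \<Rightarrow> 'l"
    and act :: "'l \<Rightarrow> 'w::ab_group_add \<Rightarrow> 'w"
    and wt :: "'l \<Rightarrow> 'r::comm_monoid_add"
    and N :: "'r \<Rightarrow> 'w set"
  assumes N_zero: "0 \<in> N s"
    and N_add: "v \<in> N s \<Longrightarrow> w \<in> N s \<Longrightarrow> v + w \<in> N s"
    and N_uminus: "w \<in> N s \<Longrightarrow> - w \<in> N s"
    and act_add: "act x (v + w) = act x v + act x w"
    and act_N: "w \<in> N s \<Longrightarrow> act x w \<in> N (wt x + s)"
    and wt_br: "wt (br x y) = wt x + wt y"
    and act_br: "act (br x y) w = act x (act y w) - act y (act x w)"
begin

lemma act_zero [simp]: "act x 0 = 0"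
  using act_add[of x 0 0] by simp

lemma act_uminus: "act x (- v) = - act x v"
  using act_add[of x v "- v"] by (simp add: eq_neg_iff_add_eq_0 add.commute)

lemma act_diff: "act x (v - w) = act x v - act x w"
  using act_add[of x v "- w"] by (simp add: act_uminus)

lemma N_diff: "v \<in> N s \<Longrightarrow> w \<in> N s \<Longrightarrow> v - w \<in> N s"
  using N_add[of v s "- w"] N_uminus by simp

lemma N_sum: "(\<And>i. i \<in> I \<Longrightarrow> f i \<in> N s) \<Longrightarrow> sum f I \<in> N s"
  by (induction I rule: infinite_finite_induct) (auto intro: N_zero N_add)

lemma N_iterate_uminus: "w \<in> N s \<Longrightarrow> (uminus ^^ n) w \<in> N s"
  by (induction n) (auto intro: N_uminus)

lemma N_eq: "v \<in> N s \<Longrightarrow> v = w \<Longrightarrow> s = s' \<Longrightarrow> w \<in> N s'"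
  by simp

abbreviation wts :: "'l list \<Rightarrow> 'r" where
  "wts xs \<equiv> sum_list (map wt xs)"

text \<open>The adjoint action of x on the arguments, one slot after the other: the part of the Lie
  derivative \<open>Lie\<close> that does not come from the action on values.\<close>

primrec bsum :: "'l \<Rightarrow> ('l list \<Rightarrow> 'w) \<Rightarrow> 'l list \<Rightarrow> 'w" where
  "bsum x \<Phi> [] = 0"
| "bsum x \<Phi> (y # ys) = \<Phi> (br x y # ys) + bsum x (\<lambda>zs. \<Phi> (y # zs)) ys"

definition Lie :: "'l \<Rightarrow> ('l list \<Rightarrow> 'w) \<Rightarrow> 'l list \<Rightarrow> 'w" where
  "Lie x \<Phi> xs = act x (\<Phi> xs) - bsum x \<Phi> xs"

text \<open>The recursion is Cartan's formula \<open>\<iota>\<^sub>x d + d \<iota>\<^sub>x = L\<^sub>x\<close>.\<close>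

primrec dif :: "('l list \<Rightarrow> 'w) \<Rightarrow> 'l list \<Rightarrow> 'w" where
  "dif \<Phi> [] = 0"
| "dif \<Phi> (x # xs) = Lie x \<Phi> xs - dif (\<lambda>ys. \<Phi> (x # ys)) xs"

text \<open>The parameter c is the total degree of the arguments inserted so far. With it a
  condition on \<Phi> at c passes to the contraction \<open>\<Phi> (x # ys)\<close> at
  \<open>c + wt x\<close>, which is what inductions on the argument list need.\<close>

definition null :: "'r \<Rightarrow> ('l list \<Rightarrow> 'w) \<Rightarrow> bool" where
  "null c \<Phi> \<longleftrightarrow> (\<forall>xs. \<Phi> xs \<in> N (c + wts xs))"

lemma nullD: "null c \<Phi> \<Longrightarrow> \<Phi> xs \<in> N (c + wts xs)"
  by (simp add: null_def)

lemma null_contract: "null c \<Phi> \<Longrightarrow> null (c + wt x) (\<lambda>ys. \<Phi> (x # ys))"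
  unfolding null_def by (metis add.assoc list.map(2) sum_list.Cons)

lemma bsum_add: "bsum x (\<lambda>ys. \<Phi> ys + \<Psi> ys) xs = bsum x \<Phi> xs + bsum x \<Psi> xs"
  by (induction xs arbitrary: \<Phi> \<Psi>) simp_all

lemma bsum_diff: "bsum x (\<lambda>ys. \<Phi> ys - \<Psi> ys) xs = bsum x \<Phi> xs - bsum x \<Psi> xs"
  by (induction xs arbitrary: \<Phi> \<Psi>) simp_all

lemma bsum_act: "bsum x (\<lambda>ys. act y (\<Phi> ys)) xs = act y (bsum x \<Phi> xs)"
  by (induction xs arbitrary: \<Phi>) (simp_all add: act_add)

lemma Lie_Cons: "Lie x \<Phi> (y # ys) = Lie x (\<lambda>zs. \<Phi> (y # zs)) ys - \<Phi> (br x y # ys)"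
  by (simp add: Lie_def)

lemma Lie_add: "Lie x (\<lambda>ys. \<Phi> ys + \<Psi> ys) xs = Lie x \<Phi> xs + Lie x \<Psi> xs"
  by (simp add: Lie_def bsum_add act_add)

lemma Lie_diff: "Lie x (\<lambda>ys. \<Phi> ys - \<Psi> ys) xs = Lie x \<Phi> xs - Lie x \<Psi> xs"
  by (simp add: Lie_def bsum_diff act_diff)

lemma dif_add: "dif (\<lambda>ys. \<Phi> ys + \<Psi> ys) xs = dif \<Phi> xs + dif \<Psi> xs"
  by (induction xs arbitrary: \<Phi> \<Psi>) (simp_all add: Lie_add)

lemma dif_diff: "dif (\<lambda>ys. \<Phi> ys - \<Psi> ys) xs = dif \<Phi> xs - dif \<Psi> xs"
  by (induction xs arbitrary: \<Phi> \<Psi>) (simp_all add: Lie_diff)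

lemma bsum_null: "null c \<Phi> \<Longrightarrow> bsum x \<Phi> xs \<in> N (c + wt x + wts xs)"
proof (induction xs arbitrary: \<Phi> c)
  case (Cons y ys)
  have "\<Phi> (br x y # ys) \<in> N (c + wt x + wts (y # ys))"
    using nullD[OF Cons.prems, of "br x y # ys"] by (simp add: wt_br ac_simps)
  moreover have "bsum x (\<lambda>zs. \<Phi> (y # zs)) ys \<in> N (c + wt x + wts (y # ys))"
    using Cons.IH[OF null_contract[OF Cons.prems, of y]] by (simp add: ac_simps)
  ultimately show ?case by (simp add: N_add)
qed (simp add: N_zero)

lemma Lie_null: "null c \<Phi> \<Longrightarrow> null (c + wt x) (Lie x \<Phi>)"
  unfolding null_def[of "c + wt x"] Lie_def
  using act_N[OF nullD, of c \<Phi> x] bsum_null[of c \<Phi> x]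
  by (auto intro!: N_diff simp: ac_simps)

lemma dif_null: "null c \<Phi> \<Longrightarrow> null c (dif \<Phi>)"
proof -
  have "null c \<Phi> \<Longrightarrow> dif \<Phi> xs \<in> N (c + wts xs)" for xs
  proof (induction xs arbitrary: \<Phi> c)
    case (Cons y ys)
    show ?case
      using N_diff[OF nullD[OF Lie_null[OF Cons.prems]] Cons.IH[OF null_contract[OF Cons.prems]]]
      by (simp add: ac_simps)
  qed (simp add: N_zero)
  then show "null c \<Phi> \<Longrightarrow> null c (dif \<Phi>)" by (simp add: null_def)
qed

text \<open>Elements of the algebra are not added here, so the Leibniz identity of the bracket is
  stated in the form in which it is seen through a slot of \<Phi>.\<close>

definition leibniz :: "'r \<Rightarrow> ('l list \<Rightarrow> 'w) \<Rightarrow> bool" where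
  "leibniz c \<Phi> \<longleftrightarrow> (\<forall>ys x y z zs.
     \<Phi> (ys @ br x (br y z) # zs) - \<Phi> (ys @ br y (br x z) # zs) - \<Phi> (ys @ br (br x y) z # zs)
       \<in> N (c + wts ys + wt x + wt y + wt z + wts zs))"

lemma leibniz_contract: "leibniz c \<Phi> \<Longrightarrow> leibniz (c + wt x) (\<lambda>ys. \<Phi> (x # ys))"
  unfolding leibniz_def
proof (intro allI)
  fix ys y z w zs
  assume "\<forall>ys x y z zs. \<Phi> (ys @ br x (br y z) # zs) - \<Phi> (ys @ br y (br x z) # zs)
    - \<Phi> (ys @ br (br x y) z # zs) \<in> N (c + wts ys + wt x + wt y + wt z + wts zs)"
  from this[rule_format, of "x # ys" y z w zs]
  show "\<Phi> (x # ys @ br y (br z w) # zs) - \<Phi> (x # ys @ br z (br y w) # zs)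
    - \<Phi> (x # ys @ br (br y z) w # zs) \<in> N (c + wt x + wts ys + wt y + wt z + wt w + wts zs)"
    by (simp add: ac_simps)
qed

text \<open>Terms in which the two brackets fall into different slots cancel between the two orders.
  If both fall into the same slot, the difference is governed by \<open>leibniz\<close>.\<close>

lemma bsum_commutator:
  assumes "leibniz c \<Phi>"
  shows "bsum x (bsum y \<Phi>) zs - bsum y (bsum x \<Phi>) zs + bsum (br x y) \<Phi> zs
    \<in> N (c + wt x + wt y + wts zs)"
  using assms
proof (induction zs arbitrary: \<Phi> c)
  case (Cons z zs)
  have 1: "\<Phi> (br x (br y z) # zs) - \<Phi> (br y (br x z) # zs) - \<Phi> (br (br x y) z # zs)
      \<in> N (c + wt x + wt y + wts (z # zs))"
    using Cons.prems[unfolded leibniz_def, rule_format, of "[]" x y z zs] by (simp add: ac_simps)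
  let ?\<Psi> = "\<lambda>zs. \<Phi> (z # zs)"
  have 2: "bsum x (bsum y ?\<Psi>) zs - bsum y (bsum x ?\<Psi>) zs + bsum (br x y) ?\<Psi> zs
      \<in> N (c + wt x + wt y + wts (z # zs))"
    using Cons.IH[OF leibniz_contract[OF Cons.prems, of z]] by (simp add: ac_simps)
  show ?case
    by (rule N_eq[OF N_diff[OF 2 1] _ refl]) (simp add: bsum_add)
qed (simp add: N_zero)

text \<open>The mixed terms, one action and one bracket, are symmetric in x and y and drop out;
  \<open>act_br\<close> settles the pure actions and \<open>bsum_commutator\<close> the pure
  brackets.\<close>

lemma Lie_commutator:
  assumes "leibniz c \<Phi>"
  shows "null (c + wt x + wt y) (\<lambda>zs. Lie x (Lie y \<Phi>) zs - Lie y (Lie x \<Phi>) zs - Lie (br x y) \<Phi> zs)"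
  unfolding null_def
proof
  fix zs
  have "Lie x (Lie y \<Phi>) zs - Lie y (Lie x \<Phi>) zs - Lie (br x y) \<Phi> zs
    = bsum x (bsum y \<Phi>) zs - bsum y (bsum x \<Phi>) zs + bsum (br x y) \<Phi> zs"
    by (simp add: Lie_def[abs_def] bsum_diff bsum_act act_diff act_br)
  then show "Lie x (Lie y \<Phi>) zs - Lie y (Lie x \<Phi>) zs - Lie (br x y) \<Phi> zs
      \<in> N (c + wt x + wt y + wts zs)"
    using bsum_commutator[OF assms] by simp
qed

lemma dif_Cons_fun: "(\<lambda>ys. dif \<Phi> (x # ys)) = (\<lambda>ys. Lie x \<Phi> ys - dif (\<lambda>ys. \<Phi> (x # ys)) ys)"
  by simp

text \<open>Contract with the first argument y. Cartan's formula and [L_x, i_y] = i_[x,y] reduce the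
  claim to \<open>Lie_commutator\<close> for x and y and to the claim for i_y \<Phi>, which has one
  argument less.\<close>

lemma Lie_dif:
  assumes "leibniz c \<Phi>"
  shows "null (c + wt x) (\<lambda>zs. Lie x (dif \<Phi>) zs - dif (Lie x \<Phi>) zs)"
proof -
  have "Lie x (dif \<Phi>) zs - dif (Lie x \<Phi>) zs \<in> N (c + wt x + wts zs)" for zs
    using assms
  proof (induction zs arbitrary: \<Phi> c)
    case Nil
    then show ?case by (simp add: Lie_def N_zero)
  next
    case (Cons y ys)
    let ?\<Psi> = "\<lambda>zs. \<Phi> (y # zs)"
    have 1: "Lie x (Lie y \<Phi>) ys - Lie y (Lie x \<Phi>) ys - Lie (br x y) \<Phi> ys
        \<in> N (c + wt x + wts (y # ys))"
      using nullD[OF Lie_commutator[OF Cons.prems], of x y ys] by (simp add: ac_simps)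
    have 2: "Lie x (dif ?\<Psi>) ys - dif (Lie x ?\<Psi>) ys \<in> N (c + wt x + wts (y # ys))"
      using Cons.IH[OF leibniz_contract[OF Cons.prems, of y]] by (simp add: ac_simps)
    show ?case
      by (rule N_eq[OF N_diff[OF 1 2] _ refl])
        (simp add: Lie_Cons dif_Cons_fun dif_diff Lie_diff del: dif.simps(2) add: dif.simps(2)[of _ y ys]
          dif.simps(2)[of _ "br x y" ys])
  qed
  then show ?thesis by (simp add: null_def)
qed

text \<open>By Cartan's formula i_y d d = (L_y d - d L_y) + d d i_y. The bracketed term is null by
  \<open>Lie_dif\<close>, the other one by induction.\<close>

theorem dif_dif:
  assumes "leibniz c \<Phi>"
  shows "null c (dif (dif \<Phi>))"
proof -
  have "dif (dif \<Phi>) zs \<in> N (c + wts zs)" for zs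
    using assms
  proof (induction zs arbitrary: \<Phi> c)
    case (Cons y ys)
    let ?\<Psi> = "\<lambda>zs. \<Phi> (y # zs)"
    have 1: "Lie y (dif \<Phi>) ys - dif (Lie y \<Phi>) ys \<in> N (c + wts (y # ys))"
      using nullD[OF Lie_dif[OF Cons.prems], of y ys] by (simp add: ac_simps)
    have 2: "dif (dif ?\<Psi>) ys \<in> N (c + wts (y # ys))"
      using Cons.IH[OF leibniz_contract[OF Cons.prems, of y]] by (simp add: ac_simps)
    show ?case
      by (rule N_eq[OF N_add[OF 1 2] _ refl]) (simp add: dif_diff)
  qed (simp add: N_zero)
  then show ?thesis by (simp add: null_def)
qed

definition alternating :: "'r \<Rightarrow> ('l list \<Rightarrow> 'w) \<Rightarrow> bool" where
  "alternating c \<Phi> \<longleftrightarrow> (\<forall>ys x y zs.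
     \<Phi> (ys @ x # y # zs) + \<Phi> (ys @ y # x # zs) \<in> N (c + wts ys + wt x + wt y + wts zs))"

definition skew_killing :: "'r \<Rightarrow> ('l list \<Rightarrow> 'w) \<Rightarrow> bool" where
  "skew_killing c \<Phi> \<longleftrightarrow> (\<forall>ys x y zs.
     \<Phi> (ys @ br x y # zs) + \<Phi> (ys @ br y x # zs) \<in> N (c + wts ys + wt x + wt y + wts zs))"

lemma alternatingD:
  "alternating c \<Phi> \<Longrightarrow> \<Phi> (ys @ x # y # zs) + \<Phi> (ys @ y # x # zs) \<in> N (c + wts ys + wt x + wt y + wts zs)"
  by (simp add: alternating_def)

lemma alternating_contract: "alternating c \<Phi> \<Longrightarrow> alternating (c + wt x) (\<lambda>ys. \<Phi> (x # ys))"
  unfolding alternating_def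
proof (intro allI)
  fix ys y z zs
  assume "\<forall>ys x y zs. \<Phi> (ys @ x # y # zs) + \<Phi> (ys @ y # x # zs)
    \<in> N (c + wts ys + wt x + wt y + wts zs)"
  from this[rule_format, of "x # ys" y z zs]
  show "\<Phi> (x # ys @ y # z # zs) + \<Phi> (x # ys @ z # y # zs)
      \<in> N (c + wt x + wts ys + wt y + wt z + wts zs)"
    by (simp add: ac_simps)
qed

lemma skew_killing_contract: "skew_killing c \<Phi> \<Longrightarrow> skew_killing (c + wt x) (\<lambda>ys. \<Phi> (x # ys))"
  unfolding skew_killing_def
proof (intro allI)
  fix ys y z zs
  assume "\<forall>ys x y zs. \<Phi> (ys @ br x y # zs) + \<Phi> (ys @ br y x # zs)
    \<in> N (c + wts ys + wt x + wt y + wts zs)"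
  from this[rule_format, of "x # ys" y z zs]
  show "\<Phi> (x # ys @ br y z # zs) + \<Phi> (x # ys @ br z y # zs)
      \<in> N (c + wt x + wts ys + wt y + wt z + wts zs)"
    by (simp add: ac_simps)
qed

lemma alternating_null:
  "alternating c \<Phi> \<Longrightarrow> null (c + wt x + wt y) (\<lambda>zs. \<Phi> (x # y # zs) + \<Phi> (y # x # zs))"
  unfolding null_def using alternatingD[of c \<Phi> "[]" x y] by simp

text \<open>If the bracket falls on one of the two exchanged arguments, the term pairs with the term
  of the other sum in which the same argument is bracketed.\<close>

lemma bsum_alternating:
  assumes "alternating c \<Phi>"
  shows "bsum z \<Phi> (ys @ x # y # zs) + bsum z \<Phi> (ys @ y # x # zs)
    \<in> N (c + wt z + wts ys + wt x + wt y + wts zs)"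
  using assms
proof (induction ys arbitrary: \<Phi> c)
  case Nil
  let ?s = "c + wt z + wts [] + wt x + wt y + wts zs"
  have 1: "\<Phi> (br z x # y # zs) + \<Phi> (y # br z x # zs) \<in> N ?s"
    using alternatingD[OF Nil, of "[]" "br z x" y zs] by (simp add: wt_br ac_simps)
  have 2: "\<Phi> (br z y # x # zs) + \<Phi> (x # br z y # zs) \<in> N ?s"
    using alternatingD[OF Nil, of "[]" "br z y" x zs] by (simp add: wt_br ac_simps)
  have 3: "bsum z (\<lambda>zs. \<Phi> (x # y # zs) + \<Phi> (y # x # zs)) zs \<in> N ?s"
    using bsum_null[OF alternating_null[OF Nil, of x y], of z zs] by (simp add: ac_simps)
  show ?case
    by (rule N_eq[OF N_add[OF N_add[OF 1 2] 3] _ refl]) (simp add: bsum_add)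
next
  case (Cons w ys)
  let ?s = "c + wt z + wts (w # ys) + wt x + wt y + wts zs"
  have 1: "\<Phi> (br z w # ys @ x # y # zs) + \<Phi> (br z w # ys @ y # x # zs) \<in> N ?s"
    using alternatingD[OF Cons.prems, of "br z w # ys" x y zs] by (simp add: wt_br ac_simps)
  have 2: "bsum z (\<lambda>zs. \<Phi> (w # zs)) (ys @ x # y # zs) + bsum z (\<lambda>zs. \<Phi> (w # zs)) (ys @ y # x # zs)
      \<in> N ?s"
    using Cons.IH[OF alternating_contract[OF Cons.prems, of w]] by (simp add: ac_simps)
  show ?case
    by (rule N_eq[OF N_add[OF 1 2] _ refl]) simp
qed

lemma Lie_alternating:
  assumes "alternating c \<Phi>"
  shows "alternating (c + wt z) (Lie z \<Phi>)"
  unfolding alternating_def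
proof (intro allI)
  fix ys x y zs
  let ?s = "c + wt z + wts ys + wt x + wt y + wts zs"
  have 1: "act z (\<Phi> (ys @ x # y # zs) + \<Phi> (ys @ y # x # zs)) \<in> N ?s"
    using act_N[OF alternatingD[OF assms, of ys x y zs], of z] by (simp add: ac_simps)
  show "Lie z \<Phi> (ys @ x # y # zs) + Lie z \<Phi> (ys @ y # x # zs) \<in> N ?s"
    by (rule N_eq[OF N_diff[OF 1 bsum_alternating[OF assms]] _ refl])
      (simp add: Lie_def act_add)
qed

text \<open>With x and y at the head, opening both by Cartan's formula makes the Lie derivative
  terms cancel. What is left is d of the symmetrised \<Phi>, which is null, and \<Phi> at
  \<open>br x y\<close> and at \<open>br y x\<close>; this is where skew-symmetry of the bracket
  enters.\<close>

theorem dif_alternating: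
  assumes "alternating c \<Phi>" "skew_killing c \<Phi>"
  shows "alternating c (dif \<Phi>)"
proof -
  have "dif \<Phi> (ys @ x # y # zs) + dif \<Phi> (ys @ y # x # zs) \<in> N (c + wts ys + wt x + wt y + wts zs)"
    for ys x y zs
    using assms
  proof (induction ys arbitrary: \<Phi> c)
    case Nil
    let ?s = "c + wts [] + wt x + wt y + wts zs"
    have 1: "\<Phi> (br x y # zs) + \<Phi> (br y x # zs) \<in> N ?s"
      using Nil(2)[unfolded skew_killing_def, rule_format, of "[]" x y zs] by simp
    have 2: "dif (\<lambda>zs. \<Phi> (x # y # zs) + \<Phi> (y # x # zs)) zs \<in> N ?s"
      using nullD[OF dif_null[OF alternating_null[OF Nil(1), of x y]], of zs] by simp
    show ?case
      by (rule N_eq[OF N_diff[OF 2 1] _ refl]) (simp add: dif_add Lie_Cons)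
  next
    case (Cons w ys)
    let ?s = "c + wts (w # ys) + wt x + wt y + wts zs"
    have 1: "Lie w \<Phi> (ys @ x # y # zs) + Lie w \<Phi> (ys @ y # x # zs) \<in> N ?s"
      using alternatingD[OF Lie_alternating[OF Cons.prems(1)], of w ys x y zs]
      by (simp add: ac_simps)
    have 2: "dif (\<lambda>zs. \<Phi> (w # zs)) (ys @ x # y # zs) + dif (\<lambda>zs. \<Phi> (w # zs)) (ys @ y # x # zs) \<in> N ?s"
      using Cons.IH[OF alternating_contract[OF Cons.prems(1), of w]
          skew_killing_contract[OF Cons.prems(2), of w]] by (simp add: ac_simps)
    show ?case
      by (rule N_eq[OF N_diff[OF 1 2] _ refl]) simp
  qed
  then show ?thesis by (simp add: alternating_def)
qed

lemma alternating_front: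
  assumes "alternating c \<Phi>"
  shows "\<Phi> (ys @ x # zs) - (uminus ^^ length ys) (\<Phi> (x # ys @ zs)) \<in> N (c + wts ys + wt x + wts zs)"
  using assms
proof (induction ys arbitrary: \<Phi> c)
  case (Cons y ys)
  let ?s = "c + wts (y # ys) + wt x + wts zs"
  have 1: "\<Phi> (y # ys @ x # zs) - (uminus ^^ length ys) (\<Phi> (y # x # ys @ zs)) \<in> N ?s"
    using Cons.IH[OF alternating_contract[OF Cons.prems, of y]] by (simp add: ac_simps)
  have 2: "(uminus ^^ length ys) (\<Phi> (y # x # ys @ zs) + \<Phi> (x # y # ys @ zs)) \<in> N ?s"
    using N_iterate_uminus[OF alternatingD[OF Cons.prems, of "[]" x y "ys @ zs"]]
    by (simp add: ac_simps)
  have "(uminus ^^ n) (v + w) = (uminus ^^ n) v + (uminus ^^ n) w" for n and v w :: 'w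
    by (induction n) simp_all
  then show ?case
    by (intro N_eq[OF N_add[OF 1 2] _ refl]) simp
qed (simp add: N_zero)

lemma alternating_exchange:
  assumes "alternating c \<Phi>"
  shows "\<Phi> (ys @ x # zs @ y # us) + \<Phi> (ys @ y # zs @ x # us)
    \<in> N (c + wts (ys @ x # zs @ y # us))"
  using assms
proof (induction zs arbitrary: ys)
  case Nil
  then show ?case using alternatingD[of c \<Phi> ys x y us] by (simp add: ac_simps)
next
  case (Cons z zs)
  let ?s = "c + wts (ys @ x # (z # zs) @ y # us)"
  have 1: "\<Phi> (ys @ x # z # zs @ y # us) + \<Phi> (ys @ z # x # zs @ y # us) \<in> N ?s"
    using alternatingD[OF Cons.prems, of ys x z "zs @ y # us"] by (simp add: ac_simps)
  have 2: "\<Phi> (ys @ z # x # zs @ y # us) + \<Phi> (ys @ z # y # zs @ x # us) \<in> N ?s"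
    using Cons.IH[OF Cons.prems, of "ys @ [z]"] by (simp add: ac_simps)
  have 3: "\<Phi> (ys @ y # z # zs @ x # us) + \<Phi> (ys @ z # y # zs @ x # us) \<in> N ?s"
    using alternatingD[OF Cons.prems, of ys y z "zs @ x # us"] by (simp add: ac_simps)
  show ?case
    by (rule N_eq[OF N_add[OF N_diff[OF 1 2] 3] _ refl]) simp
qed


end

section \<open>Lists with one or two entries removed\<close>

lemma nths_Cons_Compl:
  "nths (x # xs) (- {0}) = xs"
  "nths (x # xs) (- {Suc i}) = x # nths xs (- {i})"
  "nths (x # xs) (- {0, Suc i}) = nths xs (- {i})"
  "nths (x # xs) (- {Suc i, Suc j}) = x # nths xs (- {i, j})"
proof -
  have "{j. Suc j \<in> - {0}} = UNIV" "{j. Suc j \<in> - {Suc i}} = - {i}"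
    "{j. Suc j \<in> - {0, Suc i}} = - {i}" "{k. Suc k \<in> - {Suc i, Suc j}} = - {i, j}"
    by auto
  then show "nths (x # xs) (- {0}) = xs"
    "nths (x # xs) (- {Suc i}) = x # nths xs (- {i})"
    "nths (x # xs) (- {0, Suc i}) = nths xs (- {i})"
    "nths (x # xs) (- {Suc i, Suc j}) = x # nths xs (- {i, j})"
    by (simp_all add: nths_Cons nths_all)
qed

lemma nths_Compl_singleton: "nths xs (- {i}) = take i xs @ drop (Suc i) xs"
proof (induction xs arbitrary: i)
  case (Cons x xs)
  then show ?case by (cases i) (simp_all add: nths_Cons_Compl)
qed simp

lemma sum_list_nths:
  fixes xs :: "'b::comm_monoid_add list"
  shows "i < length xs \<Longrightarrow> sum_list xs = xs ! i + sum_list (nths xs (- {i}))"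
    and "i < j \<Longrightarrow> j < length xs \<Longrightarrow> sum_list xs = xs ! i + xs ! j + sum_list (nths xs (- {i, j}))"
proof -
  show 1: "sum_list xs = xs ! i + sum_list (nths xs (- {i}))" if "i < length xs" for xs :: "'b list" and i
    using that
  proof (induction xs arbitrary: i)
    case (Cons x xs)
    show ?case
    proof (cases i)
      case (Suc i')
      then have "sum_list xs = xs ! i' + sum_list (nths xs (- {i'}))"
        using Cons.prems by (intro Cons.IH) simp
      then show ?thesis using Suc by (simp add: nths_Cons_Compl ac_simps)
    qed (simp add: nths_Cons_Compl)
  qed simp
  show "i < j \<Longrightarrow> j < length xs \<Longrightarrow> sum_list xs = xs ! i + xs ! j + sum_list (nths xs (- {i, j}))"
  proof (induction xs arbitrary: i j)
    case (Cons x xs)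
    obtain j' where j': "j = Suc j'" using Cons.prems by (cases j) auto
    show ?case
    proof (cases i)
      case 0
      have "sum_list xs = xs ! j' + sum_list (nths xs (- {j'}))"
        using Cons.prems j' by (intro 1) simp
      then show ?thesis using 0 j' by (simp add: nths_Cons_Compl ac_simps)
    next
      case (Suc i')
      then have "sum_list xs = xs ! i' + xs ! j' + sum_list (nths xs (- {i', j'}))"
        using Cons.prems j' by (intro Cons.IH) auto
      then show ?thesis using Suc j' by (simp add: nths_Cons_Compl ac_simps)
    qed
  qed simp
qed

section \<open>Conditions on a single slot and their inheritance by the differential\<close>

context loday_complex begin

lemma bsum_append:
  "bsum z \<Phi> (ys @ zs) = bsum z (\<lambda>ys. \<Phi> (ys @ zs)) ys + bsum z (\<lambda>zs. \<Phi> (ys @ zs)) zs"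
  by (induction ys arbitrary: \<Phi>) (simp_all add: add.assoc)

text \<open>The variant of \<open>bsum_null\<close> for conditions known only on arguments from a
  set that is stable under bracketing with x. It serves for points that avoid a given
  variable.\<close>

lemma bsum_in_N:
  assumes Z: "\<And>y. y \<in> Z \<Longrightarrow> br x y \<in> Z"
    and \<Phi>: "\<And>ys. set ys \<subseteq> Z \<Longrightarrow> \<Phi> ys \<in> N (c + wts ys)" and xs: "set xs \<subseteq> Z"
  shows "bsum x \<Phi> xs \<in> N (c + wt x + wts xs)"
  using \<Phi> xs
proof (induction xs arbitrary: \<Phi> c)
  case (Cons y ys)
  have "\<Phi> (br x y # ys) \<in> N (c + wts (br x y # ys))"
    by (rule Cons.prems(1)) (use Cons.prems(2) Z in auto)
  then have 1: "\<Phi> (br x y # ys) \<in> N (c + wt x + wts (y # ys))"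
    by (simp add: wt_br ac_simps)
  have "\<Phi> (y # zs) \<in> N (c + wt y + wts zs)" if "set zs \<subseteq> Z" for zs
    using Cons.prems(1)[of "y # zs"] Cons.prems(2) that by (simp add: ac_simps)
  then have 2: "bsum x (\<lambda>zs. \<Phi> (y # zs)) ys \<in> N (c + wt x + wts (y # ys))"
    using Cons.IH[of "\<lambda>zs. \<Phi> (y # zs)" "c + wt y"] Cons.prems(2) by (simp add: ac_simps)
  show ?case using N_add[OF 1 2] by simp
qed (simp add: N_zero)

text \<open>
  A slot rule is a list of pairs of an operator \<open>O\<close> and an element \<open>x\<close>; it holds for \<open>\<Phi>\<close> if the sum
  of the \<open>O (\<Phi> (\<dots>, x, \<dots>))\<close> vanishes modulo \<open>N\<close>, wherever the slot is.
\<close>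

definition slot :: "(('w \<Rightarrow> 'w) \<times> 'l) list \<Rightarrow> ('l list \<Rightarrow> 'w) \<Rightarrow> 'l list \<Rightarrow> 'l list \<Rightarrow> 'w" where
  "slot \<rho> \<Phi> ys zs = (\<Sum>(T, x)\<leftarrow>\<rho>. T (\<Phi> (ys @ x # zs)))"

lemma slot_Nil [simp]: "slot [] \<Phi> ys zs = 0"
  and slot_Cons [simp]: "slot ((T, x) # \<rho>) \<Phi> ys zs = T (\<Phi> (ys @ x # zs)) + slot \<rho> \<Phi> ys zs"
  by (simp_all add: slot_def)

definition additive_ops :: "(('w \<Rightarrow> 'w) \<times> 'l) list \<Rightarrow> bool" where
  "additive_ops \<rho> \<longleftrightarrow> list_all (\<lambda>(T, x). \<forall>v w. T (v + w) = T v + T w) \<rho>"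

lemma additive_ops_Nil [simp]: "additive_ops []"
  and additive_ops_Cons [simp]:
    "additive_ops ((T, x) # \<rho>) \<longleftrightarrow> (\<forall>v w. T (v + w) = T v + T w) \<and> additive_ops \<rho>"
  by (simp_all add: additive_ops_def)

lemma slot_diff:
  assumes "additive_ops \<rho>"
  shows "slot \<rho> (\<lambda>ys. \<Phi> ys - \<Psi> ys) ys zs = slot \<rho> \<Phi> ys zs - slot \<rho> \<Psi> ys zs"
  using assms
proof (induction \<rho>)
  case (Cons \<rho>1 \<rho>)
  obtain T x where [simp]: "\<rho>1 = (T, x)" by force
  have T: "T (v + w) = T v + T w" for v w using Cons.prems by simp
  have "T (v - w) = T v - T w" for v w
    using T[of "v - w" w] by simp
  then show ?case using Cons by simp
qed simp

text \<open>The bracket with z falls before the slot, into it, or behind it. Only the middle sum is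
  not again an instance of the rule for \<Phi>.\<close>

lemma slot_bsum:
  assumes "additive_ops \<rho>"
  shows "slot \<rho> (bsum z \<Phi>) ys zs = bsum z (\<lambda>ys. slot \<rho> \<Phi> ys zs) ys
    + (\<Sum>(T, x)\<leftarrow>\<rho>. T (\<Phi> (ys @ br z x # zs))) + bsum z (\<lambda>zs. slot \<rho> \<Phi> ys zs) zs"
  using assms
proof (induction \<rho>)
  case Nil
  have "bsum z (\<lambda>ys. 0) us = 0" for us by (induction us) simp_all
  then show ?case by simp
next
  case (Cons \<rho>1 \<rho>)
  obtain T x where [simp]: "\<rho>1 = (T, x)" by force
  have T: "T (v + w) = T v + T w" for v w using Cons.prems by simp
  have T0: "T 0 = 0" using T[of 0 0] by simp
  have "T (bsum z \<Psi> us) = bsum z (\<lambda>ys. T (\<Psi> ys)) us" for \<Psi> us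
    by (induction us arbitrary: \<Psi>) (simp_all add: T T0)
  then show ?case
    using Cons by (simp add: bsum_append T bsum_add add_ac)
qed

text \<open>Brackets outside the slot keep the other arguments in Z, so there the rule for \<Phi>
  applies. The hypothesis \<open>core\<close> is exactly what remains: z acting on the value, and z
  bracketed into the slot.\<close>

lemma Lie_slot:
  assumes T_add: "additive_ops \<rho>"
    and Z: "\<And>y. y \<in> Z \<Longrightarrow> br z y \<in> Z"
    and \<Phi>: "\<And>ys zs. set ys \<subseteq> Z \<Longrightarrow> set zs \<subseteq> Z \<Longrightarrow> slot \<rho> \<Phi> ys zs \<in> N (c + w0 + wts ys + wts zs)"
    and core: "(\<Sum>(T, x)\<leftarrow>\<rho>. T (act z (\<Phi> (ys @ x # zs)) - \<Phi> (ys @ br z x # zs)))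
      \<in> N (c + wt z + w0 + wts ys + wts zs)"
    and ys: "set ys \<subseteq> Z" and zs: "set zs \<subseteq> Z"
  shows "slot \<rho> (Lie z \<Phi>) ys zs \<in> N (c + wt z + w0 + wts ys + wts zs)"
proof -
  let ?s = "c + wt z + w0 + wts ys + wts zs"
  have 1: "bsum z (\<lambda>ys. slot \<rho> \<Phi> ys zs) ys \<in> N ?s"
  proof (rule N_eq[OF bsum_in_N[OF Z _ ys]])
    fix us assume "set us \<subseteq> Z"
    then show "slot \<rho> \<Phi> us zs \<in> N (c + w0 + wts zs + wts us)"
      using \<Phi>[OF _ zs] by (simp add: ac_simps)
  qed (simp_all add: ac_simps)
  have 2: "bsum z (\<lambda>zs. slot \<rho> \<Phi> ys zs) zs \<in> N ?s"
    by (rule N_eq[OF bsum_in_N[OF Z \<Phi>[OF ys] zs]]) (simp_all add: ac_simps)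
  have "(\<Sum>(T, x)\<leftarrow>\<rho>'. T (act z (\<Phi> (ys @ x # zs)) - \<Phi> (ys @ br z x # zs))) =
      slot \<rho>' (\<lambda>ys. act z (\<Phi> ys)) ys zs - (\<Sum>(T, x)\<leftarrow>\<rho>'. T (\<Phi> (ys @ br z x # zs)))"
    if "additive_ops \<rho>'" for \<rho>'
    using that
  proof (induction \<rho>')
    case (Cons \<rho>1 \<rho>')
    obtain T x where [simp]: "\<rho>1 = (T, x)" by force
    have T: "T (v + w) = T v + T w" for v w using Cons.prems by simp
    have "T (v - w) = T v - T w" for v w
      using T[of "v - w" w] by simp
    then show ?case using Cons by simp
  qed simp
  from this[OF T_add] show ?thesis
    by (intro N_eq[OF N_diff[OF N_diff[OF core 1] 2] _ refl])
      (simp add: Lie_def[abs_def] slot_diff[OF T_add] slot_bsum[OF T_add])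
qed

text \<open>F is a family of cochains closed under insertion of arguments from Z, and w0 is the
  degree that every operator of the rule leaves to the slot. The induction is on the number of
  arguments besides the slot: an argument before the slot is opened by Cartan's formula, a slot at
  the head is exchanged with its neighbour, and \<open>F_base\<close> is the case without
  neighbours. The set S holds the degrees at which the operators respect N.\<close>

theorem dif_slot:
  assumes T_add: "additive_ops \<rho>"
    and T_N: "\<And>T x s w. (T, x) \<in> set \<rho> \<Longrightarrow> s \<in> S \<Longrightarrow> w \<in> N (s + wt x) \<Longrightarrow> T w \<in> N (s + w0)"
    and S: "\<And>s z. s \<in> S \<Longrightarrow> z \<in> Z \<Longrightarrow> s + wt z \<in> S"
    and F_S: "\<And>c \<Phi>. F c \<Phi> \<Longrightarrow> c \<in> S"
    and F_alt: "\<And>c \<Phi>. F c \<Phi> \<Longrightarrow> alternating c \<Phi>"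
    and F_skew: "\<And>c \<Phi>. F c \<Phi> \<Longrightarrow> skew_killing c \<Phi>"
    and F_contract: "\<And>c \<Phi> z. F c \<Phi> \<Longrightarrow> z \<in> Z \<Longrightarrow> F (c + wt z) (\<lambda>ys. \<Phi> (z # ys))"
    and F_Lie: "\<And>c \<Phi> z ys zs. F c \<Phi> \<Longrightarrow> z \<in> Z \<Longrightarrow> set ys \<subseteq> Z \<Longrightarrow> set zs \<subseteq> Z \<Longrightarrow>
      slot \<rho> (Lie z \<Phi>) ys zs \<in> N (c + wt z + w0 + wts ys + wts zs)"
    and F_base: "\<And>c \<Phi>. F c \<Phi> \<Longrightarrow> (\<Sum>(T, x)\<leftarrow>\<rho>. T (act x (\<Phi> []))) \<in> N (c + w0)"
  shows "F c \<Phi> \<Longrightarrow> set ys \<subseteq> Z \<Longrightarrow> set zs \<subseteq> Z \<Longrightarrow>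
    slot \<rho> (dif \<Phi>) ys zs \<in> N (c + w0 + wts ys + wts zs)"
proof (induction "length ys + length zs" arbitrary: c \<Phi> ys zs)
  case 0
  have "slot \<rho>' (dif \<Phi>) [] [] = (\<Sum>(T, x)\<leftarrow>\<rho>'. T (act x (\<Phi> [])))" for \<rho>'
    by (induction \<rho>') (auto simp: Lie_def)
  then show ?case using F_base[OF 0(2)] 0(1) by simp
next
  case (Suc n)
  have S_wts: "s + wts us \<in> S" if "s \<in> S" "set us \<subseteq> Z" for s us
    using that by (induction us arbitrary: s) (auto simp flip: add.assoc intro: S)
  have step: "slot \<rho> (dif \<Phi>) (u # us) vs \<in> N (c + w0 + wts (u # us) + wts vs)"
    if "length us + length vs = n" "u \<in> Z" "set us \<subseteq> Z" "set vs \<subseteq> Z" for u us vs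
  proof -
    have 1: "slot \<rho> (dif (\<lambda>ys. \<Phi> (u # ys))) us vs \<in> N (c + w0 + wts (u # us) + wts vs)"
      using Suc(1)[OF that(1)[symmetric] F_contract[OF Suc(3) that(2)] that(3,4)]
      by (simp add: ac_simps)
    have 2: "slot \<rho> (Lie u \<Phi>) us vs \<in> N (c + w0 + wts (u # us) + wts vs)"
      using F_Lie[OF Suc(3) that(2-4)] by (simp add: ac_simps)
    have "slot \<rho> (dif \<Phi>) (u # us) vs = slot \<rho> (\<lambda>ys. dif \<Phi> (u # ys)) us vs"
      by (simp add: slot_def)
    then show ?thesis
      using N_diff[OF 2 1] by (simp add: dif_Cons_fun slot_diff[OF T_add])
  qed
  show ?case
  proof (cases ys)
    case (Cons u us)
    then show ?thesis using step[of us zs u] Suc(2-5) by simp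
  next
    case Nil
    \<comment> \<open>The slot is at the head: its neighbour v is moved in front of it, where
      \<open>step\<close> applies.\<close>
    then obtain v vs where zs: "zs = v # vs" "length vs = n" "v \<in> Z" "set vs \<subseteq> Z"
      using Suc(2,5) by (cases zs) auto
    have 1: "slot \<rho> (dif \<Phi>) [v] vs \<in> N (c + w0 + wts zs)"
      using step[of "[]" vs v] zs by (simp add: ac_simps)
    \<comment> \<open>The exchange is made for one summand of the rule at a time, hence the
      generalisation to sublists of the rule.\<close>
    have "slot \<rho>' (dif \<Phi>) [v] vs + slot \<rho>' (dif \<Phi>) [] (v # vs) \<in> N (c + w0 + wts zs)"
      if "set \<rho>' \<subseteq> set \<rho>" "additive_ops \<rho>'" for \<rho>'
      using that
    proof (induction \<rho>')
      case Nil then show ?case by (simp add: N_zero)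
    next
      case (Cons \<rho>1 \<rho>')
      obtain T x where [simp]: "\<rho>1 = (T, x)" by force
      have T: "T (v + w) = T v + T w" for v w using Cons.prems by simp
      have "dif \<Phi> (v # x # vs) + dif \<Phi> (x # v # vs) \<in> N (c + wts zs + wt x)"
        using alternatingD[OF dif_alternating[OF F_alt F_skew, OF Suc(3) Suc(3)], of "[]" v x vs]
        by (simp add: zs(1) ac_simps del: dif.simps)
      then have "T (dif \<Phi> (v # x # vs) + dif \<Phi> (x # v # vs)) \<in> N (c + wts zs + w0)"
        by (intro T_N[OF _ S_wts[OF F_S[OF Suc(3)] Suc(5)]]) (use Cons.prems in auto)
      then have 2: "T (dif \<Phi> (v # x # vs) + dif \<Phi> (x # v # vs)) \<in> N (c + w0 + wts zs)"
        by (rule N_eq) (simp_all add: ac_simps)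
      have "slot \<rho>' (dif \<Phi>) [v] vs + slot \<rho>' (dif \<Phi>) [] (v # vs) \<in> N (c + w0 + wts zs)"
        using Cons.IH Cons.prems by simp
      from N_add[OF 2 this] show ?case
        by (rule N_eq) (simp_all add: T add_ac del: dif.simps)
    qed
    from N_diff[OF this[OF order_refl T_add] 1] show ?thesis
      by (simp add: zs(1) Nil)
  qed
qed

section \<open>Naturality of the differential, the explicit formula, permutations\<close>

lemma Lie_natural:
  assumes \<sigma>_add: "\<And>v w. \<sigma> (v + w) = \<sigma> v + \<sigma> w"
    and \<sigma>_act: "\<And>x w. \<sigma> (act x w) = act (h x) (\<sigma> w)"
    and h_br: "\<And>x y. h (br x y) = br (h x) (h y)"
    and nat: "\<And>xs. \<sigma> (\<Phi> xs) - \<Psi> (map h xs) \<in> N (c + wts (map h xs))"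
  shows "\<sigma> (Lie x \<Phi> xs) - Lie (h x) \<Psi> (map h xs) \<in> N (c + wt (h x) + wts (map h xs))"
proof -
  have \<sigma>0: "\<sigma> 0 = 0" using \<sigma>_add[of 0 0] by simp
  have \<sigma>_diff: "\<sigma> (v - w) = \<sigma> v - \<sigma> w" for v w
    using \<sigma>_add[of "v - w" w] by simp
  have 1: "\<sigma> (bsum x \<Phi> xs) - bsum (h x) \<Psi> (map h xs) \<in> N (c + wt (h x) + wts (map h xs))"
    using nat
  proof (induction xs arbitrary: \<Phi> \<Psi> c)
    case (Cons y ys)
    let ?s = "c + wt (h x) + wts (map h (y # ys))"
    have 1: "\<sigma> (\<Phi> (br x y # ys)) - \<Psi> (br (h x) (h y) # map h ys) \<in> N ?s"
      using Cons.prems[of "br x y # ys"] by (simp add: h_br wt_br ac_simps)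
    have "\<sigma> (\<Phi> (y # zs)) - \<Psi> (h y # map h zs) \<in> N (c + wt (h y) + wts (map h zs))" for zs
      using Cons.prems[of "y # zs"] by (simp add: ac_simps)
    from Cons.IH[of "\<lambda>zs. \<Phi> (y # zs)" "\<lambda>zs. \<Psi> (h y # zs)", OF this]
    have 2: "\<sigma> (bsum x (\<lambda>zs. \<Phi> (y # zs)) ys) - bsum (h x) (\<lambda>zs. \<Psi> (h y # zs)) (map h ys) \<in> N ?s"
      by (simp add: ac_simps)
    show ?case by (rule N_eq[OF N_add[OF 1 2] _ refl]) (simp add: \<sigma>_add)
  qed (simp add: \<sigma>0 N_zero)
  have 2: "act (h x) (\<sigma> (\<Phi> xs) - \<Psi> (map h xs)) \<in> N (c + wt (h x) + wts (map h xs))"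
    using act_N[OF nat, of "h x" xs] by (simp add: ac_simps)
  show ?thesis
    by (rule N_eq[OF N_diff[OF 2 1] _ refl]) (simp add: Lie_def \<sigma>_diff \<sigma>_act act_diff)
qed

text \<open>For substitutions, with h acting on points and \<sigma> on values. Two cochains \<Phi>
  and \<Psi> are needed even to compare one with itself, since the induction inserts y on one side
  and h y on the other.\<close>

theorem dif_natural:
  assumes \<sigma>_add: "\<And>v w. \<sigma> (v + w) = \<sigma> v + \<sigma> w"
    and \<sigma>_act: "\<And>x w. \<sigma> (act x w) = act (h x) (\<sigma> w)"
    and h_br: "\<And>x y. h (br x y) = br (h x) (h y)"
    and nat: "\<And>xs. \<sigma> (\<Phi> xs) - \<Psi> (map h xs) \<in> N (c + wts (map h xs))"
  shows "\<sigma> (dif \<Phi> xs) - dif \<Psi> (map h xs) \<in> N (c + wts (map h xs))"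
  using nat
proof (induction xs arbitrary: \<Phi> \<Psi> c)
  case Nil
  have "\<sigma> 0 = 0" using \<sigma>_add[of 0 0] by simp
  then show ?case by (simp add: N_zero)
next
  case (Cons y ys)
  have \<sigma>_diff: "\<sigma> (v - w) = \<sigma> v - \<sigma> w" for v w
    using \<sigma>_add[of "v - w" w] by simp
  let ?s = "c + wts (map h (y # ys))"
  have 1: "\<sigma> (Lie y \<Phi> ys) - Lie (h y) \<Psi> (map h ys) \<in> N ?s"
    using Lie_natural[OF \<sigma>_add \<sigma>_act h_br, of \<Phi> \<Psi> c y ys] Cons.prems by (simp add: ac_simps)
  have "\<sigma> (\<Phi> (y # zs)) - \<Psi> (h y # map h zs) \<in> N (c + wt (h y) + wts (map h zs))" for zs
    using Cons.prems[of "y # zs"] by (simp add: ac_simps)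
  from Cons.IH[of "\<lambda>zs. \<Phi> (y # zs)" "\<lambda>zs. \<Psi> (h y # zs)", OF this]
  have 2: "\<sigma> (dif (\<lambda>zs. \<Phi> (y # zs)) ys) - dif (\<lambda>zs. \<Psi> (h y # zs)) (map h ys) \<in> N ?s"
    by (simp add: ac_simps)
  show ?case by (rule N_eq[OF N_diff[OF 1 2] _ refl]) (simp add: \<sigma>_diff)
qed

text \<open>The Chevalley-Eilenberg formula with the bracket in front. The recursion
  \<open>dif\<close> leaves the bracket at the place of the later of its two arguments, so that the
  two are compared for alternating cochains.\<close>

definition explicit :: "('l list \<Rightarrow> 'w) \<Rightarrow> 'l list \<Rightarrow> 'w" where
  "explicit \<Phi> xs =
     (\<Sum>i<length xs. (uminus ^^ i) (act (xs ! i) (\<Phi> (nths xs (- {i}))))) +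
     (\<Sum>(i, j)\<in>{(i, j). i < j \<and> j < length xs}.
        (uminus ^^ (i + j)) (\<Phi> (br (xs ! i) (xs ! j) # nths xs (- {i, j}))))"

lemma iterate_uminus:
  fixes v w :: 'w
  shows "(uminus ^^ n) (v + w) = (uminus ^^ n) v + (uminus ^^ n) w"
    "(uminus ^^ n) (v - w) = (uminus ^^ n) v - (uminus ^^ n) w"
    "(uminus ^^ n) (- w) = - (uminus ^^ n) w"
  by (induction n) simp_all

text \<open>Bringing the bracket from place j to the front passes j arguments, whence the
  sign.\<close>

lemma bsum_explicit:
  assumes "alternating c \<Phi>"
  shows "bsum x \<Phi> xs - (\<Sum>j<length xs. (uminus ^^ j) (\<Phi> (br x (xs ! j) # nths xs (- {j}))))
    \<in> N (c + wt x + wts xs)"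
proof -
  have "bsum x \<Phi> xs = (\<Sum>j<length xs. \<Phi> (take j xs @ br x (xs ! j) # drop (Suc j) xs))"
  proof (induction xs arbitrary: \<Phi>)
    case (Cons y ys)
    then show ?case by (simp add: sum.lessThan_Suc_shift del: sum.lessThan_Suc)
  qed simp
  moreover have "(\<Sum>j<length xs. \<Phi> (take j xs @ br x (xs ! j) # drop (Suc j) xs)
      - (uminus ^^ j) (\<Phi> (br x (xs ! j) # nths xs (- {j})))) \<in> N (c + wt x + wts xs)"
  proof (rule N_sum)
    fix j assume "j \<in> {..<length xs}"
    then have j: "j < length xs" by simp
    have "wts xs = wts (take j xs @ xs ! j # drop (Suc j) xs)"
      by (rule arg_cong[OF id_take_nth_drop[OF j], of "\<lambda>xs. wts xs"])
    then show "\<Phi> (take j xs @ br x (xs ! j) # drop (Suc j) xs)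
        - (uminus ^^ j) (\<Phi> (br x (xs ! j) # nths xs (- {j}))) \<in> N (c + wt x + wts xs)"
      using alternating_front[OF assms, of "take j xs" "br x (xs ! j)" "drop (Suc j) xs"] j
      by (simp add: nths_Compl_singleton wt_br ac_simps min_def)
  qed
  ultimately show ?thesis by (simp add: sum_subtractf)
qed

text \<open>Terms involving x as acting or bracketed element come from \<open>Lie x\<close>, the
  others from the contraction with x. In the latter the bracket stands behind x, and exchanging the
  two absorbs the minus sign of Cartan's recursion.\<close>

theorem dif_explicit:
  assumes "alternating c \<Phi>"
  shows "dif \<Phi> xs - explicit \<Phi> xs \<in> N (c + wts xs)"
  using assms
proof (induction xs arbitrary: \<Phi> c)
  case Nil
  then show ?case by (simp add: explicit_def N_zero)
next
  case (Cons x xs)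
  let ?s = "c + wts (x # xs)" and ?n = "length xs"
  let ?P = "\<lambda>n. {(i, j). i < j \<and> j < n}"
  have fin: "finite (?P n)" for n :: nat
    by (rule finite_subset[of _ "{..<n} \<times> {..<n}"]) auto
  have P: "?P (Suc ?n) = (\<lambda>j. (0, Suc j)) ` {..<?n} \<union> (\<lambda>(i, j). (Suc i, Suc j)) ` ?P ?n"
  proof (intro equalityI subsetI)
    fix ij assume "ij \<in> ?P (Suc ?n)"
    then obtain i j where ij: "ij = (i, j)" "i < j" "j < Suc ?n" by auto
    then obtain j' where j': "j = Suc j'" by (cases j) auto
    show "ij \<in> (\<lambda>j. (0, Suc j)) ` {..<?n} \<union> (\<lambda>(i, j). (Suc i, Suc j)) ` ?P ?n"
      using ij j' by (cases i) auto
  qed auto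
  have disj: "(\<lambda>j. (0, Suc j)) ` {..<?n} \<inter> (\<lambda>(i, j). (Suc i, Suc j)) ` ?P ?n = {}"
    by auto
  have e: "explicit \<Phi> (x # xs) = act x (\<Phi> xs)
    - (\<Sum>i<?n. (uminus ^^ i) (act (xs ! i) (\<Phi> (x # nths xs (- {i})))))
    - (\<Sum>j<?n. (uminus ^^ j) (\<Phi> (br x (xs ! j) # nths xs (- {j}))))
    + (\<Sum>(i, j)\<in>?P ?n. (uminus ^^ (i + j)) (\<Phi> (br (xs ! i) (xs ! j) # x # nths xs (- {i, j}))))"
    unfolding explicit_def list.size(4) add_Suc_right add_0_right P
      sum.union_disjoint[OF finite_imageI[OF finite_lessThan] finite_imageI[OF fin] disj]
    by (simp add: sum.reindex inj_on_def nths_Cons_Compl sum.lessThan_Suc_shift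
        sum_negf case_prod_unfold del: sum.lessThan_Suc)
  have e': "explicit (\<lambda>ys. \<Phi> (x # ys)) xs =
    (\<Sum>i<?n. (uminus ^^ i) (act (xs ! i) (\<Phi> (x # nths xs (- {i}))))) +
    (\<Sum>(i, j)\<in>?P ?n. (uminus ^^ (i + j)) (\<Phi> (x # br (xs ! i) (xs ! j) # nths xs (- {i, j}))))"
    by (simp add: explicit_def)
  have wts_nths: "wts xs = wt (xs ! i) + wt (xs ! j) + wts (nths xs (- {i, j}))"
    if "i < j" "j < length xs" for i j
    using sum_list_nths(2)[of i j "map wt xs"] that by (simp add: nths_map)
  have 1: "dif (\<lambda>ys. \<Phi> (x # ys)) xs - explicit (\<lambda>ys. \<Phi> (x # ys)) xs \<in> N ?s"
    using Cons.IH[OF alternating_contract[OF Cons.prems, of x]] by (simp add: ac_simps)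
  have 2: "bsum x \<Phi> xs - (\<Sum>j<?n. (uminus ^^ j) (\<Phi> (br x (xs ! j) # nths xs (- {j})))) \<in> N ?s"
    using bsum_explicit[OF Cons.prems, of x xs] by (simp add: ac_simps)
  have 3: "(\<Sum>(i, j)\<in>?P ?n. (uminus ^^ (i + j)) (\<Phi> (br (xs ! i) (xs ! j) # x # nths xs (- {i, j}))
      + \<Phi> (x # br (xs ! i) (xs ! j) # nths xs (- {i, j})))) \<in> N ?s"
  proof (intro N_sum, clarify, rule N_iterate_uminus)
    fix i j assume "i < j" "j < ?n"
    then show "\<Phi> (br (xs ! i) (xs ! j) # x # nths xs (- {i, j}))
        + \<Phi> (x # br (xs ! i) (xs ! j) # nths xs (- {i, j})) \<in> N ?s"
      using alternatingD[OF Cons.prems, of "[]" "br (xs ! i) (xs ! j)" x "nths xs (- {i, j})"]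
      by (simp add: wt_br wts_nths[of i j] ac_simps)
  qed
  show ?case
    by (rule N_eq[OF N_uminus[OF N_add[OF N_add[OF 1 2] 3]] _ refl])
      (simp add: e e' Lie_def iterate_uminus sum.distrib case_prod_unfold algebra_simps)
qed

text \<open>Induction along a product of transpositions; a general transposition is covered by
  \<open>alternating_exchange\<close>.\<close>

theorem alternating_permutes:
  assumes "alternating c \<Phi>" and "\<pi> permutes {..<k}" and "length xs = k"
  shows "\<Phi> xs - (let v = \<Phi> (map (\<lambda>i. xs ! \<pi> i) [0..<k]) in if sign \<pi> = 1 then v else - v)
    \<in> N (c + wts xs)"
proof -
  let ?Q = "\<lambda>\<pi>. \<forall>xs. length xs = k \<longrightarrow>
    \<Phi> xs - (let v = \<Phi> (map (\<lambda>i. xs ! \<pi> i) [0..<k]) in if sign \<pi> = 1 then v else - v) \<in> N (c + wts xs)"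
  have swap: "\<Phi> xs + \<Phi> (map (\<lambda>i. xs ! transpose a b i) [0..<k]) \<in> N (c + wts xs)"
    if "length xs = k" "a < b" "b < k" for xs a b
  proof -
    let ?ys = "take a xs" and ?zs = "take (b - Suc a) (drop (Suc a) xs)" and ?us = "drop (Suc b) xs"
    have xs: "xs = ?ys @ xs ! a # ?zs @ xs ! b # ?us"
      using that by (intro nth_equalityI) (auto simp: nth_append nth_Cons' min_def intro!: arg_cong[of _ b "(!) xs"])
    have map_eq: "map (\<lambda>i. xs ! transpose a b i) [0..<k] = ?ys @ xs ! b # ?zs @ xs ! a # ?us"
      using that by (intro nth_equalityI) (auto simp: nth_append nth_Cons' min_def transpose_def)
    show ?thesis
      using alternating_exchange[OF assms(1), of ?ys "xs ! a" ?zs "xs ! b" ?us]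
      unfolding map_eq xs[symmetric] .
  qed
  have swap': "\<Phi> xs + \<Phi> (map (\<lambda>i. xs ! transpose a b i) [0..<k]) \<in> N (c + wts xs)"
    if "length xs = k" "a \<noteq> b" "a < k" "b < k" for xs a b
    using swap[OF that(1), of a b] swap[OF that(1), of b a] that
    by (cases "a < b") (simp_all add: transpose_commute)
  have "?Q \<pi>"
    using finite_lessThan assms(2)
  proof (induction rule: permutes_rev_induct)
    case id
    then show ?case by (auto simp: map_nth Let_def N_zero)
  next
    case (swap a b p)
    show ?case
    proof (intro allI impI)
      fix xs :: "'l list" assume xs: "length xs = k"
      let ?ys = "map (\<lambda>i. xs ! p i) [0..<k]" and ?t = "transpose a b"
      \<comment> \<open>Permuting the arguments preserves the total degree, so that the congruences
        to be combined are modulo the same N.\<close>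
      have "wts ?ys = (\<Sum>i<k. wt (xs ! p i))"
        by (simp add: comp_def interv_sum_list_conv_sum_set_nat atLeast0LessThan)
      also have "\<dots> = (\<Sum>i<k. wt (xs ! i))"
        using sum.permute[OF swap(4), of "\<lambda>i. wt (xs ! i)"] by (simp add: comp_def)
      also have "\<dots> = wts xs"
        by (simp add: xs sum_list_sum_nth atLeast0LessThan)
      finally have "\<Phi> ?ys + \<Phi> (map (\<lambda>i. ?ys ! ?t i) [0..<k]) \<in> N (c + wts xs)"
        using swap'[of ?ys a b] swap(1-3) by simp
      moreover have "map (\<lambda>i. ?ys ! ?t i) [0..<k] = map (\<lambda>i. xs ! (p \<circ> ?t) i) [0..<k]"
        using swap(1-2) by (intro nth_equalityI) (auto simp: transpose_def)
      ultimately have h1: "\<Phi> ?ys + \<Phi> (map (\<lambda>i. xs ! (p \<circ> ?t) i) [0..<k]) \<in> N (c + wts xs)"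
        by simp
      have "permutation p"
        using swap(4) permutation_permutes by blast
      then have sgn: "sign (p \<circ> ?t) = - sign p"
        using swap(3) by (simp add: sign_compose permutation_swap_id sign_swap_id)
      from swap(5) xs have h2: "\<Phi> xs - (let v = \<Phi> ?ys in if sign p = 1 then v else - v)
          \<in> N (c + wts xs)"
        by blast
      consider "sign p = 1" | "sign p = - 1" by (cases rule: sign_cases[of p]) auto
      then show "\<Phi> xs - (let v = \<Phi> (map (\<lambda>i. xs ! (p \<circ> ?t) i) [0..<k])
          in if sign (p \<circ> ?t) = 1 then v else - v) \<in> N (c + wts xs)"
      proof cases
        case 1
        show ?thesis
          by (rule N_eq[OF N_add[OF h2 h1] _ refl]) (simp add: sgn 1)
      next
        case 2
        show ?thesis
          by (rule N_eq[OF N_diff[OF h2 h1] _ refl]) (simp add: sgn 2)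
      qed
    qed
  qed
  then show ?thesis using assms(3) by blast
qed

text \<open>The number j counts the arguments already inserted, so that the hypothesis on \<Phi>
  passes to its contractions with j raised by one.\<close>

lemma dif_length:
  assumes "\<And>xs. length xs + j \<noteq> k \<Longrightarrow> \<Phi> xs = 0" and "length xs + j \<noteq> Suc k"
  shows "dif \<Phi> xs = 0"
proof -
  have bsum: "bsum x \<Phi> xs = 0" if "\<And>xs. length xs + j \<noteq> k \<Longrightarrow> \<Phi> xs = 0" "length xs + j \<noteq> k" for x \<Phi> xs j
    using that
  proof (induction xs arbitrary: \<Phi> j)
    case (Cons y ys)
    have "bsum x (\<lambda>zs. \<Phi> (y # zs)) ys = 0"
      using Cons.prems(2) by (intro Cons.IH[of "Suc j"] Cons.prems(1)) auto
    moreover have "\<Phi> (br x y # ys) = 0"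
      using Cons.prems(2) by (intro Cons.prems(1)) simp
    ultimately show ?case by simp
  qed simp
  show ?thesis
    using assms
  proof (induction xs arbitrary: \<Phi> j)
    case (Cons x xs)
    have "dif (\<lambda>ys. \<Phi> (x # ys)) xs = 0"
      using Cons.prems(2) by (intro Cons.IH[of "Suc j"] Cons.prems(1)) auto
    moreover have "bsum x \<Phi> xs = 0"
      using Cons.prems(2) by (intro bsum[of j, OF Cons.prems(1)]) auto
    moreover have "\<Phi> xs = 0"
      using Cons.prems(2) by (intro Cons.prems(1)) simp
    ultimately show ?case by (simp add: Lie_def)
  qed simp
qed

end

section \<open>Additive maps\<close>

definition add_map :: "('v::ab_group_add \<Rightarrow> 'w::ab_group_add) \<Rightarrow> bool" where
  "add_map f \<longleftrightarrow> (\<forall>x y. f (x + y) = f x + f y)"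

definition biadd_map :: "('u::ab_group_add \<Rightarrow> 'v::ab_group_add \<Rightarrow> 'w::ab_group_add) \<Rightarrow> bool" where
  "biadd_map f \<longleftrightarrow> (\<forall>u. add_map (f u)) \<and> (\<forall>v. add_map (\<lambda>u. f u v))"

lemma add_mapI: "(\<And>x y. f (x + y) = f x + f y) \<Longrightarrow> add_map f"
  by (simp add: add_map_def)

lemma add_map_add: "add_map f \<Longrightarrow> f (x + y) = f x + f y"
  by (simp add: add_map_def)

lemma add_map_zero: "add_map f \<Longrightarrow> f 0 = 0"
  using add_map_add[of f 0 0] by simp

lemma add_map_diff: "add_map f \<Longrightarrow> f (x - y) = f x - f y"
  using add_map_add[of f "x - y" y] by simp

lemma add_map_uminus: "add_map f \<Longrightarrow> f (- x) = - f x"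
  using add_map_diff[of f 0 x] by (simp add: add_map_zero)

lemma add_map_sum: "add_map f \<Longrightarrow> f (sum g I) = (\<Sum>i\<in>I. f (g i))"
  by (induction I rule: infinite_finite_induct) (simp_all add: add_map_zero add_map_add)

lemma add_map_comp: "add_map f \<Longrightarrow> add_map g \<Longrightarrow> add_map (\<lambda>x. f (g x))"
  by (simp add: add_map_def)

lemma add_map_funpow: "add_map f \<Longrightarrow> add_map (f ^^ n)" for f :: "'v::ab_group_add \<Rightarrow> 'v"
  by (induction n) (simp_all add: add_map_def)

lemma add_map_single: "add_map (Poly_Mapping.single m)"
  by (simp add: add_map_def single_add)

lemma biadd_mapI:
  "(\<And>u v w. f u (v + w) = f u v + f u w) \<Longrightarrow> (\<And>u v w. f (u + v) w = f u w + f v w) \<Longrightarrow> biadd_map f"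
  by (simp add: add_map_def biadd_map_def)

lemma biadd_map_right: "biadd_map f \<Longrightarrow> add_map (f u)"
  and biadd_map_left: "biadd_map f \<Longrightarrow> add_map (\<lambda>u. f u v)"
  by (simp_all add: biadd_map_def)

lemma poly_mapping_single_induct [case_names single add]:
  fixes q :: "'k \<Rightarrow>\<^sub>0 'v::comm_monoid_add"
  assumes "\<And>m v. P (Poly_Mapping.single m v)" and "\<And>p q. P p \<Longrightarrow> P q \<Longrightarrow> P (p + q)"
  shows "P q"
proof (induction q rule: update_induct)
  case const
  then show ?case using assms(1)[of undefined 0] by simp
next
  case (update q m v)
  have "Poly_Mapping.update m v q = Poly_Mapping.single m v + q"
    using update(1) by (intro poly_mapping_eqI)
      (auto simp: lookup_update lookup_add lookup_single in_keys_iff when_def)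
  then show ?case using assms update(3) by simp
qed

text \<open>One map for each index, extended to finitely supported functions. Additivity of the maps
  makes the extension additive although the set of keys shrinks when coefficients cancel; operators
  built this way are then determined by their values on monomials.\<close>

definition lin :: "('k \<Rightarrow> 'v::ab_group_add \<Rightarrow> 'w::ab_group_add) \<Rightarrow> ('k \<Rightarrow>\<^sub>0 'v) \<Rightarrow> 'w" where
  "lin f q = (\<Sum>m\<in>Poly_Mapping.keys q. f m (Poly_Mapping.lookup q m))"

lemma lin_superset:
  assumes "\<And>m. add_map (f m)" "finite K" "Poly_Mapping.keys q \<subseteq> K"
  shows "lin f q = (\<Sum>m\<in>K. f m (Poly_Mapping.lookup q m))"
  unfolding lin_def using assms
  by (intro sum.mono_neutral_left) (auto simp: in_keys_iff add_map_zero)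

lemma lin_add:
  assumes "\<And>m. add_map (f m)"
  shows "lin f (p + q) = lin f p + lin f q"
proof -
  let ?K = "Poly_Mapping.keys p \<union> Poly_Mapping.keys q"
  have "lin f r = (\<Sum>m\<in>?K. f m (Poly_Mapping.lookup r m))" if "Poly_Mapping.keys r \<subseteq> ?K" for r
    using lin_superset[OF assms _ that] by simp
  then show ?thesis
    using keys_add[of p q] assms by (simp add: lookup_add add_map_add sum.distrib)
qed

lemma lin_single: "(\<And>m. add_map (f m)) \<Longrightarrow> lin f (Poly_Mapping.single m v) = f m v"
  by (simp add: lin_def add_map_zero)

lemma lin_fun_add: "lin (\<lambda>m v. f m v + g m v) q = lin f q + lin g q"
  by (simp add: lin_def sum.distrib)

lemma add_map_lin_param:
  assumes "\<And>m v. add_map (\<lambda>u. f u m v)"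
  shows "add_map (\<lambda>u. lin (f u) q)"
  using assms by (simp add: add_map_def lin_def sum.distrib)


section \<open>Polynomials with coefficients in an abelian group\<close>

text \<open>Integer multiples in an abelian group; one of the two sums is always empty.\<close>

definition zmul :: "int \<Rightarrow> 'v::ab_group_add \<Rightarrow> 'v" where
  "zmul n v = (\<Sum>i<nat n. v) - (\<Sum>i<nat (- n). v)"

lemma zmul_0 [simp]: "zmul 0 v = 0"
  by (simp add: zmul_def)

lemma zmul_add_1: "zmul (n + 1) v = zmul n v + v"
proof (cases "n \<ge> 0")
  case True
  then have "nat (n + 1) = Suc (nat n)" by simp
  with True show ?thesis by (simp add: zmul_def)
next
  case False
  then have "nat (- n) = Suc (nat (- (n + 1)))" by simp
  with False show ?thesis by (simp add: zmul_def)
qed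

lemma zmul_1 [simp]: "zmul 1 v = v"
  using zmul_add_1[of 0 v] by simp

lemma zmul_add_left: "zmul (m + n) v = zmul m v + zmul n v"
proof (induction n rule: int_induct[where k = 0])
  case (step1 i)
  then show ?case using zmul_add_1[of "m + i" v] zmul_add_1[of i v] by (simp add: ac_simps)
next
  case (step2 i)
  then show ?case using zmul_add_1[of "m + (i - 1)" v] zmul_add_1[of "i - 1" v]
    by (simp add: algebra_simps)
qed simp

lemma zmul_add_right: "zmul n (v + w) = zmul n v + zmul n w"
  by (simp add: zmul_def sum.distrib)

lemma zmul_mult: "zmul (m * n) v = zmul m (zmul n v)"
proof (induction m rule: int_induct[where k = 0])
  case (step1 i)
  then show ?case by (simp add: distrib_right zmul_add_left)
next
  case (step2 i)
  have "(i - 1) * n + n = i * n" by (simp add: algebra_simps)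
  then have "zmul ((i - 1) * n) v + zmul n v = zmul i (zmul n v)"
    using step2 zmul_add_left[of "(i - 1) * n" n v] by simp
  moreover have "zmul (i - 1) (zmul n v) + zmul n v = zmul i (zmul n v)"
    using zmul_add_1[of "i - 1" "zmul n v"] by simp
  ultimately show ?case by (metis add_right_cancel)
qed simp

lemma add_map_zmul: "add_map f \<Longrightarrow> f (zmul n v) = zmul n (f v)"
  by (simp add: zmul_def add_map_diff add_map_sum)

lemma zmul_int: "zmul m n = m * n"
  by (simp add: zmul_def)

text \<open>The ring \<open>\<int>[\<lambda>\<^sub>0, \<lambda>\<^sub>1, \<dots>]\<close> acts on polynomials with coefficients in any abelian group.\<close>

definition ract :: "int mpoly \<Rightarrow> 'v::ab_group_add mpoly \<Rightarrow> 'v mpoly" (infixr "\<bullet>" 75) where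
  "r \<bullet> q = lin (\<lambda>m a. lin (\<lambda>l v. Poly_Mapping.single (m + l) (zmul a v)) q) r"

definition X :: "nat \<Rightarrow> int mpoly" where
  "X i = Poly_Mapping.single (Poly_Mapping.single i 1) 1"

lemma biadd_ract: "biadd_map (ract :: int mpoly \<Rightarrow> 'v::ab_group_add mpoly \<Rightarrow> 'v mpoly)"
proof (rule biadd_mapI)
  have 1: "add_map (\<lambda>v. Poly_Mapping.single (m + l) (zmul a v))" for m l :: "nat \<Rightarrow>\<^sub>0 nat" and a
    by (simp add: add_map_def zmul_add_right single_add)
  show "u \<bullet> (v + w) = u \<bullet> v + u \<bullet> w" for u and v w :: "'v mpoly"
    unfolding ract_def lin_add[OF 1] lin_fun_add ..
  show "(u + v) \<bullet> w = u \<bullet> w + v \<bullet> w" for u v and w :: "'v mpoly"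
    unfolding ract_def
    by (rule lin_add, rule add_map_lin_param)
      (simp add: add_map_def zmul_add_left single_add)
qed

lemma ract_add_left: "(r + s) \<bullet> q = r \<bullet> q + s \<bullet> q"
  using add_map_add[OF biadd_map_left[OF biadd_ract]] .

lemma ract_add_right: "r \<bullet> (p + q) = r \<bullet> p + r \<bullet> q"
  using add_map_add[OF biadd_map_right[OF biadd_ract]] .

lemma add_map_ract: "add_map (ract r)" and add_map_ract_left: "add_map (\<lambda>r. r \<bullet> q)"
  using biadd_map_right[OF biadd_ract] biadd_map_left[OF biadd_ract] .

lemma ract_zero_left [simp]: "0 \<bullet> q = 0" and ract_zero_right [simp]: "r \<bullet> 0 = 0"
  by (simp_all add: ract_def lin_def)

lemma ract_diff_left: "(r - s) \<bullet> q = r \<bullet> q - s \<bullet> q"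
  using add_map_diff[OF add_map_ract_left] .

lemma ract_diff_right: "r \<bullet> (p - q) = r \<bullet> p - r \<bullet> q"
  using add_map_diff[OF add_map_ract] .

lemma ract_uminus_left: "(- r) \<bullet> q = - (r \<bullet> q)"
  using add_map_uminus[OF add_map_ract_left] .

lemma ract_uminus_right: "r \<bullet> (- q) = - (r \<bullet> q)"
  using add_map_uminus[OF add_map_ract] .

lemma ract_single: "Poly_Mapping.single m a \<bullet> Poly_Mapping.single l v = Poly_Mapping.single (m + l) (zmul a v)"
  for v :: "'a::ab_group_add"
proof -
  have 1: "add_map (\<lambda>v. Poly_Mapping.single (k + l) (zmul a v))" for k l :: "nat \<Rightarrow>\<^sub>0 nat" and a
    by (simp add: add_map_def zmul_add_right single_add)
  have "add_map (\<lambda>a. lin (\<lambda>l v. Poly_Mapping.single (k + l) (zmul a v)) q)"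
    for k and q :: "'a mpoly"
    by (rule add_map_lin_param) (simp add: add_map_def zmul_add_left single_add)
  then show ?thesis
    unfolding ract_def
    by (subst lin_single) (simp_all add: lin_single[of "\<lambda>l v. Poly_Mapping.single (m + l) (zmul a v)", OF 1])
qed

lemma ract_mult: "(r * s) \<bullet> q = r \<bullet> s \<bullet> q"
proof (induction r rule: poly_mapping_single_induct)
  case (single m a)
  show ?case
  proof (induction s rule: poly_mapping_single_induct)
    case (single l b)
    show ?case
      by (induction q rule: poly_mapping_single_induct)
        (simp_all add: mult_single ract_single zmul_mult add.assoc ract_add_right)
  qed (simp add: ract_add_left ract_add_right distrib_left)
qed (simp add: ract_add_left distrib_right)

lemma ract_one [simp]: "1 \<bullet> q = q"
  by (induction q rule: poly_mapping_single_induct)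
    (simp_all add: ract_add_right ract_single flip: single_one)

lemma ract_commute: "r \<bullet> s \<bullet> q = s \<bullet> r \<bullet> q"
  by (metis mult.commute ract_mult)

lemma ract_power: "(ract p ^^ n) q = (p ^ n) \<bullet> q"
  by (induction n) (simp_all add: ract_mult)

lemma ract_int: "r \<bullet> s = r * s" for s :: "int mpoly"
proof (induction r rule: poly_mapping_single_induct)
  case (single m a)
  show ?case
    by (induction s rule: poly_mapping_single_induct)
      (simp_all add: ract_single mult_single zmul_int ract_add_right distrib_left)
qed (simp add: ract_add_left distrib_right)

lemma ract_const_mpoly: "const_mpoly a \<bullet> q = zmul a q"
  by (induction q rule: poly_mapping_single_induct)
    (simp_all add: ract_single ract_add_right add_map_zmul[OF add_map_single, symmetric] zmul_add_right)

lemma mmult_eq: "mmult m q = Poly_Mapping.single m 1 \<bullet> q"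
  unfolding mmult_def lin_def[symmetric, of "\<lambda>l. Poly_Mapping.single (m + l)"]
  by (induction q rule: poly_mapping_single_induct)
    (simp_all add: lin_single lin_add add_map_single ract_single ract_add_right)

lemma lam_eq: "lam i q = X i \<bullet> q"
  by (simp add: lam_def mmult_eq X_def)

text \<open>For additive identities that are compatible with \<open>ract\<close>, the check on
  constants is all that remains. Most identities below are proved in this way.\<close>

lemma mpoly_induct [case_names const mul add]:
  fixes q :: "'v::ab_group_add mpoly"
  assumes "\<And>v. P (const_mpoly v)" and "\<And>r q. P q \<Longrightarrow> P (r \<bullet> q)"
    and "\<And>p q. P p \<Longrightarrow> P q \<Longrightarrow> P (p + q)"
  shows "P q"
proof (induction q rule: poly_mapping_single_induct)
  case (single m v)
  show ?case using assms(2)[OF assms(1)[of v], of "Poly_Mapping.single m 1"] by (simp add: ract_single)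
qed (rule assms(3))

abbreviation mmap :: "('v::zero \<Rightarrow> 'w::zero) \<Rightarrow> ('k \<Rightarrow>\<^sub>0 'v) \<Rightarrow> 'k \<Rightarrow>\<^sub>0 'w" where
  "mmap \<equiv> Poly_Mapping.map"

lemma lookup_mmap: "f 0 = 0 \<Longrightarrow> Poly_Mapping.lookup (mmap f q) m = f (Poly_Mapping.lookup q m)"
  by (simp add: map.rep_eq when_def)

lemma mmap_zero [simp]: "mmap f 0 = 0"
  by (rule poly_mapping_eqI) (simp add: map.rep_eq)

lemma mmap_add: "add_map f \<Longrightarrow> mmap f (p + q) = mmap f p + mmap f q"
  by (rule poly_mapping_eqI) (simp add: lookup_mmap lookup_add add_map_zero add_map_add)

lemma add_map_mmap: "add_map f \<Longrightarrow> add_map (mmap f)"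
  by (simp add: add_map_def mmap_add)

lemma mmap_ract:
  assumes "add_map f"
  shows "mmap f (r \<bullet> q) = r \<bullet> mmap f q"
proof (induction r rule: poly_mapping_single_induct)
  case (single m a)
  show ?case
    by (induction q rule: poly_mapping_single_induct)
      (simp_all add: ract_single ract_add_right mmap_add add_map_zero[OF assms]
        add_map_zmul[OF assms] assms)
qed (simp add: ract_add_left mmap_add[OF assms])

text \<open>For additive f, the extension of f to polynomials that is linear over the integer
  polynomials.\<close>

definition lift :: "('v::ab_group_add \<Rightarrow> 'w::ab_group_add mpoly) \<Rightarrow> 'v mpoly \<Rightarrow> 'w mpoly" where
  "lift f = lin (\<lambda>m v. Poly_Mapping.single m 1 \<bullet> f v)"

lemma lift_aux: "add_map f \<Longrightarrow> add_map (\<lambda>v. Poly_Mapping.single m 1 \<bullet> f v)"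
  by (rule add_map_comp[OF add_map_ract])

lemma lift_add: "add_map f \<Longrightarrow> lift f (p + q) = lift f p + lift f q"
  unfolding lift_def by (rule lin_add) (rule lift_aux)

lemma lift_single: "add_map f \<Longrightarrow> lift f (Poly_Mapping.single m v) = Poly_Mapping.single m 1 \<bullet> f v"
  unfolding lift_def by (rule lin_single) (rule lift_aux)

lemma lift_const: "add_map f \<Longrightarrow> lift f (const_mpoly v) = f v"
  by (simp add: lift_single)

lemma lift_ract:
  assumes "add_map f"
  shows "lift f (r \<bullet> q) = r \<bullet> lift f q"
proof (induction r rule: poly_mapping_single_induct)
  case (single m a)
  show ?case
  proof (induction q rule: poly_mapping_single_induct)
    case (single l v)
    have "Poly_Mapping.single m a \<bullet> Poly_Mapping.single l 1 \<bullet> f v =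
        Poly_Mapping.single (m + l) 1 \<bullet> Poly_Mapping.single 0 a \<bullet> f v"
      by (simp add: mult_single flip: ract_mult)
    also have "Poly_Mapping.single 0 a \<bullet> f v = zmul a (f v)"
      by (rule ract_const_mpoly)
    finally show ?case
      by (simp add: ract_single lift_single[OF assms] add_map_zmul[OF assms])
  qed (simp add: ract_add_right lift_add[OF assms])
qed (simp add: ract_add_left lift_add[OF assms])

lemma lift_fun_add: "lift (\<lambda>v. f v + g v) q = lift f q + lift g q"
  by (simp add: lift_def ract_add_right lin_fun_add)

lemma lift_param: "(\<And>v. add_map (\<lambda>u. f u v)) \<Longrightarrow> add_map (\<lambda>u. lift (f u) q)"
  unfolding lift_def by (rule add_map_lin_param) (rule add_map_comp[OF add_map_ract])

definition bilift ::
  "('u::ab_group_add \<Rightarrow> 'v::ab_group_add \<Rightarrow> 'w::ab_group_add mpoly) \<Rightarrow> 'u mpoly \<Rightarrow> 'v mpoly \<Rightarrow> 'w mpoly"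
where
  "bilift f p q = lift (\<lambda>u. lift (f u) q) p"

lemma bilift_aux: "biadd_map f \<Longrightarrow> add_map (\<lambda>u. lift (f u) q)"
  by (rule lift_param) (rule biadd_map_left)

lemma bilift_add_left: "biadd_map f \<Longrightarrow> bilift f (p + p') q = bilift f p q + bilift f p' q"
  unfolding bilift_def by (rule lift_add) (rule bilift_aux)

lemma bilift_ract_left: "biadd_map f \<Longrightarrow> bilift f (r \<bullet> p) q = r \<bullet> bilift f p q"
  unfolding bilift_def by (rule lift_ract) (rule bilift_aux)

lemma bilift_add_right: "biadd_map f \<Longrightarrow> bilift f p (q + q') = bilift f p q + bilift f p q'"
  by (simp add: bilift_def lift_add[OF biadd_map_right] lift_fun_add)

lemma bilift_const_left: "biadd_map f \<Longrightarrow> bilift f (const_mpoly u) q = lift (f u) q"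
  unfolding bilift_def by (rule lift_const) (rule bilift_aux)

lemma bilift_ract_right: "biadd_map f \<Longrightarrow> bilift f p (r \<bullet> q) = r \<bullet> bilift f p q"
  by (induction p rule: mpoly_induct)
    (simp_all add: bilift_const_left bilift_add_left bilift_ract_left lift_ract biadd_map_right
      ract_add_right ract_commute[of r])

lemma bilift_const: "biadd_map f \<Longrightarrow> bilift f (const_mpoly u) (const_mpoly v) = f u v"
  by (simp add: bilift_const_left lift_const biadd_map_right)

section \<open>Evaluation and substitution\<close>

lemma map_poly_add: "add_map f \<Longrightarrow> map_poly f (p + q) = map_poly f p + map_poly f q"
  by (rule poly_eqI) (simp add: coeff_map_poly add_map_zero add_map_add)

lemma coeff_map_poly_add_map: "add_map f \<Longrightarrow> coeff (map_poly f p) n = f (coeff p n)"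
  by (simp add: coeff_map_poly add_map_zero)

lemma lambda_plus_pCons:
  "add_map d \<Longrightarrow> lambda_plus d (pCons v q) = [:d v:] + pCons 0 (lambda_plus d q) + pCons 0 [:v:]"
  by (rule poly_eqI)
    (simp add: lambda_plus_def coeff_map_poly_add_map coeff_pCons split: nat.split)

lemma add_map_pCons: "add_map (pCons 0)"
  by (simp add: add_map_def)

lemma add_map_lambda_plus: "add_map d \<Longrightarrow> add_map (lambda_plus d)"
  unfolding add_map_def[of "lambda_plus d"] lambda_plus_def by (simp add: map_poly_add)

text \<open>The value P(p) of a polynomial in one variable. Integer polynomials p cover all
  substitutions that occur: variables, their sums and differences.\<close>

definition pev :: "int mpoly \<Rightarrow> 'v::ab_group_add poly \<Rightarrow> 'v mpoly" where
  "pev p P = subst1 P (ract p)"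

lemma pev_altdef: "degree P \<le> n \<Longrightarrow> pev p P = (\<Sum>i\<le>n. p ^ i \<bullet> const_mpoly (coeff P i))"
  unfolding pev_def subst1_def ract_power
  by (rule sum.mono_neutral_left) (auto simp: coeff_eq_0)

lemma pev_add: "pev p (P + Q) = pev p P + pev p Q"
proof -
  let ?n = "max (degree P) (degree Q)"
  have "degree (P + Q) \<le> ?n" by (rule degree_add_le_max)
  then show ?thesis
    by (simp add: pev_altdef[of _ ?n] single_add ract_add_right sum.distrib)
qed

lemma add_map_pev: "add_map (pev p)"
  by (simp add: add_map_def pev_add)

lemma pev_zero [simp]: "pev p 0 = 0"
  by (simp add: pev_def subst1_def)

lemma pev_pCons: "pev p (pCons v P) = const_mpoly v + p \<bullet> pev p P"
proof -
  have "pev p (pCons v P) = (\<Sum>i\<le>Suc (degree P). p ^ i \<bullet> const_mpoly (coeff (pCons v P) i))"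
    by (rule pev_altdef) (simp add: degree_pCons_le)
  also have "\<dots> = const_mpoly v + (\<Sum>i\<le>degree P. p \<bullet> p ^ i \<bullet> const_mpoly (coeff P i))"
    by (simp add: sum.atMost_Suc_shift ract_mult del: sum.atMost_Suc)
  finally show ?thesis
    by (simp add: pev_altdef[of P "degree P"] add_map_sum[OF add_map_ract])
qed

lemma pev_map_poly: "add_map f \<Longrightarrow> pev p (map_poly f P) = mmap f (pev p P)"
proof (induction P)
  case (pCons v P)
  have "map_poly f (pCons v P) = pCons (f v) (map_poly f P)"
    using pCons.prems by (rule_tac poly_eqI)
      (simp add: coeff_map_poly_add_map coeff_pCons split: nat.split)
  then show ?case
    using pCons by (simp add: pev_pCons mmap_add add_map_zero mmap_ract)
qed simp

lemma pev_lambda_plus: "add_map d \<Longrightarrow> pev p (lambda_plus d P) = p \<bullet> pev p P + mmap d (pev p P)"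
  by (simp add: lambda_plus_def pev_add pev_pCons pev_map_poly)

lemma lambda_apply_eq: "lambda_apply f (ract p) q = lift (\<lambda>v. pev p (f v)) q"
  by (simp add: lambda_apply_def lift_def lin_def mmult_eq pev_def)

definition mon :: "(nat \<Rightarrow> int mpoly) \<Rightarrow> (nat \<Rightarrow>\<^sub>0 nat) \<Rightarrow> int mpoly" where
  "mon h m = (\<Prod>i\<in>Poly_Mapping.keys m. h i ^ Poly_Mapping.lookup m i)"

lemma mon_superset:
  "finite K \<Longrightarrow> Poly_Mapping.keys m \<subseteq> K \<Longrightarrow> mon h m = (\<Prod>i\<in>K. h i ^ Poly_Mapping.lookup m i)"
  unfolding mon_def by (rule prod.mono_neutral_left) (auto simp: in_keys_iff)

lemma mon_add: "mon h (m + l) = mon h m * mon h l"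
proof -
  let ?K = "Poly_Mapping.keys m \<union> Poly_Mapping.keys l"
  show ?thesis
    using keys_add[of m l]
    by (simp add: mon_superset[of ?K] lookup_add power_add prod.distrib)
qed

lemma mon_zero [simp]: "mon h 0 = 1"
  by (simp add: mon_def)

lemma mon_single: "mon h (Poly_Mapping.single i n) = h i ^ n"
  by (cases "n = 0") (simp_all add: mon_def)

definition sub :: "(nat \<Rightarrow> int mpoly) \<Rightarrow> 'v::ab_group_add mpoly \<Rightarrow> 'v mpoly" where
  "sub h = lin (\<lambda>m v. mon h m \<bullet> const_mpoly v)"

lemma sub_aux: "add_map (\<lambda>v. r \<bullet> const_mpoly v)"
  by (rule add_map_comp[OF add_map_ract add_map_single])

lemma sub_add: "sub h (p + q) = sub h p + sub h q"
  unfolding sub_def by (rule lin_add) (rule sub_aux)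

lemma add_map_sub: "add_map (sub h)"
  by (simp add: add_map_def sub_add)

lemma sub_single: "sub h (Poly_Mapping.single m v) = mon h m \<bullet> const_mpoly v"
  unfolding sub_def by (rule lin_single) (rule sub_aux)

lemma sub_const [simp]: "sub h (const_mpoly v) = const_mpoly v"
  by (simp add: sub_single)

lemma sub_X [simp]: "sub h (X i) = h i"
  by (simp add: X_def sub_single mon_single ract_int)

lemma sub_ract: "sub h (r \<bullet> q) = sub h r \<bullet> sub h q"
proof (induction r rule: poly_mapping_single_induct)
  case (single m a)
  show ?case
  proof (induction q rule: poly_mapping_single_induct)
    case (single l v)
    have "mon h m \<bullet> mon h l \<bullet> const_mpoly (zmul a v) = mon h m \<bullet> mon h l \<bullet> const_mpoly a \<bullet> const_mpoly v"
      by (simp add: ract_single)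
    also have "\<dots> = (mon h m * const_mpoly a) \<bullet> mon h l \<bullet> const_mpoly v"
      by (simp add: ract_mult ract_commute[of "const_mpoly a"])
    finally show ?case
      by (simp add: ract_single sub_single mon_add ract_mult ract_int)
  qed (simp add: ract_add_right sub_add)
qed (simp add: ract_add_left sub_add)

lemma sub_mult: "sub h (r * s) = sub h r * sub h s" for r s :: "int mpoly"
  using sub_ract[of h r s] by (simp add: ract_int)

lemma sub_one [simp]: "sub h (1 :: int mpoly) = 1"
  unfolding single_one[symmetric] by (rule sub_const)

lemma sub_power: "sub h (r ^ n) = sub h r ^ n" for r :: "int mpoly"
  by (induction n) (simp_all add: sub_mult)

lemma sub_sub: "sub h (sub g q) = sub (\<lambda>i. sub h (g i)) q"
proof (induction q rule: poly_mapping_single_induct)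
  case (single m v)
  have "sub h (\<Prod>i\<in>I. g i ^ k i) = (\<Prod>i\<in>I. sub h (g i) ^ k i)" for I and k :: "nat \<Rightarrow> nat"
    by (induction I rule: infinite_finite_induct) (simp_all add: sub_mult sub_power)
  then have "sub h (mon g m) = mon (\<lambda>i. sub h (g i)) m"
    unfolding mon_def .
  then show ?case by (simp add: sub_single sub_ract)
qed (simp add: sub_add)

lemma sub_cong:
  assumes "\<And>m i. m \<in> Poly_Mapping.keys q \<Longrightarrow> i \<in> Poly_Mapping.keys m \<Longrightarrow> h i = g i"
  shows "sub h q = sub g q"
  unfolding sub_def lin_def mon_def using assms by (intro sum.cong refl arg_cong2[of _ _ _ _ ract] prod.cong) auto

lemma X_power: "X i ^ n = Poly_Mapping.single (Poly_Mapping.single i n) 1"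
proof (induction n)
  case (Suc n)
  have "Poly_Mapping.single i (Suc n) = Poly_Mapping.single i 1 + Poly_Mapping.single i n"
    unfolding single_add[symmetric] by simp
  then show ?case using Suc by (simp add: X_def mult_single)
qed simp

lemma mon_X: "mon X m = Poly_Mapping.single m 1"
proof -
  have "mon X m = Poly_Mapping.single (\<Sum>i\<in>Poly_Mapping.keys m. Poly_Mapping.single i (Poly_Mapping.lookup m i)) 1"
  proof -
    have "(\<Prod>i\<in>I. X i ^ k i) = Poly_Mapping.single (\<Sum>i\<in>I. Poly_Mapping.single i (k i)) 1" for I k
      by (induction I rule: infinite_finite_induct) (simp_all add: mult_single X_power)
    then show ?thesis unfolding mon_def .
  qed
  also have "(\<Sum>i\<in>Poly_Mapping.keys m. Poly_Mapping.single i (Poly_Mapping.lookup m i)) = m"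
    by (rule poly_mapping_eqI) (auto simp: lookup_sum lookup_single when_def in_keys_iff)
  finally show ?thesis .
qed

lemma sub_X_id [simp]: "sub X q = q"
  by (induction q rule: poly_mapping_single_induct) (simp_all add: sub_single mon_X ract_single sub_add)

lemma sub_mmap: "add_map f \<Longrightarrow> sub h (mmap f q) = mmap f (sub h q)"
  by (induction q rule: mpoly_induct)
    (simp_all add: add_map_zero mmap_add sub_add mmap_ract sub_ract)

lemma sub_lift:
  "add_map f \<Longrightarrow> add_map g \<Longrightarrow> (\<And>v. sub h (f v) = g v) \<Longrightarrow> sub h (lift f q) = lift g (sub h q)"
  by (induction q rule: mpoly_induct) (simp_all add: lift_const lift_ract lift_add sub_ract sub_add)

lemma sub_bilift:
  assumes "biadd_map f" "biadd_map g" "\<And>u v. sub h (f u v) = g u v"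
  shows "sub h (bilift f p q) = bilift g (sub h p) (sub h q)"
proof (induction p rule: mpoly_induct)
  case (const u)
  then show ?case
    using assms by (simp add: bilift_const_left sub_lift[where g = "g u"] biadd_map_right)
qed (simp_all add: bilift_add_left bilift_ract_left sub_add sub_ract assms)

lemma sub_pev: "sub h (pev p P) = pev (sub h p) P"
  by (induction P) (simp_all add: add_map_zero[OF add_map_sub] pev_pCons sub_add sub_ract)

definition vars :: "'v::zero mpoly \<Rightarrow> nat set" where
  "vars q = (\<Union>m\<in>Poly_Mapping.keys q. Poly_Mapping.keys m)"

text \<open>The definitions substitute operators, applied in the order of the list. For
  multiplication operators the order is immaterial, and the result is the substitution
  \<open>sub\<close> of polynomials.\<close>

lemma subst_mpoly_ract:
  fixes q :: "'v::ab_group_add mpoly"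
  assumes "vars q \<subseteq> {..<length ps}"
  shows "subst_mpoly (map ract ps) q = sub (\<lambda>i. ps ! i) q"
  unfolding subst_mpoly_def sub_def lin_def
proof (rule sum.cong[OF refl])
  fix m assume "m \<in> Poly_Mapping.keys q"
  then have m: "Poly_Mapping.keys m \<subseteq> {..<length ps}"
    using assms by (auto simp: vars_def)
  have "foldr (\<lambda>i. (map ract ps ! i) ^^ k i) [j..<length ps] w = (\<Prod>i\<in>{j..<length ps}. ps ! i ^ k i) \<bullet> w"
    if "j \<le> length ps" for j k and w :: "'v mpoly"
    using that
  proof (induction j rule: inc_induct)
    case (step j)
    then show ?case
      by (simp add: upt_conv_Cons ract_power prod.atLeast_Suc_lessThan ract_mult)
  qed simp
  from this[of 0] show "foldr (\<lambda>i. (map ract ps ! i) ^^ Poly_Mapping.lookup m i) [0..<length (map ract ps)]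
      (const_mpoly (Poly_Mapping.lookup q m)) = mon ((!) ps) m \<bullet> const_mpoly (Poly_Mapping.lookup q m)"
    using mon_superset[OF _ m, of "(!) ps"] by (simp add: atLeast0LessThan)
qed

section \<open>Polynomials not involving a given variable\<close>

definition tfree :: "nat \<Rightarrow> 'v::zero mpoly \<Rightarrow> bool" where
  "tfree t q \<longleftrightarrow> (\<forall>m\<in>Poly_Mapping.keys q. Poly_Mapping.lookup m t = 0)"

lemma tfree_zero [simp]: "tfree t 0"
  by (simp add: tfree_def)

lemma tfree_single: "Poly_Mapping.lookup m t = 0 \<Longrightarrow> tfree t (Poly_Mapping.single m v)"
  by (simp add: tfree_def)

lemma tfree_const [simp]: "tfree t (const_mpoly v)"
  by (simp add: tfree_single)

lemma tfree_X: "i \<noteq> t \<Longrightarrow> tfree t (X i)"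
  by (simp add: X_def tfree_single lookup_single)

lemma tfree_add: "tfree t p \<Longrightarrow> tfree t q \<Longrightarrow> tfree t (p + q)"
  unfolding tfree_def using keys_add[of p q] by blast

lemma poly_mapping_sum_single:
  "q = (\<Sum>m\<in>Poly_Mapping.keys q. Poly_Mapping.single m (Poly_Mapping.lookup q m))"
  by (rule poly_mapping_eqI) (auto simp: lookup_sum lookup_single when_def in_keys_iff)

lemma tfree_single_induct [consumes 1, case_names single add]:
  fixes q :: "'v::ab_group_add mpoly"
  assumes "tfree t q"
    and single: "\<And>m v. Poly_Mapping.lookup m t = 0 \<Longrightarrow> P (Poly_Mapping.single m v)"
    and add: "\<And>p q. P p \<Longrightarrow> P q \<Longrightarrow> P (p + q)"
  shows "P q"
proof -
  have "P (\<Sum>m\<in>K. Poly_Mapping.single m (Poly_Mapping.lookup q m))" if "K \<subseteq> Poly_Mapping.keys q" for K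
    using finite_subset[OF that finite_keys] that
  proof (induction K rule: finite_induct)
    case empty
    then show ?case using single[of 0 0] by simp
  next
    case (insert m K)
    then show ?case using assms(1) by (auto simp: tfree_def intro!: add single)
  qed
  then show ?thesis using poly_mapping_sum_single[of q] by fastforce
qed

lemma tfree_induct [consumes 1, case_names const mul add]:
  fixes q :: "'v::ab_group_add mpoly"
  assumes "tfree t q" and "\<And>v. P (const_mpoly v)" and "\<And>r q. tfree t r \<Longrightarrow> P q \<Longrightarrow> P (r \<bullet> q)"
    and "\<And>p q. P p \<Longrightarrow> P q \<Longrightarrow> P (p + q)"
  shows "P q"
  using assms(1)
proof (induction rule: tfree_single_induct)
  case (single m v)
  show ?case
    using assms(3)[OF tfree_single[OF single, of 1] assms(2)[of v]] by (simp add: ract_single)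
qed (rule assms(4))

text \<open>For operators such as \<open>Sop t\<close> and \<open>tau t\<close>, which commute with
  all variables except lambda_t.\<close>

lemma mpoly_induct_var [case_names const mul var add]:
  fixes q :: "'v::ab_group_add mpoly"
  assumes "\<And>v. P (const_mpoly v)" and "\<And>r q. tfree t r \<Longrightarrow> P q \<Longrightarrow> P (r \<bullet> q)"
    and "\<And>q. P q \<Longrightarrow> P (X t \<bullet> q)" and "\<And>p q. P p \<Longrightarrow> P q \<Longrightarrow> P (p + q)"
  shows "P q"
proof (induction q rule: poly_mapping_single_induct)
  case (single m v)
  let ?n = "Poly_Mapping.lookup m t"
  let ?m = "m - Poly_Mapping.single t ?n"
  have m: "m = Poly_Mapping.single t ?n + ?m"
    by (rule poly_mapping_eqI) (auto simp: lookup_add lookup_minus lookup_single when_def)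
  have 1: "tfree t (Poly_Mapping.single ?m (1 :: int))"
    by (rule tfree_single) (simp add: lookup_minus)
  have "P (Poly_Mapping.single ?m v)"
    using assms(2)[OF 1 assms(1)[of v]] by (simp add: ract_single)
  then have "P (Poly_Mapping.single (Poly_Mapping.single t n + ?m) v)" for n
  proof (induction n)
    case (Suc n)
    have "Poly_Mapping.single t (Suc n) = Poly_Mapping.single t 1 + Poly_Mapping.single t n"
      unfolding single_add[symmetric] by simp
    then show ?case
      using assms(3)[OF Suc.IH[OF Suc.prems]] by (simp add: X_def ract_single add.assoc)
  qed simp
  from this[of ?n] show ?case using m by simp
qed (rule assms(4))

lemma tfree_ract: "tfree t r \<Longrightarrow> tfree t q \<Longrightarrow> tfree t (r \<bullet> q)"
proof (induction rule: tfree_single_induct)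
  case (single m a)
  from single(2,1) show ?case
    by (induction rule: tfree_single_induct)
      (simp_all add: ract_single tfree_single lookup_add ract_add_right tfree_add)
qed (simp add: ract_add_left tfree_add)

lemma tfree_mult: "tfree t r \<Longrightarrow> tfree t s \<Longrightarrow> tfree t (r * s)" for r s :: "int mpoly"
  using tfree_ract[of t r s] by (simp add: ract_int)

lemma tfree_one [simp]: "tfree t (1 :: int mpoly)"
  unfolding single_one[symmetric] by (rule tfree_const)

lemma tfree_power: "tfree t r \<Longrightarrow> tfree t (r ^ n)" for r :: "int mpoly"
  by (induction n) (simp_all add: tfree_mult)

lemma tfree_mmap: "tfree t q \<Longrightarrow> tfree t (mmap f q)"
  by (auto simp: tfree_def in_keys_iff map.rep_eq when_def)

lemma tfree_lift: "tfree t q \<Longrightarrow> add_map f \<Longrightarrow> (\<And>v. tfree t (f v)) \<Longrightarrow> tfree t (lift f q)"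
  by (induction rule: tfree_induct) (simp_all add: lift_const lift_ract lift_add tfree_ract tfree_add)

lemma tfree_bilift:
  assumes "tfree t p" "tfree t q" "biadd_map f" "\<And>u v. tfree t (f u v)"
  shows "tfree t (bilift f p q)"
  using assms(1)
proof (induction rule: tfree_induct)
  case (const u)
  then show ?case
    using assms by (simp add: bilift_const_left tfree_lift biadd_map_right)
qed (simp_all add: bilift_ract_left bilift_add_left assms tfree_ract tfree_add)

lemma tfree_pev: "tfree t p \<Longrightarrow> tfree t (pev p P)"
  by (induction P) (simp_all add: pev_pCons tfree_add tfree_ract)

lemma tfree_sub: "tfree t q \<Longrightarrow> (\<And>i. i \<noteq> t \<Longrightarrow> h i = g i) \<Longrightarrow> sub h q = sub g q"
  by (rule sub_cong) (metis in_keys_iff tfree_def)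

lemma tfree_sub_id: "tfree t q \<Longrightarrow> (\<And>i. i \<noteq> t \<Longrightarrow> h i = X i) \<Longrightarrow> sub h q = q"
  using tfree_sub[of t q h X] by simp

lemma tfree_subI:
  assumes "\<And>i. tfree t (h i)"
  shows "tfree t (sub h q)"
proof (induction q rule: poly_mapping_single_induct)
  case (single m v)
  have "tfree t (\<Prod>i\<in>I. h i ^ k i)" for I and k :: "nat \<Rightarrow> nat"
    by (induction I rule: infinite_finite_induct) (simp_all add: tfree_mult tfree_power assms)
  then show ?case by (simp add: sub_single mon_def tfree_ract)
qed (simp add: sub_add tfree_add)

text \<open>Two uses: the shift of lambda_t by a degree q in the anchor term of
  \<open>bev_Sop\<close>, and, with a variable for q, the expression lambda_i + x.\<close>

definition tshift :: "nat \<Rightarrow> int mpoly \<Rightarrow> nat \<Rightarrow> int mpoly" where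
  "tshift t q = X(t := X t + q)"

lemma sub_tshift_tfree: "tfree t w \<Longrightarrow> sub (tshift t q) w = w"
  by (rule tfree_sub_id) (auto simp: tshift_def)

lemma tshift_same: "tshift t q t = X t + q"
  by (simp add: tshift_def)


section \<open>Replacing a variable by a derivation\<close>

locale derivation_action =
  fixes d :: "'a::comm_ring_1 \<Rightarrow> 'a" and sc :: "'a \<Rightarrow> 'v::ab_group_add \<Rightarrow> 'v"
  assumes d_add: "add_map d" and sc_biadd: "biadd_map sc"
begin

definition amul :: "'a mpoly \<Rightarrow> 'v mpoly \<Rightarrow> 'v mpoly" where
  "amul = bilift (\<lambda>a v. const_mpoly (sc a v))"

lemma amul_aux: "biadd_map (\<lambda>a v. const_mpoly (sc a v))"
  using sc_biadd by (simp add: biadd_map_def add_map_def single_add)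

lemma amul_add_left: "amul (\<alpha> + \<beta>) w = amul \<alpha> w + amul \<beta> w"
  and amul_add_right: "amul \<alpha> (v + w) = amul \<alpha> v + amul \<alpha> w"
  and amul_ract_left: "amul (r \<bullet> \<alpha>) w = r \<bullet> amul \<alpha> w"
  and amul_ract_right: "amul \<alpha> (r \<bullet> w) = r \<bullet> amul \<alpha> w"
  and amul_const: "amul (const_mpoly a) (const_mpoly x) = const_mpoly (sc a x)"
  unfolding amul_def using amul_aux
  by (simp_all add: bilift_add_left bilift_add_right bilift_ract_left bilift_ract_right bilift_const)

lemma tfree_amul: "tfree t \<alpha> \<Longrightarrow> tfree t w \<Longrightarrow> tfree t (amul \<alpha> w)"
  unfolding amul_def by (rule tfree_bilift[OF _ _ amul_aux]) simp_all

lemma sub_amul: "sub h (amul \<alpha> w) = amul (sub h \<alpha>) (sub h w)"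
  unfolding amul_def by (rule sub_bilift[OF amul_aux amul_aux]) simp

text \<open>\<open>Sop t a\<close> replaces \<open>\<lambda>\<^sub>t\<^sup>n\<close> by \<open>\<partial>\<^sup>n(a)\<close>; in the notation of the paper it is \<open>(|\<^bsub>x=\<partial>\<^esub> a) w\<close> with
  \<open>x = \<lambda>\<^sub>t\<close>.\<close>

definition Sop :: "nat \<Rightarrow> 'a mpoly \<Rightarrow> 'v mpoly \<Rightarrow> 'v mpoly" where
  "Sop t \<alpha> w = lift (\<lambda>a. lin (\<lambda>l v. Poly_Mapping.single (l - Poly_Mapping.single t (Poly_Mapping.lookup l t))
     (sc ((d ^^ Poly_Mapping.lookup l t) a) v)) w) \<alpha>"

lemma Sop_aux1: "add_map (\<lambda>v. Poly_Mapping.single m (sc a v))"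
  using sc_biadd by (simp add: biadd_map_def add_map_def single_add)

lemma Sop_aux2: "add_map (\<lambda>a. lin (\<lambda>l v. Poly_Mapping.single (f l) (sc ((d ^^ g l) a) v)) w)"
  by (rule add_map_lin_param)
    (use add_map_funpow[OF d_add] sc_biadd in \<open>simp add: biadd_map_def add_map_def single_add\<close>)

lemma Sop_add_left: "Sop t (\<alpha> + \<beta>) w = Sop t \<alpha> w + Sop t \<beta> w"
  unfolding Sop_def by (rule lift_add) (rule Sop_aux2)

lemma Sop_ract_left: "Sop t (r \<bullet> \<alpha>) w = r \<bullet> Sop t \<alpha> w"
  unfolding Sop_def by (rule lift_ract) (rule Sop_aux2)

lemma Sop_add_right: "Sop t \<alpha> (v + w) = Sop t \<alpha> v + Sop t \<alpha> w"
  unfolding Sop_def lin_add[OF Sop_aux1] lift_fun_add ..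

lemma add_map_Sop: "add_map (Sop t \<alpha>)" and add_map_Sop_left: "add_map (\<lambda>\<alpha>. Sop t \<alpha> w)"
  by (simp_all add: add_map_def Sop_add_left Sop_add_right)

lemma Sop_single:
  "Sop t (const_mpoly a) (Poly_Mapping.single l v) =
    Poly_Mapping.single (l - Poly_Mapping.single t (Poly_Mapping.lookup l t)) (sc ((d ^^ Poly_Mapping.lookup l t) a) v)"
  unfolding Sop_def by (rule trans[OF lift_const[OF Sop_aux2] lin_single[OF Sop_aux1]])

lemma Sop_const: "Sop t (const_mpoly a) (const_mpoly v) = const_mpoly (sc a v)"
  by (simp add: Sop_single)

lemma Sop_ract_right:
  assumes "tfree t r"
  shows "Sop t \<alpha> (r \<bullet> w) = r \<bullet> Sop t \<alpha> w"
proof (induction \<alpha> rule: mpoly_induct)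
  case (const a)
  from assms show ?case
  proof (induction rule: tfree_single_induct)
    case (single m c)
    show ?case
    proof (induction w rule: poly_mapping_single_induct)
      case (single l v)
      have "m + l - Poly_Mapping.single t (Poly_Mapping.lookup l t)
          = m + (l - Poly_Mapping.single t (Poly_Mapping.lookup l t))"
        by (rule poly_mapping_eqI) (simp add: lookup_minus lookup_add lookup_single when_def)
      then show ?case
        using \<open>Poly_Mapping.lookup m t = 0\<close>
        by (simp add: ract_single Sop_single lookup_add add_map_zmul[OF biadd_map_right[OF sc_biadd]])
    qed (simp add: ract_add_right Sop_add_right)
  qed (simp add: ract_add_left Sop_add_right)
qed (simp_all add: Sop_ract_left Sop_add_left ract_add_right ract_commute[of r])

text \<open>Together with \<open>Sop_ract_right\<close> and \<open>Sop_tfree\<close> this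
  characterises \<open>Sop t\<close>: other variables pass through it, and a factor lambda_t is
  traded for a derivative of \<alpha>.\<close>

lemma Sop_X: "Sop t \<alpha> (X t \<bullet> w) = Sop t (mmap d \<alpha>) w"
proof (induction \<alpha> rule: mpoly_induct)
  case (const a)
  show ?case
  proof (induction w rule: poly_mapping_single_induct)
    case (single l v)
    have "Poly_Mapping.single t 1 + l - Poly_Mapping.single t (Suc (Poly_Mapping.lookup l t))
        = l - Poly_Mapping.single t (Poly_Mapping.lookup l t)"
      by (rule poly_mapping_eqI) (simp add: lookup_minus lookup_add lookup_single when_def)
    then show ?case
      by (simp add: X_def ract_single Sop_single lookup_add add_map_zero[OF d_add]
          funpow_swap1)
  qed (simp add: ract_add_right Sop_add_right)
qed (simp_all add: Sop_ract_left Sop_add_left mmap_ract[OF d_add] mmap_add[OF d_add])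

lemma Sop_tfree: "tfree t w \<Longrightarrow> Sop t \<alpha> w = amul \<alpha> w"
proof (induction rule: tfree_induct)
  case (const v)
  show ?case
    by (induction \<alpha> rule: mpoly_induct)
      (simp_all add: Sop_const amul_const Sop_ract_left amul_ract_left Sop_add_left amul_add_left)
qed (simp_all add: Sop_ract_right amul_ract_right Sop_add_right amul_add_right)

lemma Sop_add_var: "tfree t p \<Longrightarrow> Sop t \<alpha> ((p + X t) \<bullet> w) = Sop t (p \<bullet> \<alpha> + mmap d \<alpha>) w"
  by (simp add: ract_add_left Sop_add_right Sop_ract_right Sop_X Sop_add_left Sop_ract_left)

text \<open>By \<open>Sop_add_var\<close> a factor p + lambda_t acts on the polynomial over A as p +
  d, and p + d after the substitution of p is \<open>lambda_plus d\<close> before it.\<close>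

lemma Sop_power:
  assumes "tfree t p"
  shows "Sop t (pev p Q) ((p + X t) ^ n \<bullet> const_mpoly v) = amul (pev p ((lambda_plus d ^^ n) Q)) (const_mpoly v)"
proof (induction n arbitrary: Q)
  case 0
  then show ?case by (simp add: Sop_tfree)
next
  case (Suc n)
  show ?case
    using Suc[of "lambda_plus d Q"] assms
    by (simp add: ract_mult Sop_add_var pev_lambda_plus[OF d_add] funpow_swap1)
qed

lemma adjoint_symbol_const [simp]: "adjoint_symbol \<delta> [:a:] = [:a:]"
  by (simp add: adjoint_symbol_def)

lemma pev_map_poly_sc: "pev p (map_poly (\<lambda>b. sc b v) Q) = amul (pev p Q) (const_mpoly v)"
proof -
  have a: "add_map (\<lambda>b. sc b v)" using biadd_map_left[OF sc_biadd] .
  have "mmap (\<lambda>b. sc b v) \<alpha> = amul \<alpha> (const_mpoly v)" for \<alpha>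
    by (induction \<alpha> rule: mpoly_induct)
      (simp_all add: add_map_zero[OF a] amul_const mmap_ract[OF a] amul_ract_left
        mmap_add[OF a] amul_add_left)
  then show ?thesis by (simp add: pev_map_poly[OF a])
qed

text \<open>An element of A is its own adjoint symbol, and the n-th power of lambda + d in
  \<open>twist\<close> is what \<open>Sop t\<close> makes of the n-th power of p + lambda_t. Thus
  the action of A on conformal maps is expressed by a fresh variable.\<close>

lemma pev_twist_const:
  assumes "tfree t p"
  shows "pev p (twist d sc [:a:] P) = Sop t (const_mpoly a) (pev (p + X t) P)"
proof -
  have "pev p (twist d sc [:a:] P) = (\<Sum>n\<le>degree P. amul (pev p ((lambda_plus d ^^ n) [:a:])) (const_mpoly (coeff P n)))"
    by (simp add: twist_def add_map_sum[OF add_map_pev] pev_map_poly_sc)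
  also have "\<dots> = (\<Sum>n\<le>degree P. Sop t (pev p [:a:]) ((p + X t) ^ n \<bullet> const_mpoly (coeff P n)))"
    by (simp add: Sop_power[OF assms])
  also have "\<dots> = Sop t (const_mpoly a) (pev (p + X t) P)"
    by (simp add: pev_pCons pev_altdef[of P "degree P"] add_map_sum[OF add_map_Sop])
  finally show ?thesis .
qed

end

section \<open>Evaluation of lambda-brackets and lambda-actions at polynomials\<close>

lemma bilift_const_right: "biadd_map f \<Longrightarrow> bilift f p (const_mpoly v) = lift (\<lambda>u. f u v) p"
  by (simp add: bilift_def lift_const biadd_map_right)

definition bev ::
  "('u::ab_group_add \<Rightarrow> 'v::ab_group_add \<Rightarrow> 'w::ab_group_add poly) \<Rightarrow> int mpoly \<Rightarrow>
   'u mpoly \<Rightarrow> 'v mpoly \<Rightarrow> 'w mpoly" where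
  "bev f p = bilift (\<lambda>u v. pev p (f u v))"

lemma bev_aux: "biadd_map f \<Longrightarrow> biadd_map (\<lambda>u v. pev p (f u v))"
  by (simp add: biadd_map_def add_map_def pev_add)

lemma bev_add_left: "biadd_map f \<Longrightarrow> bev f p (U + U') V = bev f p U V + bev f p U' V"
  and bev_add_right: "biadd_map f \<Longrightarrow> bev f p U (V + V') = bev f p U V + bev f p U V'"
  and bev_ract_left: "biadd_map f \<Longrightarrow> bev f p (r \<bullet> U) V = r \<bullet> bev f p U V"
  and bev_ract_right: "biadd_map f \<Longrightarrow> bev f p U (r \<bullet> V) = r \<bullet> bev f p U V"
  and bev_const: "biadd_map f \<Longrightarrow> bev f p (const_mpoly u) (const_mpoly v) = pev p (f u v)"
  unfolding bev_def using bev_aux[of f p]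
  by (simp_all add: bilift_add_left bilift_add_right bilift_ract_left bilift_ract_right bilift_const)

lemmas bev_linear = bev_add_left bev_add_right bev_ract_left bev_ract_right

lemma add_map_bev: "biadd_map f \<Longrightarrow> add_map (bev f p U)"
  by (simp add: add_map_def[of "bev f p U"] bev_add_right)

lemma sub_bev: "biadd_map f \<Longrightarrow> sub h (bev f p U V) = bev f (sub h p) (sub h U) (sub h V)"
  unfolding bev_def by (rule sub_bilift) (simp_all add: bev_aux sub_pev)

lemma tfree_bev: "biadd_map f \<Longrightarrow> tfree t p \<Longrightarrow> tfree t U \<Longrightarrow> tfree t V \<Longrightarrow> tfree t (bev f p U V)"
  unfolding bev_def by (rule tfree_bilift) (simp_all add: bev_aux tfree_pev)

lemma bev_const_left: "biadd_map f \<Longrightarrow> bev f p (const_mpoly u) V = lambda_apply (f u) (ract p) V"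
  by (simp add: bev_def bilift_const_left bev_aux lambda_apply_eq)

lemma bev_const_right: "biadd_map f \<Longrightarrow> bev f p U (const_mpoly v) = lambda_apply (\<lambda>u. f u v) (ract p) U"
  by (simp add: bev_def bilift_const_right bev_aux lambda_apply_eq)

lemma sub_uminus: "sub h (- q) = - sub h q" and sub_diff: "sub h (p - q) = sub h p - sub h q"
  using add_map_uminus[OF add_map_sub] add_map_diff[OF add_map_sub] by blast+

lemma bev_deriv:
  assumes f: "biadd_map f" and \<delta>: "add_map \<delta>" "add_map \<delta>'"
    and "\<And>u v. f u (\<delta> v) = lambda_plus \<delta>' (f u v)"
  shows "bev f p U (mmap \<delta> V) = p \<bullet> bev f p U V + mmap \<delta>' (bev f p U V)"
proof (induction U rule: mpoly_induct)
  case (const u)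
  show ?case
  proof (induction V rule: mpoly_induct)
    case (const v)
    show ?case
      by (simp add: add_map_zero[OF \<delta>(1)] bev_const[OF f] assms(4) pev_lambda_plus[OF \<delta>(2)])
  qed (simp_all add: mmap_ract mmap_add \<delta> bev_linear f ract_add_right ract_commute[of p] add_ac)
qed (simp_all add: mmap_ract mmap_add \<delta> bev_linear f ract_add_right ract_commute[of p] add_ac)

lemma (in derivation_action) amul_const_left: "amul (const_mpoly a) w = mmap (sc a) w"
proof -
  have a: "add_map (sc a)" using biadd_map_right[OF sc_biadd] .
  show ?thesis
    by (induction w rule: mpoly_induct)
      (simp_all add: amul_const add_map_zero[OF a] amul_ract_right mmap_ract[OF a]
        amul_add_right mmap_add[OF a])
qed

text \<open>Axiom (i) of algebroids and modules, with \<open>\<theta>\<close> the anchor, in two forms.\<close>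

lemma (in derivation_action) bev_amul:
  assumes f: "biadd_map f" and \<theta>: "biadd_map \<theta>"
    and rule: "\<And>u a v. f u (sc a v) = map_poly (sc a) (f u v) + map_poly (\<lambda>b. sc b v) (\<theta> u a)"
  shows "bev f p U (amul \<alpha> V) = amul \<alpha> (bev f p U V) + amul (bev \<theta> p U \<alpha>) V"
proof (induction U rule: mpoly_induct)
  case (const u)
  show ?case
  proof (induction \<alpha> rule: mpoly_induct)
    case (const a)
    have a: "add_map (sc a)" using biadd_map_right[OF sc_biadd] .
    show ?case
    proof (induction V rule: mpoly_induct)
      case (const v)
      show ?case
        by (simp add: add_map_zero[OF a] bev_const[OF f] bev_const[OF \<theta>] rule pev_add pev_map_poly[OF a]
            pev_map_poly_sc amul_const_left)
    qed (simp_all add: amul_ract_right amul_add_right bev_linear f \<theta> ract_add_right add_ac)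
  qed (simp_all add: amul_ract_left amul_add_left bev_linear f \<theta> ract_add_right add_ac)
qed (simp_all add: amul_ract_left amul_add_left amul_ract_right amul_add_right bev_linear f \<theta> ract_add_right add_ac)

lemma (in derivation_action) bev_Sop:
  assumes f: "biadd_map f" and \<theta>: "biadd_map \<theta>"
    and rule: "\<And>u a v. f u (sc a v) = map_poly (sc a) (f u v) + map_poly (\<lambda>b. sc b v) (\<theta> u a)"
    and \<theta>_d: "\<And>u a. \<theta> u (d a) = lambda_plus d (\<theta> u a)"
    and "tfree t p" "tfree t U"
  shows "bev f p U (Sop t \<alpha> w) = Sop t \<alpha> (bev f p U w) + Sop t (bev \<theta> p U \<alpha>) (sub (tshift t p) w)"
  using \<open>tfree t U\<close>
proof (induction rule: tfree_induct)
  case (const u)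
  show ?case
  proof (induction w arbitrary: \<alpha> rule: mpoly_induct_var[where t = t])
    case (const v)
    have "tfree t (bev f p (const_mpoly u) (const_mpoly v))"
      by (rule tfree_bev) (simp_all add: f \<open>tfree t p\<close>)
    then show ?case
      by (simp add: Sop_tfree bev_amul[OF f \<theta> rule])
  next
    case (mul r w)
    then show ?case
      by (simp add: Sop_ract_right bev_linear f \<theta> sub_ract sub_tshift_tfree ract_add_right)
  next
    \<comment> \<open>A factor lambda_t of w turns \<alpha> into its derivative, and \<theta> at p
      of that derivative is (p + d) applied to \<theta> of \<alpha>. The d reproduces lambda_t; the
      extra p is the shift of lambda_t in the second term.\<close>
    case (var w)
    show ?case
      by (simp add: Sop_X var bev_deriv[OF \<theta> d_add d_add \<theta>_d] bev_ract_right[OF f] sub_ract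
          tshift_same ract_add_left Sop_add_right Sop_ract_right[OF \<open>tfree t p\<close>] Sop_add_left Sop_ract_left add_ac)
  next
    case (add v w)
    then show ?case by (simp add: Sop_add_right bev_linear f \<theta> sub_add add_ac)
  qed
qed (simp_all add: bev_linear f \<theta> Sop_ract_right Sop_ract_left Sop_add_right Sop_add_left ract_add_right add_ac)

text \<open>The variable lambda_t plays the part of x. Degree and arguments avoid it, so that
  \<open>Sop t\<close> replaces nothing but x by the derivation.\<close>

lemma (in derivation_action) bev_amul_left:
  assumes f: "biadd_map f" and g: "biadd_map g"
    and rule: "\<And>a u v. f (g a u) v = twist d sc [:a:] (f u v)"
    and t: "tfree t p" "tfree t U" "tfree t w"
  shows "bev f p (bilift (\<lambda>a u. const_mpoly (g a u)) \<alpha> U) w = Sop t \<alpha> (bev f (p + X t) U w)"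
proof -
  have g': "biadd_map (\<lambda>a u. const_mpoly (g a u))"
    using g by (simp add: biadd_map_def add_map_def single_add)
  note g_simps = bilift_ract_left[OF g'] bilift_ract_right[OF g'] bilift_add_left[OF g']
    bilift_add_right[OF g']
  show ?thesis
  proof (induction \<alpha> rule: mpoly_induct)
    case (const a)
    from t(2) show ?case
    proof (induction rule: tfree_induct)
      case (const u)
      from t(3) show ?case
        by (induction rule: tfree_induct)
          (simp_all add: bilift_const[OF g'] bev_const[OF f] rule pev_twist_const[OF t(1)]
            bev_linear f Sop_ract_right Sop_add_right)
    qed (simp_all add: g_simps bev_linear f Sop_ract_right Sop_add_right)
  qed (simp_all add: g_simps bev_linear f Sop_ract_left Sop_add_left)
qed

lemma (in derivation_action) mmap_Sop:
  assumes \<delta>: "add_map \<delta>" and leib: "\<And>a v. \<delta> (sc a v) = sc (d a) v + sc a (\<delta> v)"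
  shows "mmap \<delta> (Sop t \<alpha> w) = Sop t (mmap d \<alpha>) w + Sop t \<alpha> (mmap \<delta> w)"
proof (induction \<alpha> rule: mpoly_induct)
  case (const a)
  show ?case
    by (induction w rule: poly_mapping_single_induct)
      (simp_all add: Sop_single add_map_zero[OF \<delta>] add_map_zero[OF d_add] leib single_add
        Sop_add_right mmap_add[OF \<delta>] funpow_swap1 add_ac)
qed (simp_all add: Sop_ract_left Sop_add_left mmap_ract mmap_add \<delta> d_add ract_add_right add_ac)

lemma lam_eq_ract: "lam i = ract (X i)"
  by (rule ext) (rule lam_eq)

lemma lam_plus_eq_ract: "(\<lambda>q. lam i q + lam j q) = ract (X i + X j)"
  by (rule ext) (simp add: lam_eq ract_add_left)

lemma lam_minus_eq_ract: "(\<lambda>q. lam i q - lam j q) = ract (X i - X j)"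
  by (rule ext) (simp add: lam_eq ract_diff_left)

section \<open>The Lie algebra of a Lie conformal algebroid and its module\<close>

context lie_conformal_algebroid_module
begin

abbreviation "dE \<equiv> dact actE"
abbreviation "dM \<equiv> dact actM"
abbreviation "scE \<equiv> \<lambda>a. actE [:a:]"
abbreviation "scM \<equiv> \<lambda>a. actM [:a:]"

lemma add_map_dA: "add_map dA"
  by (simp add: add_map_def A.deriv_add)

lemma dA_one [simp]: "dA 1 = 0"
  using A.deriv_mult[of 1 1] by simp

lemma biadd_scE: "biadd_map scE" and biadd_scM: "biadd_map scM"
  using E.act_add_left[of "[:a:]" "[:b:]" for a b] M.act_add_left[of "[:a:]" "[:b:]" for a b]
  by (auto intro!: biadd_mapI E.act_add_right M.act_add_right)

lemma add_map_dE: "add_map dE" and add_map_dM: "add_map dM"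
  by (simp_all add: add_map_def dact_def E.act_add_right M.act_add_right)

sublocale SE: derivation_action dA scE
  by (simp add: derivation_action.intro add_map_dA biadd_scE)

sublocale SM: derivation_action dA scM
  by (simp add: derivation_action.intro add_map_dA biadd_scM)

lemma map_poly_X: "map_poly (\<lambda>c. sA c 1) [:0, 1:] = [:0, 1:]"
  by (rule poly_eqI) (simp add: coeff_map_poly coeff_pCons split: nat.split)

lemma conformal_deriv: "actE (map_poly (\<lambda>c. sA c 1) [:0, 1:]) = dE"
  by (simp add: map_poly_X dact_def del: map_poly_pCons)

lemma biadd_br: "biadd_map br"
  by (simp add: biadd_mapI conformal.br_add_left conformal.br_add_right)

lemma biadd_lact: "biadd_map lact"
  by (simp add: biadd_mapI lact_add_left lact_add_right)

lemma anchor_CDerD: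
  "anchor u (a + b) = anchor u a + anchor u b"
  "anchor u (dA a) = lambda_plus dA (anchor u a)"
  "anchor u (a * b) = Polynomial.smult b (anchor u a) + Polynomial.smult a (anchor u b)"
  using anchor_CDer[of u] by (auto simp: CDer_def)

lemma biadd_anchor: "biadd_map anchor"
  by (simp add: biadd_mapI anchor_add anchor_CDerD)

lemma anchor_zero [simp]: "anchor u 0 = 0"
  using add_map_zero[OF biadd_map_right[OF biadd_anchor]] .

lemma anchor_one [simp]: "anchor u 1 = 0"
  using anchor_CDerD(3)[of u 1 1] by simp

lemma lambda_plus_const: "lambda_plus dA [:a:] = [:dA a, a:]"
  by (rule poly_eqI)
    (simp add: lambda_plus_def coeff_map_poly_add_map[OF add_map_dA] coeff_pCons
      add_map_zero[OF add_map_dA] split: nat.split)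

lemma dM_scM: "dM (scM a v) = scM (dA a) v + scM a (dM v)"
proof -
  have "dop_mult dA [:0, 1:] [:a:] = [:dA a:] + dop_mult dA [:a:] [:0, 1:]"
    by (simp add: dop_mult_def lambda_plus_const)
  then show ?thesis
    unfolding dact_def by (metis M.act_add_left M.act_mult)
qed

lemma anchor_rule_const:
  "anchor_rule act \<theta> [:a:] p v = map_poly (act [:a:]) p + map_poly (\<lambda>b. act [:b:] v) (\<theta> a)"
  by (simp add: anchor_rule_def)

lemma br_scE: "br u (scE a v) = map_poly (scE a) (br u v) + map_poly (\<lambda>b. scE b v) (anchor u a)"
  by (simp add: br_act_right anchor_rule_const)

lemma lact_scM: "lact u (scM a v) = map_poly (scM a) (lact u v) + map_poly (\<lambda>b. scM b v) (anchor u a)"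
  by (simp add: lact_act_right anchor_rule_const)

lemma br_dE: "br u (dE v) = lambda_plus dE (br u v)"
  using conformal.sesqui_right[of u v] by (simp only: conformal_deriv)

text \<open>The case a(d) = d of the rule on the right; the anchor terms vanish because the
  coefficients of its symbol are 0 and 1.\<close>

lemma lact_dM: "lact u (dM v) = lambda_plus dM (lact u v)"
proof -
  have "scM 1 = (\<lambda>v. v)" by (rule ext) (simp add: M.act_one flip: one_pCons)
  moreover have "actM 0 = (\<lambda>v. 0)"
    using add_map_zero[OF biadd_map_left[OF biadd_scM]] by (intro ext) simp
  moreover have "map_poly (\<lambda>v. 0) q = 0" for q :: "'m poly"
    by (rule poly_eqI) (simp add: coeff_map_poly)
  ultimately show ?thesis
    by (simp add: dact_def[of actM] lact_act_right anchor_rule_def)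
qed

lemma lambda_plus_monom: "(lambda_plus dA ^^ n) (monom 1 k) = monom 1 (n + k)"
proof (induction n)
  case (Suc n)
  have "map_poly dA (monom 1 j) = 0" for j
    by (rule poly_eqI) (simp add: coeff_map_poly_add_map[OF add_map_dA] coeff_monom add_map_zero[OF add_map_dA])
  then have "lambda_plus dA (monom 1 j) = monom 1 (Suc j)" for j
    by (simp add: lambda_plus_def monom_Suc)
  then show ?case by (simp add: Suc)
qed simp

lemma adjoint_symbol_X: "adjoint_symbol dA [:0, 1:] = - monom 1 1"
proof -
  have "adjoint_symbol dA [:0, 1:] = - lambda_plus dA [:1:]"
    using add_map_zero[OF add_map_lambda_plus[OF add_map_dA]]
    by (simp add: adjoint_symbol_def)
  also have "lambda_plus dA [:1:] = monom 1 1"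
    using lambda_plus_monom[of 1 0] by (simp flip: one_pCons)
  finally show ?thesis .
qed

text \<open>The adjoint symbol of d is - lambda, and the n-th power of lambda + d maps it to minus
  the power n + 1 of lambda. In this way sesquilinearity on the left, \<open>lact_dE\<close>, is
  contained in linearity over A[d].\<close>

lemma twist_X: "twist dA scM [:0, 1:] P = - pCons 0 P"
proof -
  have z: "actM 0 v = 0" for v
    using add_map_zero[OF biadd_map_left[OF biadd_scM], of v] by simp
  have "(lambda_plus dA ^^ n) (- monom 1 1) = - monom 1 (Suc n)" for n
    using lambda_plus_monom[of n 1]
    by (simp add: add_map_uminus[OF add_map_funpow[OF add_map_lambda_plus[OF add_map_dA]]])
  moreover have "map_poly (\<lambda>b. scM b v) (- monom 1 n) = - monom v n" for v n
    using add_map_uminus[OF biadd_map_left[OF biadd_scM], of 1 v] M.act_one[of v]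
    by (intro poly_eqI) (simp add: coeff_map_poly_add_map[OF biadd_map_left[OF biadd_scM]] coeff_monom z
        flip: one_pCons)
  ultimately have "twist dA scM [:0, 1:] P = (\<Sum>n\<le>degree P. - monom (coeff P n) (Suc n))"
    by (simp add: twist_def adjoint_symbol_X)
  also have "\<dots> = - pCons 0 (\<Sum>n\<le>degree P. monom (coeff P n) n)"
    unfolding sum_negf monom_Suc by (simp add: add_map_sum[OF add_map_pCons])
  finally show ?thesis by (simp add: poly_as_sum_of_monoms)
qed

lemma lact_dE: "lact (dE u) m = - pCons 0 (lact u m)"
  using lact_act_left[of "[:0, 1:]" u m] twist_X by (simp add: dact_def)

definition brU where "brU = bev br"
definition actU where "actU = bev lact"
definition thU where "thU = bev anchor"

lemma jacobiU: "brU p U (brU q V W) = brU q V (brU p U W) + brU (p + q) (brU p U V) W"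
proof (induction U rule: mpoly_induct)
  case (const u)
  show ?case
  proof (induction V rule: mpoly_induct)
    case (const v)
    show ?case
    proof (induction W rule: mpoly_induct)
      case (const w)
      \<comment> \<open>The axiom is an identity in the variables 0 and 1; substituting p and q for
        them gives it at arbitrary degrees.\<close>
      let ?h = "\<lambda>i :: nat. if i = 0 then p else q"
      note j = conformal.jacobi[of u v w, unfolded lam_plus_eq_ract, unfolded lam_eq_ract, folded pev_def,
          folded bev_const_left[OF biadd_br] bev_const_right[OF biadd_br] bev_const[OF biadd_br]]
      show ?case
        using arg_cong[OF j, of "sub ?h"]
        by (simp add: sub_diff sub_bev biadd_br sub_add brU_def algebra_simps)
    qed (simp_all add: brU_def bev_linear biadd_br ract_add_right add_ac)
  qed (simp_all add: brU_def bev_linear biadd_br ract_add_right add_ac)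
qed (simp_all add: brU_def bev_linear biadd_br ract_add_right add_ac)

lemma actU_brU: "actU (p + q) (brU p U V) w = actU p U (actU q V w) - actU q V (actU p U w)"
proof -
  have "actU p U (actU q V w) = actU q V (actU p U w) + actU (p + q) (brU p U V) w"
  proof (induction U rule: mpoly_induct)
    case (const u)
    show ?case
    proof (induction V rule: mpoly_induct)
      case (const v)
      show ?case
      proof (induction w rule: mpoly_induct)
        case (const w)
        \<comment> \<open>In this axiom the second variable is the total degree, hence p + q and not
          q.\<close>
        let ?h = "\<lambda>i :: nat. if i = 0 then p else p + q"
        note j = lact_br[of w u v, unfolded lam_minus_eq_ract, unfolded lam_eq_ract, folded pev_def,
            folded bev_const_left[OF biadd_lact] bev_const_right[OF biadd_lact] bev_const[OF biadd_br]
            bev_const[OF biadd_lact]]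
        show ?case
          using arg_cong[OF j, of "sub ?h"]
          by (simp add: sub_diff sub_bev biadd_br biadd_lact sub_add brU_def actU_def algebra_simps)
      qed (simp_all add: brU_def actU_def bev_linear biadd_br biadd_lact ract_add_right add_ac)
    qed (simp_all add: brU_def actU_def bev_linear biadd_br biadd_lact ract_add_right add_ac)
  qed (simp_all add: brU_def actU_def bev_linear biadd_br biadd_lact ract_add_right add_ac)
  then show ?thesis by simp
qed

lemmas brU_deriv = bev_deriv[OF biadd_br add_map_dE add_map_dE br_dE, folded brU_def]
lemmas actU_deriv = bev_deriv[OF biadd_lact add_map_dM add_map_dM lact_dM, folded actU_def]

lemma actU_kill: "actU p (p \<bullet> U + mmap dE U) w = 0"
proof -
  have "actU p (mmap dE U) w = - (p \<bullet> actU p U w)"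
  proof (induction U rule: mpoly_induct)
    case (const u)
    show ?case
      by (induction w rule: mpoly_induct)
        (simp_all add: add_map_zero[OF add_map_dE] actU_def bev_linear bev_const biadd_lact
          lact_dE add_map_uminus[OF add_map_pev] pev_pCons ract_add_right ract_uminus_right
          ract_commute[of p])
  qed (simp_all add: actU_def bev_linear biadd_lact mmap_ract mmap_add add_map_dE ract_add_right
      ract_uminus_right ract_commute[of p])
  then show ?thesis by (simp add: actU_def bev_linear biadd_lact)
qed

lemmas brU_amul = SE.bev_amul[OF biadd_br biadd_anchor br_scE, folded brU_def thU_def]
lemmas actU_Sop = SM.bev_Sop[OF biadd_lact biadd_anchor lact_scM anchor_CDerD(2), folded actU_def thU_def]

lemma actU_amul:
  "tfree t p \<Longrightarrow> tfree t U \<Longrightarrow> tfree t w \<Longrightarrow> actU p (SE.amul \<alpha> U) w = SM.Sop t \<alpha> (actU (p + X t) U w)"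
  unfolding actU_def SE.amul_def by (rule SM.bev_amul_left[OF biadd_lact biadd_scE lact_act_left])

lemmas mmap_SopM = SM.mmap_Sop[OF add_map_dM dM_scM]

text \<open>Modulo Q, the image of p + q + d, multiplication by p agrees with -(q + d). So
  substituting p for lambda in the bracket of u and v agrees with substituting -(q + d), and by
  skew-symmetry the latter is minus the bracket of v and u at q.\<close>

lemma skewU: "\<exists>Z. brU p U V + brU q V U = (p + q) \<bullet> Z + mmap dE Z"
proof -
  define Q where "Q = range (\<lambda>Z. (p + q) \<bullet> Z + mmap dE Z)"
  have Q_add: "v + w \<in> Q" if vw: "v \<in> Q" "w \<in> Q" for v w
  proof -
    obtain Z Z' where "v = (p + q) \<bullet> Z + mmap dE Z" "w = (p + q) \<bullet> Z' + mmap dE Z'"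
      using vw by (auto simp: Q_def)
    then have "v + w = (p + q) \<bullet> (Z + Z') + mmap dE (Z + Z')"
      by (simp add: ract_add_right mmap_add[OF add_map_dE] add_ac)
    then show ?thesis by (auto simp: Q_def)
  qed
  have Q_ract: "r \<bullet> v \<in> Q" if v: "v \<in> Q" for r v
  proof -
    obtain Z where "v = (p + q) \<bullet> Z + mmap dE Z"
      using v by (auto simp: Q_def)
    then have "r \<bullet> v = (p + q) \<bullet> (r \<bullet> Z) + mmap dE (r \<bullet> Z)"
      by (simp add: ract_add_right mmap_ract[OF add_map_dE] ract_commute[of r])
    then show ?thesis by (auto simp: Q_def)
  qed
  have Q_dE: "mmap dE v \<in> Q" if v: "v \<in> Q" for v
  proof -
    obtain Z where "v = (p + q) \<bullet> Z + mmap dE Z"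
      using v by (auto simp: Q_def)
    then have "mmap dE v = (p + q) \<bullet> mmap dE Z + mmap dE (mmap dE Z)"
      by (simp add: mmap_add[OF add_map_dE] mmap_ract[OF add_map_dE])
    then show ?thesis by (auto simp: Q_def)
  qed
  have Q_zero: "0 \<in> Q" unfolding Q_def by (rule range_eqI[of _ _ 0]) simp
  have Q_uminus: "- v \<in> Q" if "v \<in> Q" for v
    using Q_ract[OF that, of "- 1"] by (simp add: ract_uminus_left)
  have Q_sum: "sum f I \<in> Q" if "\<And>i. i \<in> I \<Longrightarrow> f i \<in> Q" for f and I :: "nat set"
    using that by (induction I rule: infinite_finite_induct) (auto intro: Q_add Q_zero)
  let ?T = "\<lambda>w. - (q \<bullet> w + mmap dE w)"
  have T_Q: "?T v \<in> Q" if "v \<in> Q" for v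
    using that by (intro Q_uminus Q_add Q_ract Q_dE)
  have T_add: "add_map ?T"
    by (simp add: add_map_def ract_add_right mmap_add[OF add_map_dE])
  have power: "p ^ n \<bullet> w - (?T ^^ n) w \<in> Q" for n w
  proof (induction n)
    case (Suc n)
    have "p ^ Suc n \<bullet> w - (?T ^^ Suc n) w = ((p + q) \<bullet> (p ^ n \<bullet> w) + mmap dE (p ^ n \<bullet> w))
        + ?T (p ^ n \<bullet> w - (?T ^^ n) w)"
      using add_map_diff[OF T_add, of "p ^ n \<bullet> w" "(?T ^^ n) w"]
      by (simp add: ract_mult ract_add_left)
    moreover have "(p + q) \<bullet> (p ^ n \<bullet> w) + mmap dE (p ^ n \<bullet> w) \<in> Q"
      unfolding Q_def by blast
    ultimately show ?case using Q_add[OF _ T_Q[OF Suc]] by simp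
  qed (simp add: Q_zero)
  have pev_adj: "pev q (adjoint_symbol dE P) = (\<Sum>n\<le>degree P. (?T ^^ n) (const_mpoly (coeff P n)))" for P
  proof -
    have "pev q (((\<lambda>q. - lambda_plus dE q) ^^ n) P) = (?T ^^ n) (pev q P)" for n P
      by (induction n) (simp_all add: add_map_uminus[OF add_map_pev] pev_lambda_plus[OF add_map_dE])
    then show ?thesis
      by (simp add: adjoint_symbol_def add_map_sum[OF add_map_pev] pev_pCons)
  qed
  have "brU p U V + brU q V U \<in> Q"
  proof (induction U rule: mpoly_induct)
    case (const u)
    show ?case
    proof (induction V rule: mpoly_induct)
      case (const v)
      have "pev p (br u v) - pev q (adjoint_symbol dE (br u v)) =
          (\<Sum>n\<le>degree (br u v). p ^ n \<bullet> const_mpoly (coeff (br u v) n)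
            - (?T ^^ n) (const_mpoly (coeff (br u v) n)))"
        by (simp add: pev_altdef[of "br u v" "degree (br u v)"] pev_adj sum_subtractf)
      also have "\<dots> \<in> Q" by (rule Q_sum) (rule power)
      finally show ?case
        using conformal.skew[of v u, unfolded conformal_deriv]
        by (simp add: brU_def bev_const biadd_br add_map_uminus[OF add_map_pev])
    next
      case (mul r V)
      then show ?case using Q_ract[OF mul, of r] by (simp add: brU_def bev_linear biadd_br ract_add_right)
    next
      case (add V W)
      then show ?case using Q_add[OF add] by (simp add: brU_def bev_linear biadd_br add_ac)
    qed
  next
    case (mul r V)
    then show ?case using Q_ract[OF mul, of r] by (simp add: brU_def bev_linear biadd_br ract_add_right)
  next
    case (add V W)
    then show ?case using Q_add[OF add] by (simp add: brU_def bev_linear biadd_br add_ac)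
  qed
  then show ?thesis by (auto simp: Q_def)
qed

end

section \<open>Cochains on the extended Lie algebra\<close>

text \<open>Basic and reduced cochains are treated together: the identities hold modulo \<open>0\<close> in the basic
  case and modulo \<open>(\<lambda>\<^sub>1 + \<dots> + \<lambda>\<^sub>k + \<partial>) M[\<lambda>\<^sub>1, \<lambda>\<^sub>2, \<dots>]\<close> in the reduced case.\<close>

locale algebroid_cochains =
  lie_conformal_algebroid_module sA dA actE br anchor actM lact
  for sA :: "'f::field_char_0 \<Rightarrow> 'a::comm_ring_1 \<Rightarrow> 'a"
    and dA :: "'a \<Rightarrow> 'a"
    and actE :: "'a poly \<Rightarrow> 'e::ab_group_add \<Rightarrow> 'e"
    and br :: "'e \<Rightarrow> 'e \<Rightarrow> 'e poly"
    and anchor :: "'e \<Rightarrow> 'a \<Rightarrow> 'a poly"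
    and actM :: "'a poly \<Rightarrow> 'm::ab_group_add \<Rightarrow> 'm"
    and lact :: "'e \<Rightarrow> 'm \<Rightarrow> 'm poly" +
  fixes reduced :: bool
begin

definition N :: "int mpoly \<Rightarrow> 'm mpoly set" where
  "N s = (\<lambda>w. s \<bullet> w + mmap dM w) ` {w. reduced \<or> w = 0}"

lemma N_map:
  assumes "w \<in> N s" "add_map F" "\<And>w. F (s \<bullet> w + mmap dM w) = s' \<bullet> G w + mmap dM (G w)" "G 0 = 0"
  shows "F w \<in> N s'"
  using assms(1,3,4) unfolding N_def by (auto intro!: rev_image_eqI)

lemma N_zero: "0 \<in> N s"
  unfolding N_def by (rule image_eqI[of _ _ 0]) simp_all

lemma N_add: "v \<in> N s \<Longrightarrow> w \<in> N s \<Longrightarrow> v + w \<in> N s"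
proof -
  assume "v \<in> N s" "w \<in> N s"
  then obtain x y where "v = s \<bullet> x + mmap dM x" "w = s \<bullet> y + mmap dM y" "reduced \<or> x = 0" "reduced \<or> y = 0"
    unfolding N_def by auto
  then show ?thesis
    unfolding N_def
    by (intro image_eqI[of _ _ "x + y"]) (auto simp: ract_add_right mmap_add[OF add_map_dM])
qed

lemma N_ract: "w \<in> N s \<Longrightarrow> r \<bullet> w \<in> N s"
  by (rule N_map[where F = "ract r" and G = "ract r"])
    (simp_all add: add_map_ract ract_add_right mmap_ract[OF add_map_dM] ract_commute[of r])

lemma N_uminus: "w \<in> N s \<Longrightarrow> - w \<in> N s"
  using N_ract[of w s "- 1"] by (simp add: ract_uminus_left)

lemma N_sub: "w \<in> N s \<Longrightarrow> sub h w \<in> N (sub h s)"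
  by (rule N_map[where F = "sub h" and G = "sub h"])
    (simp_all add: add_map_sub sub_add sub_ract sub_mmap[OF add_map_dM] add_map_zero[OF add_map_sub])

lemma N_actU: "w \<in> N s \<Longrightarrow> actU p U w \<in> N (p + s)"
proof (rule N_map[where F = "actU p U" and G = "actU p U"])
  show a: "add_map (actU p U)"
    unfolding actU_def by (rule add_map_bev[OF biadd_lact])
  show "actU p U (s \<bullet> w + mmap dM w) = (p + s) \<bullet> actU p U w + mmap dM (actU p U w)" for w
    unfolding add_map_add[OF a] actU_deriv
    by (simp add: actU_def bev_ract_right[OF biadd_lact] ract_add_left add_ac)
  show "actU p U 0 = 0" using add_map_zero[OF a] .
qed

lemma actU_diff: "actU p U (v - w) = actU p U v - actU p U w"
  unfolding actU_def using add_map_diff[OF add_map_bev[OF biadd_lact]] .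

text \<open>Under \<open>Sop t\<close> a factor lambda_t becomes a derivative of \<alpha>. Together
  with d on the value this is d of the product by the Leibniz rule, so the operator s + lambda_t + d
  turns into s + d.\<close>

lemma N_Sop:
  assumes "w \<in> N (s + X t)" "tfree t s"
  shows "SM.Sop t \<alpha> w \<in> N s"
proof (rule N_map[OF assms(1), of "SM.Sop t \<alpha>" s "SM.Sop t \<alpha>"])
  show "SM.Sop t \<alpha> ((s + X t) \<bullet> w + mmap dM w) = s \<bullet> SM.Sop t \<alpha> w + mmap dM (SM.Sop t \<alpha> w)" for w
    unfolding SM.Sop_add_right SM.Sop_add_var[OF assms(2)] mmap_SopM SM.Sop_add_left SM.Sop_ract_left
    by (simp add: add.assoc)
qed (simp_all add: SM.add_map_Sop add_map_zero[OF SM.add_map_Sop])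

definition brL :: "int mpoly \<times> 'e mpoly \<Rightarrow> int mpoly \<times> 'e mpoly \<Rightarrow> int mpoly \<times> 'e mpoly" where
  "brL x y = (fst x + fst y, brU (fst x) (snd x) (snd y))"

definition actL :: "int mpoly \<times> 'e mpoly \<Rightarrow> 'm mpoly \<Rightarrow> 'm mpoly" where
  "actL x = actU (fst x) (snd x)"

sublocale CE: loday_complex brL actL fst N
proof
  show "actL x (v + w) = actL x v + actL x w" for x v w
    by (simp add: actL_def actU_def bev_linear biadd_lact)
  show "actL (brL x y) w = actL x (actL y w) - actL y (actL x w)" for x y w
    by (simp add: actL_def brL_def actU_brU)
qed (simp_all add: N_zero N_add N_uminus actL_def brL_def N_actU)

definition slot_linear :: "int mpoly \<Rightarrow> ((int mpoly \<times> 'e mpoly) list \<Rightarrow> 'm mpoly) \<Rightarrow> bool" where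
  "slot_linear c \<Phi> \<longleftrightarrow> (\<forall>ys zs p r U V.
     \<Phi> (ys @ (p, r \<bullet> U + V) # zs) - r \<bullet> \<Phi> (ys @ (p, U) # zs) - \<Phi> (ys @ (p, V) # zs)
       \<in> N (c + p + CE.wts ys + CE.wts zs))"

definition kills :: "int mpoly \<Rightarrow> ((int mpoly \<times> 'e mpoly) list \<Rightarrow> 'm mpoly) \<Rightarrow> bool" where
  "kills c \<Phi> \<longleftrightarrow> (\<forall>ys zs p U. \<Phi> (ys @ (p, p \<bullet> U + mmap dE U) # zs) \<in> N (c + p + CE.wts ys + CE.wts zs))"

lemma slot_linearD:
  "slot_linear c \<Phi> \<Longrightarrow> \<Phi> (ys @ (p, r \<bullet> U + V) # zs) - r \<bullet> \<Phi> (ys @ (p, U) # zs) - \<Phi> (ys @ (p, V) # zs)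
       \<in> N (c + p + CE.wts ys + CE.wts zs)"
  by (simp add: slot_linear_def)

lemma slot_linear_add:
  "slot_linear c \<Phi> \<Longrightarrow> \<Phi> (ys @ (p, U + V) # zs) - \<Phi> (ys @ (p, U) # zs) - \<Phi> (ys @ (p, V) # zs)
       \<in> N (c + p + CE.wts ys + CE.wts zs)"
  using slot_linearD[of c \<Phi> ys p 1 U V zs] by simp

lemma slot_linear_contract: "slot_linear c \<Phi> \<Longrightarrow> slot_linear (c + fst x) (\<lambda>ys. \<Phi> (x # ys))"
  unfolding slot_linear_def[of "c + fst x"]
proof (intro allI)
  fix ys zs p r U V assume "slot_linear c \<Phi>"
  from slot_linearD[OF this, of "x # ys" p r U V zs]
  show "\<Phi> (x # ys @ (p, r \<bullet> U + V) # zs) - r \<bullet> \<Phi> (x # ys @ (p, U) # zs) - \<Phi> (x # ys @ (p, V) # zs)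
       \<in> N (c + fst x + p + CE.wts ys + CE.wts zs)"
    by (simp add: ac_simps)
qed

lemma kills_contract: "kills c \<Phi> \<Longrightarrow> kills (c + fst x) (\<lambda>ys. \<Phi> (x # ys))"
  unfolding kills_def
proof (intro allI)
  fix ys zs and p :: "int mpoly" and U :: "'e mpoly"
  assume "\<forall>ys zs p U. \<Phi> (ys @ (p, p \<bullet> U + mmap dE U) # zs) \<in> N (c + p + CE.wts ys + CE.wts zs)"
  from this[rule_format, of "x # ys" p U zs]
  show "\<Phi> (x # ys @ (p, p \<bullet> U + mmap dE U) # zs) \<in> N (c + fst x + p + CE.wts ys + CE.wts zs)"
    by (simp add: ac_simps)
qed

lemma slot_linear_leibniz:
  assumes "slot_linear c \<Phi>"
  shows "CE.leibniz c \<Phi>"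
  unfolding CE.leibniz_def
proof (intro allI)
  fix ys zs and x y z :: "int mpoly \<times> 'e mpoly"
  let ?s = "fst x + fst y + fst z"
  let ?V = "brU (fst y) (snd y) (brU (fst x) (snd x) (snd z))"
    and ?W = "brU (fst x + fst y) (brU (fst x) (snd x) (snd y)) (snd z)"
  have "\<Phi> (ys @ (?s, ?V + ?W) # zs) - \<Phi> (ys @ (?s, ?V) # zs) - \<Phi> (ys @ (?s, ?W) # zs)
      \<in> N (c + ?s + CE.wts ys + CE.wts zs)"
    by (rule slot_linear_add[OF assms])
  then show "\<Phi> (ys @ brL x (brL y z) # zs) - \<Phi> (ys @ brL y (brL x z) # zs) - \<Phi> (ys @ brL (brL x y) z # zs)
       \<in> N (c + CE.wts ys + fst x + fst y + fst z + CE.wts zs)"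
    by (simp add: brL_def ac_simps jacobiU[of "fst x" "snd x" "fst y" "snd y" "snd z"])
qed

lemma slot_linear_skew_killing:
  assumes "slot_linear c \<Phi>" "kills c \<Phi>"
  shows "CE.skew_killing c \<Phi>"
  unfolding CE.skew_killing_def
proof (intro allI)
  fix ys zs and x y :: "int mpoly \<times> 'e mpoly"
  let ?s = "fst x + fst y"
  let ?V = "brU (fst x) (snd x) (snd y)" and ?W = "brU (fst y) (snd y) (snd x)"
  obtain Z where Z: "?V + ?W = ?s \<bullet> Z + mmap dE Z"
    using skewU by blast
  have 1: "\<Phi> (ys @ (?s, ?V + ?W) # zs) \<in> N (c + ?s + CE.wts ys + CE.wts zs)"
    unfolding Z using assms(2) by (auto simp: kills_def)
  have 2: "\<Phi> (ys @ (?s, ?V + ?W) # zs) - \<Phi> (ys @ (?s, ?V) # zs) - \<Phi> (ys @ (?s, ?W) # zs)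
      \<in> N (c + ?s + CE.wts ys + CE.wts zs)"
    by (rule slot_linear_add[OF assms(1)])
  show "\<Phi> (ys @ brL x y # zs) + \<Phi> (ys @ brL y x # zs) \<in> N (c + CE.wts ys + fst x + fst y + CE.wts zs)"
    by (rule CE.N_eq[OF CE.N_diff[OF 1 2]]) (simp_all add: brL_def ac_simps)
qed

text \<open>The terms of linearity form a slot rule. Its core for \<open>Lie z\<close> is z acting
  on the rule for \<Phi>, minus the rule for \<Phi> with U and V replaced by their brackets with
  z.\<close>

theorem dif_slot_linear:
  assumes "slot_linear c \<Phi>" "CE.alternating c \<Phi>" "CE.skew_killing c \<Phi>"
  shows "slot_linear c (CE.dif \<Phi>)"
  unfolding slot_linear_def
proof (intro allI)
  fix ys zs and p r :: "int mpoly" and U V :: "'e mpoly"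
  let ?\<rho> = "[(\<lambda>w. w :: 'm mpoly, (p :: int mpoly, r \<bullet> U + V)), (\<lambda>w. - (r \<bullet> w), (p, U)), (uminus, (p, V))]"
  let ?F = "\<lambda>c \<Phi>. slot_linear c \<Phi> \<and> CE.alternating c \<Phi> \<and> CE.skew_killing c \<Phi>"
  have \<rho>: "CE.additive_ops ?\<rho>"
    by (simp add: ract_add_right)
  have F_Lie: "CE.slot ?\<rho> (CE.Lie z \<Phi>) ys zs \<in> N (c + fst z + p + CE.wts ys + CE.wts zs)"
    if F: "?F c \<Phi>" for c \<Phi> z ys zs
  proof (rule CE.Lie_slot[OF \<rho>, of UNIV])
    have 1: "CE.slot ?\<rho> \<Phi> ys zs \<in> N (c + p + CE.wts ys + CE.wts zs)" for ys zs
      by (rule CE.N_eq[OF slot_linearD[of c \<Phi> ys p r U V zs]]) (use F in simp_all)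
    then show "CE.slot ?\<rho> \<Phi> ys zs \<in> N (c + p + CE.wts ys + CE.wts zs)" for ys zs .
    let ?B = "\<lambda>U. (fst z + p, brU (fst z) (snd z) U)"
    have 2: "actL z (CE.slot ?\<rho> \<Phi> ys zs) \<in> N (c + fst z + p + CE.wts ys + CE.wts zs)"
      using CE.act_N[OF 1[of ys zs], of z] by (simp add: ac_simps)
    have 3: "\<Phi> (ys @ ?B (r \<bullet> U + V) # zs) - r \<bullet> \<Phi> (ys @ ?B U # zs) - \<Phi> (ys @ ?B V # zs)
        \<in> N (c + fst z + p + CE.wts ys + CE.wts zs)"
      using slot_linearD[of c \<Phi> ys "fst z + p" r "brU (fst z) (snd z) U" "brU (fst z) (snd z) V" zs] F
      by (simp add: brU_def bev_linear biadd_br ac_simps)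
    have act_ract: "actL z (r \<bullet> w) = r \<bullet> actL z w" for w
      by (simp add: actL_def actU_def bev_linear biadd_lact)
    show "(\<Sum>(T, x)\<leftarrow>?\<rho>. T (actL z (\<Phi> (ys @ x # zs)) - \<Phi> (ys @ brL z x # zs)))
        \<in> N (c + fst z + p + CE.wts ys + CE.wts zs)"
      by (rule CE.N_eq[OF CE.N_diff[OF 2 3] _ refl])
        (simp add: brL_def CE.act_add CE.act_diff CE.act_uminus act_ract ract_diff_right)
  qed simp_all
  have "CE.slot ?\<rho> (CE.dif \<Phi>) ys zs \<in> N (c + p + CE.wts ys + CE.wts zs)"
  proof (rule CE.dif_slot[where F = ?F and S = UNIV and Z = UNIV, OF \<rho>])
    show "T w \<in> N (s + p)" if "(T, x) \<in> set ?\<rho>" "w \<in> N (s + fst x)" for T x s w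
      using that by (auto intro!: N_uminus N_ract)
    show "(\<Sum>(T, x)\<leftarrow>?\<rho>. T (actL x (\<Phi> []))) \<in> N (c + p)" for c \<Phi>
      by (simp add: actL_def actU_def bev_linear biadd_lact N_zero)
  qed (use assms F_Lie in \<open>auto intro: slot_linear_contract CE.alternating_contract CE.skew_killing_contract\<close>)
  then show "CE.dif \<Phi> (ys @ (p, r \<bullet> U + V) # zs) - r \<bullet> CE.dif \<Phi> (ys @ (p, U) # zs)
      - CE.dif \<Phi> (ys @ (p, V) # zs) \<in> N (c + p + CE.wts ys + CE.wts zs)"
    by (rule CE.N_eq) simp_all
qed

theorem dif_kills:
  assumes "kills c \<Phi>" "CE.alternating c \<Phi>" "CE.skew_killing c \<Phi>"
  shows "kills c (CE.dif \<Phi>)"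
  unfolding kills_def
proof (intro allI)
  fix ys zs and p :: "int mpoly" and U :: "'e mpoly"
  let ?\<rho> = "[(\<lambda>w. w :: 'm mpoly, (p :: int mpoly, p \<bullet> U + mmap dE U))]"
  let ?F = "\<lambda>c \<Phi>. kills c \<Phi> \<and> CE.alternating c \<Phi> \<and> CE.skew_killing c \<Phi>"
  have \<rho>: "CE.additive_ops ?\<rho>" by simp
  have F_Lie: "CE.slot ?\<rho> (CE.Lie z \<Phi>) ys zs \<in> N (c + fst z + p + CE.wts ys + CE.wts zs)"
    if F: "?F c \<Phi>" for c \<Phi> z ys zs
  proof (rule CE.Lie_slot[OF \<rho>, of UNIV])
    have 1: "CE.slot ?\<rho> \<Phi> ys zs \<in> N (c + p + CE.wts ys + CE.wts zs)" for ys zs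
      using F by (simp add: kills_def)
    then show "CE.slot ?\<rho> \<Phi> ys zs \<in> N (c + p + CE.wts ys + CE.wts zs)" for ys zs .
    have 2: "actL z (CE.slot ?\<rho> \<Phi> ys zs) \<in> N (c + fst z + p + CE.wts ys + CE.wts zs)"
      using CE.act_N[OF 1[of ys zs], of z] by (simp add: ac_simps)
    let ?B = "brU (fst z) (snd z) U"
    \<comment> \<open>The bracket with z carries p + d to p + d raised by the degree of z, so the
      bracketed argument is again of the kind that \<Phi> kills.\<close>
    have B: "brU (fst z) (snd z) (p \<bullet> U + mmap dE U) = (fst z + p) \<bullet> ?B + mmap dE ?B"
      using brU_deriv[of "fst z" "snd z" U]
      by (simp add: brU_def bev_linear biadd_br ract_add_left add_ac)
    have 3: "\<Phi> (ys @ (fst z + p, (fst z + p) \<bullet> ?B + mmap dE ?B) # zs)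
        \<in> N (c + fst z + p + CE.wts ys + CE.wts zs)"
      using F[THEN conjunct1, unfolded kills_def, rule_format, of ys "fst z + p" ?B zs]
      by (simp only: add.assoc)
    show "(\<Sum>(T, x)\<leftarrow>?\<rho>. T (actL z (\<Phi> (ys @ x # zs)) - \<Phi> (ys @ brL z x # zs)))
        \<in> N (c + fst z + p + CE.wts ys + CE.wts zs)"
      by (rule CE.N_eq[OF CE.N_diff[OF 2 3] _ refl]) (simp add: brL_def B)
  qed simp_all
  have "CE.slot ?\<rho> (CE.dif \<Phi>) ys zs \<in> N (c + p + CE.wts ys + CE.wts zs)"
  proof (rule CE.dif_slot[where F = ?F and S = UNIV and Z = UNIV, OF \<rho>])
    show "(\<Sum>(T, x)\<leftarrow>?\<rho>. T (actL x (\<Phi> []))) \<in> N (c + p)" for c \<Phi>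
      by (simp add: actL_def actU_kill N_zero)
  qed (use assms F_Lie in \<open>auto intro: kills_contract CE.alternating_contract CE.skew_killing_contract\<close>)
  then show "CE.dif \<Phi> (ys @ (p, p \<bullet> U + mmap dE U) # zs) \<in> N (c + p + CE.wts ys + CE.wts zs)"
    by simp
qed

section \<open>Points that avoid an auxiliary variable, and linearity over A\<close>

definition free_pts :: "nat \<Rightarrow> (int mpoly \<times> 'e mpoly) set" where
  "free_pts t = {x. tfree t (fst x) \<and> tfree t (snd x)}"

definition subL :: "(nat \<Rightarrow> int mpoly) \<Rightarrow> int mpoly \<times> 'e mpoly \<Rightarrow> int mpoly \<times> 'e mpoly" where
  "subL h x = (sub h (fst x), sub h (snd x))"

lemma free_pts_brL: "x \<in> free_pts t \<Longrightarrow> y \<in> free_pts t \<Longrightarrow> brL x y \<in> free_pts t"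
  by (simp add: free_pts_def brL_def brU_def tfree_add tfree_bev biadd_br)

lemma subL_brL: "subL h (brL x y) = brL (subL h x) (subL h y)"
  by (simp add: subL_def brL_def brU_def sub_bev biadd_br sub_add)

lemma sub_actL: "sub h (actL x w) = actL (subL h x) (sub h w)"
  by (simp add: subL_def actL_def actU_def sub_bev biadd_lact)

text \<open>The action of a point of degree q on a value under \<open>Sop t\<close> shifts lambda_t
  by q (\<open>bev_Sop\<close>). This condition moves such a shift from the value into the
  arguments.\<close>

definition natural_in :: "nat \<Rightarrow> int mpoly \<Rightarrow> ((int mpoly \<times> 'e mpoly) list \<Rightarrow> 'm mpoly) \<Rightarrow> bool" where
  "natural_in t c \<Phi> \<longleftrightarrow> (\<forall>q xs. tfree t q \<longrightarrow>
     sub (tshift t q) (\<Phi> xs) - \<Phi> (map (subL (tshift t q)) xs)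
       \<in> N (c + CE.wts (map (subL (tshift t q)) xs)))"

text \<open>Serves the base case of the twist rule, where the element acts on the single value
  \<open>\<Phi> []\<close>; stated for all lists so that it passes to contractions.\<close>

definition free_valued :: "nat \<Rightarrow> ((int mpoly \<times> 'e mpoly) list \<Rightarrow> 'm mpoly) \<Rightarrow> bool" where
  "free_valued t \<Phi> \<longleftrightarrow> (\<forall>xs. set xs \<subseteq> free_pts t \<longrightarrow> tfree t (\<Phi> xs))"

definition twist_rule :: "nat \<Rightarrow> int mpoly \<Rightarrow> ((int mpoly \<times> 'e mpoly) list \<Rightarrow> 'm mpoly) \<Rightarrow> bool" where
  "twist_rule t c \<Phi> \<longleftrightarrow> (\<forall>ys zs p U \<alpha>. set ys \<subseteq> free_pts t \<longrightarrow> set zs \<subseteq> free_pts t \<longrightarrow>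
     tfree t p \<longrightarrow> tfree t U \<longrightarrow> tfree t \<alpha> \<longrightarrow>
     \<Phi> (ys @ (p, SE.amul \<alpha> U) # zs) - SM.Sop t \<alpha> (\<Phi> (ys @ (p + X t, U) # zs))
       \<in> N (c + p + CE.wts ys + CE.wts zs))"

lemma subL_free: "x \<in> free_pts t \<Longrightarrow> subL (tshift t q) x = x"
  by (simp add: free_pts_def subL_def sub_tshift_tfree)

lemma map_subL_free: "set xs \<subseteq> free_pts t \<Longrightarrow> map (subL (tshift t q)) xs = xs"
  by (induction xs) (simp_all add: subL_free)

lemma tfree_wts: "set xs \<subseteq> free_pts t \<Longrightarrow> tfree t (CE.wts xs)"
  by (induction xs) (simp_all add: tfree_add free_pts_def)

lemma natural_in_contract:
  assumes "natural_in t c \<Phi>" "x \<in> free_pts t"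
  shows "natural_in t (c + fst x) (\<lambda>ys. \<Phi> (x # ys))"
  unfolding natural_in_def
proof (intro allI impI)
  fix q :: "int mpoly" and xs assume q: "tfree t q"
  from assms(1)[unfolded natural_in_def, rule_format, OF q, of "x # xs"]
  show "sub (tshift t q) (\<Phi> (x # xs)) - \<Phi> (x # map (subL (tshift t q)) xs)
      \<in> N (c + fst x + CE.wts (map (subL (tshift t q)) xs))"
    by (simp add: subL_free[OF assms(2)] ac_simps)
qed

lemma free_valued_contract: "free_valued t \<Phi> \<Longrightarrow> x \<in> free_pts t \<Longrightarrow> free_valued t (\<lambda>ys. \<Phi> (x # ys))"
  by (auto simp: free_valued_def)

lemma twist_ruleD:
  "twist_rule t c \<Phi> \<Longrightarrow> set ys \<subseteq> free_pts t \<Longrightarrow> set zs \<subseteq> free_pts t \<Longrightarrow>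
     tfree t p \<Longrightarrow> tfree t U \<Longrightarrow> tfree t \<alpha> \<Longrightarrow>
     \<Phi> (ys @ (p, SE.amul \<alpha> U) # zs) - SM.Sop t \<alpha> (\<Phi> (ys @ (p + X t, U) # zs))
       \<in> N (c + p + CE.wts ys + CE.wts zs)"
  by (simp add: twist_rule_def)

lemma twist_rule_contract:
  assumes "twist_rule t c \<Phi>" "x \<in> free_pts t"
  shows "twist_rule t (c + fst x) (\<lambda>ys. \<Phi> (x # ys))"
  unfolding twist_rule_def
proof (intro allI impI)
  fix ys zs and p :: "int mpoly" and U :: "'e mpoly" and \<alpha> :: "'a mpoly"
  assume "set ys \<subseteq> free_pts t" "set zs \<subseteq> free_pts t" "tfree t p" "tfree t U" "tfree t \<alpha>"
  then show "\<Phi> (x # ys @ (p, SE.amul \<alpha> U) # zs) - SM.Sop t \<alpha> (\<Phi> (x # ys @ (p + X t, U) # zs))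
       \<in> N (c + fst x + p + CE.wts ys + CE.wts zs)"
    using twist_ruleD[OF assms(1), of "x # ys" zs p U \<alpha>] assms(2) by (simp add: ac_simps)
qed

text \<open>On the side of the argument, [z, \<alpha> U] is \<alpha> [z, U] plus \<theta>(\<alpha>)
  U. On the side of the value, z commutes with \<open>Sop t \<alpha>\<close> up to
  \<open>Sop t (\<theta>(\<alpha>))\<close> of the value with lambda_t shifted. The two anchor terms
  match by the twist rule for \<theta>(\<alpha>) once naturality has undone the shift. Since
  \<theta>(\<alpha>) has polynomial coefficients even for \<alpha> in A, the rule is stated for
  polynomials \<alpha> over A.\<close>

theorem dif_twist_rule:
  assumes "tfree t c" "twist_rule t c \<Phi>" "natural_in t c \<Phi>" "free_valued t \<Phi>" "slot_linear c \<Phi>"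
    "CE.alternating c \<Phi>" "CE.skew_killing c \<Phi>"
  shows "twist_rule t c (CE.dif \<Phi>)"
  unfolding twist_rule_def
proof (intro allI impI)
  fix ys zs and p :: "int mpoly" and U :: "'e mpoly" and \<alpha> :: "'a mpoly"
  assume ys: "set ys \<subseteq> free_pts t" and zs: "set zs \<subseteq> free_pts t"
    and p: "tfree t p" and U: "tfree t U" and \<alpha>: "tfree t \<alpha>"
  let ?\<rho> = "[(\<lambda>w. w :: 'm mpoly, (p :: int mpoly, SE.amul \<alpha> U)), (\<lambda>w. - SM.Sop t \<alpha> w, (p + X t, U))]"
  let ?F = "\<lambda>c \<Phi>. tfree t c \<and> twist_rule t c \<Phi> \<and> natural_in t c \<Phi> \<and> free_valued t \<Phi> \<and> slot_linear c \<Phi> \<and>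
    CE.alternating c \<Phi> \<and> CE.skew_killing c \<Phi>"
  have \<rho>: "CE.additive_ops ?\<rho>"
    by (simp add: SM.Sop_add_right)
  have F_Lie: "CE.slot ?\<rho> (CE.Lie z \<Phi>) ys zs \<in> N (c + fst z + p + CE.wts ys + CE.wts zs)"
    if F: "?F c \<Phi>" and z: "z \<in> free_pts t" and ys: "set ys \<subseteq> free_pts t" and zs: "set zs \<subseteq> free_pts t"
    for c \<Phi> z ys zs
  proof (rule CE.Lie_slot[OF \<rho> _ _ _ ys zs])
    show "brL z y \<in> free_pts t" if "y \<in> free_pts t" for y
      using free_pts_brL[OF z that] .
    have tw: "\<Phi> (ys @ (p, SE.amul \<alpha> U) # zs) - SM.Sop t \<alpha> (\<Phi> (ys @ (p + X t, U) # zs))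
        \<in> N (c + p + CE.wts ys + CE.wts zs)"
      if "set ys \<subseteq> free_pts t" "set zs \<subseteq> free_pts t" "tfree t p" "tfree t U" "tfree t \<alpha>"
      for ys zs p and U :: "'e mpoly" and \<alpha> :: "'a mpoly"
      using F that by (auto intro: twist_ruleD)
    show "CE.slot ?\<rho> \<Phi> ys zs \<in> N (c + p + CE.wts ys + CE.wts zs)"
      if "set ys \<subseteq> free_pts t" "set zs \<subseteq> free_pts t" for ys zs
      using tw[OF that p U \<alpha>] by simp
    let ?q = "fst z" and ?W = "snd z"
    let ?s = "c + fst z + p + CE.wts ys + CE.wts zs"
    let ?B = "brU ?q ?W U" and ?\<theta> = "thU ?q ?W \<alpha>"
    have q: "tfree t ?q" and W: "tfree t ?W"
      using z by (simp_all add: free_pts_def)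
    have B: "tfree t ?B"
      by (simp add: brU_def tfree_bev biadd_br q W U)
    have \<theta>: "tfree t ?\<theta>"
      by (simp add: thU_def tfree_bev biadd_anchor q W \<alpha>)
    have s: "tfree t ?s"
      using F q p tfree_wts[OF ys] tfree_wts[OF zs] by (simp add: tfree_add)
    \<comment> \<open>Five null terms make up the core: z applied to the rule; the rule for the
      bracket [z, U]; the rule for the anchor term; additivity, which splits the slot into these
      two; and naturality, which removes the shift.\<close>
    have 1: "actL z (\<Phi> (ys @ (p, SE.amul \<alpha> U) # zs) - SM.Sop t \<alpha> (\<Phi> (ys @ (p + X t, U) # zs))) \<in> N ?s"
      using CE.act_N[OF tw[OF ys zs p U \<alpha>], of z] by (simp add: ac_simps)
    have 2: "\<Phi> (ys @ (?q + p, SE.amul \<alpha> ?B) # zs) - SM.Sop t \<alpha> (\<Phi> (ys @ (?q + p + X t, ?B) # zs)) \<in> N ?s"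
      using tw[OF ys zs tfree_add[OF q p] B \<alpha>] by (simp add: ac_simps)
    have 3: "\<Phi> (ys @ (?q + p, SE.amul ?\<theta> U) # zs) - SM.Sop t ?\<theta> (\<Phi> (ys @ (?q + p + X t, U) # zs)) \<in> N ?s"
      using tw[OF ys zs tfree_add[OF q p] U \<theta>] by (simp add: ac_simps)
    have 4: "\<Phi> (ys @ (?q + p, SE.amul \<alpha> ?B + SE.amul ?\<theta> U) # zs) - \<Phi> (ys @ (?q + p, SE.amul \<alpha> ?B) # zs)
        - \<Phi> (ys @ (?q + p, SE.amul ?\<theta> U) # zs) \<in> N ?s"
      using slot_linear_add[of c \<Phi> ys "?q + p" "SE.amul \<alpha> ?B" "SE.amul ?\<theta> U" zs] F by (simp add: ac_simps)
    have "sub (tshift t ?q) (\<Phi> (ys @ (p + X t, U) # zs)) - \<Phi> (ys @ (?q + p + X t, U) # zs) \<in> N (?s + X t)"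
      using F[THEN conjunct2, THEN conjunct2, THEN conjunct1, unfolded natural_in_def, rule_format,
          OF q, of "ys @ (p + X t, U) # zs"]
      by (simp add: map_subL_free[OF ys] map_subL_free[OF zs] subL_def sub_add tshift_same
          sub_tshift_tfree p U ac_simps)
    then have 5: "SM.Sop t ?\<theta> (sub (tshift t ?q) (\<Phi> (ys @ (p + X t, U) # zs))
        - \<Phi> (ys @ (?q + p + X t, U) # zs)) \<in> N ?s"
      using N_Sop s by blast
    show "(\<Sum>(T, x)\<leftarrow>?\<rho>. T (actL z (\<Phi> (ys @ x # zs)) - \<Phi> (ys @ brL z x # zs))) \<in> N ?s"
      by (rule CE.N_eq[OF CE.N_add[OF CE.N_diff[OF CE.N_diff[OF CE.N_diff[OF 1 2] 3] 4] 5] _ refl])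
        (simp add: brL_def actU_diff brU_amul actL_def actU_Sop[OF q W] add_map_diff[OF SM.add_map_Sop]
          add.assoc algebra_simps)
  qed
  have "CE.slot ?\<rho> (CE.dif \<Phi>) ys zs \<in> N (c + p + CE.wts ys + CE.wts zs)"
  proof (rule CE.dif_slot[where F = ?F and S = "{s. tfree t s}" and Z = "free_pts t", OF \<rho> _ _ _ _ _ _ _ _ _ ys zs])
    show "T w \<in> N (s + p)" if "(T, x) \<in> set ?\<rho>" "s \<in> {s. tfree t s}" "w \<in> N (s + fst x)" for T x s w
      using that p by (auto intro!: N_uminus N_Sop tfree_add simp: add.assoc)
    show "(\<Sum>(T, x)\<leftarrow>?\<rho>. T (actL x (\<Phi> []))) \<in> N (c + p)" if "?F c \<Phi>" for c \<Phi>
    proof -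
      have "tfree t (\<Phi> [])" using that by (simp add: free_valued_def)
      then show ?thesis by (simp add: actL_def actU_amul[OF p U] N_zero)
    qed
  qed (use assms F_Lie in \<open>auto simp: free_pts_def tfree_add intro: slot_linear_contract CE.alternating_contract
        CE.skew_killing_contract natural_in_contract free_valued_contract twist_rule_contract\<close>)
  then show "CE.dif \<Phi> (ys @ (p, SE.amul \<alpha> U) # zs) - SM.Sop t \<alpha> (CE.dif \<Phi> (ys @ (p + X t, U) # zs))
      \<in> N (c + p + CE.wts ys + CE.wts zs)"
    by simp
qed

theorem dif_subL:
  assumes "\<And>xs. sub h (\<Phi> xs) - \<Phi> (map (subL h) xs) \<in> N (CE.wts (map (subL h) xs))"
  shows "sub h (CE.dif \<Phi> xs) - CE.dif \<Phi> (map (subL h) xs) \<in> N (CE.wts (map (subL h) xs))"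
  using CE.dif_natural[of "sub h" "subL h" \<Phi> \<Phi> 0 xs] assms
  by (simp add: sub_add sub_actL subL_brL)

end

section \<open>Multilinear extension\<close>

lemma lift_raw: "lift f q = (\<Sum>m\<in>Poly_Mapping.keys q. Poly_Mapping.single m 1 \<bullet> f (Poly_Mapping.lookup q m))"
  by (simp add: lift_def lin_def)

text \<open>The function \<open>g\<close> need not be additive: representatives of reduced cochains are additive only
  modulo \<open>N\<close>.\<close>

primrec ext :: "('e::ab_group_add list \<Rightarrow> 'm::ab_group_add mpoly) \<Rightarrow> 'e mpoly list \<Rightarrow> 'm mpoly" where
  "ext g [] = g []"
| "ext g (U # Us) = lift (\<lambda>u. ext (\<lambda>us. g (u # us)) Us) U"

lemma lift_fun_op:
  assumes "add_map T"
    and "\<And>m w. m \<in> Poly_Mapping.keys U \<Longrightarrow> T (Poly_Mapping.single m 1 \<bullet> w) = Poly_Mapping.single m 1 \<bullet> T w"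
  shows "lift (\<lambda>u. T (f u)) U = T (lift f U)"
  unfolding lift_raw add_map_sum[OF assms(1)] using assms(2) by (intro sum.cong) simp_all

lemma lift_fun_ract: "lift (\<lambda>u. r \<bullet> f u) U = r \<bullet> lift f U"
  by (rule lift_fun_op) (simp_all add: add_map_ract ract_commute[of r])

lemma lift_fun_zero [simp]: "lift (\<lambda>u. 0) U = 0"
  by (simp add: lift_raw)

lemma lift_fun_sum: "lift (\<lambda>u. \<Sum>i\<in>I. f i u) U = (\<Sum>i\<in>I. lift (f i) U)"
  by (induction I rule: infinite_finite_induct) (simp_all add: lift_fun_add)

lemma ext_fun_zero [simp]: "ext (\<lambda>us. 0) Us = 0"
  by (induction Us) simp_all

lemma ext_fun_add: "ext (\<lambda>us. g us + g' us) Us = ext g Us + ext g' Us"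
  by (induction Us arbitrary: g g') (simp_all add: lift_fun_add)

text \<open>Commutation is asked only for monomials that occur in the arguments, because
  \<open>Sop t\<close> commutes just with those free of lambda_t.\<close>

lemma ext_fun_op:
  assumes "add_map T"
    and "\<And>U m w. U \<in> set Us \<Longrightarrow> m \<in> Poly_Mapping.keys U \<Longrightarrow>
      T (Poly_Mapping.single m 1 \<bullet> w) = Poly_Mapping.single m 1 \<bullet> T w"
  shows "ext (\<lambda>us. T (g us)) Us = T (ext g Us)"
  using assms(2)
proof (induction Us arbitrary: g)
  case (Cons U Us)
  have "ext (\<lambda>us. T (g (u # us))) Us = T (ext (\<lambda>us. g (u # us)) Us)" for u
    using Cons.prems by (intro Cons.IH) auto
  moreover have "lift (\<lambda>u. T (ext (\<lambda>us. g (u # us)) Us)) U = T (lift (\<lambda>u. ext (\<lambda>us. g (u # us)) Us) U)"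
    by (rule lift_fun_op[OF assms(1)], rule Cons.prems[of U]) simp_all
  ultimately show ?case by simp
qed simp

lemma ext_fun_ract: "ext (\<lambda>us. r \<bullet> g us) Us = r \<bullet> ext g Us"
  by (rule ext_fun_op) (simp_all add: add_map_ract ract_commute[of r])

lemma ext_fun_uminus: "ext (\<lambda>us. - g us) Us = - ext g Us"
  using ext_fun_ract[of "- 1" g Us] by (simp add: ract_uminus_left)

lemma ext_fun_diff: "ext (\<lambda>us. g us - g' us) Us = ext g Us - ext g' Us"
  using ext_fun_add[of g "\<lambda>us. - g' us" Us] by (simp add: ext_fun_uminus)

lemma ext_fun_sum: "ext (\<lambda>us. \<Sum>i\<in>I. g i us) Us = (\<Sum>i\<in>I. ext (g i) Us)"
  by (induction I rule: infinite_finite_induct) (simp_all add: ext_fun_add)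

lemma ext_cong: "(\<And>us. length us = length Us \<Longrightarrow> g us = g' us) \<Longrightarrow> ext g Us = ext g' Us"
proof (induction Us arbitrary: g g')
  case (Cons U Us)
  have "ext (\<lambda>us. g (u # us)) Us = ext (\<lambda>us. g' (u # us)) Us" for u
    by (rule Cons.IH) (simp add: Cons.prems)
  then show ?case by simp
qed simp

lemma lift_ext_swap: "lift (\<lambda>u. ext (g u) Us) U = ext (\<lambda>us. lift (\<lambda>u. g u us) U) Us"
  by (simp add: lift_raw ext_fun_sum ext_fun_ract)

lemma lift_swap: "lift (\<lambda>u. lift (f u) V) U = lift (\<lambda>v. lift (\<lambda>u. f u v) U) V"
  unfolding lift_raw[of _ V] lift_fun_sum lift_fun_ract ..

text \<open>The finite sums over the terms of the different arguments can be interchanged, for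
  arbitrary g. Expanding the slot under study innermost reduces statements on it to functions of one
  argument.\<close>

lemma ext_move:
  "ext g (Us @ U # Vs) =
    ext (\<lambda>us. lift (\<lambda>u. g (take (length Us) us @ u # drop (length Us) us)) U) (Us @ Vs)"
  by (induction Us arbitrary: g) (simp_all add: lift_ext_swap)

lemma ext_move2:
  "ext g (Us @ U # V # Vs) =
    ext (\<lambda>us. lift (\<lambda>v. lift (\<lambda>u. g (take (length Us) us @ u # v # drop (length Us) us)) U) V) (Us @ Vs)"
  unfolding ext_move[of g] ext_move[of _ Us V] by (rule ext_cong) simp

lemma tfree_sum: "(\<And>i. i \<in> I \<Longrightarrow> tfree t (f i)) \<Longrightarrow> tfree t (sum f I)"
  for f :: "'i \<Rightarrow> 'v::comm_monoid_add mpoly"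
  by (induction I rule: infinite_finite_induct) (auto intro: tfree_add)

lemma tfree_lift_raw: "tfree t U \<Longrightarrow> (\<And>v. tfree t (f v)) \<Longrightarrow> tfree t (lift f U)"
  unfolding lift_raw
  by (rule tfree_sum) (auto simp: tfree_def[of t U] intro!: tfree_ract tfree_single)

lemma tfree_ext: "(\<And>U. U \<in> set Us \<Longrightarrow> tfree t U) \<Longrightarrow> (\<And>us. tfree t (g us)) \<Longrightarrow> tfree t (ext g Us)"
  by (induction Us arbitrary: g) (simp_all add: tfree_lift_raw)

text \<open>The substitution fixes lambda_t and brings it in nowhere else, so the powers of lambda_t
  read by \<open>Sop t\<close> are unchanged.\<close>

lemma (in derivation_action) sub_Sop:
  assumes "h t = X t" "\<And>j. j \<noteq> t \<Longrightarrow> tfree t (h j)"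
  shows "sub h (Sop t \<alpha> w) = Sop t (sub h \<alpha>) (sub h w)"
proof (induction w arbitrary: \<alpha> rule: mpoly_induct_var[where t = t])
  case (const v)
  show ?case
    by (simp add: Sop_tfree sub_amul)
next
  case (mul r w)
  have "tfree t (sub h r)"
    using assms(2) tfree_subI[of t "h(t := 0)" r] tfree_sub[OF mul(1), of h "h(t := 0)"] by auto
  then show ?case
    by (simp add: Sop_ract_right mul sub_ract)
next
  case (var w)
  then show ?case
    by (simp add: Sop_X sub_ract assms(1) sub_mmap[OF d_add])
qed (simp add: Sop_add_right sub_add)

definition sigma :: "nat \<Rightarrow> int mpoly" where
  "sigma k = (\<Sum>i<k. X i)"

lemma sub_sigma: "sub h (sigma k) = (\<Sum>i<k. h i)"
  by (simp add: sigma_def add_map_sum[OF add_map_sub])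

lemma sub_sigma_nth: "length ps = k \<Longrightarrow> sub ((!) ps) (sigma k) = sum_list ps"
  by (simp add: sub_sigma sum_list_sum_nth atLeast0LessThan)

abbreviation below :: "nat \<Rightarrow> 'v::zero mpoly \<Rightarrow> bool" where
  "below k q \<equiv> \<forall>t\<ge>k. tfree t q"

lemma sub_below: "below k q \<Longrightarrow> (\<And>i. i < k \<Longrightarrow> h i = g i) \<Longrightarrow> sub h q = sub g q"
  by (rule sub_cong) (metis in_keys_iff not_le tfree_def)

lemma sub_below_id: "below k q \<Longrightarrow> (\<And>i. i < k \<Longrightarrow> h i = X i) \<Longrightarrow> sub h q = q"
  using sub_below[of k q h X] by simp

lemma sub_nth_below: "below k q \<Longrightarrow> length ps = k \<Longrightarrow> sub h (sub ((!) ps) q) = sub ((!) (map (sub h) ps)) q"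
  unfolding sub_sub by (rule sub_below) auto

lemma tfree_sub_below: "below k q \<Longrightarrow> (\<And>i. i < k \<Longrightarrow> tfree t (h i)) \<Longrightarrow> tfree t (sub h q)"
  using sub_below[of k q h "\<lambda>i. if i < k then h i else 0"] tfree_subI[of t "\<lambda>i. if i < k then h i else 0" q]
  by simp

section \<open>Congruence modulo N and functions that are additive modulo N\<close>

context algebroid_cochains
begin

definition cg :: "int mpoly \<Rightarrow> 'm mpoly \<Rightarrow> 'm mpoly \<Rightarrow> bool" where
  "cg s v w \<longleftrightarrow> v - w \<in> N s"

lemma cg_refl [simp, intro]: "cg s v v"
  by (simp add: cg_def N_zero)

lemma cg_sym: "cg s v w \<Longrightarrow> cg s w v"
  unfolding cg_def using N_uminus[of "v - w" s] by simp

lemma cg_trans [trans]: "cg s u v \<Longrightarrow> cg s v w \<Longrightarrow> cg s u w"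
  unfolding cg_def using N_add[of "u - v" s "v - w"] by simp

lemma cg_eq_trans [trans]: "cg s u v \<Longrightarrow> v = w \<Longrightarrow> cg s u w" "u = v \<Longrightarrow> cg s v w \<Longrightarrow> cg s u w"
  by simp_all

lemma cg_add: "cg s v w \<Longrightarrow> cg s v' w' \<Longrightarrow> cg s (v + v') (w + w')"
  unfolding cg_def using N_add[of "v - w" s "v' - w'"] by (simp add: add_diff_add)

lemma cg_uminus: "cg s v w \<Longrightarrow> cg s (- v) (- w)"
  unfolding cg_def using N_uminus[of "v - w" s] by simp

lemma cg_diff: "cg s v w \<Longrightarrow> cg s v' w' \<Longrightarrow> cg s (v - v') (w - w')"
  using cg_add[of s v w "- v'" "- w'"] cg_uminus[of s v' w'] by simp

lemma cg_ract: "cg s v w \<Longrightarrow> cg s (r \<bullet> v) (r \<bullet> w)"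
  unfolding cg_def using N_ract[of "v - w" s r] by (simp add: ract_diff_right)

lemma cg_sum: "(\<And>i. i \<in> I \<Longrightarrow> cg s (f i) (g i)) \<Longrightarrow> cg s (sum f I) (sum g I)"
  by (induction I rule: infinite_finite_induct) (auto intro: cg_add)

lemma cg_sub: "cg s v w \<Longrightarrow> cg (sub h s) (sub h v) (sub h w)"
  unfolding cg_def using N_sub[of "v - w" s h] by (simp add: sub_diff)

lemma cg_Sop: "cg (s + X t) v w \<Longrightarrow> tfree t s \<Longrightarrow> cg s (SM.Sop t \<alpha> v) (SM.Sop t \<alpha> w)"
  unfolding cg_def using N_Sop[of "v - w" s t \<alpha>] by (simp add: add_map_diff[OF SM.add_map_Sop])

lemma cg_zero_iff: "cg s v 0 \<longleftrightarrow> v \<in> N s"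
  by (simp add: cg_def)

definition nadd :: "int mpoly \<Rightarrow> ('e \<Rightarrow> 'm mpoly) \<Rightarrow> bool" where
  "nadd s f \<longleftrightarrow> (\<forall>u v. cg s (f (u + v)) (f u + f v))"

lemma nadd_zero: "nadd s f \<Longrightarrow> cg s (f 0) 0"
  using spec[OF spec[of _ 0], of "\<lambda>u v. cg s (f (u + v)) (f u + f v)" 0] N_uminus[of "- f 0" s]
  by (simp add: nadd_def cg_def)

lemma lift_cg: "(\<And>v. cg s (f v) (g v)) \<Longrightarrow> cg s (lift f U) (lift g U)"
  unfolding lift_raw by (intro cg_sum cg_ract) simp

text \<open>An index at which U has coefficient 0 contributes f 0, which need not be 0 but is
  null.\<close>

lemma lift_cg_superset:
  assumes "nadd s f" "finite K" "Poly_Mapping.keys U \<subseteq> K"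
  shows "cg s (lift f U) (\<Sum>m\<in>K. Poly_Mapping.single m 1 \<bullet> f (Poly_Mapping.lookup U m))"
proof -
  let ?g = "\<lambda>m. Poly_Mapping.single m 1 \<bullet> f (Poly_Mapping.lookup U m)"
  have "cg s (sum ?g (K - Poly_Mapping.keys U)) (\<Sum>m\<in>K - Poly_Mapping.keys U. Poly_Mapping.single m 1 \<bullet> 0)"
    using nadd_zero[OF assms(1)] by (intro cg_sum cg_ract) (simp add: in_keys_iff)
  from cg_add[OF this, of "lift f U" "lift f U"] show ?thesis
    using sum.subset_diff[OF assms(3,2), of ?g] by (simp add: lift_raw cg_sym)
qed

lemma lift_cg_add:
  assumes "nadd s f"
  shows "cg s (lift f (U + V)) (lift f U + lift f V)"
proof -
  let ?K = "Poly_Mapping.keys U \<union> Poly_Mapping.keys V"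
  let ?g = "\<lambda>U m. Poly_Mapping.single m 1 \<bullet> f (Poly_Mapping.lookup U m)"
  have "cg s (lift f (U + V)) (\<Sum>m\<in>?K. ?g (U + V) m)"
    using keys_add[of U V] by (intro lift_cg_superset[OF assms]) auto
  also have "cg s \<dots> (\<Sum>m\<in>?K. ?g U m + ?g V m)"
    unfolding ract_add_right[symmetric] lookup_add
    using assms by (intro cg_sum cg_ract) (simp add: nadd_def)
  also have "\<dots> = (\<Sum>m\<in>?K. ?g U m) + (\<Sum>m\<in>?K. ?g V m)"
    by (rule sum.distrib)
  also have "cg s \<dots> (lift f U + lift f V)"
    by (intro cg_add cg_sym[OF lift_cg_superset[OF assms]]) auto
  finally show ?thesis .
qed

lemma lift_cg_single:
  "nadd s f \<Longrightarrow> cg s (lift f (Poly_Mapping.single m v)) (Poly_Mapping.single m 1 \<bullet> f v)"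
  using lift_cg_superset[of s f "{m}" "Poly_Mapping.single m v"] by simp

lemma lift_cg_const: "nadd s f \<Longrightarrow> cg s (lift f (const_mpoly v)) (f v)"
  using lift_cg_single[of s f 0 v] by simp

lemma nadd_zmul:
  assumes "nadd s f"
  shows "cg s (f (zmul n v)) (zmul n (f v))"
proof (induction n rule: int_induct[where k = 0])
  case base
  then show ?case using nadd_zero[OF assms] by simp
next
  case (step1 i)
  have "cg s (f (zmul i v + v)) (f (zmul i v) + f v)"
    using assms by (simp add: nadd_def)
  also have "cg s \<dots> (zmul i (f v) + f v)"
    by (intro cg_add step1 cg_refl)
  finally show ?case by (simp add: zmul_add_1)
next
  case (step2 i)
  have e: "zmul i w = zmul (i - 1) w + w" for w :: "'x::ab_group_add"
    using zmul_add_1[of "i - 1" w] by simp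
  have "cg s (f (zmul (i - 1) v + v)) (f (zmul (i - 1) v) + f v)"
    using assms by (simp add: nadd_def)
  from cg_trans[OF cg_sym[OF this] step2(2)[unfolded e[of v]]]
  have "cg s (f (zmul (i - 1) v) + f v - f v) (zmul i (f v) - f v)"
    by (intro cg_diff cg_refl)
  then show ?case by (simp add: e[of "f v"])
qed

lemma lift_cg_ract:
  assumes "nadd s f"
  shows "cg s (lift f (r \<bullet> U)) (r \<bullet> lift f U)"
proof (induction r rule: poly_mapping_single_induct)
  case (single m a)
  show ?case
  proof (induction U rule: poly_mapping_single_induct)
    case (single l v)
    have "cg s (lift f (Poly_Mapping.single (m + l) (zmul a v))) (Poly_Mapping.single (m + l) 1 \<bullet> f (zmul a v))"
      by (rule lift_cg_single[OF assms])
    also have "cg s \<dots> (Poly_Mapping.single (m + l) 1 \<bullet> zmul a (f v))"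
      by (rule cg_ract[OF nadd_zmul[OF assms]])
    also have "\<dots> = Poly_Mapping.single m a \<bullet> Poly_Mapping.single l 1 \<bullet> f v"
      by (simp add: mult_single flip: ract_mult ract_const_mpoly)
    also have "cg s \<dots> (Poly_Mapping.single m a \<bullet> lift f (Poly_Mapping.single l v))"
      by (rule cg_ract[OF cg_sym[OF lift_cg_single[OF assms]]])
    finally show ?case by (simp add: ract_single)
  next
    case (add U V)
    let ?r = "Poly_Mapping.single m a"
    have "cg s (lift f (?r \<bullet> U + ?r \<bullet> V)) (lift f (?r \<bullet> U) + lift f (?r \<bullet> V))"
      by (rule lift_cg_add[OF assms])
    also have "cg s \<dots> (?r \<bullet> lift f U + ?r \<bullet> lift f V)"
      by (rule cg_add[OF add])
    also have "\<dots> = ?r \<bullet> (lift f U + lift f V)"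
      by (simp add: ract_add_right)
    also have "cg s \<dots> (?r \<bullet> lift f (U + V))"
      by (rule cg_ract[OF cg_sym[OF lift_cg_add[OF assms]]])
    finally show ?case by (simp add: ract_add_right)
  qed
next
  case (add r r')
  show ?case
    using cg_trans[OF lift_cg_add[OF assms] cg_add[OF add]] by (simp add: ract_add_left)
qed

lemma lift_cg_sub:
  assumes "nadd s f"
  shows "cg (sub h s) (sub h (lift f U)) (lift (\<lambda>u. sub h (f u)) (sub h U))"
proof -
  have f': "nadd (sub h s) (\<lambda>u. sub h (f u))"
    unfolding nadd_def sub_add[symmetric] using assms by (auto simp: nadd_def intro!: cg_sub)
  show ?thesis
  proof (induction U rule: mpoly_induct)
    case (const u)
    show ?case
      using cg_trans[OF cg_sub[OF lift_cg_const[OF assms]] cg_sym[OF lift_cg_const[OF f']]] by simp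
  next
    case (mul r U)
    have "cg (sub h s) (sub h (lift f (r \<bullet> U))) (sub h (r \<bullet> lift f U))"
      by (rule cg_sub[OF lift_cg_ract[OF assms]])
    also have "\<dots> = sub h r \<bullet> sub h (lift f U)"
      by (rule sub_ract)
    also have "cg (sub h s) \<dots> (sub h r \<bullet> lift (\<lambda>u. sub h (f u)) (sub h U))"
      by (rule cg_ract[OF mul])
    also have "cg (sub h s) \<dots> (lift (\<lambda>u. sub h (f u)) (sub h r \<bullet> sub h U))"
      by (rule cg_sym[OF lift_cg_ract[OF f']])
    finally show ?case by (simp add: sub_ract)
  next
    case (add U V)
    have "cg (sub h s) (sub h (lift f (U + V))) (sub h (lift f U + lift f V))"
      by (rule cg_sub[OF lift_cg_add[OF assms]])
    also have "\<dots> = sub h (lift f U) + sub h (lift f V)"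
      by (rule sub_add)
    also have "cg (sub h s) \<dots> (lift (\<lambda>u. sub h (f u)) (sub h U) + lift (\<lambda>u. sub h (f u)) (sub h V))"
      by (rule cg_add[OF add])
    also have "cg (sub h s) \<dots> (lift (\<lambda>u. sub h (f u)) (sub h U + sub h V))"
      by (rule cg_sym[OF lift_cg_add[OF f']])
    finally show ?case by (simp add: sub_add)
  qed
qed

lemma ext_cg: "(\<And>us. length us = length Us \<Longrightarrow> cg s (g us) (g' us)) \<Longrightarrow> cg s (ext g Us) (ext g' Us)"
proof (induction Us arbitrary: g g')
  case (Cons U Us)
  have "cg s (ext (\<lambda>us. g (u # us)) Us) (ext (\<lambda>us. g' (u # us)) Us)" for u
    by (rule Cons.IH) (simp add: Cons.prems)
  then show ?case by (simp add: lift_cg)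
qed simp

definition slot_additive :: "int mpoly \<Rightarrow> nat \<Rightarrow> ('e list \<Rightarrow> 'm mpoly) \<Rightarrow> bool" where
  "slot_additive s n g \<longleftrightarrow> (\<forall>ys zs u v. length ys + length zs + 1 = n \<longrightarrow>
     cg s (g (ys @ (u + v) # zs)) (g (ys @ u # zs) + g (ys @ v # zs)))"

lemma slot_additive_contract: "slot_additive s (Suc n) g \<Longrightarrow> slot_additive s n (\<lambda>us. g (u # us))"
  unfolding slot_additive_def
proof (intro allI impI)
  fix ys zs :: "'e list" and v w :: 'e
  assume "\<forall>ys zs u v. length ys + length zs + 1 = Suc n \<longrightarrow>
     cg s (g (ys @ (u + v) # zs)) (g (ys @ u # zs) + g (ys @ v # zs))" "length ys + length zs + 1 = n"
  then show "cg s (g (u # ys @ (v + w) # zs)) (g (u # ys @ v # zs) + g (u # ys @ w # zs))"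
    using spec[of "\<lambda>ys. \<forall>zs u v. length ys + length zs + 1 = Suc n \<longrightarrow>
      cg s (g (ys @ (u + v) # zs)) (g (ys @ u # zs) + g (ys @ v # zs))" "u # ys"] by simp
qed

lemma slot_additive_nadd:
  assumes "slot_additive s (Suc (length Us)) g"
  shows "nadd s (\<lambda>u. ext (\<lambda>us. g (u # us)) Us)"
  unfolding nadd_def ext_fun_add[symmetric]
  using assms[unfolded slot_additive_def, rule_format, of "[]"] by (auto intro!: ext_cg)

lemma ext_cg_const: "slot_additive s (length us) g \<Longrightarrow> cg s (ext g (map const_mpoly us)) (g us)"
proof (induction us arbitrary: g)
  case (Cons u us)
  have "slot_additive s (Suc (length (map const_mpoly us))) g" using Cons.prems by simp
  from cg_trans[OF lift_cg_const[OF slot_additive_nadd[OF this]]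
      Cons.IH[OF slot_additive_contract[of s "length us" g u]]] Cons.prems
  show ?case by simp
qed simp

lemma ext_cg_sub:
  "slot_additive s (length Us) g \<Longrightarrow>
    cg (sub h s) (sub h (ext g Us)) (ext (\<lambda>us. sub h (g us)) (map (sub h) Us))"
proof (induction Us arbitrary: g)
  case (Cons U Us)
  have a: "slot_additive s (Suc (length Us)) g" using Cons.prems by simp
  have "cg (sub h s) (sub h (lift (\<lambda>u. ext (\<lambda>us. g (u # us)) Us) U))
      (lift (\<lambda>u. sub h (ext (\<lambda>us. g (u # us)) Us)) (sub h U))"
    by (rule lift_cg_sub[OF slot_additive_nadd[OF a]])
  also have "cg (sub h s) \<dots> (lift (\<lambda>u. ext (\<lambda>us. sub h (g (u # us))) (map (sub h) Us)) (sub h U))"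
    by (intro lift_cg Cons.IH slot_additive_contract a)
  finally show ?case by simp
qed simp

end

section \<open>Cochains as functions of points\<close>

context algebroid_cochains
begin

text \<open>For \<open>reduced = False\<close> these are the basic cochains, for \<open>reduced = True\<close> the functions
  representing reduced cochains value by value.\<close>

definition precochain :: "nat \<Rightarrow> ('e list \<Rightarrow> 'm mpoly) \<Rightarrow> bool" where
  "precochain k \<psi> \<longleftrightarrow>
     (\<forall>us. length us \<noteq> k \<longrightarrow> \<psi> us = 0) \<and>
     (\<forall>us. below k (\<psi> us)) \<and>
     slot_additive (sigma k) k \<psi> \<and>
     (\<forall>ys zs u. length ys + length zs + 1 = k \<longrightarrow>
        cg (sigma k) (\<psi> (ys @ dE u # zs)) (- (X (length ys) \<bullet> \<psi> (ys @ u # zs)))) \<and>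
     (\<forall>ys zs a u t. length ys + length zs + 1 = k \<and> k \<le> t \<longrightarrow>
        cg (sigma k) (\<psi> (ys @ scE a u # zs))
          (SM.Sop t (const_mpoly a) (sub (tshift (length ys) (X t)) (\<psi> (ys @ u # zs))))) \<and>
     (\<forall>ys zs u v. length ys + length zs + 2 = k \<longrightarrow>
        cg (sigma k) (\<psi> (ys @ u # v # zs))
          (- sub (\<lambda>j. X (transpose (length ys) (Suc (length ys)) j)) (\<psi> (ys @ v # u # zs))))"

lemma precochainD:
  assumes "precochain k \<psi>"
  shows "length us \<noteq> k \<Longrightarrow> \<psi> us = 0"
    and "below k (\<psi> us)"
    and "slot_additive (sigma k) k \<psi>"
    and "length ys + length zs + 1 = k \<Longrightarrow>
        cg (sigma k) (\<psi> (ys @ dE u # zs)) (- (X (length ys) \<bullet> \<psi> (ys @ u # zs)))"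
    and "length ys + length zs + 1 = k \<Longrightarrow> k \<le> t \<Longrightarrow>
        cg (sigma k) (\<psi> (ys @ scE a u # zs))
          (SM.Sop t (const_mpoly a) (sub (tshift (length ys) (X t)) (\<psi> (ys @ u # zs))))"
    and "length ys + length zs + 2 = k \<Longrightarrow>
        cg (sigma k) (\<psi> (ys @ u # v # zs))
          (- sub (\<lambda>j. X (transpose (length ys) (Suc (length ys)) j)) (\<psi> (ys @ v # u # zs)))"
  using assms unfolding precochain_def by blast+

text \<open>\<open>pt \<psi> [(p\<^sub>1, U\<^sub>1), \<dots>, (p\<^sub>k, U\<^sub>k)]\<close> is \<open>\<psi>\<^bsub>p1, \<dots>, pk\<^esub>(U\<^sub>1, \<dots>, U\<^sub>k)\<close>.\<close>

definition pt :: "('e list \<Rightarrow> 'm mpoly) \<Rightarrow> (int mpoly \<times> 'e mpoly) list \<Rightarrow> 'm mpoly" where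
  "pt \<psi> xs = ext (\<lambda>us. sub ((!) (map fst xs)) (\<psi> us)) (map snd xs)"

lemma pt_wrong_length:
  assumes "precochain k \<psi>" "length xs \<noteq> k"
  shows "pt \<psi> xs = 0"
proof -
  have "pt \<psi> xs = ext (\<lambda>us. 0) (map snd xs)"
    unfolding pt_def using assms
    by (intro ext_cong) (simp add: precochainD(1)[OF assms(1)] add_map_zero[OF add_map_sub])
  then show ?thesis by simp
qed

lemma pt_slot:
  "pt \<psi> (ys @ (p, U) # zs) = ext (\<lambda>us. lift (\<lambda>u. sub ((!) (map fst ys @ p # map fst zs))
     (\<psi> (take (length ys) us @ u # drop (length ys) us))) U) (map snd ys @ map snd zs)"
  by (simp add: pt_def ext_move)

lemma pt_slot2:
  "pt \<psi> (ys @ (p, U) # (q, V) # zs) =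
    ext (\<lambda>us. lift (\<lambda>v. lift (\<lambda>u. sub ((!) (map fst ys @ p # q # map fst zs))
     (\<psi> (take (length ys) us @ u # v # drop (length ys) us))) U) V) (map snd ys @ map snd zs)"
  by (simp add: pt_def ext_move2)

lemma cg_sub_nth: "cg (sigma k) v w \<Longrightarrow> length ps = k \<Longrightarrow> cg (sum_list ps) (sub ((!) ps) v) (sub ((!) ps) w)"
  using cg_sub[of "sigma k" v w "(!) ps"] by (simp add: sub_sigma_nth)

lemma slot_additiveD:
  "slot_additive s n g \<Longrightarrow> length ys + length zs + 1 = n \<Longrightarrow>
    cg s (g (ys @ (u + v) # zs)) (g (ys @ u # zs) + g (ys @ v # zs))"
  by (simp add: slot_additive_def)

lemma precochain_nadd:
  assumes "precochain k \<psi>" "length us + length vs + 1 = k" "length ps = k"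
  shows "nadd (sum_list ps) (\<lambda>u. sub ((!) ps) (\<psi> (us @ u # vs)))"
  unfolding nadd_def sub_add[symmetric]
  by (intro allI cg_sub_nth[OF slot_additiveD[OF precochainD(3)[OF assms(1)] assms(2)] assms(3)])

lemma precochain_slot_additive_sub:
  assumes "precochain k \<psi>" "length ps = k"
  shows "slot_additive (sum_list ps) k (\<lambda>us. sub ((!) ps) (\<psi> us))"
  unfolding slot_additive_def sub_add[symmetric]
  by (intro allI impI cg_sub_nth[OF slot_additiveD[OF precochainD(3)[OF assms(1)]] assms(2)])

lemma pt_slot_linear:
  assumes "precochain k \<psi>"
  shows "slot_linear 0 (pt \<psi>)"
  unfolding slot_linear_def
proof (intro allI)
  fix ys zs and p r :: "int mpoly" and U V :: "'e mpoly"
  show "pt \<psi> (ys @ (p, r \<bullet> U + V) # zs) - r \<bullet> pt \<psi> (ys @ (p, U) # zs) - pt \<psi> (ys @ (p, V) # zs)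
      \<in> N (0 + p + CE.wts ys + CE.wts zs)"
  proof (cases "length ys + length zs + 1 = k")
    case False
    then show ?thesis by (simp add: pt_wrong_length[OF assms] N_zero)
  next
    case True
    let ?ps = "map fst ys @ p # map fst zs"
    let ?f = "\<lambda>us u. sub ((!) ?ps) (\<psi> (take (length ys) us @ u # drop (length ys) us))"
    let ?s = "sum_list ?ps"
    have "pt \<psi> (ys @ (p, r \<bullet> U + V) # zs) - r \<bullet> pt \<psi> (ys @ (p, U) # zs) - pt \<psi> (ys @ (p, V) # zs)
      = ext (\<lambda>us. lift (?f us) (r \<bullet> U + V) - r \<bullet> lift (?f us) U - lift (?f us) V) (map snd ys @ map snd zs)"
      by (simp add: pt_slot ext_fun_diff ext_fun_ract)
    also have "cg ?s \<dots> (ext (\<lambda>us. 0) (map snd ys @ map snd zs))"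
    proof (rule ext_cg)
      fix us :: "'e list" assume us: "length us = length (map snd ys @ map snd zs)"
      have f: "nadd ?s (?f us)"
        by (rule precochain_nadd[OF assms]) (use us True in auto)
      have "cg ?s (lift (?f us) (r \<bullet> U + V)) (lift (?f us) (r \<bullet> U) + lift (?f us) V)"
        by (rule lift_cg_add[OF f])
      also have "cg ?s \<dots> (r \<bullet> lift (?f us) U + lift (?f us) V)"
        by (intro cg_add lift_cg_ract[OF f] cg_refl)
      finally show "cg ?s (lift (?f us) (r \<bullet> U + V) - r \<bullet> lift (?f us) U - lift (?f us) V) 0"
        by (simp add: cg_def algebra_simps)
    qed
    finally show ?thesis by (simp add: cg_def ac_simps)
  qed
qed

lemma pt_kills:
  assumes "precochain k \<psi>"
  shows "kills 0 (pt \<psi>)"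
  unfolding kills_def
proof (intro allI)
  fix ys zs and p :: "int mpoly" and U :: "'e mpoly"
  show "pt \<psi> (ys @ (p, p \<bullet> U + mmap dE U) # zs) \<in> N (0 + p + CE.wts ys + CE.wts zs)"
  proof (cases "length ys + length zs + 1 = k")
    case False
    then show ?thesis by (simp add: pt_wrong_length[OF assms] N_zero)
  next
    case True
    let ?ps = "map fst ys @ p # map fst zs"
    let ?f = "\<lambda>us u. sub ((!) ?ps) (\<psi> (take (length ys) us @ u # drop (length ys) us))"
    let ?s = "sum_list ?ps"
    have "cg ?s (pt \<psi> (ys @ (p, p \<bullet> U + mmap dE U) # zs)) (ext (\<lambda>us. 0) (map snd ys @ map snd zs))"
      unfolding pt_slot
    proof (rule ext_cg)
      fix us :: "'e list" assume us: "length us = length (map snd ys @ map snd zs)"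
      have f: "nadd ?s (?f us)"
        by (rule precochain_nadd[OF assms]) (use us True in auto)
      have d: "cg ?s (?f us (dE u)) (- (p \<bullet> ?f us u))" for u
      proof -
        have "cg ?s (?f us (dE u)) (sub ((!) ?ps) (- (X (length ys) \<bullet> \<psi> (take (length ys) us @ u # drop (length ys) us))))"
          using precochainD(4)[OF assms, of "take (length ys) us" "drop (length ys) us" u] us True
          by (intro cg_sub_nth) simp_all
        then show ?thesis by (simp add: sub_uminus sub_ract nth_append)
      qed
      have "cg ?s (lift (?f us) (mmap dE U)) (- (p \<bullet> lift (?f us) U))"
      proof (induction U rule: mpoly_induct)
        case (const u)
        have "cg ?s (lift (?f us) (const_mpoly (dE u))) (?f us (dE u))"
          by (rule lift_cg_const[OF f])
        also note d
        also have "cg ?s (- (p \<bullet> ?f us u)) (- (p \<bullet> lift (?f us) (const_mpoly u)))"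
          by (intro cg_uminus cg_ract cg_sym[OF lift_cg_const[OF f]])
        finally show ?case by (simp add: add_map_zero[OF add_map_dE])
      next
        case (mul r U)
        have "cg ?s (lift (?f us) (r \<bullet> mmap dE U)) (r \<bullet> lift (?f us) (mmap dE U))"
          by (rule lift_cg_ract[OF f])
        also have "cg ?s \<dots> (r \<bullet> - (p \<bullet> lift (?f us) U))"
          by (rule cg_ract[OF mul])
        also have "\<dots> = - (p \<bullet> r \<bullet> lift (?f us) U)"
          by (simp add: ract_uminus_right ract_commute[of r])
        also have "cg ?s \<dots> (- (p \<bullet> lift (?f us) (r \<bullet> U)))"
          by (intro cg_uminus cg_ract cg_sym[OF lift_cg_ract[OF f]])
        finally show ?case by (simp add: mmap_ract[OF add_map_dE])
      next
        case (add U V)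
        have "cg ?s (lift (?f us) (mmap dE U + mmap dE V)) (lift (?f us) (mmap dE U) + lift (?f us) (mmap dE V))"
          by (rule lift_cg_add[OF f])
        also have "cg ?s \<dots> (- (p \<bullet> lift (?f us) U) + - (p \<bullet> lift (?f us) V))"
          by (rule cg_add[OF add])
        also have "\<dots> = - (p \<bullet> (lift (?f us) U + lift (?f us) V))"
          by (simp add: ract_add_right)
        also have "cg ?s \<dots> (- (p \<bullet> lift (?f us) (U + V)))"
          by (intro cg_uminus cg_ract cg_sym[OF lift_cg_add[OF f]])
        finally show ?case by (simp add: mmap_add[OF add_map_dE])
      qed
      from cg_add[OF lift_cg_ract[OF f] this, of p U]
      have "cg ?s (lift (?f us) (p \<bullet> U) + lift (?f us) (mmap dE U)) 0"
        by simp
      then show "cg ?s (lift (?f us) (p \<bullet> U + mmap dE U)) 0"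
        using cg_trans[OF lift_cg_add[OF f]] by blast
    qed
    then show ?thesis by (simp add: cg_def ac_simps)
  qed
qed

lemma pt_alternating:
  assumes "precochain k \<psi>"
  shows "CE.alternating 0 (pt \<psi>)"
  unfolding CE.alternating_def
proof (intro allI)
  fix ys zs and x y :: "int mpoly \<times> 'e mpoly"
  obtain p U q V where xy: "x = (p, U)" "y = (q, V)" by (cases x, cases y) auto
  show "pt \<psi> (ys @ x # y # zs) + pt \<psi> (ys @ y # x # zs) \<in> N (0 + CE.wts ys + fst x + fst y + CE.wts zs)"
  proof (cases "length ys + length zs + 2 = k")
    case False
    then show ?thesis by (simp add: pt_wrong_length[OF assms] N_zero)
  next
    case True
    let ?n = "length ys"
    let ?ps = "map fst ys @ p # q # map fst zs" and ?qs = "map fst ys @ q # p # map fst zs"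
    let ?L = "\<lambda>u v us. take ?n us @ u # v # drop ?n us"
    have "pt \<psi> (ys @ x # y # zs) + pt \<psi> (ys @ y # x # zs) =
      ext (\<lambda>us. lift (\<lambda>v. lift (\<lambda>u. sub ((!) ?ps) (\<psi> (?L u v us)) + sub ((!) ?qs) (\<psi> (?L v u us))) U) V)
        (map snd ys @ map snd zs)"
      by (simp add: xy pt_slot2 ext_fun_add lift_fun_add lift_swap[of _ V U])
    also have "cg (sum_list ?ps) \<dots> (ext (\<lambda>us. lift (\<lambda>v. lift (\<lambda>u. 0) U) V) (map snd ys @ map snd zs))"
    proof (intro ext_cg lift_cg)
      fix us :: "'e list" and u v :: 'e assume us: "length us = length (map snd ys @ map snd zs)"
      have len: "length (take ?n us) = ?n" "length (drop ?n us) = length zs"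
        using us by simp_all
      have "cg (sum_list ?ps) (sub ((!) ?ps) (\<psi> (?L u v us)))
          (sub ((!) ?ps) (- sub (\<lambda>j. X (transpose ?n (Suc ?n) j)) (\<psi> (?L v u us))))"
        using precochainD(6)[OF assms, of "take ?n us" "drop ?n us" u v, unfolded len] True
        by (intro cg_sub_nth) simp_all
      also have "\<dots> = - sub (\<lambda>j. ?ps ! transpose ?n (Suc ?n) j) (\<psi> (?L v u us))"
        by (simp add: sub_uminus sub_sub)
      also have "sub (\<lambda>j. ?ps ! transpose ?n (Suc ?n) j) (\<psi> (?L v u us)) = sub ((!) ?qs) (\<psi> (?L v u us))"
        by (rule sub_below[OF precochainD(2)[OF assms]])
          (auto simp: transpose_def nth_append nth_Cons split: nat.split)
      finally show "cg (sum_list ?ps) (sub ((!) ?ps) (\<psi> (?L u v us)) + sub ((!) ?qs) (\<psi> (?L v u us))) 0"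
        by (simp add: cg_def)
    qed
    finally show ?thesis by (simp add: cg_def xy ac_simps)
  qed
qed

lemma pt_sub:
  assumes "precochain k \<psi>"
  shows "sub h (pt \<psi> xs) - pt \<psi> (map (subL h) xs) \<in> N (CE.wts (map (subL h) xs))"
proof (cases "length xs = k")
  case False
  then show ?thesis by (simp add: pt_wrong_length[OF assms] N_zero add_map_zero[OF add_map_sub])
next
  case True
  let ?ps = "map fst xs"
  have "cg (sub h (sum_list ?ps)) (sub h (pt \<psi> xs))
      (ext (\<lambda>us. sub h (sub ((!) ?ps) (\<psi> us))) (map (sub h) (map snd xs)))"
    unfolding pt_def by (rule ext_cg_sub) (use True precochain_slot_additive_sub[OF assms] in auto)
  also have "(\<lambda>us. sub h (sub ((!) ?ps) (\<psi> us))) = (\<lambda>us. sub ((!) (map (sub h) ?ps)) (\<psi> us))"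
    using True by (intro ext sub_nth_below[OF precochainD(2)[OF assms]]) simp
  also have "ext \<dots> (map (sub h) (map snd xs)) = pt \<psi> (map (subL h) xs)"
    by (simp add: pt_def subL_def comp_def)
  also have "sub h (sum_list ?ps) = CE.wts (map (subL h) xs)"
    by (induction xs) (simp_all add: add_map_zero[OF add_map_sub] sub_add subL_def)
  finally show ?thesis by (simp add: cg_def)
qed

lemma pt_natural_in: "precochain k \<psi> \<Longrightarrow> natural_in t 0 (pt \<psi>)"
  unfolding natural_in_def add_0 using pt_sub by blast

lemma pt_free_valued:
  assumes "precochain k \<psi>"
  shows "free_valued t (pt \<psi>)"
  unfolding free_valued_def
proof (intro allI impI)
  fix xs :: "(int mpoly \<times> 'e mpoly) list" assume xs: "set xs \<subseteq> free_pts t"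
  show "tfree t (pt \<psi> xs)"
  proof (cases "length xs = k")
    case True
    show ?thesis
      unfolding pt_def
    proof (rule tfree_ext)
      show "tfree t (sub ((!) (map fst xs)) (\<psi> us))" for us
        by (rule tfree_sub_below[OF precochainD(2)[OF assms]])
          (use xs True nth_mem[of _ xs] in \<open>fastforce simp: free_pts_def\<close>)
    qed (use xs in \<open>auto simp: free_pts_def\<close>)
  qed (simp add: pt_wrong_length[OF assms])
qed

lemma pt_twist_rule:
  assumes "precochain k \<psi>" "k \<le> t"
  shows "twist_rule t 0 (pt \<psi>)"
  unfolding twist_rule_def
proof (intro allI impI)
  fix ys zs and p :: "int mpoly" and U :: "'e mpoly" and \<alpha> :: "'a mpoly"
  assume ys: "set ys \<subseteq> free_pts t" and zs: "set zs \<subseteq> free_pts t"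
    and p: "tfree t p" and U: "tfree t U" and \<alpha>: "tfree t \<alpha>"
  show "pt \<psi> (ys @ (p, SE.amul \<alpha> U) # zs) - SM.Sop t \<alpha> (pt \<psi> (ys @ (p + X t, U) # zs))
      \<in> N (0 + p + CE.wts ys + CE.wts zs)"
  proof (cases "length ys + length zs + 1 = k")
    case False
    then show ?thesis
      by (simp add: pt_wrong_length[OF assms(1)] N_zero add_map_zero[OF SM.add_map_Sop])
  next
    case True
    let ?n = "length ys"
    let ?ps = "map fst ys @ p # map fst zs" and ?qs = "map fst ys @ (p + X t) # map fst zs"
    let ?s = "sum_list ?ps"
    let ?f = "\<lambda>us u. sub ((!) ?ps) (\<psi> (take ?n us @ u # drop ?n us))"
    let ?g = "\<lambda>us u. sub ((!) ?qs) (\<psi> (take ?n us @ u # drop ?n us))"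
    have s: "tfree t ?s"
      using tfree_add[OF tfree_wts[OF ys] tfree_add[OF p tfree_wts[OF zs]]] by simp
    have qs: "sum_list ?qs = ?s + X t"
      by (simp add: ac_simps)
    have ps: "tfree t (?ps ! j)" if "j < k" for j
    proof -
      have "?ps ! j \<in> set ?ps" using that True by (intro nth_mem) simp
      then show ?thesis using ys zs p by (auto simp: free_pts_def)
    qed
    have "SM.Sop t \<alpha> (pt \<psi> (ys @ (p + X t, U) # zs)) =
        ext (\<lambda>us. SM.Sop t \<alpha> (lift (?g us) U)) (map snd ys @ map snd zs)"
      unfolding pt_slot
    proof (rule ext_fun_op[symmetric, OF SM.add_map_Sop])
      fix V m and w :: "'m mpoly"
      assume "V \<in> set (map snd ys @ map snd zs)" "m \<in> Poly_Mapping.keys V"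
      then have "Poly_Mapping.lookup m t = 0"
        using ys zs by (auto simp: free_pts_def tfree_def)
      then show "SM.Sop t \<alpha> (Poly_Mapping.single m 1 \<bullet> w) = Poly_Mapping.single m 1 \<bullet> SM.Sop t \<alpha> w"
        by (intro SM.Sop_ract_right tfree_single)
    qed
    moreover have "cg ?s (pt \<psi> (ys @ (p, SE.amul \<alpha> U) # zs)) (ext (\<lambda>us. SM.Sop t \<alpha> (lift (?g us) U)) (map snd ys @ map snd zs))"
      unfolding pt_slot
    proof (rule ext_cg)
      fix us :: "'e list" assume us: "length us = length (map snd ys @ map snd zs)"
      have f: "nadd ?s (?f us)"
        by (rule precochain_nadd[OF assms(1)]) (use us True in auto)
      have g: "nadd (?s + X t) (?g us)"
        unfolding qs[symmetric] by (rule precochain_nadd[OF assms(1)]) (use us True in auto)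
      have len: "length (take ?n us) = ?n" "length (drop ?n us) = length zs"
        using us by simp_all
      have base: "cg ?s (?f us (scE a u)) (SM.Sop t (const_mpoly a) (?g us u))" for a u
      proof -
        \<comment> \<open>The degrees are substituted for the first k variables and all others are
          kept, so that lambda_t survives under \<open>Sop t\<close>; beyond the length of
          \<open>?ps\<close> the entry \<open>?ps ! j\<close> would be unspecified.\<close>
        define h where "h = (\<lambda>j. if j < k then ?ps ! j else X j)"
        let ?w = "\<psi> (take ?n us @ u # drop ?n us)"
        have h_sigma: "sub h (sigma k) = ?s"
          using True sub_sigma_nth[of ?ps k] by (simp add: sub_sigma h_def)
        have "cg ?s (sub h (\<psi> (take ?n us @ scE a u # drop ?n us)))
            (sub h (SM.Sop t (const_mpoly a) (sub (tshift ?n (X t)) ?w)))"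
          unfolding h_sigma[symmetric]
          using precochainD(5)[OF assms(1), of "take ?n us" "drop ?n us" t a u, unfolded len] True assms(2)
          by (intro cg_sub) simp
        also have "sub h (\<psi> (take ?n us @ scE a u # drop ?n us)) = ?f us (scE a u)"
          by (rule sub_below[OF precochainD(2)[OF assms(1)]]) (simp add: h_def)
        also have "sub h (SM.Sop t (const_mpoly a) (sub (tshift ?n (X t)) ?w))
            = SM.Sop t (const_mpoly a) (sub h (sub (tshift ?n (X t)) ?w))"
          using ps assms(2) tfree_X by (subst SM.sub_Sop) (auto simp: h_def)
        also have "sub h (sub (tshift ?n (X t)) ?w) = ?g us u"
          unfolding sub_sub
        proof (rule sub_below[OF precochainD(2)[OF assms(1)]])
          fix j assume "j < k"
          then show "sub h (tshift ?n (X t) j) = ?qs ! j"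
            using True assms(2) by (auto simp: tshift_def h_def sub_add nth_append nth_Cons split: nat.split)
        qed
        finally show ?thesis .
      qed
      from \<alpha> show "cg ?s (lift (?f us) (SE.amul \<alpha> U)) (SM.Sop t \<alpha> (lift (?g us) U))"
      proof (induction rule: tfree_induct)
        case (const a)
        from U show ?case
        proof (induction rule: tfree_induct)
          case (const u)
          have "cg ?s (lift (?f us) (const_mpoly (scE a u))) (?f us (scE a u))"
            by (rule lift_cg_const[OF f])
          also note base
          also have "cg ?s (SM.Sop t (const_mpoly a) (?g us u)) (SM.Sop t (const_mpoly a) (lift (?g us) (const_mpoly u)))"
            by (rule cg_Sop[OF cg_sym[OF lift_cg_const[OF g]] s])
          finally show ?case by (simp add: SE.amul_const)
        next
          case (mul r U)
          let ?A = "const_mpoly a"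
          have "cg ?s (lift (?f us) (r \<bullet> SE.amul ?A U)) (r \<bullet> lift (?f us) (SE.amul ?A U))"
            by (rule lift_cg_ract[OF f])
          also have "cg ?s \<dots> (r \<bullet> SM.Sop t ?A (lift (?g us) U))"
            by (rule cg_ract[OF mul(2)])
          also have "\<dots> = SM.Sop t ?A (r \<bullet> lift (?g us) U)"
            by (simp add: SM.Sop_ract_right[OF mul(1)])
          also have "cg ?s \<dots> (SM.Sop t ?A (lift (?g us) (r \<bullet> U)))"
            by (rule cg_Sop[OF cg_sym[OF lift_cg_ract[OF g]] s])
          finally show ?case by (simp add: SE.amul_ract_right)
        next
          case (add U V)
          let ?A = "const_mpoly a"
          have "cg ?s (lift (?f us) (SE.amul ?A U + SE.amul ?A V)) (lift (?f us) (SE.amul ?A U) + lift (?f us) (SE.amul ?A V))"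
            by (rule lift_cg_add[OF f])
          also have "cg ?s \<dots> (SM.Sop t ?A (lift (?g us) U) + SM.Sop t ?A (lift (?g us) V))"
            by (rule cg_add[OF add])
          also have "\<dots> = SM.Sop t ?A (lift (?g us) U + lift (?g us) V)"
            by (simp add: SM.Sop_add_right)
          also have "cg ?s \<dots> (SM.Sop t ?A (lift (?g us) (U + V)))"
            by (rule cg_Sop[OF cg_sym[OF lift_cg_add[OF g]] s])
          finally show ?case by (simp add: SE.amul_add_right)
        qed
      next
        case (mul r \<alpha>)
        show ?case
          using cg_trans[OF lift_cg_ract[OF f] cg_ract[OF mul(2)]]
          by (simp add: SE.amul_ract_left SM.Sop_ract_left)
      next
        case (add \<alpha> \<beta>)
        show ?case
          using cg_trans[OF lift_cg_add[OF f] cg_add[OF add]]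
          by (simp add: SE.amul_add_left SM.Sop_add_left)
      qed
    qed
    ultimately show ?thesis by (simp add: cg_def ac_simps)
  qed
qed

lemma pt_const:
  assumes "precochain k \<psi>" "length ps = length us"
  shows "cg (sum_list ps) (pt \<psi> (zip ps (map const_mpoly us))) (sub ((!) ps) (\<psi> us))"
proof (cases "length us = k")
  case True
  then show ?thesis
    using ext_cg_const[of "sum_list ps" us "\<lambda>us. sub ((!) ps) (\<psi> us)"] assms
      precochain_slot_additive_sub[OF assms(1), of ps]
    by (simp add: pt_def)
next
  case False
  then show ?thesis
    using assms by (simp add: pt_wrong_length[OF assms(1)] precochainD(1)[OF assms(1)] add_map_zero[OF add_map_sub])
qed

lemma pt_leibniz: "precochain k \<psi> \<Longrightarrow> CE.leibniz 0 (pt \<psi>)"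
  using slot_linear_leibniz pt_slot_linear by blast

lemma pt_skew_killing: "precochain k \<psi> \<Longrightarrow> CE.skew_killing 0 (pt \<psi>)"
  using slot_linear_skew_killing pt_slot_linear pt_kills by blast

text \<open>Linearity reduces one argument after the other to constants, starting with the last. In
  the induction zs holds the arguments already known to be constant.\<close>

lemma slot_linear_null:
  assumes "slot_linear 0 \<Phi>"
    and "\<And>ps us. length ps = length us \<Longrightarrow> \<Phi> (zip ps (map const_mpoly us)) \<in> N (sum_list ps)"
  shows "CE.null 0 \<Phi>"
proof -
  let ?C = "\<lambda>xs. \<forall>x\<in>set xs. \<exists>u. snd x = const_mpoly u"
  have "\<Phi> (ys @ zs) \<in> N (CE.wts (ys @ zs))" if "?C zs" for ys zs
    using that
  proof (induction ys arbitrary: zs rule: rev_induct)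
    case Nil
    have "\<exists>us. length us = length xs \<and> xs = zip (map fst xs) (map const_mpoly us)" if "?C xs" for xs
      using that
    proof (induction xs)
      case (Cons x xs)
      then obtain us u where "length us = length xs" "xs = zip (map fst xs) (map const_mpoly us)"
        "snd x = const_mpoly u" by auto
      then show ?case by (intro exI[of _ "u # us"]) (auto simp: prod_eq_iff)
    qed simp
    from this[OF Nil] obtain us where us: "length us = length zs" "zs = zip (map fst zs) (map const_mpoly us)"
      by blast
    then show ?case using assms(2)[of "map fst zs" us] by simp
  next
    case (snoc x ys)
    obtain p U where x: "x = (p, U)" by force
    let ?s = "0 + p + CE.wts ys + CE.wts zs"
    have "\<Phi> (ys @ (p, U) # zs) \<in> N ?s"
    proof (induction U rule: mpoly_induct)
      case (const u)
      show ?case using snoc.IH[of "(p, const_mpoly u) # zs"] snoc.prems by (auto simp: ac_simps)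
    next
      case (mul r U)
      \<comment> \<open>The rule with V = 0 leaves the value at 0 over, as \<Phi> is additive only
        modulo N. Since 0 is a constant, the induction hypothesis covers it.\<close>
      have 0: "\<Phi> (ys @ (p, 0) # zs) \<in> N ?s"
      proof -
        have "\<exists>u :: 'e. (0 :: 'e mpoly) = const_mpoly u" by (rule exI[of _ 0]) simp
        then show ?thesis using snoc.IH[of "(p, 0) # zs"] snoc.prems by (auto simp: ac_simps)
      qed
      show ?case
        by (rule CE.N_eq[OF N_add[OF N_add[OF slot_linearD[OF assms(1), of ys p r U 0 zs] N_ract[OF mul, of r]] 0]
              _ refl]) simp
    next
      case (add U V)
      show ?case
        by (rule CE.N_eq[OF N_add[OF N_add[OF slot_linear_add[OF assms(1), of ys p U V zs] add(1)] add(2)]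
              _ refl]) simp
    qed
    then show ?case by (simp add: x ac_simps)
  qed
  from this[of "[]"] show ?thesis by (simp add: CE.null_def)
qed

end

section \<open>The differential\<close>

lemma nths_zip: "length xs = length ys \<Longrightarrow> nths (zip xs ys) S = zip (nths xs S) (nths ys S)"
  by (induction xs ys arbitrary: S rule: list_induct2) (simp_all add: nths_Cons)

lemma length_nths_Compl:
  "i < length xs \<Longrightarrow> length (nths xs (- {i})) = length xs - 1"
  "i < j \<Longrightarrow> j < length xs \<Longrightarrow> length (nths xs (- {i, j})) = length xs - 2"
proof -
  show "length (nths xs (- {i})) = length xs - 1" if "i < length xs"
    using that by (simp add: nths_Compl_singleton)
  show "length (nths xs (- {i, j})) = length xs - 2" if "i < j" "j < length xs"
  proof -
    have "{l. l < length xs \<and> l \<in> - {i, j}} = {..<length xs} - {i, j}" by auto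
    then show ?thesis using that by (simp add: length_nths card_Diff_subset)
  qed
qed

lemma vars_below: "below k q \<Longrightarrow> vars q \<subseteq> {..<k}"
  by (auto simp: vars_def tfree_def in_keys_iff) (metis not_le in_keys_iff neq0_conv)

lemma subst_mpoly_map_ract:
  "below (length ps) q \<Longrightarrow> subst_mpoly (map ract ps) q = sub ((!) ps) q"
  using subst_mpoly_ract[OF vars_below] .

lemma subst_mpoly_zero [simp]: "subst_mpoly Ts 0 = 0"
  by (simp add: subst_mpoly_def)

lemma lambda_apply_zero [simp]: "lambda_apply f T 0 = 0"
  by (simp add: lambda_apply_def)

lemma iterate_uminus_zero [simp]: "(uminus ^^ n) (0 :: 'v::ab_group_add) = 0"
  by (induction n) simp_all

lemma tfree_uminus: "tfree t q \<Longrightarrow> tfree t (- q)" for q :: "'v::ab_group_add mpoly"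
  by (simp add: tfree_def)

lemma tfree_iterate_uminus: "tfree t q \<Longrightarrow> tfree t ((uminus ^^ n) q)" for q :: "'v::ab_group_add mpoly"
  by (induction n) (simp_all add: tfree_uminus)

context lie_conformal_algebroid_module
begin

abbreviation "dform \<equiv> differential_formula br lact"

lemma dform_eq:
  assumes "\<And>us. below k (\<psi> us)" "length us = Suc k"
  shows "dform \<psi> us =
    (\<Sum>i<Suc k. (uminus ^^ i) (bev lact (X i) (const_mpoly (us ! i))
       (sub ((!) (nths (map X [0..<Suc k]) (- {i}))) (\<psi> (nths us (- {i})))))) +
    (\<Sum>(i, j)\<in>{(i, j). i < j \<and> j < Suc k}. (uminus ^^ (i + j))
       (\<Sum>n\<le>degree (br (us ! i) (us ! j)). X i ^ n \<bullet>
          sub ((!) ((X i + X j) # nths (map X [0..<Suc k]) (- {i, j})))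
            (\<psi> (coeff (br (us ! i) (us ! j)) n # nths us (- {i, j})))))"
proof -
  have lam: "map lam [0..<Suc k] = map (ract :: _ \<Rightarrow> 'm mpoly \<Rightarrow> _) (map X [0..<Suc k])"
    by (simp add: lam_eq_ract)
  have 1: "lambda_apply (lact (us ! i)) (lam i) (subst_mpoly (nths (map lam [0..<Suc k]) (- {i})) (\<psi> (nths us (- {i}))))
      = bev lact (X i) (const_mpoly (us ! i)) (sub ((!) (nths (map X [0..<Suc k]) (- {i}))) (\<psi> (nths us (- {i}))))"
    if "i < Suc k" for i
  proof -
    have "length (nths (map X [0..<Suc k]) (- {i})) = k"
      using that length_nths_Compl(1)[of i "map X [0..<Suc k]"] by simp
    then have "below (length (nths (map X [0..<Suc k]) (- {i}))) (\<psi> (nths us (- {i})))"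
      using assms(1) by (simp only:) blast
    then show ?thesis
      unfolding bev_const_left[OF biadd_lact] lam_eq_ract[of i] lam nths_map[of ract]
      by (simp only: subst_mpoly_map_ract)
  qed
  have 2: "subst_mpoly ((\<lambda>q. lam i q + lam j q) # nths (map lam [0..<Suc k]) (- {i, j})) (\<psi> vs)
      = sub ((!) ((X i + X j) # nths (map X [0..<Suc k]) (- {i, j}))) (\<psi> vs)"
    if "i < j" "j < Suc k" for i j vs
  proof -
    have "(\<lambda>q. lam i q + lam j q) # nths (map lam [0..<Suc k]) (- {i, j})
      = map (ract :: _ \<Rightarrow> 'm mpoly \<Rightarrow> _) ((X i + X j) # nths (map X [0..<Suc k]) (- {i, j}))"
      unfolding lam by (simp add: lam_plus_eq_ract nths_map del: upt_Suc)
    moreover have "length ((X i + X j) # nths (map X [0..<Suc k]) (- {i, j})) = k"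
      using that length_nths_Compl(2)[of i j "map X [0..<Suc k]"] by simp
    moreover from this have "below (length ((X i + X j) # nths (map X [0..<Suc k]) (- {i, j}))) (\<psi> vs)"
      using assms(1) by (simp only:) blast
    ultimately show ?thesis
      by (simp only: subst_mpoly_map_ract)
  qed
  have "(\<Sum>i<Suc k. (uminus ^^ i) (lambda_apply (lact (us ! i)) (lam i)
        (subst_mpoly (nths (map lam [0..<Suc k]) (- {i})) (\<psi> (nths us (- {i})))))) =
      (\<Sum>i<Suc k. (uminus ^^ i) (bev lact (X i) (const_mpoly (us ! i))
       (sub ((!) (nths (map X [0..<Suc k]) (- {i}))) (\<psi> (nths us (- {i}))))))"
    by (rule sum.cong[OF refl], subst 1) simp_all
  moreover have "(\<Sum>(i, j)\<in>{(i, j). i < j \<and> j < Suc k}. (uminus ^^ (i + j))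
      (\<Sum>n\<le>degree (br (us ! i) (us ! j)). (lam i ^^ n)
        (subst_mpoly ((\<lambda>q. lam i q + lam j q) # nths (map lam [0..<Suc k]) (- {i, j}))
          (\<psi> (coeff (br (us ! i) (us ! j)) n # nths us (- {i, j})))))) =
    (\<Sum>(i, j)\<in>{(i, j). i < j \<and> j < Suc k}. (uminus ^^ (i + j))
      (\<Sum>n\<le>degree (br (us ! i) (us ! j)). X i ^ n \<bullet>
          sub ((!) ((X i + X j) # nths (map X [0..<Suc k]) (- {i, j})))
            (\<psi> (coeff (br (us ! i) (us ! j)) n # nths us (- {i, j})))))"
  proof (rule sum.cong[OF refl], clarify)
    fix i j assume "i < j" "j < Suc k"
    then show "(uminus ^^ (i + j)) (\<Sum>n\<le>degree (br (us ! i) (us ! j)). (lam i ^^ n)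
        (subst_mpoly ((\<lambda>q. lam i q + lam j q) # nths (map lam [0..<Suc k]) (- {i, j}))
          (\<psi> (coeff (br (us ! i) (us ! j)) n # nths us (- {i, j}))))) =
      (uminus ^^ (i + j)) (\<Sum>n\<le>degree (br (us ! i) (us ! j)). X i ^ n \<bullet>
          sub ((!) ((X i + X j) # nths (map X [0..<Suc k]) (- {i, j})))
            (\<psi> (coeff (br (us ! i) (us ! j)) n # nths us (- {i, j}))))"
      unfolding lam_eq_ract[of i, symmetric]
      by (simp only: 2) (simp only: lam_eq_ract ract_power)
  qed
  ultimately show ?thesis
    unfolding differential_formula_def Let_def assms(2) by (simp only:)
qed

lemma dform_length:
  assumes "\<And>us. length us \<noteq> k \<Longrightarrow> \<psi> us = 0" "length us \<noteq> Suc k"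
  shows "dform \<psi> us = 0"
proof -
  have "\<psi> (nths us (- {i})) = 0" if "i < length us" for i
    using that assms(2) by (intro assms(1)) (simp add: length_nths_Compl)
  moreover have "\<psi> (c # nths us (- {i, j})) = 0" if "i < j" "j < length us" for c i j
    using that assms(2) by (intro assms(1)) (simp add: length_nths_Compl)
  moreover have "(lam i ^^ n) (0 :: 'm mpoly) = 0" for i n
    by (simp add: lam_eq_ract ract_power)
  ultimately show ?thesis
    by (auto simp: differential_formula_def Let_def case_prod_unfold intro!: sum.neutral)
qed

lemma tfree_nths_X:
  assumes "Suc k \<le> t" "i < length (nths (map X [0..<Suc k]) S)"
  shows "tfree t (nths (map X [0..<Suc k]) S ! i)"
proof -
  have "nths (map X [0..<Suc k]) S ! i \<in> X ` {..<Suc k}"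
    using nth_mem[OF assms(2)] notin_set_nthsI[of _ "map X [0..<Suc k]" S] by fastforce
  then obtain x where "nths (map X [0..<Suc k]) S ! i = X x" "x < Suc k"
    by blast
  then show ?thesis using assms(1) by (simp only: tfree_X)
qed

lemma below_dform:
  assumes "\<And>us. length us \<noteq> k \<Longrightarrow> \<psi> us = 0" "\<And>us. below k (\<psi> us)"
  shows "below (Suc k) (dform \<psi> us)"
proof (cases "length us = Suc k")
  case True
  show ?thesis
  proof (intro allI impI)
    fix t assume t: "Suc k \<le> t"
    let ?P = "map X [0..<Suc k]"
    have 1: "tfree t (bev lact (X i) (const_mpoly (us ! i)) (sub ((!) (nths ?P (- {i}))) (\<psi> vs)))"
      if "i < Suc k" for i vs
      using that t length_nths_Compl(1)[of i ?P]
      by (intro tfree_bev biadd_lact tfree_X tfree_const tfree_sub_below[OF assms(2)] tfree_nths_X) auto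
    have 2: "tfree t (X i ^ n \<bullet> sub ((!) ((X i + X j) # nths ?P (- {i, j}))) (\<psi> vs))"
      if "i < j" "j < Suc k" for i j n vs
    proof (intro tfree_ract tfree_power tfree_X tfree_sub_below[OF assms(2)])
      fix l assume "l < k"
      then show "tfree t (((X i + X j) # nths ?P (- {i, j})) ! l)"
        using that t length_nths_Compl(2)[of i j ?P]
        by (cases l) (auto intro!: tfree_add tfree_X tfree_nths_X simp del: upt_Suc)
    qed (use that t in auto)
    show "tfree t (dform \<psi> us)"
      unfolding dform_eq[OF assms(2) True]
      by (intro tfree_add tfree_sum) (auto intro!: tfree_iterate_uminus tfree_sum 1 2 simp del: upt_Suc)
  qed
qed (simp add: dform_length[OF assms(1)])

end

section \<open>The differential at universal points\<close>

context algebroid_cochains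
begin

text \<open>The universal point over us: every point with the same constant arguments arises from it
  by a substitution (\<open>subL_univ\<close>), so identities at arbitrary degrees follow from those
  at \<open>univ us\<close> by naturality.\<close>

definition univ :: "'e list \<Rightarrow> (int mpoly \<times> 'e mpoly) list" where
  "univ us = zip (map X [0..<length us]) (map const_mpoly us)"

lemma sum_list_X: "sum_list (map X [0..<k]) = sigma k"
  by (simp add: sigma_def interv_sum_list_conv_sum_set_nat atLeast0LessThan)

lemma univ_simps: "length (univ us) = length us" "map fst (univ us) = map X [0..<length us]"
  "CE.wts (univ us) = sigma (length us)"
  "i < length us \<Longrightarrow> univ us ! i = (X i, const_mpoly (us ! i))"
  by (simp_all add: univ_def sum_list_X)

lemma cg_actU: "cg s v w \<Longrightarrow> cg (p + s) (actU p U v) (actU p U w)"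
  unfolding cg_def using N_actU[of "v - w" s p U] by (simp add: actU_diff)

lemma cg_iterate_uminus: "cg s v w \<Longrightarrow> cg s ((uminus ^^ n) v) ((uminus ^^ n) w)"
  by (induction n) (auto intro: cg_uminus)

lemma slot_linear_sum:
  assumes "slot_linear 0 \<Phi>" "finite I"
  shows "cg (p + CE.wts zs) (\<Phi> ((p, \<Sum>n\<in>I. r n \<bullet> U n) # zs)) (\<Sum>n\<in>I. r n \<bullet> \<Phi> ((p, U n) # zs))"
  using assms(2)
proof (induction I rule: finite_induct)
  case empty
  have "\<Phi> ([] @ (p, 0 + 0) # zs) - \<Phi> ([] @ (p, 0) # zs) - \<Phi> ([] @ (p, 0) # zs) \<in> N (0 + p + CE.wts [] + CE.wts zs)"
    by (rule slot_linear_add[OF assms(1)])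
  from N_uminus[OF this] show ?case by (simp add: cg_def)
next
  case (insert n I)
  have "cg (p + CE.wts zs) (\<Phi> ((p, r n \<bullet> U n + (\<Sum>n\<in>I. r n \<bullet> U n)) # zs))
      (r n \<bullet> \<Phi> ((p, U n) # zs) + \<Phi> ((p, \<Sum>n\<in>I. r n \<bullet> U n) # zs))"
    using slot_linearD[OF assms(1), of "[]" p "r n" "U n" "\<Sum>n\<in>I. r n \<bullet> U n" zs]
    by (simp add: cg_def algebra_simps)
  also have "cg (p + CE.wts zs) \<dots> (r n \<bullet> \<Phi> ((p, U n) # zs) + (\<Sum>n\<in>I. r n \<bullet> \<Phi> ((p, U n) # zs)))"
    by (intro cg_add cg_refl insert.IH)
  finally show ?case using insert.hyps by simp
qed

text \<open>At \<open>univ us\<close> the formula for the differential is \<open>explicit\<close>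
  for \<open>pt \<psi>\<close>; in the second sum, linearity in the first slot expands the bracket
  in powers of lambda_i.\<close>

lemma dform_dif:
  assumes "precochain k \<psi>" "length us = Suc k"
  shows "cg (sigma (Suc k)) (dform \<psi> us) (CE.dif (pt \<psi>) (univ us))"
proof -
  let ?P = "map X [0..<Suc k]" and ?s = "sigma (Suc k)"
  have len: "length (univ us) = Suc k" by (simp add: univ_simps assms(2))
  have nths_univ: "nths (univ us) S = zip (nths ?P S) (map const_mpoly (nths us S))" for S
    by (simp add: univ_def assms(2) nths_zip nths_map del: upt_Suc)
  have len_nths: "length (nths ?P S) = length (nths us S)" for S
    by (simp add: length_nths assms(2) del: upt_Suc)
  have 1: "cg ?s (bev lact (X i) (const_mpoly (us ! i)) (sub ((!) (nths ?P (- {i}))) (\<psi> (nths us (- {i})))))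
      (actL (univ us ! i) (pt \<psi> (nths (univ us) (- {i}))))" if "i < Suc k" for i
  proof -
    have s: "?s = X i + sum_list (nths ?P (- {i}))"
      using sum_list_nths(1)[of i ?P] that by (simp add: sum_list_X del: upt_Suc)
    show ?thesis
      unfolding s nths_univ using that assms(2)
      by (simp add: univ_simps actL_def actU_def[symmetric] del: upt_Suc)
        (intro cg_actU cg_sym[OF pt_const[OF assms(1) len_nths]])
  qed
  have 2: "cg ?s (\<Sum>n\<le>degree (br (us ! i) (us ! j)). X i ^ n \<bullet>
          sub ((!) ((X i + X j) # nths ?P (- {i, j}))) (\<psi> (coeff (br (us ! i) (us ! j)) n # nths us (- {i, j}))))
      (pt \<psi> (brL (univ us ! i) (univ us ! j) # nths (univ us) (- {i, j})))" if ij: "i < j" "j < Suc k" for i j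
  proof -
    let ?p = "X i + X j" and ?zs = "nths (univ us) (- {i, j})" and ?B = "br (us ! i) (us ! j)"
    have s: "?s = ?p + sum_list (nths ?P (- {i, j}))"
      using sum_list_nths(2)[of i j ?P] ij by (simp add: sum_list_X del: upt_Suc)
    have "CE.wts ?zs = sum_list (nths ?P (- {i, j}))"
      unfolding nths_univ by (simp add: len_nths del: upt_Suc)
    then have s': "?p + CE.wts ?zs = ?s" using s by simp
    have "brL (univ us ! i) (univ us ! j) = (?p, \<Sum>n\<le>degree ?B. X i ^ n \<bullet> const_mpoly (coeff ?B n))"
      using ij assms(2) by (simp add: univ_simps brL_def brU_def bev_const biadd_br pev_altdef[of _ "degree ?B"])
    then have "cg ?s (pt \<psi> (brL (univ us ! i) (univ us ! j) # ?zs))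
        (\<Sum>n\<le>degree ?B. X i ^ n \<bullet> pt \<psi> ((?p, const_mpoly (coeff ?B n)) # ?zs))"
      using slot_linear_sum[OF pt_slot_linear[OF assms(1)], of "{..degree ?B}" ?p ?zs "\<lambda>n. X i ^ n"
          "\<lambda>n. const_mpoly (coeff ?B n)"] by (simp add: s')
    also have "cg ?s \<dots> (\<Sum>n\<le>degree ?B. X i ^ n \<bullet>
        sub ((!) (?p # nths ?P (- {i, j}))) (\<psi> (coeff ?B n # nths us (- {i, j}))))"
    proof (intro cg_sum cg_ract)
      fix n
      show "cg ?s (pt \<psi> ((?p, const_mpoly (coeff ?B n)) # ?zs))
          (sub ((!) (?p # nths ?P (- {i, j}))) (\<psi> (coeff ?B n # nths us (- {i, j}))))"
        using pt_const[OF assms(1), of "?p # nths ?P (- {i, j})" "coeff ?B n # nths us (- {i, j})"]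
        by (simp add: s nths_univ len_nths del: upt_Suc)
    qed
    finally show ?thesis by (rule cg_sym)
  qed
  have "cg ?s (dform \<psi> us) (CE.explicit (pt \<psi>) (univ us))"
    unfolding dform_eq[OF precochainD(2)[OF assms(1)] assms(2)] CE.explicit_def len
    by (intro cg_add cg_sum) (auto intro!: cg_iterate_uminus 1 2 simp del: upt_Suc)
  moreover have "cg ?s (CE.dif (pt \<psi>) (univ us)) (CE.explicit (pt \<psi>) (univ us))"
    using CE.dif_explicit[OF pt_alternating[OF assms(1)], of "univ us"] univ_simps(3)[of us]
    by (simp only: cg_def assms(2) add_0)
  ultimately show ?thesis using cg_trans cg_sym by blast
qed

lemma univ_append:
  "univ (ys @ zs) = univ ys @ zip (map X [length ys..<length ys + length zs]) (map const_mpoly zs)"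
  unfolding univ_def by (simp add: upt_add_eq_append[of 0])

lemma univ_slot:
  "univ (ys @ u # zs) = univ ys @ (X (length ys), const_mpoly u) #
     zip (map X [Suc (length ys)..<Suc (length ys + length zs)]) (map const_mpoly zs)"
  by (simp add: univ_append upt_conv_Cons del: upt_Suc)

lemma univ_slot2:
  "univ (ys @ u # v # zs) = univ ys @ (X (length ys), const_mpoly u) # (X (Suc (length ys)), const_mpoly v) #
     zip (map X [Suc (Suc (length ys))..<Suc (Suc (length ys + length zs))]) (map const_mpoly zs)"
  by (simp add: univ_append upt_conv_Cons del: upt_Suc)

lemma subL_univ:
  "length ps = length us \<Longrightarrow> (\<And>i. i < length us \<Longrightarrow> h i = ps ! i) \<Longrightarrow>
    map (subL h) (univ us) = zip ps (map const_mpoly us)"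
  by (rule nth_equalityI) (simp_all add: univ_simps subL_def)

lemma cg_kill: "v \<in> N s \<Longrightarrow> v - u - w \<in> N s \<Longrightarrow> cg s w (- u)"
  unfolding cg_def using CE.N_diff[of v s "v - u - w"] by (simp add: add.commute)

lemma zip_X_subL:
  "(\<And>i. i \<in> set is \<Longrightarrow> h i = X i) \<Longrightarrow>
    map (subL h) (zip (map X is) (map const_mpoly us)) = zip (map X is) (map const_mpoly us)"
proof (induction "is" arbitrary: us)
  case (Cons i "is")
  then show ?case by (cases us) (simp_all add: subL_def)
qed simp

lemma zip_X_free_pts:
  "t \<notin> set is \<Longrightarrow> set (zip (map X is) (map const_mpoly us)) \<subseteq> free_pts t"
proof (induction "is" arbitrary: us)
  case (Cons i "is")
  then show ?case by (cases us) (auto simp: free_pts_def tfree_X)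
qed simp

text \<open>Each condition is known for \<open>dif (pt \<psi>)\<close> at all points. Read at
  universal points it becomes, through \<open>dform_dif\<close>, the condition on
  \<open>dform \<psi>\<close>.\<close>

theorem precochain_dform:
  assumes \<psi>: "precochain k \<psi>"
  shows "precochain (Suc k) (dform \<psi>)"
proof -
  let ?\<Phi> = "CE.dif (pt \<psi>)" and ?s = "sigma (Suc k)"
  note alt = pt_alternating[OF \<psi>] and skew = pt_skew_killing[OF \<psi>]
  note lin = dif_slot_linear[OF pt_slot_linear[OF \<psi>] alt skew]
    and kill = dif_kills[OF pt_kills[OF \<psi>] alt skew]
  have dform: "cg ?s (dform \<psi> us) (?\<Phi> (univ us))" if "length us = Suc k" for us
    by (rule dform_dif[OF \<psi> that])
  have wts: "0 + X (length ys) + CE.wts (univ ys) +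
      CE.wts (zip (map X [Suc (length ys)..<Suc (length ys + length zs)]) (map const_mpoly zs)) = ?s"
    if "length ys + length zs + 1 = Suc k" for ys zs :: "'e list"
  proof -
    have "CE.wts (univ (ys @ undefined # zs)) = ?s"
      unfolding univ_simps(3) using that by simp
    then show ?thesis
      unfolding univ_slot by (simp only: map_append list.map sum_list.append sum_list.Cons fst_conv add_0 ac_simps)
  qed
  have nat: "cg (sub h ?s) (sub h (?\<Phi> (univ us))) (?\<Phi> (map (subL h) (univ us)))"
    if "length us = Suc k" for h us
  proof -
    have "CE.wts (map (subL h) xs) = sub h (CE.wts xs)" for xs
      by (induction xs) (simp_all add: add_map_zero[OF add_map_sub] sub_add subL_def)
    from this[of "univ us"] have "CE.wts (map (subL h) (univ us)) = sub h ?s"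
      using univ_simps(3)[of us] that by (simp only:)
    then show ?thesis
      using dif_subL[OF pt_sub[OF \<psi>], of h "univ us"] by (simp add: cg_def)
  qed
  have "slot_additive ?s (Suc k) (dform \<psi>)"
    unfolding slot_additive_def
  proof (intro allI impI)
    fix ys zs :: "'e list" and u v assume len: "length ys + length zs + 1 = Suc k"
    have "cg ?s (dform \<psi> (ys @ (u + v) # zs)) (?\<Phi> (univ (ys @ (u + v) # zs)))"
      by (rule dform) (use len in simp)
    also have "cg ?s \<dots> (?\<Phi> (univ (ys @ u # zs)) + ?\<Phi> (univ (ys @ v # zs)))"
      using slot_linear_add[OF lin, of "univ ys" "X (length ys)" "const_mpoly u" "const_mpoly v"
          "zip (map X [Suc (length ys)..<Suc (length ys + length zs)]) (map const_mpoly zs)"]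
      unfolding wts[OF len] univ_slot single_add cg_def diff_diff_eq .
    also have "cg ?s \<dots> (dform \<psi> (ys @ u # zs) + dform \<psi> (ys @ v # zs))"
      by (intro cg_add cg_sym[OF dform]) (use len in simp_all)
    finally show "cg ?s (dform \<psi> (ys @ (u + v) # zs)) (dform \<psi> (ys @ u # zs) + dform \<psi> (ys @ v # zs))" .
  qed
  moreover have "cg ?s (dform \<psi> (ys @ dE u # zs)) (- (X (length ys) \<bullet> dform \<psi> (ys @ u # zs)))"
    if len: "length ys + length zs + 1 = Suc k" for ys zs u
  proof -
    let ?Z = "zip (map X [Suc (length ys)..<Suc (length ys + length zs)]) (map const_mpoly zs)"
    let ?p = "X (length ys)" and ?U = "const_mpoly u"
    have dU: "mmap dE ?U = const_mpoly (dE u)"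
      by (simp add: add_map_zero[OF add_map_dE])
    have "?\<Phi> (univ ys @ (?p, ?p \<bullet> ?U + mmap dE ?U) # ?Z) \<in> N (0 + ?p + CE.wts (univ ys) + CE.wts ?Z)"
      using kill unfolding kills_def by blast
    from cg_kill[OF this slot_linearD[OF lin, of "univ ys" ?p ?p ?U "mmap dE ?U" ?Z]]
    have "cg ?s (?\<Phi> (univ (ys @ dE u # zs))) (- (?p \<bullet> ?\<Phi> (univ (ys @ u # zs))))"
      unfolding wts[OF len] univ_slot dU .
    from cg_trans[OF dform cg_trans[OF this cg_uminus[OF cg_ract[OF cg_sym[OF dform]]]]]
    show ?thesis using len by simp
  qed
  moreover have "cg ?s (dform \<psi> (ys @ scE a u # zs))
      (SM.Sop t (const_mpoly a) (sub (tshift (length ys) (X t)) (dform \<psi> (ys @ u # zs))))"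
    if len: "length ys + length zs + 1 = Suc k" and t: "Suc k \<le> t" for ys zs a u t
  proof -
    let ?Z = "zip (map X [Suc (length ys)..<Suc (length ys + length zs)]) (map const_mpoly zs)"
    let ?p = "X (length ys)" and ?U = "const_mpoly u" and ?A = "const_mpoly a"
    let ?h = "tshift (length ys) (X t)"
    have "twist_rule t 0 ?\<Phi>"
      using dif_twist_rule[of t 0 "pt \<psi>"] pt_twist_rule[OF \<psi>, of t] pt_natural_in[OF \<psi>] pt_free_valued[OF \<psi>]
        pt_slot_linear[OF \<psi>] alt skew t by simp
    moreover have Y: "set (univ ys) \<subseteq> free_pts t"
      unfolding univ_def by (rule zip_X_free_pts) (use len t in simp)
    moreover have Z: "set ?Z \<subseteq> free_pts t"
      by (rule zip_X_free_pts) (use len t in simp)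
    ultimately have "?\<Phi> (univ ys @ (?p, SE.amul ?A ?U) # ?Z) - SM.Sop t ?A (?\<Phi> (univ ys @ (?p + X t, ?U) # ?Z))
        \<in> N (0 + ?p + CE.wts (univ ys) + CE.wts ?Z)"
      using len t by (intro twist_ruleD) (auto intro: tfree_X)
    then have 1: "cg ?s (?\<Phi> (univ (ys @ scE a u # zs))) (SM.Sop t ?A (?\<Phi> (univ ys @ (?p + X t, ?U) # ?Z)))"
      unfolding wts[OF len] by (simp add: cg_def univ_slot SE.amul_const del: upt_Suc)
    \<comment> \<open>The degree lambda_i + lambda_t does not occur in a universal point, but the
      whole point is the shift of one. By naturality its value is the shifted value of
      \<open>dform \<psi>\<close>.\<close>
    have 2: "univ ys @ (?p + X t, ?U) # ?Z = map (subL ?h) (univ (ys @ u # zs))"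
    proof -
      have "map (subL ?h) (univ ys) = univ ys"
        unfolding univ_def by (rule zip_X_subL) (auto simp: tshift_def)
      moreover have "map (subL ?h) ?Z = ?Z"
        by (rule zip_X_subL) (auto simp: tshift_def)
      ultimately show ?thesis by (simp add: univ_slot subL_def tshift_same del: upt_Suc)
    qed
    have s: "sub ?h ?s = ?s + X t"
    proof -
      have "sub ?h ?s = (\<Sum>i<Suc k. X i + (if i = length ys then X t else 0))"
        unfolding sub_sigma by (intro sum.cong) (auto simp: tshift_def)
      also have "\<dots> = ?s + (\<Sum>i<Suc k. if i = length ys then X t else 0)"
        by (simp only: sum.distrib sigma_def)
      finally show ?thesis using len by simp
    qed
    have "cg (?s + X t) (?\<Phi> (map (subL ?h) (univ (ys @ u # zs)))) (sub ?h (dform \<psi> (ys @ u # zs)))"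
      unfolding s[symmetric]
      by (rule cg_sym[OF cg_trans[OF cg_sub[OF dform] nat]]) (use len in simp_all)
    moreover have "tfree t ?s"
      using t unfolding sigma_def by (intro tfree_sum tfree_X) auto
    ultimately have "cg ?s (SM.Sop t ?A (?\<Phi> (univ ys @ (?p + X t, ?U) # ?Z)))
        (SM.Sop t ?A (sub ?h (dform \<psi> (ys @ u # zs))))"
      unfolding 2 by (rule cg_Sop)
    from cg_trans[OF dform cg_trans[OF 1 this]] show ?thesis using len by simp
  qed
  moreover have "cg ?s (dform \<psi> (ys @ u # v # zs))
      (- sub (\<lambda>j. X (transpose (length ys) (Suc (length ys)) j)) (dform \<psi> (ys @ v # u # zs)))"
    if len: "length ys + length zs + 2 = Suc k" for ys zs u v
  proof -
    let ?n = "length ys"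
    let ?Z = "zip (map X [Suc (Suc ?n)..<Suc (Suc (?n + length zs))]) (map const_mpoly zs)"
    let ?h = "\<lambda>j. X (transpose ?n (Suc ?n) j)"
    have "?\<Phi> (univ ys @ (X ?n, const_mpoly u) # (X (Suc ?n), const_mpoly v) # ?Z)
        + ?\<Phi> (univ ys @ (X (Suc ?n), const_mpoly v) # (X ?n, const_mpoly u) # ?Z) \<in>
        N (0 + CE.wts (univ ys) + X ?n + X (Suc ?n) + CE.wts ?Z)"
      using CE.alternatingD[OF CE.dif_alternating[OF alt skew], of "univ ys" "(X ?n, const_mpoly u)"
          "(X (Suc ?n), const_mpoly v)" ?Z] by simp
    moreover have "0 + CE.wts (univ ys) + X ?n + X (Suc ?n) + CE.wts ?Z = ?s"
    proof -
      have "CE.wts (univ (ys @ u # v # zs)) = ?s"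
        unfolding univ_simps(3) using len by simp
      then show ?thesis
        unfolding univ_slot2
        by (simp only: map_append list.map sum_list.append sum_list.Cons fst_conv add_0 ac_simps)
    qed
    moreover have "univ ys @ (X (Suc ?n), const_mpoly v) # (X ?n, const_mpoly u) # ?Z
        = map (subL ?h) (univ (ys @ v # u # zs))"
    proof -
      have "map (subL ?h) (univ ys) = univ ys"
        unfolding univ_def by (rule zip_X_subL) (auto simp: transpose_def)
      moreover have "map (subL ?h) ?Z = ?Z"
        by (rule zip_X_subL) (auto simp: transpose_def)
      ultimately show ?thesis by (simp add: univ_slot2 subL_def del: upt_Suc)
    qed
    ultimately have 1: "cg ?s (?\<Phi> (univ (ys @ u # v # zs))) (- ?\<Phi> (map (subL ?h) (univ (ys @ v # u # zs))))"
      by (simp add: cg_def univ_slot2 del: upt_Suc)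
    have s: "sub ?h ?s = ?s"
    proof -
      have "transpose ?n (Suc ?n) permutes {..<Suc k}"
        using len by (intro permutes_swap_id) auto
      from sum.permute[OF this, of X] show ?thesis
        unfolding sub_sigma unfolding sigma_def comp_def by (rule sym)
    qed
    have "cg ?s (?\<Phi> (map (subL ?h) (univ (ys @ v # u # zs)))) (sub ?h (dform \<psi> (ys @ v # u # zs)))"
      using cg_sym[OF cg_trans[OF cg_sub[OF dform] nat], of "ys @ v # u # zs" ?h] len
      by (simp add: s)
    from cg_trans[OF dform cg_trans[OF 1 cg_uminus[OF this]]] show ?thesis using len by simp
  qed
  moreover have "dform \<psi> us = 0" if "length us \<noteq> Suc k" for us
    using dform_length[of k \<psi> us] precochainD(1)[OF \<psi>] that by blast
  moreover have "below (Suc k) (dform \<psi> us)" for us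
    using below_dform[of k \<psi> us] precochainD(1,2)[OF \<psi>] by blast
  ultimately show ?thesis
    unfolding precochain_def by blast
qed

text \<open>This makes the differential of a reduced cochain independent of the representatives:
  congruent precochains have congruent values at all points, and \<open>dif\<close> preserves null
  functions.\<close>

lemma dform_cong:
  assumes "precochain k \<psi>" "precochain k \<psi>'" "\<And>us. cg (sigma k) (\<psi> us) (\<psi>' us)" "length us = Suc k"
  shows "cg (sigma (Suc k)) (dform \<psi> us) (dform \<psi>' us)"
proof -
  have "CE.null 0 (\<lambda>xs. pt \<psi> xs - pt \<psi>' xs)"
    unfolding CE.null_def
  proof
    fix xs
    show "pt \<psi> xs - pt \<psi>' xs \<in> N (0 + CE.wts xs)"
    proof (cases "length xs = k")
      case True
      have "cg (sum_list (map fst xs)) (pt \<psi> xs) (pt \<psi>' xs)"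
        unfolding pt_def using assms(3) True by (intro ext_cg cg_sub_nth) simp_all
      then show ?thesis by (simp add: cg_def)
    qed (simp add: pt_wrong_length[OF assms(1)] pt_wrong_length[OF assms(2)] N_zero)
  qed
  from CE.nullD[OF CE.dif_null[OF this], of "univ us"]
  have "cg (sigma (Suc k)) (CE.dif (pt \<psi>) (univ us)) (CE.dif (pt \<psi>') (univ us))"
    using univ_simps(3)[of us] by (simp only: CE.dif_diff assms(4) cg_def add_0)
  then show ?thesis
    using dform_dif[OF assms(1,4)] dform_dif[OF assms(2,4)] cg_trans cg_sym by blast
qed

text \<open>The functions \<open>pt (dform \<psi>)\<close> and \<open>dif (pt \<psi>)\<close> agree
  modulo N at universal points, hence by naturality at constant arguments, hence by linearity
  everywhere. So the second differential may be computed as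
  \<open>dif (dif (pt \<psi>))\<close>.\<close>

theorem dform_dform:
  assumes \<psi>: "precochain k \<psi>" and "length us = Suc (Suc k)"
  shows "dform (dform \<psi>) us \<in> N (sigma (Suc (Suc k)))"
proof -
  let ?\<Phi> = "CE.dif (pt \<psi>)"
  note d\<psi> = precochain_dform[OF \<psi>]
  have lin: "slot_linear 0 ?\<Phi>"
    by (rule dif_slot_linear[OF pt_slot_linear[OF \<psi>] pt_alternating[OF \<psi>] pt_skew_killing[OF \<psi>]])
  have "CE.null 0 (\<lambda>xs. pt (dform \<psi>) xs - ?\<Phi> xs)"
  proof (rule slot_linear_null)
    show "slot_linear 0 (\<lambda>xs. pt (dform \<psi>) xs - ?\<Phi> xs)"
      unfolding slot_linear_def
    proof (intro allI)
      fix ys zs and p r :: "int mpoly" and U V :: "'e mpoly"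
      show "pt (dform \<psi>) (ys @ (p, r \<bullet> U + V) # zs) - ?\<Phi> (ys @ (p, r \<bullet> U + V) # zs)
        - r \<bullet> (pt (dform \<psi>) (ys @ (p, U) # zs) - ?\<Phi> (ys @ (p, U) # zs))
        - (pt (dform \<psi>) (ys @ (p, V) # zs) - ?\<Phi> (ys @ (p, V) # zs)) \<in> N (0 + p + CE.wts ys + CE.wts zs)"
        by (rule CE.N_eq[OF CE.N_diff[OF slot_linearD[OF pt_slot_linear[OF d\<psi>], of ys p r U V zs]
              slot_linearD[OF lin, of ys p r U V zs]] _ refl]) (simp add: ract_diff_right)
    qed
    fix ps :: "int mpoly list" and us :: "'e list" assume len: "length ps = length us"
    let ?xs = "zip ps (map const_mpoly us)"
    show "pt (dform \<psi>) ?xs - ?\<Phi> ?xs \<in> N (sum_list ps)"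
    proof (cases "length us = Suc k")
      case True
      have s: "sub ((!) ps) (sigma (Suc k)) = sum_list ps"
        using len True by (simp add: sub_sigma_nth)
      have m: "map (subL ((!) ps)) (univ us) = ?xs"
        by (rule subL_univ) (simp_all add: len)
      have w: "CE.wts ?xs = sum_list ps" by (simp add: len)
      have "cg (sum_list ps) (pt (dform \<psi>) ?xs) (sub ((!) ps) (dform \<psi> us))"
        by (rule pt_const[OF d\<psi> len])
      also have "cg (sum_list ps) \<dots> (sub ((!) ps) (?\<Phi> (univ us)))"
        unfolding s[symmetric] by (rule cg_sub[OF dform_dif[OF \<psi> True]])
      also have "cg (sum_list ps) \<dots> (?\<Phi> ?xs)"
        using dif_subL[OF pt_sub[OF \<psi>], of "(!) ps" "univ us"] unfolding m w by (simp add: cg_def)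
      finally show ?thesis by (simp add: cg_def)
    next
      case False
      have "?\<Phi> ?xs = 0"
        using False len by (intro CE.dif_length[of 0 k] pt_wrong_length[OF \<psi>]) simp_all
      then show ?thesis
        using False len by (simp add: pt_wrong_length[OF d\<psi>] N_zero)
    qed
  qed
  from CE.nullD[OF CE.dif_null[OF this], of "univ us"]
  have "cg (sigma (Suc (Suc k))) (CE.dif (pt (dform \<psi>)) (univ us)) (CE.dif ?\<Phi> (univ us))"
    using univ_simps(3)[of us] by (simp only: CE.dif_diff assms(2) cg_def add_0)
  from cg_trans[OF dform_dif[OF d\<psi> assms(2)] this]
  have "cg (sigma (Suc (Suc k))) (dform (dform \<psi>) us) (CE.dif ?\<Phi> (univ us))" .
  also have "cg (sigma (Suc (Suc k))) \<dots> 0"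
    using CE.nullD[OF CE.dif_dif[OF pt_leibniz[OF \<psi>]], of "univ us"] univ_simps(3)[of us]
    by (simp only: assms(2) cg_def add_0 diff_0_right)
  finally show ?thesis by (simp add: cg_def)
qed

end

section \<open>Total derivatives and twists\<close>

lemma below_iff_keys: "below k q \<longleftrightarrow> (\<forall>m\<in>Poly_Mapping.keys q. Poly_Mapping.keys m \<subseteq> {..<k})"
  by (auto simp: tfree_def in_keys_iff subset_iff) (metis in_keys_iff not_le neq0_conv)+

lemma lookup_X_ract:
  "Poly_Mapping.lookup (X i \<bullet> q) m =
    (if Poly_Mapping.lookup m i = 0 then 0 else Poly_Mapping.lookup q (m - Poly_Mapping.single i 1))"
proof (induction q rule: poly_mapping_single_induct)
  case (single l v)
  have "Poly_Mapping.single i 1 + l = m \<longleftrightarrow> Poly_Mapping.lookup m i \<noteq> 0 \<and> l = m - Poly_Mapping.single i 1"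
  proof (intro iffI conjI)
    assume "Poly_Mapping.lookup m i \<noteq> 0 \<and> l = m - Poly_Mapping.single i 1"
    then show "Poly_Mapping.single i 1 + l = m"
      by (intro poly_mapping_eqI) (auto simp: lookup_add lookup_minus lookup_single when_def)
  qed (auto simp: lookup_add)
  then show ?case
    by (auto simp: X_def ract_single lookup_single when_def)
qed (simp add: ract_add_right lookup_add)

context lie_conformal_algebroid_module
begin

definition T :: "int mpoly \<Rightarrow> 'm mpoly \<Rightarrow> 'm mpoly" where
  "T s w = s \<bullet> w + mmap dM w"

lemma total_deriv_eq: "total_deriv actM k q = T (sigma k) q"
proof -
  have "(\<Sum>i<k. lam i q) = sigma k \<bullet> q"
    by (simp add: lam_eq sigma_def add_map_sum[OF add_map_ract_left])
  then show ?thesis by (simp add: total_deriv_def T_def)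
qed

lemma add_map_T: "add_map (T s)"
  by (simp add: add_map_def T_def ract_add_right mmap_add[OF add_map_dM])

lemma T_zero [simp]: "T s 0 = 0"
  by (rule add_map_zero[OF add_map_T])

lemma T_ract: "T s (r \<bullet> w) = r \<bullet> T s w"
  by (simp add: T_def ract_add_right mmap_ract[OF add_map_dM] ract_commute[of r])

lemma T_sub: "T (sub h s) (sub h w) = sub h (T s w)"
  by (simp add: T_def sub_add sub_ract sub_mmap[OF add_map_dM])

lemma T_bev: "T (p + s) (bev lact p U w) = bev lact p U (T s w)"
  using actU_deriv[of p U w]
  by (simp add: T_def actU_def bev_linear biadd_lact ract_add_left add_ac)

lemma T_iterate_uminus: "(uminus ^^ n) (T s w) = T s ((uminus ^^ n) w)"
  by (induction n) (simp_all add: add_map_uminus[OF add_map_T])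

lemma T_Sop: "tfree t s \<Longrightarrow> SM.Sop t \<alpha> (T (s + X t) w) = T s (SM.Sop t \<alpha> w)"
  unfolding T_def SM.Sop_add_right
  by (simp add: SM.Sop_add_var mmap_SopM SM.Sop_add_left SM.Sop_ract_left add_ac)

lemma below_T: "below k w \<Longrightarrow> below k (T (sigma k) w)"
  unfolding T_def sigma_def by (auto intro!: tfree_add tfree_ract tfree_sum tfree_X tfree_mmap)

text \<open>The degree in the first variable alone is enough. Let m be a monomial of w with the
  largest exponent of lambda_0. At m times lambda_0 the coefficient of \<open>T (sigma k) w\<close>
  is that of w at m: every other contribution would come from a monomial with a larger exponent of
  lambda_0.\<close>

lemma T_eq_0_imp:
  assumes "0 < k" "T (sigma k) w = 0"
  shows "w = 0"
proof (rule ccontr)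
  assume "w \<noteq> 0"
  define e where "e = (\<lambda>m :: nat \<Rightarrow>\<^sub>0 nat. Poly_Mapping.lookup m 0)"
  let ?K = "Poly_Mapping.keys w"
  have K: "finite (e ` ?K)" "e ` ?K \<noteq> {}"
    using \<open>w \<noteq> 0\<close> by auto
  from Max_in[OF K] obtain m where m: "m \<in> ?K" "Max (e ` ?K) = e m"
    by blast
  have above: "Poly_Mapping.lookup w l = 0" if "e m < e l" for l
  proof (rule ccontr)
    assume "Poly_Mapping.lookup w l \<noteq> 0"
    then have "e l \<le> Max (e ` ?K)" using K(1) by (intro Max_ge) (auto simp: in_keys_iff)
    then have "e l \<le> e m" unfolding m(2) .
    then show False using that by simp
  qed
  let ?m = "m + Poly_Mapping.single 0 1"
  have e: "e (?m - Poly_Mapping.single i 1) = Suc (e m)" if "i \<noteq> 0" for i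
    using that by (simp add: e_def lookup_minus lookup_add lookup_single)
  have "sigma k \<bullet> w = (\<Sum>i<k. X i \<bullet> w)"
    by (simp add: sigma_def add_map_sum[OF add_map_ract_left])
  then have "Poly_Mapping.lookup (sigma k \<bullet> w) ?m = (\<Sum>i<k. Poly_Mapping.lookup (X i \<bullet> w) ?m)"
    by (simp add: lookup_sum)
  also have "\<dots> = (\<Sum>i<k. if i = 0 then Poly_Mapping.lookup w m else 0)"
  proof (rule sum.cong[OF refl])
    fix i
    show "Poly_Mapping.lookup (X i \<bullet> w) ?m = (if i = 0 then Poly_Mapping.lookup w m else 0)"
      using above[of "?m - Poly_Mapping.single i 1"] e[of i] by (simp add: lookup_X_ract lookup_add)
  qed
  also have "\<dots> = Poly_Mapping.lookup w m"
    using assms(1) by simp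
  finally have "Poly_Mapping.lookup (T (sigma k) w) ?m = Poly_Mapping.lookup w m + dM (Poly_Mapping.lookup w ?m)"
    by (simp add: T_def lookup_add lookup_mmap add_map_zero[OF add_map_dM])
  also have "Poly_Mapping.lookup w ?m = 0"
    by (rule above) (simp add: e_def lookup_add)
  finally show False
    using assms(2) m(1) by (simp add: add_map_zero[OF add_map_dM] in_keys_iff)
qed

lemma T_inj: "0 < k \<Longrightarrow> T (sigma k) v = T (sigma k) w \<Longrightarrow> v = w"
  using T_eq_0_imp[of k "v - w"] by (simp add: add_map_diff[OF add_map_T])

text \<open>In every summand the degrees substituted for the k variables, together with the degree
  of the acting element if there is one, add up to \<open>sigma (Suc k)\<close>; so T passes through
  each summand.\<close>

lemma dform_T:
  assumes "\<And>us. below k (\<psi> us)" "\<And>us. length us \<noteq> k \<Longrightarrow> \<psi> us = 0"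
  shows "dform (\<lambda>us. T (sigma k) (\<psi> us)) us = T (sigma (Suc k)) (dform \<psi> us)"
proof (cases "length us = Suc k")
  case True
  let ?P = "map X [0..<Suc k]"
  have P: "sum_list ?P = sigma (Suc k)"
    by (simp add: sigma_def interv_sum_list_conv_sum_set_nat atLeast0LessThan del: upt_Suc)
  have below: "below k (T (sigma k) (\<psi> us))" for us
    using below_T assms(1) by blast
  have 1: "bev lact (X i) U (sub ((!) (nths ?P (- {i}))) (T (sigma k) (\<psi> vs))) =
      T (sigma (Suc k)) (bev lact (X i) U (sub ((!) (nths ?P (- {i}))) (\<psi> vs)))"
    if "i < Suc k" for i U vs
  proof -
    have "sigma (Suc k) = X i + sum_list (nths ?P (- {i}))"
      using sum_list_nths(1)[of i ?P] that unfolding P by (simp del: upt_Suc)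
    moreover have "sum_list (nths ?P (- {i})) = sub ((!) (nths ?P (- {i}))) (sigma k)"
      by (rule sub_sigma_nth[symmetric]) (use that length_nths_Compl(1)[of i ?P] in simp)
    ultimately show ?thesis by (simp add: T_bev T_sub)
  qed
  have 2: "sub ((!) ((X i + X j) # nths ?P (- {i, j}))) (T (sigma k) (\<psi> vs)) =
      T (sigma (Suc k)) (sub ((!) ((X i + X j) # nths ?P (- {i, j}))) (\<psi> vs))"
    if "i < j" "j < Suc k" for i j vs
  proof -
    have "sigma (Suc k) = sum_list ((X i + X j) # nths ?P (- {i, j}))"
      using sum_list_nths(2)[of i j ?P] that unfolding P by (simp del: upt_Suc)
    also have "\<dots> = sub ((!) ((X i + X j) # nths ?P (- {i, j}))) (sigma k)"
      by (rule sub_sigma_nth[symmetric]) (use that length_nths_Compl(2)[of i j ?P] in simp)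
    finally show ?thesis by (simp only: T_sub)
  qed
  have "(\<Sum>(i, j)\<in>{(i, j). i < j \<and> j < Suc k}. (uminus ^^ (i + j))
       (\<Sum>n\<le>degree (br (us ! i) (us ! j)). X i ^ n \<bullet>
          sub ((!) ((X i + X j) # nths ?P (- {i, j})))
            (T (sigma k) (\<psi> (coeff (br (us ! i) (us ! j)) n # nths us (- {i, j})))))) =
      (\<Sum>(i, j)\<in>{(i, j). i < j \<and> j < Suc k}. T (sigma (Suc k)) ((uminus ^^ (i + j))
       (\<Sum>n\<le>degree (br (us ! i) (us ! j)). X i ^ n \<bullet>
          sub ((!) ((X i + X j) # nths ?P (- {i, j})))
            (\<psi> (coeff (br (us ! i) (us ! j)) n # nths us (- {i, j}))))))"
    by (rule sum.cong[OF refl], clarify)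
      (simp only: 2 T_ract[symmetric] add_map_sum[OF add_map_T, symmetric] T_iterate_uminus)
  moreover have "(\<Sum>i<Suc k. (uminus ^^ i) (bev lact (X i) (const_mpoly (us ! i))
       (sub ((!) (nths ?P (- {i}))) (T (sigma k) (\<psi> (nths us (- {i}))))))) =
     (\<Sum>i<Suc k. T (sigma (Suc k)) ((uminus ^^ i) (bev lact (X i) (const_mpoly (us ! i))
       (sub ((!) (nths ?P (- {i}))) (\<psi> (nths us (- {i})))))))"
    by (rule sum.cong[OF refl]) (simp only: 1 T_iterate_uminus lessThan_iff)
  ultimately show ?thesis
    unfolding dform_eq[OF below True] dform_eq[OF assms(1) True] add_map_add[OF add_map_T] add_map_sum[OF add_map_T]
    by (simp only: prod.case_distrib)
qed (simp add: dform_length[of k] assms)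

section \<open>The action of A[d] on polynomials through one variable\<close>

lemma scM_mult: "scM (a * b) v = scM a (scM b v)"
proof -
  have "dop_mult dA [:a:] [:b:] = [:a * b:]" by (simp add: dop_mult_def)
  then show ?thesis by (metis M.act_mult)
qed

lemma scM_one: "scM 1 v = v"
  using M.act_one by (simp add: one_pCons)

lemma amul_single:
  "SM.amul (Poly_Mapping.single m a) (Poly_Mapping.single l v) = Poly_Mapping.single (m + l) (scM a v)"
proof -
  have "SM.amul (Poly_Mapping.single m 1 \<bullet> const_mpoly a) (Poly_Mapping.single l 1 \<bullet> const_mpoly v)
      = Poly_Mapping.single m 1 \<bullet> Poly_Mapping.single l 1 \<bullet> const_mpoly (scM a v)"
    by (simp add: SM.amul_ract_left SM.amul_ract_right SM.amul_const ract_commute[of "Poly_Mapping.single l 1"])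
  then show ?thesis by (simp add: ract_single)
qed

lemma amul_mult: "SM.amul (\<alpha> * \<beta>) w = SM.amul \<alpha> (SM.amul \<beta> w)"
proof (induction \<alpha> rule: poly_mapping_single_induct)
  case (single m a)
  show ?case
  proof (induction \<beta> rule: poly_mapping_single_induct)
    case (single l b)
    show ?case
      by (induction w rule: poly_mapping_single_induct)
        (simp_all add: mult_single amul_single scM_mult add.assoc SM.amul_add_right)
  qed (simp add: distrib_left SM.amul_add_left SM.amul_add_right)
qed (simp add: distrib_right SM.amul_add_left)

lemma amul_one: "SM.amul 1 w = w"
  by (induction w rule: poly_mapping_single_induct)
    (simp_all add: amul_single scM_one SM.amul_add_right flip: single_one)

text \<open>\<open>tau i a\<close> is the part of \<^const>\<open>multi_twist\<close> that concerns the \<open>i\<close>-th argument.\<close>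

definition twist_coeff :: "nat \<Rightarrow> 'a poly \<Rightarrow> nat \<Rightarrow> 'a mpoly" where
  "twist_coeff i a n = pev (X i) ((lambda_plus dA ^^ n) (adjoint_symbol dA a))"

definition tau :: "nat \<Rightarrow> 'a poly \<Rightarrow> 'm mpoly \<Rightarrow> 'm mpoly" where
  "tau i a = lin (\<lambda>m v. SM.amul (twist_coeff i a (Poly_Mapping.lookup m i))
     (Poly_Mapping.single (m - Poly_Mapping.single i (Poly_Mapping.lookup m i)) v))"

lemma add_map_amul_single: "add_map (\<lambda>v. SM.amul \<alpha> (Poly_Mapping.single m v))"
  by (simp add: add_map_def single_add SM.amul_add_right)

lemma tau_add: "tau i a (v + w) = tau i a v + tau i a w"
  unfolding tau_def by (rule lin_add) (rule add_map_amul_single)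

lemma add_map_tau: "add_map (tau i a)"
  by (simp add: add_map_def tau_add)

lemma tau_single: "tau i a (Poly_Mapping.single m v) = SM.amul (twist_coeff i a (Poly_Mapping.lookup m i))
     (Poly_Mapping.single (m - Poly_Mapping.single i (Poly_Mapping.lookup m i)) v)"
  unfolding tau_def by (rule lin_single) (rule add_map_amul_single)

lemma multi_twist_add: "multi_twist dA actM as (v + w) = multi_twist dA actM as v + multi_twist dA actM as w"
  and multi_twist_single: "multi_twist dA actM as (Poly_Mapping.single m x) =
    SM.amul (\<Prod>i<length as. twist_coeff i (as ! i) (Poly_Mapping.lookup m i)) (const_mpoly x)"
proof -
  have e: "multi_twist dA actM as q = lin (\<lambda>m v. SM.amul (\<Prod>i<length as. twist_coeff i (as ! i) (Poly_Mapping.lookup m i)) (const_mpoly v)) q"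
    for q
  proof -
    have "mmap (\<lambda>b. scM b v) \<alpha> = SM.amul \<alpha> (const_mpoly v)" for \<alpha> v
    proof (induction \<alpha> rule: poly_mapping_single_induct)
      case (single m a)
      show ?case
        by (simp add: amul_single add_map_zero[OF biadd_map_left[OF biadd_scM]] del: pCons_0_0)
    qed (simp add: mmap_add[OF biadd_map_left[OF biadd_scM]] SM.amul_add_left)
    then show ?thesis
      by (simp add: multi_twist_def lin_def twist_coeff_def pev_def lam_eq_ract)
  qed
  show "multi_twist dA actM as (v + w) = multi_twist dA actM as v + multi_twist dA actM as w"
    unfolding e by (rule lin_add) (rule add_map_amul_single)
  show "multi_twist dA actM as (Poly_Mapping.single m x) =
    SM.amul (\<Prod>i<length as. twist_coeff i (as ! i) (Poly_Mapping.lookup m i)) (const_mpoly x)"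
    unfolding e by (rule lin_single) (rule add_map_amul_single)
qed

lemma tau_ract:
  assumes "tfree i r"
  shows "tau i a (r \<bullet> w) = r \<bullet> tau i a w"
  using assms
proof (induction rule: tfree_single_induct)
  case (single m c)
  show ?case
  proof (induction w rule: poly_mapping_single_induct)
    case (single l v)
    have "m + l - Poly_Mapping.single i (Poly_Mapping.lookup l i) = m + (l - Poly_Mapping.single i (Poly_Mapping.lookup l i))"
      by (rule poly_mapping_eqI) (simp add: lookup_minus lookup_add lookup_single when_def)
    then have "tau i a (Poly_Mapping.single (m + l) (zmul c v)) = SM.amul (twist_coeff i a (Poly_Mapping.lookup l i))
        (Poly_Mapping.single m c \<bullet> Poly_Mapping.single (l - Poly_Mapping.single i (Poly_Mapping.lookup l i)) v)"
      using \<open>Poly_Mapping.lookup m i = 0\<close> by (simp add: tau_single lookup_add ract_single)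
    then show ?case by (simp add: ract_single tau_single flip: SM.amul_ract_right)
  qed (simp add: ract_add_right tau_add)
qed (simp add: ract_add_left tau_add)

lemma tau_amul:
  assumes "tfree i \<beta>"
  shows "tau i a (SM.amul \<beta> w) = SM.amul \<beta> (tau i a w)"
  using assms
proof (induction rule: tfree_induct)
  case (const b)
  show ?case
  proof (induction w rule: poly_mapping_single_induct)
    case (single l v)
    have "SM.amul \<alpha> (Poly_Mapping.single m (scM b v)) = SM.amul (const_mpoly b) (SM.amul \<alpha> (Poly_Mapping.single m v))"
      for \<alpha> m
      using amul_mult[of \<alpha> "const_mpoly b" "Poly_Mapping.single m v"]
        amul_mult[of "const_mpoly b" \<alpha> "Poly_Mapping.single m v"]
      by (simp add: amul_single mult.commute)
    then show ?case by (simp add: amul_single tau_single)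
  qed (simp add: SM.amul_add_right tau_add)
qed (simp_all add: SM.amul_ract_left SM.amul_add_left tau_ract tau_add)

text \<open>The right-hand side, with the fresh variable lambda_t for x, is the form in which
  \<open>precochain\<close> states linearity over A.\<close>

lemma tau_const:
  assumes "tfree t q" "t \<noteq> i"
  shows "tau i [:a:] q = SM.Sop t (const_mpoly a) (sub (tshift i (X t)) q)"
  using assms(1)
proof (induction rule: tfree_single_induct)
  case (single m v)
  let ?n = "Poly_Mapping.lookup m i" and ?m = "m - Poly_Mapping.single i (Poly_Mapping.lookup m i)"
  have m: "m = Poly_Mapping.single i ?n + ?m"
    by (rule poly_mapping_eqI) (auto simp: lookup_add lookup_minus lookup_single when_def)
  have m0: "tfree i (Poly_Mapping.single ?m (1 :: int))" "tfree t (Poly_Mapping.single ?m (1 :: int))"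
    using single by (simp_all add: tfree_single lookup_minus)
  have "Poly_Mapping.single m v = Poly_Mapping.single ?m 1 \<bullet> X i ^ ?n \<bullet> const_mpoly v"
    using m by (simp add: X_power ract_single add.commute)
  also have "sub (tshift i (X t)) \<dots> = Poly_Mapping.single ?m 1 \<bullet> (X i + X t) ^ ?n \<bullet> const_mpoly v"
    by (simp add: sub_ract sub_power tshift_same sub_tshift_tfree[OF m0(1)])
  finally have "SM.Sop t (const_mpoly a) (sub (tshift i (X t)) (Poly_Mapping.single m v)) =
      Poly_Mapping.single ?m 1 \<bullet> SM.Sop t (pev (X i) [:a:]) ((X i + X t) ^ ?n \<bullet> const_mpoly v)"
    by (simp add: SM.Sop_ract_right[OF m0(2)] pev_pCons)
  also have "\<dots> = Poly_Mapping.single ?m 1 \<bullet> SM.amul (twist_coeff i [:a:] ?n) (const_mpoly v)"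
    using assms(2) by (simp add: SM.Sop_power tfree_X twist_coeff_def)
  also have "\<dots> = tau i [:a:] (Poly_Mapping.single m v)"
    by (simp add: tau_single ract_single flip: SM.amul_ract_right)
  finally show ?case by simp
next
  case (add p q)
  then show ?case by (simp add: tau_add sub_add SM.Sop_add_right)
qed

lemma adjoint_symbol_altdef:
  "degree p \<le> n \<Longrightarrow> adjoint_symbol dA p = (\<Sum>i\<le>n. ((\<lambda>q. - lambda_plus dA q) ^^ i) [:coeff p i:])"
proof -
  have "add_map (\<lambda>q. - lambda_plus dA q)"
    using add_map_lambda_plus[OF add_map_dA] by (simp add: add_map_def)
  from add_map_zero[OF add_map_funpow[OF this]]
  show "degree p \<le> n \<Longrightarrow> ?thesis"
    unfolding adjoint_symbol_def by (intro sum.mono_neutral_left) (auto simp: coeff_eq_0)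
qed

lemma adjoint_symbol_pCons: "adjoint_symbol dA (pCons a p) = [:a:] - lambda_plus dA (adjoint_symbol dA p)"
proof -
  have a: "add_map (\<lambda>q. - lambda_plus dA q)"
    using add_map_lambda_plus[OF add_map_dA] by (simp add: add_map_def)
  have "adjoint_symbol dA (pCons a p) = (\<Sum>i\<le>Suc (degree p). ((\<lambda>q. - lambda_plus dA q) ^^ i) [:coeff (pCons a p) i:])"
    by (rule adjoint_symbol_altdef) (simp add: degree_pCons_le)
  also have "\<dots> = [:a:] + (\<Sum>i\<le>degree p. - lambda_plus dA (((\<lambda>q. - lambda_plus dA q) ^^ i) [:coeff p i:]))"
    by (simp add: sum.atMost_Suc_shift del: sum.atMost_Suc)
  also have "\<dots> = [:a:] + - lambda_plus dA (adjoint_symbol dA p)"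
    unfolding adjoint_symbol_def add_map_sum[OF a] ..
  finally show ?thesis by simp
qed

text \<open>\<open>pCons a p\<close> is the symbol of a + p d, and d in slot i acts as
  multiplication by - lambda_i. This allows induction on the order of the operator.\<close>

lemma tau_pCons: "tau i (pCons a p) q = tau i [:a:] q - tau i p (X i \<bullet> q)"
proof (induction q rule: poly_mapping_single_induct)
  case (single m v)
  have "twist_coeff i (pCons a p) n = twist_coeff i [:a:] n - twist_coeff i p (Suc n)" for n
    unfolding twist_coeff_def adjoint_symbol_pCons[of a p]
    by (simp add: add_map_diff[OF add_map_funpow[OF add_map_lambda_plus[OF add_map_dA]]]
        add_map_diff[OF add_map_pev] funpow_swap1)
  moreover have "Poly_Mapping.single i 1 + m - Poly_Mapping.single i (Suc (Poly_Mapping.lookup m i))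
      = m - Poly_Mapping.single i (Poly_Mapping.lookup m i)"
    by (rule poly_mapping_eqI) (simp add: lookup_minus lookup_add lookup_single when_def)
  moreover have "SM.amul (\<alpha> - \<beta>) w = SM.amul \<alpha> w - SM.amul \<beta> w" for \<alpha> \<beta> w
    using SM.amul_add_left[of "\<alpha> - \<beta>" \<beta> w] by simp
  ultimately show ?case
    by (simp add: tau_single X_def ract_single lookup_add)
qed (simp add: tau_add ract_add_right)

lemma tau_zero_left: "tau i 0 q = 0"
proof -
  have "adjoint_symbol dA (0 :: 'a poly) = 0" by (simp add: adjoint_symbol_def)
  then have "twist_coeff i 0 n = 0" for n
    by (simp add: twist_coeff_def add_map_zero[OF add_map_funpow[OF add_map_lambda_plus[OF add_map_dA]]])
  moreover have "SM.amul 0 w = 0" for w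
    using SM.amul_add_left[of 0 0 w] by simp
  ultimately show ?thesis by (induction q rule: poly_mapping_single_induct) (simp_all add: tau_single tau_add)
qed

lemma twist_coeff_add: "twist_coeff i (a + b) n = twist_coeff i a n + twist_coeff i b n"
proof -
  have "add_map (\<lambda>q. - lambda_plus dA q)"
    using add_map_lambda_plus[OF add_map_dA] by (simp add: add_map_def)
  from add_map_add[OF add_map_funpow[OF this]]
  have "((\<lambda>q. - lambda_plus dA q) ^^ n) [:x + y:]
      = ((\<lambda>q. - lambda_plus dA q) ^^ n) [:x:] + ((\<lambda>q. - lambda_plus dA q) ^^ n) [:y:]" for n x y
    by (metis add_0 add_pCons)
  then have "adjoint_symbol dA (a + b) = adjoint_symbol dA a + adjoint_symbol dA b"
    using adjoint_symbol_altdef[of a "max (degree a) (degree b)"] adjoint_symbol_altdef[of b "max (degree a) (degree b)"]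
      adjoint_symbol_altdef[OF degree_add_le_max[of a b]]
    by (simp add: sum.distrib)
  then show ?thesis
    by (simp add: twist_coeff_def add_map_add[OF add_map_funpow[OF add_map_lambda_plus[OF add_map_dA]]] pev_add)
qed

lemma tau_add_left: "tau i (a + b) q = tau i a q + tau i b q"
  by (induction q rule: poly_mapping_single_induct)
    (simp_all add: tau_single twist_coeff_add SM.amul_add_left tau_add)

lemma tau_one: "tau i 1 q = q"
proof (induction q rule: poly_mapping_single_induct)
  case (single m v)
  let ?n = "Poly_Mapping.lookup m i" and ?m = "m - Poly_Mapping.single i (Poly_Mapping.lookup m i)"
  have m: "m = Poly_Mapping.single i ?n + ?m"
    by (rule poly_mapping_eqI) (auto simp: lookup_add lookup_minus lookup_single when_def)
  have "pev p (monom (1 :: 'a) n) = p ^ n \<bullet> const_mpoly 1" for p n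
  proof (induction n)
    case (Suc n)
    then show ?case by (simp add: monom_Suc pev_pCons ract_mult)
  qed (simp add: monom_0 pev_pCons)
  then have "twist_coeff i 1 n = X i ^ n \<bullet> const_mpoly 1" for n
    using lambda_plus_monom[of n 0] by (simp add: twist_coeff_def one_pCons monom_0)
  then have "twist_coeff i 1 ?n = X i ^ ?n \<bullet> const_mpoly 1" .
  then show ?case
    using m by (simp add: tau_single SM.amul_ract_left amul_single scM_one X_power ract_single del: single_one)
qed (simp add: tau_add)

lemma tfree_tau: "tfree t q \<Longrightarrow> t \<noteq> i \<Longrightarrow> tfree t (tau i a q)"
proof (induction rule: tfree_single_induct)
  case (single m v)
  then show ?case
    unfolding tau_single twist_coeff_def
    by (intro SM.tfree_amul tfree_pev tfree_X tfree_single) (auto simp: lookup_minus)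
qed (simp add: tau_add tfree_add)

lemma below_tau: "below k q \<Longrightarrow> i < k \<Longrightarrow> below k (tau i a q)"
  by (auto intro: tfree_tau)

lemma multi_twist_tau:
  assumes "length as = k" "below k q"
  shows "multi_twist dA actM as q = foldr (\<lambda>i. tau i (as ! i)) [0..<k] q"
proof -
  \<comment> \<open>Treating slot i consumes the exponent of lambda_i. So \<open>cut j m\<close>,
    which keeps the exponents below j, is the monomial left over after the slots j, ..., k -
    1.\<close>
  define cut where "cut = (\<lambda>j (m :: nat \<Rightarrow>\<^sub>0 nat). Poly_Mapping.mapp (\<lambda>i n. if i < j then n else 0) m)"
  have lookup_cut: "Poly_Mapping.lookup (cut j m) i = (if i < j then Poly_Mapping.lookup m i else 0)" for j m i
    by (simp add: cut_def lookup_mapp in_keys_iff when_def)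
  let ?F = "\<lambda>j. foldr (\<lambda>i. tau i (as ! i)) [j..<k]"
  have single: "?F j (Poly_Mapping.single m v) =
      SM.amul (\<Prod>i\<in>{j..<k}. twist_coeff i (as ! i) (Poly_Mapping.lookup m i)) (Poly_Mapping.single (cut j m) v)"
    if m: "Poly_Mapping.keys m \<subseteq> {..<k}" and "j \<le> k" for m v j
    using that(2)
  proof (induction j rule: inc_induct)
    case base
    have "cut k m = m"
      using m by (intro poly_mapping_eqI) (auto simp: lookup_cut in_keys_iff)
    then show ?case by (simp add: amul_one)
  next
    case (step j)
    have c: "cut (Suc j) m - Poly_Mapping.single j (Poly_Mapping.lookup m j) = cut j m"
      by (rule poly_mapping_eqI) (auto simp: lookup_cut lookup_minus lookup_single when_def)
    have free: "tfree j (\<Prod>i\<in>{Suc j..<k}. twist_coeff i (as ! i) (Poly_Mapping.lookup m i))"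
    proof -
      have prod: "tfree j (prod f I)" if "\<And>i. i \<in> I \<Longrightarrow> tfree j (f i)" for I :: "nat set" and f :: "nat \<Rightarrow> 'a mpoly"
        using that
      proof (induction I rule: infinite_finite_induct)
        case (insert i I)
        have "tfree j (\<alpha> * \<beta>)" if "tfree j \<alpha>" "tfree j \<beta>" for \<alpha> \<beta> :: "'a mpoly"
        proof -
          have "m \<in> {a + b | a b. a \<in> Poly_Mapping.keys \<alpha> \<and> b \<in> Poly_Mapping.keys \<beta>}"
            if "m \<in> Poly_Mapping.keys (\<alpha> * \<beta>)" for m
            using keys_mult[of \<alpha> \<beta>] that by blast
          then show ?thesis
            using that unfolding tfree_def by (fastforce simp: lookup_add)
        qed
        then show ?case using insert by simp
      qed (simp_all add: tfree_def)
      show ?thesis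
        by (rule prod) (auto simp: twist_coeff_def intro!: tfree_pev tfree_X)
    qed
    have "?F j (Poly_Mapping.single m v) = tau j (as ! j) (?F (Suc j) (Poly_Mapping.single m v))"
      using step(2) by (simp add: upt_conv_Cons)
    also have "\<dots> = SM.amul (\<Prod>i\<in>{Suc j..<k}. twist_coeff i (as ! i) (Poly_Mapping.lookup m i))
        (tau j (as ! j) (Poly_Mapping.single (cut (Suc j) m) v))"
      unfolding step.IH by (rule tau_amul[OF free])
    also have "tau j (as ! j) (Poly_Mapping.single (cut (Suc j) m) v) =
        SM.amul (twist_coeff j (as ! j) (Poly_Mapping.lookup m j)) (Poly_Mapping.single (cut j m) v)"
      by (simp add: tau_single lookup_cut c)
    finally show ?case
      using step(2) by (simp add: prod.atLeast_Suc_lessThan mult.commute flip: amul_mult)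
  qed
  have F_add: "foldr (\<lambda>i. tau i (as ! i)) is (v + w) = foldr (\<lambda>i. tau i (as ! i)) is v + foldr (\<lambda>i. tau i (as ! i)) is w"
    for "is" v w
    by (induction "is") (simp_all add: tau_add)
  have add: "add_map (multi_twist dA actM as)" "add_map (?F 0)"
    by (simp_all add: add_map_def multi_twist_add F_add)
  have "multi_twist dA actM as (Poly_Mapping.single m (Poly_Mapping.lookup q m)) = ?F 0 (Poly_Mapping.single m (Poly_Mapping.lookup q m))"
    if "m \<in> Poly_Mapping.keys q" for m
  proof -
    have "cut 0 m = 0" by (rule poly_mapping_eqI) (simp add: lookup_cut)
    moreover have "Poly_Mapping.keys m \<subseteq> {..<k}" using assms(2) that by (simp add: below_iff_keys)
    ultimately show ?thesis
      using single[of m 0] by (simp add: multi_twist_single assms(1) atLeast0LessThan)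
  qed
  then show ?thesis
    by (subst (1 2) poly_mapping_sum_single[of q]) (simp add: add_map_sum[OF add(1)] add_map_sum[OF add(2)])
qed

text \<open>Induction on the order by \<open>tau_pCons\<close>. In order 0 the operator is
  \<open>Sop k\<close> after the shift of lambda_i by lambda_k; the shift turns sigma k into sigma k
  + lambda_k, and \<open>T_Sop\<close> turns it back.\<close>

lemma T_tau: "i < k \<Longrightarrow> below k w \<Longrightarrow> tau i a (T (sigma k) w) = T (sigma k) (tau i a w)"
proof (induction a arbitrary: w)
  case 0
  then show ?case by (simp add: tau_zero_left)
next
  case (pCons a p)
  have t: "tfree k (sigma k)" unfolding sigma_def by (intro tfree_sum tfree_X) auto
  have s: "sub (tshift i (X k)) (sigma k) = sigma k + X k"
  proof -
    have "sub (tshift i (X k)) (sigma k) = (\<Sum>j<k. X j + (if j = i then X k else 0))"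
      unfolding sub_sigma by (intro sum.cong) (auto simp: tshift_def)
    then show ?thesis using pCons.prems(1) by (simp add: sum.distrib sigma_def)
  qed
  have "tau i [:a:] (T (sigma k) w) = T (sigma k) (tau i [:a:] w)"
  proof -
    have "tau i [:a:] (T (sigma k) w) = SM.Sop k (const_mpoly a) (sub (tshift i (X k)) (T (sigma k) w))"
      using below_T[OF pCons.prems(2)] pCons.prems(1) by (intro tau_const) auto
    also have "\<dots> = T (sigma k) (SM.Sop k (const_mpoly a) (sub (tshift i (X k)) w))"
      unfolding T_sub[symmetric] s by (rule T_Sop[OF t])
    also have "SM.Sop k (const_mpoly a) (sub (tshift i (X k)) w) = tau i [:a:] w"
      using pCons.prems by (intro tau_const[symmetric]) auto
    finally show ?thesis .
  qed
  moreover have "tau i p (X i \<bullet> T (sigma k) w) = T (sigma k) (tau i p (X i \<bullet> w))"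
    unfolding T_ract[symmetric] using pCons.prems by (intro pCons.IH) (auto intro!: tfree_ract tfree_X)
  ultimately show ?case
    unfolding tau_pCons[of i a p] by (simp add: add_map_diff[OF add_map_T])
qed

end

context lie_conformal_algebroid_module
begin

text \<open>The relation d a = a d + d(a) of A[d], read in slot i, where d is multiplication by -
  lambda_i.\<close>

lemma tau_X:
  "tau i [:a:] (X i \<bullet> q) = X i \<bullet> tau i [:a:] q + tau i [:dA a:] q"
proof -
  obtain t where t: "tfree t q" "t \<noteq> i"
  proof -
    have "finite (\<Union>m\<in>Poly_Mapping.keys q. Poly_Mapping.keys m)" by simp
    then obtain t where "t \<notin> insert i (\<Union>m\<in>Poly_Mapping.keys q. Poly_Mapping.keys m)"
      using ex_new_if_finite[of "insert i (\<Union>m\<in>Poly_Mapping.keys q. Poly_Mapping.keys m)"] infinite_UNIV_nat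
      by blast
    then show ?thesis by (intro that[of t]) (auto simp: tfree_def in_keys_iff)
  qed
  have Xt: "tfree t (X i)" "tfree t (X i \<bullet> q)"
    using t by (simp_all add: tfree_X tfree_ract)
  show ?thesis
    using tau_const[OF t] tau_const[OF Xt(2) t(2)]
    by (simp add: sub_ract tshift_same SM.Sop_add_var[OF Xt(1)] SM.Sop_add_left SM.Sop_ract_left
        add_map_zero[OF add_map_dA])
qed

lemma tau_uminus: "tau i a (- q) = - tau i a q"
  using add_map_uminus[OF add_map_tau] .

lemma tau_diff: "tau i a (p - q) = tau i a p - tau i a q"
  using add_map_diff[OF add_map_tau] .

lemma tau_const_mult: "tau i [:a * b:] q = tau i [:a:] (tau i [:b:] q)"
proof (induction q arbitrary: a b rule: mpoly_induct_var[where t = i])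
  case (const v)
  show ?case by (simp add: tau_single twist_coeff_def pev_pCons SM.amul_const scM_mult)
next
  case (var q)
  have "[:dA (a * b):] = [:dA a * b:] + [:a * dA b:]" by (simp add: A.deriv_mult)
  then have "tau i [:dA (a * b):] q = tau i [:dA a:] (tau i [:b:] q) + tau i [:a:] (tau i [:dA b:] q)"
    by (simp only: tau_add_left var)
  then show ?case by (simp add: tau_X var tau_add add_ac)
qed (simp_all add: tau_ract tau_add)

lemma tau_smult: "tau i (Polynomial.smult x a) q = tau i [:x:] (tau i a q)"
proof (induction a arbitrary: q)
  case 0
  show ?case using tau_add[of i "[:x:]" 0 0] by (simp add: tau_zero_left)
next
  case (pCons y p)
  have "Polynomial.smult x (pCons y p) = pCons (x * y) (Polynomial.smult x p)" by simp
  then show ?case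
    using tau_pCons[of i "x * y" "Polynomial.smult x p" q] tau_pCons[of i y p q]
    by (simp add: pCons.IH tau_const_mult tau_diff del: smult_pCons)
qed

lemma tau_lambda_plus: "tau i (lambda_plus dA a) q = - (X i \<bullet> tau i a q)"
proof (induction a arbitrary: q)
  case 0
  show ?case using add_map_zero[OF add_map_lambda_plus[OF add_map_dA]] by (simp add: tau_zero_left)
next
  case (pCons y p)
  have "tau i (lambda_plus dA (pCons y p)) q =
      tau i [:dA y:] q - tau i (lambda_plus dA p) (X i \<bullet> q) - tau i [:y:] (X i \<bullet> q)"
    unfolding lambda_plus_pCons[OF add_map_dA] tau_add_left
    using tau_pCons[of i 0 "lambda_plus dA p" q] tau_pCons[of i 0 "[:y:]" q] by (simp add: tau_zero_left)
  also have "\<dots> = - (X i \<bullet> (tau i [:y:] q - tau i p (X i \<bullet> q)))"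
    by (simp add: pCons.IH tau_X ract_diff_right)
  also have "tau i [:y:] q - tau i p (X i \<bullet> q) = tau i (pCons y p) q"
    by (simp add: tau_pCons[of i y p])
  finally show ?case .
qed

lemma tau_var: "tau i [:0, 1:] q = - (X i \<bullet> q)"
  using tau_pCons[of i 0 "[:1:]" q] tau_one[of i "X i \<bullet> q"] by (simp add: tau_zero_left one_pCons)

lemma dop_mult_pCons: "dop_mult dA (pCons x p) b = Polynomial.smult x b + dop_mult dA p (lambda_plus dA b)"
proof -
  have "dop_mult dA q b = (\<Sum>i\<le>n. Polynomial.smult (coeff q i) ((lambda_plus dA ^^ i) b))" if "degree q \<le> n" for q n
    unfolding dop_mult_def using that by (intro sum.mono_neutral_left) (auto simp: coeff_eq_0)
  from this[of "pCons x p" "Suc (degree p)"]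
  have "dop_mult dA (pCons x p) b = (\<Sum>i\<le>Suc (degree p). Polynomial.smult (coeff (pCons x p) i) ((lambda_plus dA ^^ i) b))"
    by (simp add: degree_pCons_le)
  then show ?thesis
    by (simp add: sum.atMost_Suc_shift dop_mult_def funpow_swap1 del: sum.atMost_Suc)
qed

text \<open>Polynomials over M become a left A[d]-module through each variable. The recursion of the
  composition product in its left factor reduces the claim to left factors from A
  (\<open>tau_smult\<close>) and to d (\<open>tau_lambda_plus\<close>).\<close>

lemma tau_dop_mult: "tau i (dop_mult dA a b) q = tau i a (tau i b q)"
proof (induction a arbitrary: b q)
  case 0
  have "dop_mult dA 0 b = 0" by (simp add: dop_mult_def)
  then show ?case by (simp add: tau_zero_left)
next
  case (pCons x p)
  show ?case
    by (simp add: dop_mult_pCons tau_add_left tau_smult pCons.IH tau_lambda_plus tau_uminus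
        tau_pCons[of i x p])
qed

text \<open>Each action reads only the exponent of its own variable, and the coefficients it brings
  in commute because A is commutative.\<close>

lemma tau_commute:
  assumes "i \<noteq> j"
  shows "tau i a (tau j b q) = tau j b (tau i a q)"
proof (induction q rule: poly_mapping_single_induct)
  case (single m v)
  let ?mi = "Poly_Mapping.single i (Poly_Mapping.lookup m i)" and ?mj = "Poly_Mapping.single j (Poly_Mapping.lookup m j)"
  have free: "tfree i (twist_coeff j b n)" "tfree j (twist_coeff i a n)" for n
    using assms by (auto simp: twist_coeff_def intro!: tfree_pev tfree_X)
  have m: "m - ?mj - ?mi = m - ?mi - ?mj"
    by (rule poly_mapping_eqI) (simp add: lookup_minus)
  have l: "Poly_Mapping.lookup (m - ?mj) i = Poly_Mapping.lookup m i"
    "Poly_Mapping.lookup (m - ?mi) j = Poly_Mapping.lookup m j"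
    using assms by (simp_all add: lookup_minus lookup_single)
  show ?case
    by (simp add: tau_single tau_amul free l m flip: amul_mult) (simp add: mult.commute)
qed (simp add: tau_add)

lemma tau_scM: "tau i b (mmap (scM c) q) = mmap (scM c) (tau i b q)"
  using tau_amul[of i "const_mpoly c" b q] by (simp add: SM.amul_const_left)

text \<open>An element with derivative 0 acts on coefficients only. Scalars are such elements, so
  linearity over the base field is contained in linearity over A[d].\<close>

lemma tau_dA_zero:
  assumes "dA a = 0"
  shows "tau i [:a:] q = mmap (scM a) q"
proof (induction q rule: mpoly_induct_var[where t = i])
  case (const v)
  show ?case
    using add_map_zero[OF biadd_map_right[OF biadd_scM, of a]]
    by (simp add: tau_single twist_coeff_def pev_pCons SM.amul_const )
qed (simp_all add: tau_ract tau_X tau_add tau_zero_left assms mmap_ract mmap_add biadd_map_right[OF biadd_scM])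

lemma dA_scalar [simp]: "dA (sA c 1) = 0"
  using A.deriv_scale[of c 1] A.scale_zero_right[of c] by simp

lemma actE_zero [simp]: "actE 0 u = 0"
  using E.act_add_left[of 0 0 u] by simp

lemma dop_mult_monom: "dop_mult dA p (monom 1 n) = monom 1 n * p"
proof (induction p arbitrary: n)
  case 0
  show ?case by (simp add: dop_mult_def)
next
  case (pCons x p)
  have "lambda_plus dA (monom 1 n) = monom 1 (Suc n)"
    using lambda_plus_monom[of 1 n] by simp
  then show ?case
    using pCons.IH[of "Suc n"] by (simp add: dop_mult_pCons monom_Suc mult_pCons_right)
qed

lemma actE_pCons: "actE (pCons a p) u = scE a u + actE p (dE u)"
proof -
  have "dop_mult dA p [:0, 1:] = pCons 0 p"
    using dop_mult_monom[of p 1] by (simp add: monom_Suc monom_0)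
  then have "actE (pCons 0 p) u = actE p (dE u)"
    using E.act_mult[of p "[:0, 1:]" u] by (simp add: dact_def)
  then show ?thesis
    using E.act_add_left[of "[:a:]" "pCons 0 p" u] by simp
qed

lemma signed_perm_eq:
  fixes q :: "'m mpoly"
  assumes "below k q"
  shows "signed_perm k \<pi> q = (let r = sub (\<lambda>i. X (\<pi> i)) q in if sign \<pi> = 1 then r else - r)"
proof -
  have m: "map (\<lambda>i. lam (\<pi> i)) [0..<k] = map (ract :: _ \<Rightarrow> 'm mpoly \<Rightarrow> _) (map (\<lambda>i. X (\<pi> i)) [0..<k])"
    by (simp add: lam_eq_ract)
  have "subst_mpoly (map (\<lambda>i. lam (\<pi> i)) [0..<k]) q = sub ((!) (map (\<lambda>i. X (\<pi> i)) [0..<k])) q"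
    by (rule trans[OF arg_cong[OF m, of "\<lambda>Ts. subst_mpoly Ts q"] subst_mpoly_map_ract])
      (use assms in simp)
  also have "\<dots> = sub (\<lambda>i. X (\<pi> i)) q"
    by (rule sub_below[OF assms]) simp
  finally show ?thesis by (simp add: signed_perm_def)
qed

end

section \<open>From generators of A[d] and exchanges of neighbours to all cochain conditions\<close>

context algebroid_cochains
begin

text \<open>The conditions of \<^const>\<open>cochain_set\<close>, with equality replaced by congruence modulo \<open>N\<close>.\<close>

definition cochain_mod :: "nat \<Rightarrow> ('e list \<Rightarrow> 'm mpoly) \<Rightarrow> bool" where
  "cochain_mod k \<psi> \<longleftrightarrow>
     (\<forall>us. length us \<noteq> k \<longrightarrow> \<psi> us = 0) \<and>
     (\<forall>us. below k (\<psi> us)) \<and>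
     (\<forall>us i u v. length us = k \<and> i < k \<longrightarrow>
        cg (sigma k) (\<psi> (us[i := u + v])) (\<psi> (us[i := u]) + \<psi> (us[i := v]))) \<and>
     (\<forall>us i c u. length us = k \<and> i < k \<longrightarrow>
        cg (sigma k) (\<psi> (us[i := fact_scale sA actE c u])) (mmap (fact_scale sA actM c) (\<psi> (us[i := u])))) \<and>
     (\<forall>as us. length as = k \<and> length us = k \<longrightarrow>
        cg (sigma k) (\<psi> (map2 actE as us)) (multi_twist dA actM as (\<psi> us))) \<and>
     (\<forall>\<pi> us. \<pi> permutes {..<k} \<and> length us = k \<longrightarrow>
        cg (sigma k) (\<psi> us) (signed_perm k \<pi> (\<psi> (map (\<lambda>i. us ! \<pi> i) [0..<k]))))"

lemma N_T: "N s = T s ` {w. reduced \<or> w = 0}"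
  by (simp add: N_def T_def)

lemma N_below:
  assumes "w \<in> N (sigma k)" "below k w"
  obtains x where "below k x" "reduced \<or> x = 0" "w = T (sigma k) x"
proof -
  from assms(1) obtain x where x: "reduced \<or> x = 0" "w = T (sigma k) x"
    by (auto simp: N_T)
  \<comment> \<open>Setting the variables from k on to 0 changes neither w nor sigma k, so a
    preimage can be found in the first k variables.\<close>
  define h where "h = (\<lambda>i. if i < k then X i else 0)"
  have "sub h (sigma k) = sigma k" unfolding sub_sigma by (simp add: h_def sigma_def)
  then have "w = T (sigma k) (sub h x)"
    using sub_below_id[OF assms(2), of h] T_sub[of h "sigma k" x] x(2) by (simp add: h_def)
  moreover have "below k (sub h x)"
    by (auto intro!: tfree_subI simp: h_def tfree_X)
  moreover have "reduced \<or> sub h x = 0"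
    using x(1) add_map_zero[OF add_map_sub] by auto
  ultimately show thesis using that by blast
qed

text \<open>A preimage in the first k variables is needed, since \<open>T_tau\<close> uses lambda_k
  as auxiliary variable.\<close>

lemma cg_tau: "cg (sigma k) v w \<Longrightarrow> below k v \<Longrightarrow> below k w \<Longrightarrow> i < k \<Longrightarrow> cg (sigma k) (tau i a v) (tau i a w)"
proof -
  assume a: "cg (sigma k) v w" "below k v" "below k w" "i < k"
  have "below k (v - w)"
    using a(2,3) tfree_add[of _ v "- w"] tfree_uminus[of _ w] by simp
  then obtain x where x: "below k x" "reduced \<or> x = 0" "v - w = T (sigma k) x"
    using N_below a(1) unfolding cg_def by blast
  have "tau i a v - tau i a w = T (sigma k) (tau i a x)"
    using T_tau[OF a(4) x(1)] x(3) by (simp flip: tau_diff)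
  then show ?thesis
    using x(2) add_map_zero[OF add_map_tau] by (auto simp: cg_def N_T)
qed

lemma slot_additive_zero:
  assumes "slot_additive s k \<psi>" "length ys + length zs + 1 = k"
  shows "cg s (\<psi> (ys @ 0 # zs)) 0"
  using slot_additiveD[OF assms, of 0 0] N_uminus[of "- \<psi> (ys @ 0 # zs)" s]
  by (simp add: cg_def)

text \<open>Induction on the order of a: the rules for elements of A and for d combine by
  \<open>actE_pCons\<close> on arguments and by \<open>tau_pCons\<close> on values.\<close>

lemma precochain_tau:
  assumes \<psi>: "precochain k \<psi>" and len: "length ys + length zs + 1 = k"
  shows "cg (sigma k) (\<psi> (ys @ actE a u # zs)) (tau (length ys) a (\<psi> (ys @ u # zs)))"
proof (induction a arbitrary: u)
  case 0
  show ?case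
    using slot_additive_zero[OF precochainD(3)[OF \<psi>] len] by (simp add: tau_zero_left)
next
  case (pCons a p)
  let ?i = "length ys" and ?s = "sigma k"
  note below = precochainD(2)[OF \<psi>]
  have i: "?i < k" using len by simp
  have "cg ?s (\<psi> (ys @ actE (pCons a p) u # zs)) (\<psi> (ys @ scE a u # zs) + \<psi> (ys @ actE p (dE u) # zs))"
    unfolding actE_pCons[of a p] by (rule slot_additiveD[OF precochainD(3)[OF \<psi>] len])
  also have "cg ?s \<dots> (tau ?i [:a:] (\<psi> (ys @ u # zs)) + tau ?i p (\<psi> (ys @ dE u # zs)))"
  proof (rule cg_add[OF _ pCons.IH])
    show "cg ?s (\<psi> (ys @ scE a u # zs)) (tau ?i [:a:] (\<psi> (ys @ u # zs)))"
      using precochainD(5)[OF \<psi> len order_refl, of a u] tau_const[of k "\<psi> (ys @ u # zs)" ?i a] below i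
      by simp
  qed
  also have "cg ?s \<dots> (tau ?i [:a:] (\<psi> (ys @ u # zs)) + tau ?i p (- (X ?i \<bullet> \<psi> (ys @ u # zs))))"
  proof (rule cg_add[OF cg_refl cg_tau[OF precochainD(4)[OF \<psi> len] below _ i]])
    show "below k (- (X ?i \<bullet> \<psi> (ys @ u # zs)))"
      using below i by (auto intro!: tfree_uminus tfree_ract tfree_X)
  qed
  also have "\<dots> = tau ?i (pCons a p) (\<psi> (ys @ u # zs))"
    by (simp add: tau_pCons[of ?i a p] tau_uminus)
  finally show ?case .
qed

lemma list_update_slot: "i < length us \<Longrightarrow> us[i := u] = take i us @ u # drop (Suc i) us"
  by (rule upd_conv_take_nth_drop)

text \<open>Operators in a single slot are covered by \<open>precochain_tau\<close>, operators in
  all slots by treating one slot after the other, scalars by \<open>tau_dA_zero\<close>, and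
  arbitrary permutations by \<open>alternating_permutes\<close> at the universal point.\<close>

theorem precochain_cochain_mod:
  assumes \<psi>: "precochain k \<psi>"
  shows "cochain_mod k \<psi>"
proof -
  let ?s = "sigma k"
  note below = precochainD(2)[OF \<psi>]
  have "cg ?s (\<psi> (us[i := u + v])) (\<psi> (us[i := u]) + \<psi> (us[i := v]))" if "length us = k" "i < k" for us i u v
    using slot_additiveD[OF precochainD(3)[OF \<psi>], of "take i us" "drop (Suc i) us" u v] that
    by (simp add: list_update_slot)
  moreover have "cg ?s (\<psi> (us[i := fact_scale sA actE c u])) (mmap (fact_scale sA actM c) (\<psi> (us[i := u])))"
    if "length us = k" "i < k" for us i c u
    using precochain_tau[OF \<psi>, of "take i us" "drop (Suc i) us" "[:sA c 1:]" u] that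
    by (simp add: list_update_slot fact_scale_def tau_dA_zero)
  moreover have "cg ?s (\<psi> (map2 actE as us)) (multi_twist dA actM as (\<psi> us))"
    if len: "length as = k" "length us = k" for as us
  proof -
    \<comment> \<open>The slots are treated from the last to the first: at stage j the arguments
      from j on carry their operators.\<close>
    let ?F = "\<lambda>j. foldr (\<lambda>i. tau i (as ! i)) [j..<k]"
    have "cg ?s (\<psi> (take j us @ drop j (map2 actE as us))) (?F j (\<psi> us)) \<and> below k (?F j (\<psi> us))"
      if "j \<le> k" for j
      using that
    proof (induction j rule: inc_induct)
      case base
      show ?case using len below by simp
    next
      case (step j)
      let ?zs = "drop (Suc j) (map2 actE as us)"
      have F: "?F j (\<psi> us) = tau j (as ! j) (?F (Suc j) (\<psi> us))"
        using step(2) by (simp add: upt_conv_Cons)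
      have d: "drop j (map2 actE as us) = actE (as ! j) (us ! j) # ?zs"
        using step(2) len by (simp add: Cons_nth_drop_Suc[symmetric])
      have "cg ?s (\<psi> (take j us @ actE (as ! j) (us ! j) # ?zs)) (tau j (as ! j) (\<psi> (take j us @ us ! j # ?zs)))"
        using precochain_tau[OF \<psi>, of "take j us" ?zs "as ! j" "us ! j"] step(2) len by simp
      also have "take j us @ us ! j # ?zs = take (Suc j) us @ ?zs"
        using step(2) len by (simp add: take_Suc_conv_app_nth)
      also have "cg ?s (tau j (as ! j) (\<psi> (take (Suc j) us @ ?zs))) (tau j (as ! j) (?F (Suc j) (\<psi> us)))"
        using step below by (intro cg_tau) auto
      finally show ?case
        using step below_tau[of k "?F (Suc j) (\<psi> us)" j "as ! j"] unfolding d F by simp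
    qed
    from this[of 0] show ?thesis
      using multi_twist_tau[OF len(1) below, of us] by simp
  qed
  moreover have "cg ?s (\<psi> us) (signed_perm k \<pi> (\<psi> (map (\<lambda>i. us ! \<pi> i) [0..<k])))"
    if \<pi>: "\<pi> permutes {..<k}" and len: "length us = k" for \<pi> us
  proof -
    let ?us = "map (\<lambda>i. us ! \<pi> i) [0..<k]" and ?ps = "map (\<lambda>i. X (\<pi> i)) [0..<k]"
    have \<pi>_less: "\<pi> i < k" if "i < k" for i
      using permutes_in_image[OF \<pi>, of i] that by simp
    have u: "map (\<lambda>i. univ us ! \<pi> i) [0..<k] = zip ?ps (map const_mpoly ?us)"
      by (rule nth_equalityI) (simp_all add: len univ_simps \<pi>_less)
    have s: "sum_list ?ps = ?s"
      using sum.permute[OF \<pi>, of X]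
      by (simp add: interv_sum_list_conv_sum_set_nat atLeast0LessThan sigma_def comp_def)
    have h1: "cg ?s (pt \<psi> (univ us)) (\<psi> us)"
      using pt_const[OF \<psi>, of "map X [0..<k]" us] sub_below_id[OF below, of "(!) (map X [0..<k])" us]
      by (simp add: univ_def len sum_list_X)
    have h2: "cg ?s (pt \<psi> (map (\<lambda>i. univ us ! \<pi> i) [0..<k])) (sub (\<lambda>i. X (\<pi> i)) (\<psi> ?us))"
      using pt_const[OF \<psi>, of ?ps ?us] sub_below[OF below, of "(!) ?ps" "\<lambda>i. X (\<pi> i)" ?us]
      unfolding u s by simp
    have h3: "cg ?s (pt \<psi> (univ us)) (let v = pt \<psi> (map (\<lambda>i. univ us ! \<pi> i) [0..<k]) in if sign \<pi> = 1 then v else - v)"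
      using CE.alternating_permutes[OF pt_alternating[OF \<psi>] \<pi>, of "univ us"] univ_simps(3)[of us]
      by (simp only: cg_def len univ_simps(1) add_0 simp_thms)
    have "cg ?s (let v = pt \<psi> (map (\<lambda>i. univ us ! \<pi> i) [0..<k]) in if sign \<pi> = 1 then v else - v)
        (let v = sub (\<lambda>i. X (\<pi> i)) (\<psi> ?us) in if sign \<pi> = 1 then v else - v)"
      using h2 cg_uminus[OF h2] by (simp add: Let_def)
    from cg_trans[OF cg_sym[OF h1] cg_trans[OF h3 this]]
    have "cg ?s (\<psi> us) (let v = sub (\<lambda>i. X (\<pi> i)) (\<psi> ?us) in if sign \<pi> = 1 then v else - v)" .
    then show ?thesis by (simp add: signed_perm_eq[OF below])
  qed
  ultimately show ?thesis
    using precochainD(1,2)[OF \<psi>] unfolding cochain_mod_def by blast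
qed

text \<open>The rule for one slot is the simultaneous rule with the operator 1 in all other slots;
  an exchange of neighbours is a permutation of sign - 1.\<close>

theorem cochain_mod_precochain:
  assumes "cochain_mod k \<psi>"
  shows "precochain k \<psi>"
proof -
  let ?s = "sigma k"
  note c = assms[unfolded cochain_mod_def]
  have zero: "\<psi> us = 0" if "length us \<noteq> k" for us using c that by blast
  have below: "below k (\<psi> us)" for us using c by blast
  have add: "cg ?s (\<psi> (us[i := u + v])) (\<psi> (us[i := u]) + \<psi> (us[i := v]))" if "length us = k" "i < k" for us i u v
    using c that by blast
  have tw: "cg ?s (\<psi> (map2 actE as us)) (multi_twist dA actM as (\<psi> us))" if "length as = k" "length us = k" for as us
    using c that by blast
  have perm: "cg ?s (\<psi> us) (signed_perm k \<pi> (\<psi> (map (\<lambda>i. us ! \<pi> i) [0..<k])))"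
    if "\<pi> permutes {..<k}" "length us = k" for \<pi> us
    using c that by blast
  have "slot_additive ?s k \<psi>"
    unfolding slot_additive_def
  proof (intro allI impI)
    fix ys zs :: "'e list" and u v assume "length ys + length zs + 1 = k"
    then show "cg ?s (\<psi> (ys @ (u + v) # zs)) (\<psi> (ys @ u # zs) + \<psi> (ys @ v # zs))"
      using add[of "ys @ u # zs" "length ys" u v] by simp
  qed
  moreover have tau: "cg ?s (\<psi> (ys @ actE a u # zs)) (tau (length ys) a (\<psi> (ys @ u # zs)))"
    if len: "length ys + length zs + 1 = k" for ys zs a u
  proof -
    let ?i = "length ys" and ?us = "ys @ u # zs"
    let ?as = "(replicate k 1)[length ys := a]"
    have one: "map2 actE (replicate (length vs) 1) vs = vs" for vs
      by (induction vs) (simp_all add: E.act_one)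
    have as: "?as = replicate ?i 1 @ a # replicate (length zs) 1"
    proof -
      have k: "k = ?i + Suc (length zs)" using len by simp
      show ?thesis unfolding k replicate_add by (simp add: list_update_append)
    qed
    have "map2 actE ?as ?us = ys @ actE a u # zs"
      unfolding as by (simp add: one)
    moreover have "multi_twist dA actM ?as (\<psi> ?us) = tau ?i a (\<psi> ?us)"
    proof -
      have f: "foldr (\<lambda>j. tau j (?as ! j)) js q = q" if "?i \<notin> set js" "set js \<subseteq> {..<k}" for js q
        using that by (induction js) (auto simp: tau_one)
      have "[0..<?i + Suc (length zs)] = [0..<?i] @ [?i..<?i + Suc (length zs)]"
        by (rule upt_add_eq_append) simp
      then have "[0..<k] = [0..<?i] @ ?i # [Suc ?i..<k]"
        using len by (simp add: upt_conv_Cons flip: len del: upt_Suc)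
      moreover have "foldr (\<lambda>j. tau j (?as ! j)) [0..<?i] q = q" "foldr (\<lambda>j. tau j (?as ! j)) [Suc ?i..<k] q = q" for q
        by (rule f; use len in force)+
      ultimately show ?thesis
        using len by (simp add: multi_twist_tau[OF _ below] del: upt_Suc)
    qed
    ultimately show ?thesis using tw[of ?as ?us] len by simp
  qed
  moreover have "cg ?s (\<psi> (ys @ dE u # zs)) (- (X (length ys) \<bullet> \<psi> (ys @ u # zs)))"
    if len: "length ys + length zs + 1 = k" for ys zs u
    using tau[OF len, of "[:0, 1:]" u] by (simp only: dact_def tau_var)
  moreover have "cg ?s (\<psi> (ys @ scE a u # zs))
      (SM.Sop t (const_mpoly a) (sub (tshift (length ys) (X t)) (\<psi> (ys @ u # zs))))"
    if len: "length ys + length zs + 1 = k" and t: "k \<le> t" for ys zs a u t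
    using tau[OF len, of "[:a:]" u] tau_const[of t "\<psi> (ys @ u # zs)" "length ys" a] below t len by simp
  moreover have "cg ?s (\<psi> (ys @ u # v # zs))
      (- sub (\<lambda>j. X (transpose (length ys) (Suc (length ys)) j)) (\<psi> (ys @ v # u # zs)))"
    if len: "length ys + length zs + 2 = k" for ys zs u v
  proof -
    let ?n = "length ys" and ?us = "ys @ u # v # zs"
    let ?\<pi> = "transpose ?n (Suc ?n)"
    have "?\<pi> permutes {..<k}"
      using len by (intro permutes_swap_id) auto
    moreover have "map (\<lambda>i. ?us ! ?\<pi> i) [0..<k] = ys @ v # u # zs"
      using len by (intro nth_equalityI) (auto simp: transpose_def nth_append nth_Cons split: nat.split)
    ultimately show ?thesis
      using perm[of ?\<pi> ?us] len by (simp add: signed_perm_eq[OF below] sign_swap_id)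
  qed
  ultimately show ?thesis
    using zero below unfolding precochain_def by blast
qed

end

section \<open>Modules with carriers\<close>

lemma ring_of_class_simps [simp]:
  "carrier ring_of_class = UNIV" "x \<otimes>\<^bsub>ring_of_class\<^esub> y = x * y" "\<one>\<^bsub>ring_of_class\<^esub> = 1"
  "\<zero>\<^bsub>ring_of_class\<^esub> = 0" "x \<oplus>\<^bsub>ring_of_class\<^esub> y = x + y"
  by (simp_all add: ring_of_class_def)

lemma cring_ring_of_class: "cring (ring_of_class :: 'r::comm_ring_1 ring)"
proof (rule cringI)
  show "abelian_group (ring_of_class :: 'r ring)"
  proof (rule abelian_groupI)
    fix x :: 'r
    have "- x \<oplus>\<^bsub>ring_of_class\<^esub> x = \<zero>\<^bsub>ring_of_class\<^esub>" by simp
    then show "\<exists>y\<in>carrier ring_of_class. y \<oplus>\<^bsub>ring_of_class\<^esub> x = \<zero>\<^bsub>ring_of_class\<^esub>"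
      unfolding ring_of_class_simps by blast
  qed (simp_all add: algebra_simps)
  show "comm_monoid (ring_of_class :: 'r ring)"
    by (rule comm_monoidI) (simp_all add: algebra_simps)
qed (simp_all add: algebra_simps)

lemma linear_betweenI:
  assumes "\<And>x. x \<in> carrier V \<Longrightarrow> f x \<in> carrier W"
    and "\<And>x y. x \<in> carrier V \<Longrightarrow> y \<in> carrier V \<Longrightarrow> f (x \<oplus>\<^bsub>V\<^esub> y) = f x \<oplus>\<^bsub>W\<^esub> f y"
    and "\<And>c x. c \<in> carrier R \<Longrightarrow> x \<in> carrier V \<Longrightarrow> f (c \<odot>\<^bsub>V\<^esub> x) = c \<odot>\<^bsub>W\<^esub> f x"
  shows "linear_between R V W f"
  using assms by (auto simp: linear_between_def)

lemma linear_betweenD: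
  assumes "linear_between R V W f"
  shows "x \<in> carrier V \<Longrightarrow> f x \<in> carrier W"
    and "x \<in> carrier V \<Longrightarrow> y \<in> carrier V \<Longrightarrow> f (x \<oplus>\<^bsub>V\<^esub> y) = f x \<oplus>\<^bsub>W\<^esub> f y"
    and "c \<in> carrier R \<Longrightarrow> x \<in> carrier V \<Longrightarrow> f (c \<odot>\<^bsub>V\<^esub> x) = c \<odot>\<^bsub>W\<^esub> f x"
  using assms by (auto simp: linear_between_def)

lemma linear_between_comp:
  "linear_between R U V f \<Longrightarrow> linear_between R V W g \<Longrightarrow> linear_between R U W (\<lambda>x. g (f x))"
  by (rule linear_betweenI) (simp_all add: linear_betweenD)

lemma linear_between_zero:
  assumes "Module.module R V" "Module.module R W" "linear_between R V W f"
  shows "f \<zero>\<^bsub>V\<^esub> = \<zero>\<^bsub>W\<^esub>"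
proof -
  interpret V: Module.module R V by fact
  interpret W: Module.module R W by fact
  have "f \<zero>\<^bsub>V\<^esub> \<oplus>\<^bsub>W\<^esub> f \<zero>\<^bsub>V\<^esub> = f \<zero>\<^bsub>V\<^esub>"
    using linear_betweenD(2)[OF assms(3), of "\<zero>\<^bsub>V\<^esub>" "\<zero>\<^bsub>V\<^esub>"] by simp
  then show ?thesis
    using linear_betweenD(1)[OF assms(3), of "\<zero>\<^bsub>V\<^esub>"] by (metis V.zero_closed W.add.l_cancel_one')
qed

lemma linear_between_factor:
  assumes "linear_between R V W g" "carrier W = g ` carrier V" "linear_between R V U f"
    and "\<And>x. x \<in> carrier V \<Longrightarrow> h (g x) = f x"
    and "Module.module R V"
  shows "linear_between R W U h"
proof -
  interpret V: Module.module R V by fact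
  note g = linear_betweenD[OF assms(1)] and f = linear_betweenD[OF assms(3)]
  show ?thesis
  proof (rule linear_betweenI)
    fix x y c assume "x \<in> carrier W"
    then obtain x' where x: "x = g x'" "x' \<in> carrier V" using assms(2) by auto
    show "h x \<in> carrier U" using x by (simp add: assms(4) f)
    show "h (c \<odot>\<^bsub>W\<^esub> x) = c \<odot>\<^bsub>U\<^esub> h x" if "c \<in> carrier R"
      using x assms(4)[of "c \<odot>\<^bsub>V\<^esub> x'"] that by (simp add: assms(4) f g)
    assume "y \<in> carrier W"
    then obtain y' where y: "y = g y'" "y' \<in> carrier V" using assms(2) by auto
    show "h (x \<oplus>\<^bsub>W\<^esub> y) = h x \<oplus>\<^bsub>U\<^esub> h y"
      using x y assms(4)[of "x' \<oplus>\<^bsub>V\<^esub> y'"] by (simp add: assms(4) f g)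
  qed
qed

text \<open>The axioms are inherited by images, so quotient modules obtain them without computations
  with cosets.\<close>

lemma module_image:
  assumes "Module.module R V" "linear_between R V W f" "carrier W = f ` carrier V" "\<zero>\<^bsub>W\<^esub> = f \<zero>\<^bsub>V\<^esub>"
  shows "Module.module R W"
proof -
  interpret V: Module.module R V by fact
  note f = linear_betweenD[OF assms(2)]
  have f_add: "f x \<oplus>\<^bsub>W\<^esub> f y = f (x \<oplus>\<^bsub>V\<^esub> y)" if "x \<in> carrier V" "y \<in> carrier V" for x y
    using that f by simp
  have f_smult: "c \<odot>\<^bsub>W\<^esub> f x = f (c \<odot>\<^bsub>V\<^esub> x)" if "c \<in> carrier R" "x \<in> carrier V" for c x
    using that f by simp
  show ?thesis
  proof (rule moduleI[OF V.R.is_cring])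
    show "abelian_group W"
    proof (rule abelian_groupI)
      fix x assume "x \<in> carrier W"
      then obtain x' where x: "x = f x'" "x' \<in> carrier V" using assms(3) by auto
      then have "f (\<ominus>\<^bsub>V\<^esub> x') \<oplus>\<^bsub>W\<^esub> x = \<zero>\<^bsub>W\<^esub>" by (simp add: f_add assms(4) V.M.l_neg)
      then show "\<exists>y\<in>carrier W. y \<oplus>\<^bsub>W\<^esub> x = \<zero>\<^bsub>W\<^esub>" using f(1)[of "\<ominus>\<^bsub>V\<^esub> x'"] x by auto
    qed (auto simp: assms(3,4) f_add V.M.a_ac)
  qed (auto simp: assms(3) f_add f_smult V.smult_l_distr V.smult_r_distr V.smult_assoc1)
qed

lemma module_fun_module:
  assumes "Module.module R V" "\<And>f x. f \<in> S \<Longrightarrow> f x \<in> carrier V"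
    and "(\<lambda>_. \<zero>\<^bsub>V\<^esub>) \<in> S"
    and "\<And>f g. f \<in> S \<Longrightarrow> g \<in> S \<Longrightarrow> (\<lambda>x. f x \<oplus>\<^bsub>V\<^esub> g x) \<in> S"
    and "\<And>c f. c \<in> carrier R \<Longrightarrow> f \<in> S \<Longrightarrow> (\<lambda>x. c \<odot>\<^bsub>V\<^esub> f x) \<in> S"
  shows "Module.module R (fun_module S V)"
proof -
  interpret V: Module.module R V by fact
  show ?thesis
  proof (rule moduleI[OF V.R.is_cring])
    show "abelian_group (fun_module S V)"
    proof (rule abelian_groupI)
      fix f assume f: "f \<in> carrier (fun_module S V)"
      \<comment> \<open>The negative is written as a scalar multiple because closure of S is assumed
        for scalar multiples and sums.\<close>
      let ?g = "\<lambda>x. (\<ominus>\<^bsub>R\<^esub> \<one>\<^bsub>R\<^esub>) \<odot>\<^bsub>V\<^esub> f x"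
      have "?g \<in> carrier (fun_module S V)" using f assms(5) by (simp add: fun_module_def)
      moreover have "?g \<oplus>\<^bsub>fun_module S V\<^esub> f = \<zero>\<^bsub>fun_module S V\<^esub>"
        using f assms(2) by (auto simp: fun_module_def V.smult_l_minus V.M.l_neg)
      ultimately show "\<exists>y\<in>carrier (fun_module S V). y \<oplus>\<^bsub>fun_module S V\<^esub> f = \<zero>\<^bsub>fun_module S V\<^esub>" by blast
    qed (auto simp: fun_module_def assms V.M.a_ac)
  qed (auto simp: fun_module_def assms V.smult_l_distr V.smult_r_distr V.smult_assoc1)
qed

text \<open>The recursion of Horner's scheme replaces the finite sum of the definition and allows
  induction on polynomials.\<close>

lemma poly_module_smult:
  assumes "Module.module (ring_of_class :: 'f::comm_ring_1 ring) V" "linear_between (ring_of_class :: 'f ring) V V T"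
    and "x \<in> carrier V"
  shows "p \<odot>\<^bsub>poly_module V T\<^esub> x \<in> carrier V"
    and "pCons a p \<odot>\<^bsub>poly_module V T\<^esub> x = a \<odot>\<^bsub>V\<^esub> x \<oplus>\<^bsub>V\<^esub> p \<odot>\<^bsub>poly_module V T\<^esub> T x"
    and "0 \<odot>\<^bsub>poly_module V T\<^esub> x = \<zero>\<^bsub>V\<^esub>"
proof -
  interpret V: Module.module "ring_of_class :: 'f ring" V by fact
  have T: "(T ^^ i) y \<in> carrier V" if "y \<in> carrier V" for i y
    using that by (induction i) (auto simp: linear_betweenD[OF assms(2)])
  have Tx: "T x \<in> carrier V" using T[OF assms(3), of 1] by simp
  have summand: "(\<lambda>i. coeff q i \<odot>\<^bsub>V\<^esub> (T ^^ i) y) \<in> I \<rightarrow> carrier V" if "y \<in> carrier V" for q I y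
    using T[OF that] V.smult_closed by auto
  show "p \<odot>\<^bsub>poly_module V T\<^esub> x \<in> carrier V"
    unfolding poly_module_def by (simp add: V.finsum_closed[OF summand[OF assms(3)]])
  have zero: "0 \<odot>\<^bsub>poly_module V T\<^esub> y = \<zero>\<^bsub>V\<^esub>" if "y \<in> carrier V" for y
    using V.smult_l_null[OF that] that by (simp add: poly_module_def)
  show "0 \<odot>\<^bsub>poly_module V T\<^esub> x = \<zero>\<^bsub>V\<^esub>"
    using zero assms(3) .
  show "pCons a p \<odot>\<^bsub>poly_module V T\<^esub> x = a \<odot>\<^bsub>V\<^esub> x \<oplus>\<^bsub>V\<^esub> p \<odot>\<^bsub>poly_module V T\<^esub> T x"
  proof (cases "p = 0")
    case True
    then show ?thesis
      unfolding True zero[OF Tx] using V.smult_closed[OF _ assms(3), of a] assms(3)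
      by (cases "a = 0") (auto simp: poly_module_def)
  next
    case False
    have "(\<Oplus>\<^bsub>V\<^esub>i\<in>{..Suc (degree p)}. coeff (pCons a p) i \<odot>\<^bsub>V\<^esub> (T ^^ i) x) =
        (\<Oplus>\<^bsub>V\<^esub>i\<in>{..degree p}. coeff p i \<odot>\<^bsub>V\<^esub> (T ^^ i) (T x)) \<oplus>\<^bsub>V\<^esub> a \<odot>\<^bsub>V\<^esub> x"
      using V.finsum_Suc2[OF summand[OF assms(3)], of "pCons a p" "degree p"] by (simp add: funpow_swap1)
    then show ?thesis
      using False V.finsum_closed[OF summand[OF Tx]] V.smult_closed[OF _ assms(3), of a]
      by (simp add: poly_module_def V.M.a_comm)
  qed
qed

lemma module_poly_module:
  assumes "Module.module (ring_of_class :: 'f::comm_ring_1 ring) V" "linear_between (ring_of_class :: 'f ring) V V T"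
  shows "Module.module (ring_of_class :: 'f poly ring) (poly_module V T)"
proof -
  interpret V: Module.module "ring_of_class :: 'f ring" V by fact
  note [simp] = poly_module_smult[OF assms]
  note T = linear_betweenD[OF assms(2)]
  have [simp]: "T x \<in> carrier V" if "x \<in> carrier V" for x using T(1) that .
  have [simp]: "a \<odot>\<^bsub>V\<^esub> x \<in> carrier V" if "x \<in> carrier V" for a x using V.smult_closed[OF _ that] by simp
  have add_left: "(p + q) \<odot>\<^bsub>poly_module V T\<^esub> x = p \<odot>\<^bsub>poly_module V T\<^esub> x \<oplus>\<^bsub>V\<^esub> q \<odot>\<^bsub>poly_module V T\<^esub> x"
    if "x \<in> carrier V" for p q x
    using that
  proof (induction p arbitrary: q x)
    case 0
    then show ?case by simp
  next
    case (pCons a p)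
    obtain b r where q: "q = pCons b r" by (cases q)
    show ?case
      using pCons V.smult_l_distr[of a b x] by (simp add: q V.M.a_ac)
  qed
  have add_right: "p \<odot>\<^bsub>poly_module V T\<^esub> (x \<oplus>\<^bsub>V\<^esub> y) = p \<odot>\<^bsub>poly_module V T\<^esub> x \<oplus>\<^bsub>V\<^esub> p \<odot>\<^bsub>poly_module V T\<^esub> y"
    if "x \<in> carrier V" "y \<in> carrier V" for p x y
    using that
  proof (induction p arbitrary: x y)
    case (pCons a p)
    then show ?case
      using V.smult_r_distr[of a x y] by (simp add: T(2) V.M.a_ac)
  qed simp
  have T_smult: "p \<odot>\<^bsub>poly_module V T\<^esub> T x = T (p \<odot>\<^bsub>poly_module V T\<^esub> x)" if "x \<in> carrier V" for p x
    using that
  proof (induction p arbitrary: x)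
    case 0
    then show ?case using linear_between_zero[OF assms(1) assms(1) assms(2)] by simp
  next
    case (pCons a p)
    then show ?case using T(3)[of a x] by (simp add: T(2))
  qed
  have smult: "Polynomial.smult a p \<odot>\<^bsub>poly_module V T\<^esub> x = a \<odot>\<^bsub>V\<^esub> (p \<odot>\<^bsub>poly_module V T\<^esub> x)"
    if "x \<in> carrier V" for a p x
    using that
  proof (induction p arbitrary: x)
    case 0
    then show ?case using V.smult_r_null[of a] by simp
  next
    case (pCons b p)
    then show ?case
      using V.smult_assoc1[of a b x] V.smult_r_distr[of a] by simp
  qed
  have mult: "(p * q) \<odot>\<^bsub>poly_module V T\<^esub> x = p \<odot>\<^bsub>poly_module V T\<^esub> (q \<odot>\<^bsub>poly_module V T\<^esub> x)"
    if "x \<in> carrier V" for p q x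
    using that
  proof (induction p arbitrary: x)
    case 0
    then show ?case by simp
  next
    case (pCons a p)
    then show ?case
      using V.smult_l_null[of x] by (simp add: add_left smult T_smult)
  qed
  have one: "1 \<odot>\<^bsub>poly_module V T\<^esub> x = x" if "x \<in> carrier V" for x
    using that V.smult_one[of x] by (simp add: one_pCons)
  have sel: "carrier (poly_module V T) = carrier V" "add (poly_module V T) = add V" "\<zero>\<^bsub>poly_module V T\<^esub> = \<zero>\<^bsub>V\<^esub>"
    by (simp_all add: poly_module_def)
  show ?thesis
  proof (rule moduleI[OF cring_ring_of_class])
    show "abelian_group (poly_module V T)"
    proof (rule abelian_groupI)
      fix x assume "x \<in> carrier (poly_module V T)"
      then show "\<exists>y\<in>carrier (poly_module V T). y \<oplus>\<^bsub>poly_module V T\<^esub> x = \<zero>\<^bsub>poly_module V T\<^esub>"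
        unfolding sel using V.M.l_neg V.M.a_inv_closed by blast
    qed (auto simp: sel V.M.a_ac)
  qed (simp_all add: sel add_left add_right mult one)
qed

section \<open>Quotients\<close>

lemma abelian_subgroup_submodule:
  assumes "Module.module R V" "submodule N R V"
  shows "abelian_subgroup N V"
proof -
  interpret V: Module.module R V by fact
  show ?thesis
    by (rule abelian_subgroupI3)
      (use assms(2) in \<open>auto simp: submodule_def additive_subgroup_def intro: module.axioms(2)[OF assms(1)]\<close>)
qed

lemma coset_eq_iff:
  assumes "Module.module R V" "submodule N R V" "x \<in> carrier V" "y \<in> carrier V"
  shows "N +>\<^bsub>V\<^esub> x = N +>\<^bsub>V\<^esub> y \<longleftrightarrow> x \<oplus>\<^bsub>V\<^esub> \<ominus>\<^bsub>V\<^esub> y \<in> N"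
proof -
  interpret V: Module.module R V by fact
  interpret N: abelian_subgroup N V by (rule abelian_subgroup_submodule[OF assms(1,2)])
  have "N +>\<^bsub>V\<^esub> x = N +>\<^bsub>V\<^esub> y \<longleftrightarrow> x \<in> N +>\<^bsub>V\<^esub> y"
    using N.a_repr_independence'[OF _ assms(4), of x] N.a_rcos_self[OF assms(3)] by blast
  then show ?thesis
    unfolding N.a_rcos_module[OF assms(4,3)] .
qed

lemma coset_map_class:
  assumes "Module.module R V" "submodule N R V" "x \<in> carrier V"
    and "\<And>y. y \<in> carrier V \<Longrightarrow> N +>\<^bsub>V\<^esub> y = N +>\<^bsub>V\<^esub> x \<Longrightarrow> N' +>\<^bsub>W\<^esub> f y = N' +>\<^bsub>W\<^esub> f x"
  shows "coset_map W N' f (N +>\<^bsub>V\<^esub> x) = N' +>\<^bsub>W\<^esub> f x"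
proof -
  interpret V: Module.module R V by fact
  interpret N: abelian_subgroup N V by (rule abelian_subgroup_submodule[OF assms(1,2)])
  have "N' +>\<^bsub>W\<^esub> f y = N' +>\<^bsub>W\<^esub> f x" if "y \<in> N +>\<^bsub>V\<^esub> x" for y
    using N.a_elemrcos_carrier[OF assms(3) that] N.a_repr_independence'[OF that assms(3)]
    by (intro assms(4)) auto
  then show ?thesis
    using N.a_rcos_self[OF assms(3)] unfolding coset_map_def by blast
qed

lemma linear_coset_eq:
  assumes "Module.module R V" "submodule N R V" "Module.module R W" "submodule N' R W"
    and "linear_between R V W f" "f ` N \<subseteq> N'"
    and "x \<in> carrier V" "y \<in> carrier V" "N +>\<^bsub>V\<^esub> x = N +>\<^bsub>V\<^esub> y"
  shows "N' +>\<^bsub>W\<^esub> f x = N' +>\<^bsub>W\<^esub> f y"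
proof -
  interpret V: Module.module R V by fact
  interpret W: Module.module R W by fact
  note f = linear_betweenD[OF assms(5)]
  have "f (\<ominus>\<^bsub>V\<^esub> y) \<oplus>\<^bsub>W\<^esub> f y = \<zero>\<^bsub>W\<^esub>"
    using f(2)[of "\<ominus>\<^bsub>V\<^esub> y" y] assms(8) linear_between_zero[OF assms(1,3,5)] by (simp add: V.M.l_neg)
  then have "f (\<ominus>\<^bsub>V\<^esub> y) = \<ominus>\<^bsub>W\<^esub> f y"
    using f(1) assms(8) W.M.minus_equality by simp
  moreover have "f (x \<oplus>\<^bsub>V\<^esub> \<ominus>\<^bsub>V\<^esub> y) \<in> N'"
    using coset_eq_iff[OF assms(1,2,7,8)] assms(6,9) by blast
  ultimately have "f x \<oplus>\<^bsub>W\<^esub> \<ominus>\<^bsub>W\<^esub> f y \<in> N'"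
    using f(2)[of x "\<ominus>\<^bsub>V\<^esub> y"] assms(7,8) by simp
  then show ?thesis
    unfolding coset_eq_iff[OF assms(3,4) f(1)[OF assms(7)] f(1)[OF assms(8)]] .
qed

lemma quotient_module_smult:
  fixes R :: "'s ring"
  assumes "Module.module R V" "submodule N R V" "c \<in> carrier R" "x \<in> carrier V"
  shows "c \<odot>\<^bsub>quotient_module V N\<^esub> (N +>\<^bsub>V\<^esub> x) = N +>\<^bsub>V\<^esub> (c \<odot>\<^bsub>V\<^esub> x)"
proof -
  interpret V: Module.module R V by fact
  have "linear_between R V V (\<lambda>x. c \<odot>\<^bsub>V\<^esub> x)"
    using assms(3) V.R.m_comm[OF assms(3)]
    by (intro linear_betweenI) (auto simp: V.smult_r_distr simp flip: V.smult_assoc1)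
  from linear_coset_eq[OF assms(1,2,1,2) this]
  have "N +>\<^bsub>V\<^esub> (c \<odot>\<^bsub>V\<^esub> y) = N +>\<^bsub>V\<^esub> (c \<odot>\<^bsub>V\<^esub> x)"
    if "y \<in> carrier V" "N +>\<^bsub>V\<^esub> y = N +>\<^bsub>V\<^esub> x" for y
    using that assms(4) submodule.smult_closed[OF assms(2,3)] by blast
  from coset_map_class[where f = "\<lambda>x. c \<odot>\<^bsub>V\<^esub> x" and W = V and N' = N, OF assms(1,2,4) this] show ?thesis
    by (simp add: coset_map_def quotient_module_def)
qed

lemma carrier_quotient_module: "carrier (quotient_module V N) = (\<lambda>x. N +>\<^bsub>V\<^esub> x) ` carrier V"
  by (auto simp: quotient_module_def A_RCOSETS_def')

lemma linear_between_class:
  fixes R :: "'s ring"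
  assumes "Module.module R V" "submodule N R V"
  shows "linear_between R V (quotient_module V N) (\<lambda>x. N +>\<^bsub>V\<^esub> x)"
proof -
  interpret N: abelian_subgroup N V by (rule abelian_subgroup_submodule[OF assms])
  show ?thesis
    by (rule linear_betweenI)
      (simp_all add: carrier_quotient_module quotient_module_smult[OF assms], simp add: quotient_module_def N.a_rcos_sum)
qed

lemma quotient_module_zero:
  assumes "Module.module R V" "submodule N R V"
  shows "\<zero>\<^bsub>quotient_module V N\<^esub> = N +>\<^bsub>V\<^esub> \<zero>\<^bsub>V\<^esub>"
proof -
  interpret N: abelian_subgroup N V by (rule abelian_subgroup_submodule[OF assms])
  show ?thesis using N.a_rcos_const[of "\<zero>\<^bsub>V\<^esub>"] by (simp add: quotient_module_def)
qed

lemma module_quotient_module: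
  fixes R :: "'s ring"
  assumes "Module.module R V" "submodule N R V"
  shows "Module.module R (quotient_module V N)"
  by (rule module_image[OF assms(1) linear_between_class[OF assms] carrier_quotient_module quotient_module_zero[OF assms]])

lemma coset_map_linear:
  fixes R :: "'s ring"
  assumes "Module.module R V" "submodule N R V" "Module.module R W" "submodule N' R W"
    and "linear_between R V W f" "f ` N \<subseteq> N'"
  shows "x \<in> carrier V \<Longrightarrow> coset_map W N' f (N +>\<^bsub>V\<^esub> x) = N' +>\<^bsub>W\<^esub> f x"
    and "linear_between R (quotient_module V N) (quotient_module W N') (coset_map W N' f)"
proof -
  show eq: "coset_map W N' f (N +>\<^bsub>V\<^esub> x) = N' +>\<^bsub>W\<^esub> f x" if "x \<in> carrier V" for x
    by (rule coset_map_class[OF assms(1,2) that]) (rule linear_coset_eq[OF assms _ that])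
  show "linear_between R (quotient_module V N) (quotient_module W N') (coset_map W N' f)"
    by (rule linear_between_factor[OF linear_between_class[OF assms(1,2)] carrier_quotient_module
          linear_between_comp[OF assms(5) linear_between_class[OF assms(3,4)]] eq assms(1)])
qed

lemma submodule_linear_image:
  assumes "Module.module R V" "Module.module R W" "linear_between R V W f"
  shows "submodule (f ` carrier V) R W"
proof -
  interpret V: Module.module R V by fact
  interpret W: Module.module R W by fact
  note f = linear_betweenD[OF assms(3)]
  have neg: "\<ominus>\<^bsub>W\<^esub> f x = f (\<ominus>\<^bsub>V\<^esub> x)" if "x \<in> carrier V" for x
  proof -
    have "f (\<ominus>\<^bsub>V\<^esub> x) \<oplus>\<^bsub>W\<^esub> f x = \<zero>\<^bsub>W\<^esub>"
      using f(2)[of "\<ominus>\<^bsub>V\<^esub> x" x] that linear_between_zero[OF assms] by (simp add: V.M.l_neg)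
    then show ?thesis using f(1) that W.M.minus_equality by simp
  qed
  show ?thesis
  proof (rule W.submoduleI)
    show "\<zero>\<^bsub>W\<^esub> \<in> f ` carrier V"
      using linear_between_zero[OF assms] V.M.zero_closed by (metis imageI)
  qed (auto simp: f(1) neg f(2)[symmetric] f(3)[symmetric])
qed

section \<open>Quotient complexes\<close>

lemma cochain_complexD:
  assumes "cochain_complex R C d"
  shows "Module.module R (C k)" "linear_between R (C k) (C (Suc k)) (d k)"
    and "x \<in> carrier (C k) \<Longrightarrow> d (Suc k) (d k x) = \<zero>\<^bsub>C (Suc (Suc k))\<^esub>"
  using assms by (auto simp: cochain_complex_def)

lemma quotient_complex:
  assumes C: "cochain_complex R C d" and N: "\<And>k. submodule (N k) R (C k)" and d: "\<And>k. d k ` N k \<subseteq> N (Suc k)"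
  shows "cochain_complex R (\<lambda>k. quotient_module (C k) (N k)) (\<lambda>k. coset_map (C (Suc k)) (N (Suc k)) (d k))"
    and "x \<in> carrier (C k) \<Longrightarrow> coset_map (C (Suc k)) (N (Suc k)) (d k) (N k +>\<^bsub>C k\<^esub> x) = N (Suc k) +>\<^bsub>C (Suc k)\<^esub> d k x"
proof -
  note D = cochain_complexD[OF C]
  show cls: "coset_map (C (Suc k)) (N (Suc k)) (d k) (N k +>\<^bsub>C k\<^esub> x) = N (Suc k) +>\<^bsub>C (Suc k)\<^esub> d k x"
    if "x \<in> carrier (C k)" for k x
    by (rule coset_map_linear(1)[OF D(1) N D(1) N D(2) d that])
  show "cochain_complex R (\<lambda>k. quotient_module (C k) (N k)) (\<lambda>k. coset_map (C (Suc k)) (N (Suc k)) (d k))"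
    unfolding cochain_complex_def
  proof (intro allI conjI ballI)
    fix k
    show "Module.module R (quotient_module (C k) (N k))" by (rule module_quotient_module[OF D(1) N])
    show "linear_between R (quotient_module (C k) (N k)) (quotient_module (C (Suc k)) (N (Suc k)))
        (coset_map (C (Suc k)) (N (Suc k)) (d k))"
      by (rule coset_map_linear(2)[OF D(1) N D(1) N D(2) d])
    fix X assume "X \<in> carrier (quotient_module (C k) (N k))"
    then obtain x where x: "X = N k +>\<^bsub>C k\<^esub> x" "x \<in> carrier (C k)" by (auto simp: carrier_quotient_module)
    then show "coset_map (C (Suc (Suc k))) (N (Suc (Suc k))) (d (Suc k)) (coset_map (C (Suc k)) (N (Suc k)) (d k) X) =
        \<zero>\<^bsub>quotient_module (C (Suc (Suc k))) (N (Suc (Suc k)))\<^esub>"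
      using linear_betweenD(1)[OF D(2)] by (simp add: cls D(3) quotient_module_zero[OF D(1) N])
  qed
qed

text \<open>Since N is the kernel of f, two elements have the same image exactly if their cosets
  agree. One direction makes the induced map well defined, the other makes it injective.\<close>

lemma quotient_morphism:
  assumes f: "complex_morphism R C d C' d' f" and N: "\<And>k. submodule (N k) R (C k)" and d: "\<And>k. d k ` N k \<subseteq> N (Suc k)"
    and ker: "\<And>k. N k = {x \<in> carrier (C k). f k x = \<zero>\<^bsub>C' k\<^esub>}"
  defines "Q \<equiv> \<lambda>k. quotient_module (C k) (N k)" and "g \<equiv> \<lambda>k X. the_elem (f k ` X)"
  shows "complex_morphism R Q (\<lambda>k. coset_map (C (Suc k)) (N (Suc k)) (d k)) C' d' g"
    and "x \<in> carrier (C k) \<Longrightarrow> g k (N k +>\<^bsub>C k\<^esub> x) = f k x"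
    and "inj_on (g k) (carrier (Q k))"
    and "g k ` carrier (Q k) = f k ` carrier (C k)"
proof -
  have C: "cochain_complex R C d" and C': "cochain_complex R C' d'"
    and f_lin: "\<And>k. linear_between R (C k) (C' k) (f k)"
    and f_d: "\<And>k x. x \<in> carrier (C k) \<Longrightarrow> f (Suc k) (d k x) = d' k (f k x)"
    using f by (auto simp: complex_morphism_def)
  note D = cochain_complexD[OF C] and D' = cochain_complexD[OF C']
  note qc = quotient_complex[OF C N d]
  have eq_iff: "f k x = f k y \<longleftrightarrow> N k +>\<^bsub>C k\<^esub> x = N k +>\<^bsub>C k\<^esub> y"
    if x: "x \<in> carrier (C k)" and y: "y \<in> carrier (C k)" for k x y
  proof -
    interpret V: Module.module R "C k" by (rule D(1))
    interpret W: Module.module R "C' k" by (rule D'(1))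
    note fk = linear_betweenD[OF f_lin[of k]]
    have "f k (x \<oplus>\<^bsub>C k\<^esub> \<ominus>\<^bsub>C k\<^esub> y) \<oplus>\<^bsub>C' k\<^esub> f k y = f k x"
      using x y by (simp add: fk(2)[symmetric] V.M.a_assoc V.M.l_neg)
    moreover have "f k (x \<oplus>\<^bsub>C k\<^esub> \<ominus>\<^bsub>C k\<^esub> y) \<in> carrier (C' k)" "f k y \<in> carrier (C' k)"
      using x y by (auto intro!: fk(1))
    ultimately have "f k x = f k y \<longleftrightarrow> f k (x \<oplus>\<^bsub>C k\<^esub> \<ominus>\<^bsub>C k\<^esub> y) = \<zero>\<^bsub>C' k\<^esub>"
      using W.M.add.r_cancel_one[of "f k y" "f k (x \<oplus>\<^bsub>C k\<^esub> \<ominus>\<^bsub>C k\<^esub> y)"] by simp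
    moreover have "x \<oplus>\<^bsub>C k\<^esub> \<ominus>\<^bsub>C k\<^esub> y \<in> N k \<longleftrightarrow> f k (x \<oplus>\<^bsub>C k\<^esub> \<ominus>\<^bsub>C k\<^esub> y) = \<zero>\<^bsub>C' k\<^esub>"
      using x y by (simp add: ker)
    ultimately show ?thesis
      unfolding coset_eq_iff[OF D(1) N x y] by simp
  qed
  show g: "g k (N k +>\<^bsub>C k\<^esub> x) = f k x" if x: "x \<in> carrier (C k)" for k x
  proof -
    interpret ab: abelian_subgroup "N k" "C k" by (rule abelian_subgroup_submodule[OF D(1) N])
    have "f k y = f k x" if "y \<in> N k +>\<^bsub>C k\<^esub> x" for y
      using eq_iff[OF ab.a_elemrcos_carrier[OF x that] x] ab.a_repr_independence'[OF that x] by simp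
    then have "f k ` (N k +>\<^bsub>C k\<^esub> x) = {f k x}"
      using ab.a_rcos_self[OF x] by blast
    then show ?thesis by (simp add: g_def)
  qed
  show "g k ` carrier (Q k) = f k ` carrier (C k)"
    unfolding Q_def carrier_quotient_module image_image using g by (rule image_cong[OF refl])
  show "inj_on (g k) (carrier (Q k))"
    unfolding Q_def carrier_quotient_module by (rule inj_onI) (auto simp: g eq_iff)
  show "complex_morphism R Q (\<lambda>k. coset_map (C (Suc k)) (N (Suc k)) (d k)) C' d' g"
    unfolding complex_morphism_def
  proof (intro conjI allI ballI)
    show "cochain_complex R Q (\<lambda>k. coset_map (C (Suc k)) (N (Suc k)) (d k))" unfolding Q_def by (rule qc(1))
    show "cochain_complex R C' d'" by (rule C')
    fix k
    show "linear_between R (Q k) (C' k) (g k)"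
      unfolding Q_def
      by (rule linear_between_factor[OF linear_between_class[OF D(1) N] carrier_quotient_module f_lin g D(1)])
    fix X assume "X \<in> carrier (Q k)"
    then obtain x where x: "X = N k +>\<^bsub>C k\<^esub> x" "x \<in> carrier (C k)" by (auto simp: Q_def carrier_quotient_module)
    then show "g (Suc k) (coset_map (C (Suc k)) (N (Suc k)) (d k) X) = d' k (g k X)"
      using linear_betweenD(1)[OF D(2)] by (simp add: qc(2) g f_d)
  qed
qed

lemma iterate_uminus_add: "(uminus ^^ n) (v + w) = (uminus ^^ n) v + (uminus ^^ n) w" for v w :: "'v::ab_group_add"
  by (induction n) simp_all

section \<open>Comparison of basic and reduced cochains\<close>

context lie_conformal_algebroid_module
begin

interpretation B: algebroid_cochains sA dA actE br anchor actM lact False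
  by unfold_locales

interpretation R: algebroid_cochains sA dA actE br anchor actM lact True
  by unfold_locales

lemma B_cg: "B.cg s v w \<longleftrightarrow> v = w"
  by (simp add: B.cg_def B.N_T)

lemma B_precochain_iff:
  "B.precochain k \<psi> \<longleftrightarrow>
     (\<forall>us. length us \<noteq> k \<longrightarrow> \<psi> us = 0) \<and>
     (\<forall>us. below k (\<psi> us)) \<and>
     (\<forall>ys zs u v. length ys + length zs + 1 = k \<longrightarrow> \<psi> (ys @ (u + v) # zs) = \<psi> (ys @ u # zs) + \<psi> (ys @ v # zs)) \<and>
     (\<forall>ys zs u. length ys + length zs + 1 = k \<longrightarrow> \<psi> (ys @ dE u # zs) = - (X (length ys) \<bullet> \<psi> (ys @ u # zs))) \<and>
     (\<forall>ys zs a u t. length ys + length zs + 1 = k \<and> k \<le> t \<longrightarrow>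
        \<psi> (ys @ scE a u # zs) = SM.Sop t (const_mpoly a) (sub (tshift (length ys) (X t)) (\<psi> (ys @ u # zs)))) \<and>
     (\<forall>ys zs u v. length ys + length zs + 2 = k \<longrightarrow>
        \<psi> (ys @ u # v # zs) =
          - sub (\<lambda>j. X (transpose (length ys) (Suc (length ys)) j)) (\<psi> (ys @ v # u # zs)))"
  unfolding B.precochain_def B.slot_additive_def B_cg ..

lemma sub_tshift_sigma: "i < k \<Longrightarrow> sub (tshift i (X t)) (sigma k) = sigma k + X t"
proof -
  assume "i < k"
  have "sub (tshift i (X t)) (sigma k) = (\<Sum>j<k. X j + (if j = i then X t else 0))"
    unfolding sub_sigma by (intro sum.cong) (auto simp: tshift_def)
  then show ?thesis using \<open>i < k\<close> by (simp add: sum.distrib sigma_def)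
qed

lemma sub_permutes_sigma: "\<pi> permutes {..<k} \<Longrightarrow> sub (\<lambda>j. X (\<pi> j)) (sigma k) = sigma k"
  using sum.permute[of \<pi> "{..<k}" X] unfolding sub_sigma by (simp add: sigma_def comp_def)

lemma tfree_sigma: "k \<le> t \<Longrightarrow> tfree t (sigma k)"
  unfolding sigma_def by (intro tfree_sum tfree_X) auto

lemma T_twist_const:
  "i < k \<Longrightarrow> k \<le> t \<Longrightarrow> SM.Sop t \<alpha> (sub (tshift i (X t)) (T (sigma k) w)) = T (sigma k) (SM.Sop t \<alpha> (sub (tshift i (X t)) w))"
  unfolding T_sub[symmetric] by (simp add: sub_tshift_sigma T_Sop[OF tfree_sigma])

lemma T_permutes:
  "\<pi> permutes {..<k} \<Longrightarrow> sub (\<lambda>j. X (\<pi> j)) (T (sigma k) w) = T (sigma k) (sub (\<lambda>j. X (\<pi> j)) w)"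
  unfolding T_sub[symmetric] by (simp add: sub_permutes_sigma)

lemma transpose_Suc_permutes: "n + m + 2 = k \<Longrightarrow> transpose n (Suc n) permutes {..<k}"
  by (rule permutes_swap_id) auto

section \<open>Total derivatives of basic cochains\<close>

lemma B_precochain_T:
  assumes "B.precochain k \<psi>"
  shows "B.precochain k (\<lambda>us. T (sigma k) (\<psi> us))"
proof -
  note c = assms[unfolded B_precochain_iff]
  have 1: "T (sigma k) (\<psi> us) = 0" if "length us \<noteq> k" for us
    using c that by simp
  have 2: "below k (T (sigma k) (\<psi> us))" for us
    by (rule below_T) (use c in blast)
  have 3: "T (sigma k) (\<psi> (ys @ (u + v) # zs)) = T (sigma k) (\<psi> (ys @ u # zs)) + T (sigma k) (\<psi> (ys @ v # zs))"
    if "length ys + length zs + 1 = k" for ys zs u v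
    unfolding add_map_add[OF add_map_T, symmetric] by (rule arg_cong) (use c that in blast)
  have 4: "T (sigma k) (\<psi> (ys @ dE u # zs)) = - (X (length ys) \<bullet> T (sigma k) (\<psi> (ys @ u # zs)))"
    if "length ys + length zs + 1 = k" for ys zs u
    unfolding T_ract[symmetric] add_map_uminus[OF add_map_T, symmetric] by (rule arg_cong) (use c that in blast)
  have 5: "T (sigma k) (\<psi> (ys @ scE a u # zs)) =
      SM.Sop t (const_mpoly a) (sub (tshift (length ys) (X t)) (T (sigma k) (\<psi> (ys @ u # zs))))"
    if "length ys + length zs + 1 = k" "k \<le> t" for ys zs a u t
  proof -
    have "length ys < k" using that by simp
    show ?thesis
      unfolding T_twist_const[OF \<open>length ys < k\<close> that(2)] by (rule arg_cong) (use c that in blast)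
  qed
  have 6: "T (sigma k) (\<psi> (ys @ u # v # zs)) =
      - sub (\<lambda>j. X (transpose (length ys) (Suc (length ys)) j)) (T (sigma k) (\<psi> (ys @ v # u # zs)))"
    if "length ys + length zs + 2 = k" for ys zs u v
    unfolding T_permutes[OF transpose_Suc_permutes[OF that]] add_map_uminus[OF add_map_T, symmetric]
    by (rule arg_cong) (use c that in blast)
  show ?thesis
    unfolding B_precochain_iff using 1 2 3 4 5 6 by blast
qed

text \<open>Every operation in the cochain conditions commutes with T, so both sides of each
  condition carry a T that injectivity cancels.\<close>

lemma B_precochain_T_imp:
  assumes "0 < k" "B.precochain k (\<lambda>us. T (sigma k) (\<psi> us))"
    and "\<And>us. length us \<noteq> k \<Longrightarrow> \<psi> us = 0" "\<And>us. below k (\<psi> us)"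
  shows "B.precochain k \<psi>"
proof -
  note c = assms(2)[unfolded B_precochain_iff]
  note inj = T_inj[OF assms(1)]
  have 3: "\<psi> (ys @ (u + v) # zs) = \<psi> (ys @ u # zs) + \<psi> (ys @ v # zs)"
    if "length ys + length zs + 1 = k" for ys zs u v
    by (rule inj, unfold add_map_add[OF add_map_T]) (use c that in blast)
  have 4: "\<psi> (ys @ dE u # zs) = - (X (length ys) \<bullet> \<psi> (ys @ u # zs))"
    if "length ys + length zs + 1 = k" for ys zs u
    by (rule inj, unfold add_map_uminus[OF add_map_T] T_ract) (use c that in blast)
  have 5: "\<psi> (ys @ scE a u # zs) = SM.Sop t (const_mpoly a) (sub (tshift (length ys) (X t)) (\<psi> (ys @ u # zs)))"
    if "length ys + length zs + 1 = k" "k \<le> t" for ys zs a u t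
  proof -
    have "length ys < k" using that by simp
    show ?thesis
      by (rule inj, unfold T_twist_const[OF \<open>length ys < k\<close> that(2), symmetric]) (use c that in blast)
  qed
  have 6: "\<psi> (ys @ u # v # zs) = - sub (\<lambda>j. X (transpose (length ys) (Suc (length ys)) j)) (\<psi> (ys @ v # u # zs))"
    if "length ys + length zs + 2 = k" for ys zs u v
    by (rule inj, unfold add_map_uminus[OF add_map_T] T_permutes[OF transpose_Suc_permutes[OF that], symmetric])
      (use c that in blast)
  show ?thesis
    unfolding B_precochain_iff using assms(3,4) 3 4 5 6 by blast
qed

theorem B_precochain_in_image:
  assumes "B.precochain k \<phi>" "\<And>us. \<phi> us \<in> R.N (sigma k)"
  shows "\<exists>\<psi>. B.precochain k \<psi> \<and> \<phi> = (\<lambda>us. T (sigma k) (\<psi> us))"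
proof -
  have "\<exists>x. below k x \<and> \<phi> us = T (sigma k) x \<and> (length us \<noteq> k \<longrightarrow> x = 0)" for us
  proof (cases "length us = k")
    case True
    obtain x where "below k x" "\<phi> us = T (sigma k) x"
      using R.N_below[OF assms(2)[of us] B.precochainD(2)[OF assms(1)]] by blast
    then show ?thesis using True by blast
  next
    case False
    then show ?thesis using B.precochainD(1)[OF assms(1)] by (intro exI[of _ 0]) simp
  qed
  then obtain \<psi> where "\<forall>us. below k (\<psi> us) \<and> \<phi> us = T (sigma k) (\<psi> us) \<and> (length us \<noteq> k \<longrightarrow> \<psi> us = 0)"
    using choice[of "\<lambda>us x. below k x \<and> \<phi> us = T (sigma k) x \<and> (length us \<noteq> k \<longrightarrow> x = 0)"] by blast
  then have \<psi>: "\<And>us. below k (\<psi> us)" "\<And>us. \<phi> us = T (sigma k) (\<psi> us)"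
    "\<And>us. length us \<noteq> k \<Longrightarrow> \<psi> us = 0"
    by blast+
  have \<phi>: "\<phi> = (\<lambda>us. T (sigma k) (\<psi> us))" using \<psi>(2) by blast
  \<comment> \<open>The preimages were chosen value by value. For k > 0 injectivity of T forces them
    to form a cochain; for k = 0 there is no slot, and any choice is one.\<close>
  have "B.precochain k \<psi>"
  proof (cases "k = 0")
    case True
    then show ?thesis unfolding B_precochain_iff using \<psi>(1,3) by auto
  next
    case False
    then show ?thesis using B_precochain_T_imp[of k \<psi>] assms(1) \<psi>(1,3) unfolding \<phi> by blast
  qed
  then show ?thesis using \<phi> by blast
qed

lemma R_cg_of_B: "B.cg s v w \<Longrightarrow> R.cg s v w"
  by (simp add: B_cg)

lemma R_precochain_of_B:
  assumes "B.precochain k \<psi>"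
  shows "R.precochain k \<psi>"
  unfolding R.precochain_def R.slot_additive_def
proof (intro conjI)
  note D = B.precochainD[OF assms]
  show "\<forall>us. length us \<noteq> k \<longrightarrow> \<psi> us = 0"
    using D(1) by blast
  show "\<forall>us. below k (\<psi> us)"
    using D(2) by blast
  show "\<forall>ys zs u v. length ys + length zs + 1 = k \<longrightarrow>
      R.cg (sigma k) (\<psi> (ys @ (u + v) # zs)) (\<psi> (ys @ u # zs) + \<psi> (ys @ v # zs))"
    by (intro allI impI R_cg_of_B B.slot_additiveD[OF D(3)])
  show "\<forall>ys zs u. length ys + length zs + 1 = k \<longrightarrow>
      R.cg (sigma k) (\<psi> (ys @ dE u # zs)) (- (X (length ys) \<bullet> \<psi> (ys @ u # zs)))"
    by (intro allI impI R_cg_of_B D(4))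
  show "\<forall>ys zs a u t. length ys + length zs + 1 = k \<and> k \<le> t \<longrightarrow>
      R.cg (sigma k) (\<psi> (ys @ scE a u # zs))
        (SM.Sop t (const_mpoly a) (sub (tshift (length ys) (X t)) (\<psi> (ys @ u # zs))))"
    by (intro allI impI R_cg_of_B, elim conjE, rule D(5))
  show "\<forall>ys zs u v. length ys + length zs + 2 = k \<longrightarrow>
      R.cg (sigma k) (\<psi> (ys @ u # v # zs))
        (- sub (\<lambda>j. X (transpose (length ys) (Suc (length ys)) j)) (\<psi> (ys @ v # u # zs)))"
    by (intro allI impI R_cg_of_B D(6))
qed

subsection \<open>Lifting reduced cochains\<close>

definition tau_slot :: "nat \<Rightarrow> nat \<Rightarrow> ('e list \<Rightarrow> 'm mpoly) \<Rightarrow> bool" where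
  "tau_slot k i g \<longleftrightarrow> (\<forall>us. length us = k \<longrightarrow>
     (\<forall>u v. g (us[i := u + v]) = g (us[i := u]) + g (us[i := v])) \<and>
     (\<forall>a u. g (us[i := actE a u]) = tau i a (g (us[i := u]))))"

lemma tau_slotD:
  "tau_slot k i g \<Longrightarrow> length us = k \<Longrightarrow> g (us[i := u + v]) = g (us[i := u]) + g (us[i := v])"
  "tau_slot k i g \<Longrightarrow> length us = k \<Longrightarrow> g (us[i := actE a u]) = tau i a (g (us[i := u]))"
  by (simp_all add: tau_slot_def)

lemma add_map_dop_mult: "add_map (dop_mult dA a)"
proof (rule add_mapI)
  show "dop_mult dA a (p + q) = dop_mult dA a p + dop_mult dA a q" for p q
    by (simp add: dop_mult_def add_map_add[OF add_map_funpow[OF add_map_lambda_plus[OF add_map_dA]]]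
        smult_add_right sum.distrib)
qed

text \<open>Additivity and linearity of the coordinates follow from uniqueness: the sum of two
  coordinate vectors, and the multiple of one by composition from the left, have the right value in
  E.\<close>

lemma free_coordinates:
  assumes "free_dop_module actE"
  obtains co :: "'e \<Rightarrow> 'e \<Rightarrow>\<^sub>0 'a poly" where
    "\<And>v. v = (\<Sum>b\<in>Poly_Mapping.keys (co v). actE (Poly_Mapping.lookup (co v) b) b)"
    "\<And>u v. co (u + v) = co u + co v"
    "\<And>a v. co (actE a v) = mmap (dop_mult dA a) (co v)"
proof -
  from assms obtain B where B: "\<And>v. \<exists>!c :: 'e \<Rightarrow>\<^sub>0 'a poly. Poly_Mapping.keys c \<subseteq> B \<and>
      v = (\<Sum>b\<in>Poly_Mapping.keys c. actE (Poly_Mapping.lookup c b) b)"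
    unfolding free_dop_module_def by auto
  let ?val = "lin (\<lambda>b a. actE a b)"
  have val: "(\<Sum>b\<in>Poly_Mapping.keys c. actE (Poly_Mapping.lookup c b) b) = ?val c" for c
    by (simp add: lin_def)
  have val_aux: "add_map (\<lambda>a. actE a b)" for b
    by (simp add: add_map_def E.act_add_left)
  define co where "co v = (THE c. Poly_Mapping.keys c \<subseteq> B \<and> v = ?val c)" for v
  have co: "Poly_Mapping.keys (co v) \<subseteq> B" "v = ?val (co v)" for v
    using theI'[OF B[of v]] by (simp_all add: co_def lin_def)
  have co_eq: "co v = c" if "Poly_Mapping.keys c \<subseteq> B" "v = ?val c" for v c
    using the1_equality[OF B[of v], of c] that by (simp add: co_def lin_def)
  show thesis
  proof (rule that[of co])
    show "v = (\<Sum>b\<in>Poly_Mapping.keys (co v). actE (Poly_Mapping.lookup (co v) b) b)" for v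
      unfolding val by (rule co(2))
    show "co (u + v) = co u + co v" for u v
    proof (rule co_eq)
      show "Poly_Mapping.keys (co u + co v) \<subseteq> B"
        using keys_add[of "co u" "co v"] co(1) by blast
      show "u + v = ?val (co u + co v)"
        using co(2)[of u] co(2)[of v] by (simp add: lin_add[OF val_aux])
    qed
    show "co (actE a v) = mmap (dop_mult dA a) (co v)" for a v
    proof (rule co_eq)
      have d0: "dop_mult dA a 0 = 0" by (rule add_map_zero[OF add_map_dop_mult])
      show "Poly_Mapping.keys (mmap (dop_mult dA a) (co v)) \<subseteq> B"
      proof -
        have "Poly_Mapping.keys (mmap (dop_mult dA a) c) \<subseteq> Poly_Mapping.keys c" for c :: "'e \<Rightarrow>\<^sub>0 'a poly"
          by (auto simp: in_keys_iff map.rep_eq when_def split: if_splits)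
        then show ?thesis using co(1)[of v] by blast
      qed
      have "actE a (?val c) = ?val (mmap (dop_mult dA a) c)" for c
      proof (induction c rule: poly_mapping_single_induct)
        case (single b p)
        show ?case by (simp add: d0 lin_single[OF val_aux] E.act_mult)
      next
        case (add c c')
        then show ?case by (simp add: mmap_add[OF add_map_dop_mult] lin_add[OF val_aux] E.act_add_right)
      qed
      from this[of "co v"] show "actE a v = ?val (mmap (dop_mult dA a) (co v))"
        unfolding co(2)[of v, symmetric] .
    qed
  qed
qed

text \<open>In slot i, g is replaced by the A[d]-linear map with the same values on a basis of E.
  Slots that were linear before stay so because the actions in different slots commute. The
  congruence to \<phi> survives because \<phi> is linear modulo N and \<open>tau\<close> respects
  congruence.\<close>

lemma tau_slot_step:
  assumes free: "free_dop_module actE" and \<phi>: "R.cochain_mod k \<phi>" and i: "i < k"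
    and g: "\<And>us. length us = k \<Longrightarrow> below k (g us)" "\<And>us. length us = k \<Longrightarrow> R.cg (sigma k) (g us) (\<phi> us)"
    and J: "\<And>j. j \<in> J \<Longrightarrow> j < k \<and> j \<noteq> i \<and> tau_slot k j g"
  shows "\<exists>g'. (\<forall>us. length us = k \<longrightarrow> below k (g' us) \<and> R.cg (sigma k) (g' us) (\<phi> us)) \<and>
    (\<forall>j\<in>insert i J. tau_slot k j g')"
proof -
  obtain co :: "'e \<Rightarrow> 'e \<Rightarrow>\<^sub>0 'a poly" where co:
    "\<And>v. v = (\<Sum>b\<in>Poly_Mapping.keys (co v). actE (Poly_Mapping.lookup (co v) b) b)"
    "\<And>u v. co (u + v) = co u + co v"
    "\<And>a v. co (actE a v) = mmap (dop_mult dA a) (co v)"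
    using free_coordinates[OF free] by blast
  let ?L = "\<lambda>us. lin (\<lambda>b a. tau i a (g (us[i := b])))"
  define g' where "g' us = ?L us (co (us ! i))" for us
  have L: "add_map (\<lambda>a. tau i a q)" for q
    by (simp add: add_map_def tau_add_left)
  have "tau_slot k i g'"
    unfolding tau_slot_def
  proof (intro allI impI conjI)
    fix us :: "'e list" and u v a assume us: "length us = k"
    show "g' (us[i := u + v]) = g' (us[i := u]) + g' (us[i := v])"
      using us i by (simp add: g'_def co(2) lin_add[OF L])
    have "?L us (mmap (dop_mult dA a) c) = tau i a (?L us c)" for c
    proof (induction c rule: poly_mapping_single_induct)
      case (single b p)
      show ?case by (simp add: add_map_zero[OF add_map_dop_mult] lin_single[OF L] tau_dop_mult)
    next
      case (add c c')
      then show ?case by (simp add: mmap_add[OF add_map_dop_mult] lin_add[OF L] tau_add)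
    qed
    then show "g' (us[i := actE a u]) = tau i a (g' (us[i := u]))"
      using us i by (simp add: g'_def co(3))
  qed
  moreover have "tau_slot k j g'" if "j \<in> J" for j
  proof -
    have j: "j < k" "j \<noteq> i" "tau_slot k j g" using J[OF that] by auto
    show ?thesis
      unfolding tau_slot_def
    proof (intro allI impI conjI)
      fix us :: "'e list" and u v a assume us: "length us = k"
      have s: "us[j := w, i := b] = us[i := b, j := w]" for w b
        using j(2) by (rule list_update_swap)
      show "g' (us[j := u + v]) = g' (us[j := u]) + g' (us[j := v])"
        using j us by (simp add: g'_def s tau_slotD(1)[OF j(3)] tau_add lin_fun_add)
      show "g' (us[j := actE a u]) = tau j a (g' (us[j := u]))"
        using j us
        by (simp add: g'_def s tau_slotD(2)[OF j(3)] lin_def add_map_sum[OF add_map_tau] tau_commute[of j i])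
    qed
  qed
  moreover have "below k (g' us)" if "length us = k" for us
    unfolding g'_def lin_def using that g(1) i by (auto intro!: tfree_sum tfree_tau)
  moreover have "R.cg (sigma k) (g' us) (\<phi> us)" if us: "length us = k" for us
  proof -
    have \<phi>': "R.precochain k \<phi>" by (rule R.cochain_mod_precochain[OF \<phi>])
    let ?ys = "take i us" and ?zs = "drop (Suc i) us" and ?c = "co (us ! i)"
    have len: "length ?ys + length ?zs + 1 = k" and leni: "length ?ys = i" using us i by auto
    have sum: "R.cg (sigma k) (\<phi> (?ys @ (\<Sum>b\<in>I. w b) # ?zs)) (\<Sum>b\<in>I. \<phi> (?ys @ w b # ?zs))" if "finite I" for I :: "'e set" and w
      using that
    proof (induction I rule: finite_induct)
      case empty
      show ?case using R.slot_additive_zero[OF R.precochainD(3)[OF \<phi>'] len] by simp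
    next
      case (insert b I)
      have "R.cg (sigma k) (\<phi> (?ys @ (w b + (\<Sum>b\<in>I. w b)) # ?zs)) (\<phi> (?ys @ w b # ?zs) + \<phi> (?ys @ (\<Sum>b\<in>I. w b) # ?zs))"
        by (rule R.slot_additiveD[OF R.precochainD(3)[OF \<phi>'] len])
      also have "R.cg (sigma k) \<dots> (\<phi> (?ys @ w b # ?zs) + (\<Sum>b\<in>I. \<phi> (?ys @ w b # ?zs)))"
        by (intro R.cg_add R.cg_refl insert.IH)
      finally show ?case using insert.hyps by simp
    qed
    have "us = ?ys @ us ! i # ?zs" using us i by (simp add: id_take_nth_drop)
    then have "\<phi> us = \<phi> (?ys @ (\<Sum>b\<in>Poly_Mapping.keys ?c. actE (Poly_Mapping.lookup ?c b) b) # ?zs)"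
      unfolding co(1)[of "us ! i", symmetric] by simp
    also have "R.cg (sigma k) \<dots> (\<Sum>b\<in>Poly_Mapping.keys ?c. \<phi> (?ys @ actE (Poly_Mapping.lookup ?c b) b # ?zs))"
      by (rule sum) simp
    also have "R.cg (sigma k) \<dots> (\<Sum>b\<in>Poly_Mapping.keys ?c. tau i (Poly_Mapping.lookup ?c b) (\<phi> (?ys @ b # ?zs)))"
      using R.precochain_tau[OF \<phi>' len] unfolding leni by (intro R.cg_sum) blast
    also have "R.cg (sigma k) \<dots> (\<Sum>b\<in>Poly_Mapping.keys ?c. tau i (Poly_Mapping.lookup ?c b) (g (us[i := b])))"
    proof (intro R.cg_sum R.cg_tau)
      fix b
      have e: "?ys @ b # ?zs = us[i := b]" using us i by (simp add: upd_conv_take_nth_drop)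
      show "R.cg (sigma k) (\<phi> (?ys @ b # ?zs)) (g (us[i := b]))"
        unfolding e using us by (intro R.cg_sym[OF g(2)]) simp
      show "below k (\<phi> (?ys @ b # ?zs))" by (rule R.precochainD(2)[OF \<phi>'])
      show "below k (g (us[i := b]))" using us by (intro g(1)) simp
    qed (rule i)
    finally show ?thesis by (simp add: g'_def lin_def R.cg_sym)
  qed
  ultimately show ?thesis by blast
qed

lemma tau_slot_lift:
  assumes "free_dop_module actE" "R.cochain_mod k \<phi>"
  shows "\<exists>g. (\<forall>us. length us = k \<longrightarrow> below k (g us) \<and> R.cg (sigma k) (g us) (\<phi> us)) \<and> (\<forall>j<k. tau_slot k j g)"
proof -
  have "\<exists>g. (\<forall>us. length us = k \<longrightarrow> below k (g us) \<and> R.cg (sigma k) (g us) (\<phi> us)) \<and> (\<forall>j\<in>{..<n}. tau_slot k j g)"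
    if "n \<le> k" for n
    using that
  proof (induction n)
    case 0
    show ?case
      using R.precochainD(2)[OF R.cochain_mod_precochain[OF assms(2)]] by (intro exI[of _ \<phi>]) simp
  next
    case (Suc n)
    then obtain g where g: "\<And>us. length us = k \<Longrightarrow> below k (g us)" "\<And>us. length us = k \<Longrightarrow> R.cg (sigma k) (g us) (\<phi> us)"
      "\<And>j. j \<in> {..<n} \<Longrightarrow> tau_slot k j g" by (metis Suc_leD)
    have "insert n {..<n} = {..<Suc n}" by auto
    then show ?case
      using tau_slot_step[OF assms, of n g "{..<n}"] g Suc.prems by auto
  qed
  from this[of k] show ?thesis unfolding Ball_def lessThan_iff by simp
qed

text \<open>Induction on the order. In order 0 the auxiliary variable is lambda_k, which \<pi>
  fixes.\<close>

lemma tau_permutes: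
  assumes \<pi>: "\<pi> permutes {..<k}" and "i < k" "below k q"
  shows "sub (\<lambda>j. X (\<pi> j)) (tau i a q) = tau (\<pi> i) a (sub (\<lambda>j. X (\<pi> j)) q)"
  using assms(3)
proof (induction a arbitrary: q)
  case 0
  show ?case by (simp add: tau_zero_left add_map_zero[OF add_map_sub])
next
  case (pCons a p)
  let ?h = "\<lambda>j. X (\<pi> j)"
  have \<pi>k: "\<pi> k = k" using permutes_not_in[OF \<pi>, of k] by simp
  have inj: "\<pi> j = \<pi> l \<longleftrightarrow> j = l" for j l
    using permutes_inj[OF \<pi>] by (simp add: inj_eq)
  have \<pi>i: "\<pi> i < k" using permutes_in_image[OF \<pi>, of i] assms(2) by simp
  have below: "below k (sub ?h q)"
    using pCons.prems permutes_in_image[OF \<pi>] by (auto intro!: tfree_sub_below[of k q] tfree_X) (metis lessThan_iff not_le)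
  have "sub ?h (tau i [:a:] q) = sub ?h (SM.Sop k (const_mpoly a) (sub (tshift i (X k)) q))"
    using pCons.prems assms(2) by (subst tau_const[of k]) auto
  also have "\<dots> = SM.Sop k (const_mpoly a) (sub ?h (sub (tshift i (X k)) q))"
  proof -
    have "tfree k (X (\<pi> j))" if "j \<noteq> k" for j
      using inj[of j k] \<pi>k that by (intro tfree_X) simp
    then have "sub ?h (SM.Sop k (const_mpoly a) w) = SM.Sop k (sub ?h (const_mpoly a)) (sub ?h w)" for w
      by (intro SM.sub_Sop) (simp_all only: \<pi>k)
    then show ?thesis by simp
  qed
  also have "sub ?h (sub (tshift i (X k)) q) = sub (tshift (\<pi> i) (X k)) (sub ?h q)"
    unfolding sub_sub by (rule arg_cong[of _ _ "\<lambda>h. sub h q"]) (auto simp: tshift_def sub_add \<pi>k inj)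
  also have "SM.Sop k (const_mpoly a) \<dots> = tau (\<pi> i) [:a:] (sub ?h q)"
    using below \<pi>i by (subst tau_const[of k]) auto
  finally have 1: "sub ?h (tau i [:a:] q) = tau (\<pi> i) [:a:] (sub ?h q)" .
  have "below k (X i \<bullet> q)" using pCons.prems assms(2) by (auto intro!: tfree_ract tfree_X)
  from pCons.IH[OF this] show ?case
    unfolding tau_pCons[of _ a p] by (simp add: sub_diff 1 sub_ract)
qed

section \<open>Scalars, and averaging over the symmetric group\<close>

definition scalar :: "'f \<Rightarrow> 'm mpoly \<Rightarrow> 'm mpoly" where
  "scalar c = mmap (fact_scale sA actM c)"

lemma scalar_eq: "scalar c = mmap (scM (sA c 1))"
  by (simp add: scalar_def fact_scale_def)

lemma add_map_scalar: "add_map (scalar c)"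
  unfolding scalar_eq by (rule add_map_mmap[OF biadd_map_right[OF biadd_scM]])

lemma scalar_sub: "sub h (scalar c q) = scalar c (sub h q)"
  unfolding scalar_eq by (rule sub_mmap[OF biadd_map_right[OF biadd_scM]])

lemma scalar_tau: "tau i a (scalar c q) = scalar c (tau i a q)"
  unfolding scalar_eq by (rule tau_scM)

lemma scalar_T: "T s (scalar c q) = scalar c (T s q)"
proof -
  have "mmap dM (mmap (scM (sA c 1)) q) = mmap (scM (sA c 1)) (mmap dM q)"
    using add_map_zero[OF add_map_dM] add_map_zero[OF biadd_map_right[OF biadd_scM, of "sA c 1"]]
      add_map_zero[OF biadd_map_left[OF biadd_scM]]
    by (intro poly_mapping_eqI) (simp add: lookup_mmap dM_scM[of "sA c 1"])
  then show ?thesis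
    unfolding scalar_eq T_def
    by (simp add: mmap_ract[OF biadd_map_right[OF biadd_scM]] mmap_add[OF biadd_map_right[OF biadd_scM]])
qed

lemma scalar_add_left: "scalar (c + d) q = scalar c q + scalar d q"
  using add_map_zero[OF biadd_map_right[OF biadd_scM]]
  by (intro poly_mapping_eqI)
    (simp add: scalar_eq lookup_mmap lookup_add A.scale_left_distrib flip: M.act_add_left)

lemma scalar_mult: "scalar (c * d) q = scalar c (scalar d q)"
proof -
  have "sA (c * d) 1 = sA c 1 * sA d 1"
    using A.scale_mult[of c 1 "sA d 1"] by simp
  then show ?thesis
    using add_map_zero[OF biadd_map_right[OF biadd_scM]]
    by (intro poly_mapping_eqI) (simp add: scalar_eq lookup_mmap scM_mult)
qed

lemma scalar_one: "scalar 1 q = q"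
  using add_map_zero[OF biadd_map_right[OF biadd_scM]]
  by (intro poly_mapping_eqI) (simp add: scalar_eq lookup_mmap scM_one)

text \<open>Characteristic 0 enters here: the number of summands is inverted in the field.\<close>

lemma scalar_average:
  assumes "finite I" "I \<noteq> {}"
  shows "scalar (1 / of_nat (card I)) (\<Sum>i\<in>I. q) = q"
proof -
  have "(\<Sum>i\<in>I. q) = scalar (of_nat (card I)) q"
    using assms(1)
  proof (induction I rule: finite_induct)
    case empty
    show ?case using add_map_zero[OF biadd_map_right[OF biadd_scM]] scalar_add_left[of 0 0 q] by simp
  next
    case (insert i I)
    then show ?case by (simp add: scalar_add_left scalar_one)
  qed
  then show ?thesis
    using assms by (simp add: scalar_one flip: scalar_mult)
qed

lemma R_cg_scalar: "R.cg s v w \<Longrightarrow> R.cg s (scalar c v) (scalar c w)"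
proof -
  assume "R.cg s v w"
  then obtain x where "v - w = T s x" by (auto simp: R.cg_def R.N_T)
  then have "scalar c v - scalar c w = T s (scalar c x)"
    by (simp add: scalar_T add_map_diff[OF add_map_scalar, symmetric])
  then show ?thesis by (auto simp: R.cg_def R.N_T)
qed

text \<open>The lift g that is linear in every slot is replaced by its signed average over all
  permutations. Linearity is kept because a permutation carries the action in one slot to that in
  another (\<open>tau_permutes\<close>). The class is kept because \<phi> is alternating modulo N,
  so that every summand is congruent to \<phi>.\<close>

theorem B_precochain_lift:
  assumes "free_dop_module actE" and \<phi>: "R.cochain_mod k \<phi>"
  shows "\<exists>\<psi>. B.precochain k \<psi> \<and> (\<forall>us. length us = k \<longrightarrow> R.cg (sigma k) (\<psi> us) (\<phi> us))"
proof -
  obtain g where g: "\<And>us. length us = k \<Longrightarrow> below k (g us)"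
    "\<And>us. length us = k \<Longrightarrow> R.cg (sigma k) (g us) (\<phi> us)" "\<And>j. j < k \<Longrightarrow> tau_slot k j g"
    using tau_slot_lift[OF assms] by blast
  define P where "P = {\<pi>. \<pi> permutes {..<k}}"
  define act where "act \<pi> us = map (\<lambda>i. us ! \<pi> i) [0..<k]" for \<pi> and us :: "'e list"
  define sg where "sg \<pi> v = (if sign \<pi> = 1 then v else - v)" for \<pi> :: "nat \<Rightarrow> nat" and v :: "'m mpoly"
  define h where "h \<pi> q = sg \<pi> (sub (\<lambda>j. X (\<pi> j)) q)" for \<pi> and q :: "'m mpoly"
  define S where "S us = (\<Sum>\<pi>\<in>P. h \<pi> (g (act \<pi> us)))" for us
  define \<psi> where "\<psi> us = (if length us = k then scalar (1 / of_nat (card P)) (S us) else 0)" for us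
  have P: "finite P" "P \<noteq> {}"
    unfolding P_def by (auto simp: finite_permutations intro: permutes_id)
  have len_act: "length (act \<pi> us) = k" for \<pi> us
    by (simp add: act_def)
  have sg_add: "sg \<pi> (v + w) = sg \<pi> v + sg \<pi> w" and sg_tau: "tau i a (sg \<pi> v) = sg \<pi> (tau i a v)"
    and sg_scalar: "scalar c (sg \<pi> v) = sg \<pi> (scalar c v)"
    and sg_sub: "sub f (sg \<pi> v) = sg \<pi> (sub f v)" for \<pi> v w i a c f
    by (simp_all add: sg_def tau_uminus add_map_uminus[OF add_map_scalar] sub_uminus)
  have h_add: "h \<pi> (v + w) = h \<pi> v + h \<pi> w" for \<pi> v w
    by (simp add: h_def sub_add sg_add)
  have below_h: "below k (h \<pi> q)" if "\<pi> \<in> P" "below k q" for \<pi> q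
  proof -
    have "below k (sub (\<lambda>j. X (\<pi> j)) q)"
    proof (intro allI impI)
      fix t assume t: "k \<le> t"
      have "\<pi> j \<noteq> t" if "j < k" for j
        using permutes_in_image[of \<pi> "{..<k}" j] \<open>\<pi> \<in> P\<close> that t by (auto simp: P_def)
      then show "tfree t (sub (\<lambda>j. X (\<pi> j)) q)"
        using that(2) by (intro tfree_sub_below[of k] tfree_X) auto
    qed
    then show ?thesis by (auto simp: h_def sg_def intro: tfree_uminus)
  qed
  have act_update: "act \<pi> (us[i := u]) = (act \<pi> us)[inv_into UNIV \<pi> i := u]"
    if "\<pi> \<in> P" "length us = k" "i < k" for \<pi> us i u
  proof (rule nth_equalityI)
    have \<pi>: "\<pi> permutes {..<k}" using that(1) by (simp add: P_def)
    fix l assume "l < length (act \<pi> (us[i := u]))"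
    then have l: "l < k" "\<pi> l < k" using permutes_in_image[OF \<pi>, of l] by (auto simp: len_act)
    have "\<pi> l = i \<longleftrightarrow> l = inv_into UNIV \<pi> i"
      using permutes_inverses[OF \<pi>] by metis
    then show "act \<pi> (us[i := u]) ! l = (act \<pi> us)[inv_into UNIV \<pi> i := u] ! l"
      using l that(2,3) by (auto simp: act_def nth_list_update)
  qed (simp add: len_act)
  have inv_less: "inv_into UNIV \<pi> i < k" if "\<pi> \<in> P" "i < k" for \<pi> i
    using permutes_in_image[OF permutes_inv, of \<pi> "{..<k}" i] that by (simp add: P_def)
  have slot: "tau_slot k i \<psi>" if i: "i < k" for i
    unfolding tau_slot_def
  proof (intro allI impI conjI)
    fix us :: "'e list" and u v a assume us: "length us = k"
    have "S (us[i := u + v]) = S (us[i := u]) + S (us[i := v])"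
      unfolding S_def sum.distrib[symmetric]
    proof (rule sum.cong[OF refl])
      fix \<pi> assume \<pi>: "\<pi> \<in> P"
      show "h \<pi> (g (act \<pi> (us[i := u + v]))) = h \<pi> (g (act \<pi> (us[i := u]))) + h \<pi> (g (act \<pi> (us[i := v])))"
        using tau_slotD(1)[OF g(3)[OF inv_less[OF \<pi> i]] len_act, of \<pi> us u v]
        by (simp add: act_update[OF \<pi> us i] h_add)
    qed
    then show "\<psi> (us[i := u + v]) = \<psi> (us[i := u]) + \<psi> (us[i := v])"
      using us by (simp add: \<psi>_def add_map_add[OF add_map_scalar])
    have "S (us[i := actE a u]) = tau i a (S (us[i := u]))"
      unfolding S_def add_map_sum[OF add_map_tau]
    proof (rule sum.cong[OF refl])
      fix \<pi> assume \<pi>: "\<pi> \<in> P"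
      then have p: "\<pi> permutes {..<k}" by (simp add: P_def)
      show "h \<pi> (g (act \<pi> (us[i := actE a u]))) = tau i a (h \<pi> (g (act \<pi> (us[i := u]))))"
        using tau_slotD(2)[OF g(3)[OF inv_less[OF \<pi> i]] len_act, of \<pi> us a u]
          tau_permutes[OF p inv_less[OF \<pi> i] g(1), of "(act \<pi> us)[inv_into UNIV \<pi> i := u]" a]
        by (simp add: act_update[OF \<pi> us i] h_def sg_tau len_act permutes_inverses[OF p])
    qed
    then show "\<psi> (us[i := actE a u]) = tau i a (\<psi> (us[i := u]))"
      using us by (simp add: \<psi>_def scalar_tau)
  qed
  have below: "below k (\<psi> us)" for us
  proof (cases "length us = k")
    case True
    have "below k (S us)"
      unfolding S_def using below_h g(1)[OF len_act] by (auto intro!: tfree_sum)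
    then show ?thesis by (simp add: True \<psi>_def scalar_def tfree_mmap)
  qed (simp add: \<psi>_def)
  have perm: "\<psi> us = h \<rho> (\<psi> (act \<rho> us))" if \<rho>: "\<rho> \<in> P" and us: "length us = k" for \<rho> us
  proof -
    have p: "\<rho> permutes {..<k}" using \<rho> by (simp add: P_def)
    have "h \<rho> (S (act \<rho> us)) = (\<Sum>\<pi>\<in>P. h \<rho> (h \<pi> (g (act \<pi> (act \<rho> us)))))"
      unfolding S_def by (rule add_map_sum) (simp add: add_map_def h_add)
    \<comment> \<open>Variables and arguments are both permuted by the composite of \<pi> and then
      \<rho>, so the sum is reindexed by composition with \<rho>.\<close>
    also have "\<dots> = (\<Sum>\<pi>\<in>P. h (\<rho> \<circ> \<pi>) (g (act (\<rho> \<circ> \<pi>) us)))"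
    proof (rule sum.cong[OF refl])
      fix \<pi> assume "\<pi> \<in> P"
      then have q: "\<pi> permutes {..<k}" by (simp add: P_def)
      have a: "act \<pi> (act \<rho> us) = act (\<rho> \<circ> \<pi>) us"
        using permutes_in_image[OF q] by (auto simp: act_def)
      have "permutation \<rho>" "permutation \<pi>"
        using p q permutation_permutes by blast+
      then have "sign (\<rho> \<circ> \<pi>) = sign \<rho> * sign \<pi>" by (rule sign_compose)
      then have "sg \<rho> (sg \<pi> v) = sg (\<rho> \<circ> \<pi>) v" for v
        by (cases rule: sign_cases[of \<rho>]; cases rule: sign_cases[of \<pi>]) (auto simp: sg_def)
      then show "h \<rho> (h \<pi> (g (act \<pi> (act \<rho> us)))) = h (\<rho> \<circ> \<pi>) (g (act (\<rho> \<circ> \<pi>) us))"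
        by (simp add: a h_def sg_sub sub_sub)
    qed
    also have "\<dots> = S us"
      unfolding S_def P_def by (subst (2) setum_permutations_compose_left[OF p]) (simp add: o_def)
    finally have S: "h \<rho> (S (act \<rho> us)) = S us" .
    have "h \<rho> (scalar c v) = scalar c (h \<rho> v)" for c v
      by (simp add: h_def scalar_sub sg_scalar)
    then show ?thesis
      using us S by (simp add: \<psi>_def len_act)
  qed
  have lift: "R.cg (sigma k) (\<psi> us) (\<phi> us)" if us: "length us = k" for us
  proof -
    have "R.cg (sigma k) (S us) (\<Sum>\<pi>\<in>P. \<phi> us)"
      unfolding S_def
    proof (rule R.cg_sum)
      fix \<pi> assume "\<pi> \<in> P"
      then have p: "\<pi> permutes {..<k}" by (simp add: P_def)
      have "R.cg (sub (\<lambda>j. X (\<pi> j)) (sigma k)) (sub (\<lambda>j. X (\<pi> j)) (g (act \<pi> us))) (sub (\<lambda>j. X (\<pi> j)) (\<phi> (act \<pi> us)))"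
        by (rule R.cg_sub[OF g(2)[OF len_act]])
      then have "R.cg (sigma k) (h \<pi> (g (act \<pi> us))) (h \<pi> (\<phi> (act \<pi> us)))"
        unfolding sub_permutes_sigma[OF p] by (auto simp: h_def sg_def intro: R.cg_uminus)
      also have "h \<pi> (\<phi> (act \<pi> us)) = signed_perm k \<pi> (\<phi> (act \<pi> us))"
        using R.precochainD(2)[OF R.cochain_mod_precochain[OF \<phi>]] by (simp add: signed_perm_eq h_def sg_def)
      also have "R.cg (sigma k) \<dots> (\<phi> us)"
        using \<phi> p us unfolding R.cochain_mod_def act_def by (blast intro: R.cg_sym)
      finally show "R.cg (sigma k) (h \<pi> (g (act \<pi> us))) (\<phi> us)" .
    qed
    from R_cg_scalar[OF this, of "1 / of_nat (card P)"] show ?thesis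
      using us by (simp add: \<psi>_def scalar_average[OF P])
  qed
  have len: "length (ys @ u # zs) = k \<and> length ys < k" if "length ys + length zs + 1 = k" for ys zs and u :: 'e
    using that by simp
  have 1: "\<psi> (ys @ (u + v) # zs) = \<psi> (ys @ u # zs) + \<psi> (ys @ v # zs)" if "length ys + length zs + 1 = k" for ys zs u v
    using tau_slotD(1)[OF slot, of "length ys" "ys @ u # zs" u v] len[OF that] by simp
  have tau: "\<psi> (ys @ actE a u # zs) = tau (length ys) a (\<psi> (ys @ u # zs))"
    if "length ys + length zs + 1 = k" for ys zs u a
    using tau_slotD(2)[OF slot, of "length ys" "ys @ u # zs" a u] len[OF that] by simp
  have 2: "\<psi> (ys @ dE u # zs) = - (X (length ys) \<bullet> \<psi> (ys @ u # zs))"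
    if "length ys + length zs + 1 = k" for ys zs u
    unfolding dact_def tau[OF that] by (rule tau_var)
  have 3: "\<psi> (ys @ scE a u # zs) = SM.Sop t (const_mpoly a) (sub (tshift (length ys) (X t)) (\<psi> (ys @ u # zs)))"
    if "length ys + length zs + 1 = k" "k \<le> t" for ys zs a u t
    unfolding tau[OF that(1)] by (rule tau_const) (use below that in blast, use that in auto)
  have 4: "\<psi> (ys @ u # v # zs) = - sub (\<lambda>j. X (transpose (length ys) (Suc (length ys)) j)) (\<psi> (ys @ v # u # zs))"
    if l: "length ys + length zs + 2 = k" for ys zs u v
  proof -
    let ?\<pi> = "transpose (length ys) (Suc (length ys))" and ?us = "ys @ u # v # zs"
    have "act ?\<pi> ?us = ys @ v # u # zs"
      using l by (intro nth_equalityI) (auto simp: act_def transpose_def nth_append nth_Cons split: nat.split)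
    then show ?thesis
      using perm[of ?\<pi> ?us] transpose_Suc_permutes[OF l] l by (simp add: P_def h_def sg_def sign_swap_id)
  qed
  have "\<psi> us = 0" if "length us \<noteq> k" for us
    using that by (simp add: \<psi>_def)
  then have "B.precochain k \<psi>"
    unfolding B_precochain_iff using below 1 2 3 4 by blast
  then show ?thesis using lift by blast
qed

section \<open>The complexes\<close>

abbreviation "F \<equiv> ring_of_class :: 'f ring"
abbreviation "LP \<equiv> lambda_polys sA actM"
abbreviation "TI \<equiv> total_deriv_image sA actM"
abbreviation "cl \<equiv> reduced_class sA actM"

lemma LP_simps [simp]:
  "carrier (LP k) = {q. below k q}" "v \<oplus>\<^bsub>LP k\<^esub> w = v + w" "\<zero>\<^bsub>LP k\<^esub> = 0" "c \<odot>\<^bsub>LP k\<^esub> w = scalar c w"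
  by (simp_all add: lambda_polys_def below_iff_keys scalar_def)

lemma below_scalar: "below k q \<Longrightarrow> below k (scalar c q)"
  by (simp add: scalar_def tfree_mmap)

lemma below_add: "below k v \<Longrightarrow> below k w \<Longrightarrow> below k (v + w)" for v w :: "'m mpoly"
  by (simp add: tfree_add)

lemma below_uminus: "below k v \<Longrightarrow> below k (- v)" for v :: "'m mpoly"
  by (simp add: tfree_uminus)

lemma module_LP: "Module.module F (LP k)"
proof (rule moduleI[OF cring_ring_of_class])
  show "abelian_group (LP k)"
  proof (rule abelian_groupI)
    fix x assume x: "x \<in> carrier (LP k)"
    then have "- x \<in> carrier (LP k)" "- x \<oplus>\<^bsub>LP k\<^esub> x = \<zero>\<^bsub>LP k\<^esub>"
      using below_uminus[of k x] by simp_all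
    then show "\<exists>y\<in>carrier (LP k). y \<oplus>\<^bsub>LP k\<^esub> x = \<zero>\<^bsub>LP k\<^esub>" by blast
  qed (simp_all add: below_add add_ac)
qed (simp_all add: below_scalar scalar_add_left add_map_add[OF add_map_scalar] scalar_mult scalar_one)

lemma a_inv_LP: "below k v \<Longrightarrow> \<ominus>\<^bsub>LP k\<^esub> v = - v"
proof -
  interpret V: Module.module F "LP k" by (rule module_LP)
  assume "below k v"
  then show ?thesis
    using V.M.minus_equality[of "- v" v] below_uminus[of k v] by simp
qed

lemma T_linear: "linear_between F (LP k) (LP k) (total_deriv actM k)"
  unfolding total_deriv_eq
  by (rule linear_betweenI) (simp_all add: below_T add_map_add[OF add_map_T] scalar_T)

lemma submodule_TI: "submodule (TI k) F (LP k)"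
  unfolding total_deriv_image_def by (rule submodule_linear_image[OF module_LP module_LP T_linear])

lemma TI_iff:
  assumes "below k w"
  shows "w \<in> TI k \<longleftrightarrow> w \<in> R.N (sigma k)"
proof
  assume "w \<in> TI k"
  then show "w \<in> R.N (sigma k)"
    by (auto simp: total_deriv_image_def total_deriv_eq R.N_T)
next
  assume "w \<in> R.N (sigma k)"
  then obtain x where "below k x" "w = T (sigma k) x" using assms by (rule R.N_below)
  then show "w \<in> TI k" by (auto simp: total_deriv_image_def total_deriv_eq)
qed

lemma cl_eq_iff:
  assumes "below k v" "below k w"
  shows "cl k v = cl k w \<longleftrightarrow> R.cg (sigma k) v w"
  using coset_eq_iff[OF module_LP submodule_TI, of v k w] assms TI_iff[of k "v - w"]
    below_add[OF assms(1) below_uminus[OF assms(2)]]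
  by (simp add: reduced_class_def a_inv_LP R.cg_def)

text \<open>On polynomials in the first k variables the operators agree with compositions of
  \<open>tau\<close>, respectively with a signed \<open>sub\<close>, whose compatibility with
  \<open>T (sigma k)\<close> is known. So they preserve its image, and \<open>coset_map\<close> can
  be computed on representatives.\<close>

lemma operator_properties:
  assumes "f \<in> multi_twist dA actM ` {as. length as = k} \<union> signed_perm k ` {\<pi>. \<pi> permutes {..<k}}"
  shows "linear_between F (LP k) (LP k) f" "f ` TI k \<subseteq> TI k"
proof -
  have "\<exists>g. (\<forall>q. below k q \<longrightarrow> f q = g q) \<and> (\<forall>q. below k q \<longrightarrow> below k (g q)) \<and> (\<forall>v w. g (v + w) = g v + g w) \<and>
    (\<forall>c q. g (scalar c q) = scalar c (g q)) \<and> (\<forall>q. below k q \<longrightarrow> g (T (sigma k) q) = T (sigma k) (g q))"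
    using assms
  proof (elim UnE imageE CollectE)
    fix as assume f: "f = multi_twist dA actM as" and len: "length as = k"
    let ?g = "\<lambda>l. foldr (\<lambda>i. tau i (as ! i)) l"
    have "(\<forall>q. below k q \<longrightarrow> below k (?g l q)) \<and> (\<forall>v w. ?g l (v + w) = ?g l v + ?g l w) \<and>
      (\<forall>c q. ?g l (scalar c q) = scalar c (?g l q)) \<and> (\<forall>q. below k q \<longrightarrow> ?g l (T (sigma k) q) = T (sigma k) (?g l q))"
      if "set l \<subseteq> {..<k}" for l
      using that
    proof (induction l)
      case (Cons i l)
      then have i: "i < k" by simp
      note IH = Cons.IH[OF subset_trans[OF set_subset_Cons Cons.prems]]
      show ?case
        using IH below_tau[OF _ i] T_tau[OF i] by (simp add: tau_add scalar_tau)
    qed simp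
    moreover have "set [0..<k] \<subseteq> {..<k}" by auto
    ultimately show ?thesis
      using multi_twist_tau[OF len] unfolding f by (intro exI[of _ "?g [0..<k]"]) blast
  next
    fix \<pi> assume f: "f = signed_perm k \<pi>" and \<pi>: "\<pi> permutes {..<k}"
    let ?g = "\<lambda>q :: 'm mpoly. if sign \<pi> = 1 then sub (\<lambda>i. X (\<pi> i)) q else - sub (\<lambda>i. X (\<pi> i)) q"
    have "below k (sub (\<lambda>i. X (\<pi> i)) q)" if "below k q" for q :: "'m mpoly"
    proof (intro allI impI)
      fix t assume t: "k \<le> t"
      have "\<pi> j \<noteq> t" if "j < k" for j
        using permutes_in_image[OF \<pi>, of j] that t by auto
      then show "tfree t (sub (\<lambda>j. X (\<pi> j)) q)"
        using that by (intro tfree_sub_below[of k] tfree_X) auto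
    qed
    moreover have "?g (v + w) = ?g v + ?g w" for v w by (simp add: sub_add)
    moreover have "?g (scalar c q) = scalar c (?g q)" for c q
      by (simp add: scalar_sub add_map_uminus[OF add_map_scalar])
    moreover have "?g (T (sigma k) q) = T (sigma k) (?g q)" for q
      by (simp add: T_permutes[OF \<pi>] add_map_uminus[OF add_map_T])
    ultimately show ?thesis
      unfolding f by (intro exI[of _ ?g]) (simp add: signed_perm_eq tfree_uminus Let_def)
  qed
  then obtain g where g: "\<And>q. below k q \<Longrightarrow> f q = g q" "\<And>q. below k q \<Longrightarrow> below k (g q)"
    "\<And>v w. g (v + w) = g v + g w" "\<And>c q. g (scalar c q) = scalar c (g q)"
    "\<And>q. below k q \<Longrightarrow> g (T (sigma k) q) = T (sigma k) (g q)"
    by metis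
  show "linear_between F (LP k) (LP k) f"
    by (rule linear_betweenI) (simp_all add: g(1-4) below_add below_scalar)
  show "f ` TI k \<subseteq> TI k"
    unfolding total_deriv_image_def total_deriv_eq LP_simps
    using g(2) by (auto simp: g(1) g(5) below_T)
qed

lemmas twist_linear = operator_properties[OF UnI1[OF imageI[OF CollectI]]]
  and perm_linear = operator_properties[OF UnI2[OF imageI[OF CollectI]]]

text \<open>One argument for basic and for reduced cochains: both conditions that involve L are
  preserved by sums and multiples once L makes the operators linear.\<close>

lemma module_cochains:
  assumes V: "Module.module F V"
    and L: "\<And>as. length as = k \<Longrightarrow> linear_between F V V (L (multi_twist dA actM as))"
      "\<And>\<pi>. \<pi> permutes {..<k} \<Longrightarrow> linear_between F V V (L (signed_perm k \<pi>))"
  shows "Module.module F (fun_module (cochain_set sA dA actE actM V L k) V)"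
proof -
  interpret V: Module.module F V by (rule V)
  note tw = linear_betweenD[OF L(1)] and pm = linear_betweenD[OF L(2)]
  have in_V: "f us \<in> carrier V" if "f \<in> cochain_set sA dA actE actM V L k" for f us
    using that by (cases "length us = k") (auto simp: cochain_set_def)
  have smult_carrier: "c \<odot>\<^bsub>V\<^esub> x \<in> carrier V" if "x \<in> carrier V" for c x
    using V.smult_closed[OF _ that] by simp
  show ?thesis
  proof (rule module_fun_module[OF V])
    show "f us \<in> carrier V" if "f \<in> cochain_set sA dA actE actM V L k" for f us
      by (rule in_V[OF that])
    show "(\<lambda>_. \<zero>\<^bsub>V\<^esub>) \<in> cochain_set sA dA actE actM V L k"
      using linear_between_zero[OF V V L(1)] linear_between_zero[OF V V L(2)] V.smult_r_null
      by (simp add: cochain_set_def)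
  next
    fix f g assume fg: "f \<in> cochain_set sA dA actE actM V L k" "g \<in> cochain_set sA dA actE actM V L k"
    note [simp] = in_V[OF fg(1)] in_V[OF fg(2)]
    show "(\<lambda>us. f us \<oplus>\<^bsub>V\<^esub> g us) \<in> cochain_set sA dA actE actM V L k"
      unfolding cochain_set_def mem_Collect_eq
    proof (intro conjI allI impI)
      fix us :: "'e list" assume "length us \<noteq> k"
      then show "f us \<oplus>\<^bsub>V\<^esub> g us = \<zero>\<^bsub>V\<^esub>" using fg by (simp add: cochain_set_def)
    next
      fix us :: "'e list" and i and u v assume "length us = k \<and> i < k"
      then show "f (us[i := u + v]) \<oplus>\<^bsub>V\<^esub> g (us[i := u + v]) =
          f (us[i := u]) \<oplus>\<^bsub>V\<^esub> g (us[i := u]) \<oplus>\<^bsub>V\<^esub> (f (us[i := v]) \<oplus>\<^bsub>V\<^esub> g (us[i := v]))"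
        using fg by (simp add: cochain_set_def V.M.a_ac)
    next
      fix us :: "'e list" and i c u assume "length us = k \<and> i < k"
      then show "f (us[i := fact_scale sA actE c u]) \<oplus>\<^bsub>V\<^esub> g (us[i := fact_scale sA actE c u]) =
          c \<odot>\<^bsub>V\<^esub> (f (us[i := u]) \<oplus>\<^bsub>V\<^esub> g (us[i := u]))"
        using fg by (simp add: cochain_set_def V.smult_r_distr)
    next
      fix as :: "'a poly list" and us :: "'e list" assume "length as = k \<and> length us = k"
      then show "f (map2 actE as us) \<oplus>\<^bsub>V\<^esub> g (map2 actE as us) = L (multi_twist dA actM as) (f us \<oplus>\<^bsub>V\<^esub> g us)"
        using fg by (simp add: cochain_set_def tw)
    next
      fix \<pi> and us :: "'e list" assume a: "\<pi> permutes {..<k} \<and> length us = k"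
      then have "f us = L (signed_perm k \<pi>) (f (map (\<lambda>i. us ! \<pi> i) [0..<k]))"
        "g us = L (signed_perm k \<pi>) (g (map (\<lambda>i. us ! \<pi> i) [0..<k]))"
        using fg by (auto simp: cochain_set_def)
      then show "f us \<oplus>\<^bsub>V\<^esub> g us = L (signed_perm k \<pi>)
          (f (map (\<lambda>i. us ! \<pi> i) [0..<k]) \<oplus>\<^bsub>V\<^esub> g (map (\<lambda>i. us ! \<pi> i) [0..<k]))"
        using a pm(2)[of \<pi>] by simp
    qed simp
  next
    fix c f assume f: "f \<in> cochain_set sA dA actE actM V L k"
    note [simp] = in_V[OF f] smult_carrier
    show "(\<lambda>us. c \<odot>\<^bsub>V\<^esub> f us) \<in> cochain_set sA dA actE actM V L k"
      unfolding cochain_set_def mem_Collect_eq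
    proof (intro conjI allI impI)
      fix us :: "'e list" assume "length us \<noteq> k"
      then show "c \<odot>\<^bsub>V\<^esub> f us = \<zero>\<^bsub>V\<^esub>" using f V.smult_r_null[of c] by (simp add: cochain_set_def)
    next
      fix us :: "'e list" and i and u v assume "length us = k \<and> i < k"
      then show "c \<odot>\<^bsub>V\<^esub> f (us[i := u + v]) = c \<odot>\<^bsub>V\<^esub> f (us[i := u]) \<oplus>\<^bsub>V\<^esub> c \<odot>\<^bsub>V\<^esub> f (us[i := v])"
        using f by (simp add: cochain_set_def V.smult_r_distr)
    next
      fix us :: "'e list" and i e u assume "length us = k \<and> i < k"
      then show "c \<odot>\<^bsub>V\<^esub> f (us[i := fact_scale sA actE e u]) = e \<odot>\<^bsub>V\<^esub> (c \<odot>\<^bsub>V\<^esub> f (us[i := u]))"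
        using f V.smult_assoc1[of c e "f (us[i := u])"] V.smult_assoc1[of e c "f (us[i := u])"]
        by (simp add: cochain_set_def mult.commute)
    next
      fix as :: "'a poly list" and us :: "'e list" assume "length as = k \<and> length us = k"
      then show "c \<odot>\<^bsub>V\<^esub> f (map2 actE as us) = L (multi_twist dA actM as) (c \<odot>\<^bsub>V\<^esub> f us)"
        using f by (simp add: cochain_set_def tw)
    next
      fix \<pi> and us :: "'e list" assume a: "\<pi> permutes {..<k} \<and> length us = k"
      then have "f us = L (signed_perm k \<pi>) (f (map (\<lambda>i. us ! \<pi> i) [0..<k]))"
        using f by (auto simp: cochain_set_def)
      then show "c \<odot>\<^bsub>V\<^esub> f us = L (signed_perm k \<pi>) (c \<odot>\<^bsub>V\<^esub> f (map (\<lambda>i. us ! \<pi> i) [0..<k]))"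
        using a pm(3)[of \<pi>] by simp
    qed simp
  qed
qed

section \<open>Linearity of the differential\<close>

lemma bev_scalar: "bev lact p U (scalar c V) = scalar c (bev lact p U V)"
proof -
  have a: "add_map (fact_scale sA actM c)"
    unfolding fact_scale_def by (rule biadd_map_right[OF biadd_scM])
  show ?thesis
    unfolding scalar_def
  proof (induction U rule: mpoly_induct)
    case (const u)
    show ?case
    proof (induction V rule: mpoly_induct)
      case (const v)
      show ?case
        by (simp add: add_map_zero[OF a] bev_const[OF biadd_lact] lact_scale_right pev_map_poly[OF a])
    qed (simp_all add: mmap_ract[OF a] mmap_add[OF a] bev_linear[OF biadd_lact])
  qed (simp_all add: mmap_ract[OF a] mmap_add[OF a] bev_linear[OF biadd_lact])
qed

lemma scalar_ract: "scalar c (r \<bullet> q) = r \<bullet> scalar c q"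
  unfolding scalar_eq by (rule mmap_ract[OF biadd_map_right[OF biadd_scM]])

lemma scalar_iterate_uminus: "scalar c ((uminus ^^ n) w) = (uminus ^^ n) (scalar c w)"
  by (induction n) (simp_all add: add_map_uminus[OF add_map_scalar])

lemma dform_add:
  assumes "\<And>us. below k (\<psi> us)" "\<And>us. length us \<noteq> k \<Longrightarrow> \<psi> us = 0"
    and "\<And>us. below k (\<psi>' us)" "\<And>us. length us \<noteq> k \<Longrightarrow> \<psi>' us = 0"
  shows "dform (\<lambda>us. \<psi> us + \<psi>' us) us = dform \<psi> us + dform \<psi>' us"
proof (cases "length us = Suc k")
  case True
  have "below k (\<psi> us + \<psi>' us)" for us
    by (rule below_add[OF assms(1,3)])
  from dform_eq[OF this True] show ?thesis
    unfolding dform_eq[OF assms(1) True] dform_eq[OF assms(3) True]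
    by (simp only: split_def sub_add bev_add_right[OF biadd_lact] ract_add_right iterate_uminus_add sum.distrib add_ac)
qed (simp add: dform_length[of k] assms)

lemma dform_scalar:
  assumes "\<And>us. below k (\<psi> us)" "\<And>us. length us \<noteq> k \<Longrightarrow> \<psi> us = 0"
  shows "dform (\<lambda>us. scalar c (\<psi> us)) us = scalar c (dform \<psi> us)"
proof (cases "length us = Suc k")
  case True
  have "below k (scalar c (\<psi> us))" for us
    by (rule below_scalar[OF assms(1)])
  from dform_eq[OF this True] show ?thesis
    unfolding dform_eq[OF assms(1) True]
    by (simp only: split_def scalar_sub bev_scalar scalar_ract scalar_iterate_uminus
        add_map_add[OF add_map_scalar] add_map_sum[OF add_map_scalar])
qed (simp add: dform_length[of k] assms add_map_zero[OF add_map_scalar])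

abbreviation "Ct \<equiv> basic_cochains sA dA actE actM"
abbreviation "C \<equiv> reduced_cochains sA dA actE actM"
abbreviation "VR \<equiv> reduced_polys sA actM"
abbreviation "pr \<equiv> reduced_projection sA actM"

lemma below_all_iff:
  assumes "\<And>us. length us \<noteq> k \<Longrightarrow> \<psi> us = (0 :: 'm mpoly)"
  shows "(\<forall>us. length us = k \<longrightarrow> below k (\<psi> us)) \<longleftrightarrow> (\<forall>us. below k (\<psi> us))"
proof -
  have "below k (\<psi> us)" if "length us \<noteq> k" for us
    by (simp add: assms[OF that])
  then show ?thesis by blast
qed

lemma cochain_set_basic: "cochain_set sA dA actE actM (LP k) (\<lambda>T. T) k = {\<psi>. B.precochain k \<psi>}"
proof -
  have "\<psi> \<in> cochain_set sA dA actE actM (LP k) (\<lambda>T. T) k \<longleftrightarrow> B.cochain_mod k \<psi>" for \<psi>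
    unfolding cochain_set_def B.cochain_mod_def B_cg mem_Collect_eq LP_simps scalar_def
    by (rule conj_cong[OF refl], rule conj_cong[OF below_all_iff refl]) blast
  then show ?thesis
    using B.cochain_mod_precochain B.precochain_cochain_mod by blast
qed

lemma Ct_simps [simp]:
  "carrier (Ct k) = {\<psi>. B.precochain k \<psi>}" "\<phi> \<oplus>\<^bsub>Ct k\<^esub> \<psi> = (\<lambda>us. \<phi> us + \<psi> us)"
  "\<zero>\<^bsub>Ct k\<^esub> = (\<lambda>_. 0)" "c \<odot>\<^bsub>Ct k\<^esub> \<psi> = (\<lambda>us. scalar c (\<psi> us))"
  by (simp_all add: basic_cochains_def fun_module_def cochain_set_basic)

lemma module_Ct: "Module.module F (Ct k)"
  unfolding basic_cochains_def by (rule module_cochains[OF module_LP twist_linear(1) perm_linear(1)])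

lemma cochain_deriv_eq: "cochain_deriv actM k \<psi> = (\<lambda>us. T (sigma k) (\<psi> us))"
  by (rule ext) (simp add: cochain_deriv_def total_deriv_eq)

lemma D_linear: "linear_between F (Ct k) (Ct k) (cochain_deriv actM k)"
  unfolding cochain_deriv_eq
  by (rule linear_betweenI) (simp_all add: B_precochain_T add_map_add[OF add_map_T] scalar_T)

lemma dt_linear: "linear_between F (Ct k) (Ct (Suc k)) dform"
  by (rule linear_betweenI)
    (auto intro!: ext B.precochain_dform dform_add[of k] dform_scalar[of k] dest: B.precochainD(1,2))

lemma dt_T: "B.precochain k \<psi> \<Longrightarrow> dform (cochain_deriv actM k \<psi>) = cochain_deriv actM (Suc k) (dform \<psi>)"
  unfolding cochain_deriv_eq by (rule ext, rule dform_T) (auto dest: B.precochainD(1,2))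

lemma dform_zero_length:
  assumes "\<And>us. length us \<noteq> k \<Longrightarrow> \<psi> us = 0" "length us \<noteq> Suc (Suc k)"
  shows "dform (dform \<psi>) us = 0"
  by (rule dform_length[OF dform_length[OF assms(1)] assms(2)])

lemma complex_Ct: "cochain_complex F Ct (basic_differential br lact)"
  unfolding cochain_complex_def basic_differential_def
proof (intro allI conjI ballI)
  fix k \<psi> assume "\<psi> \<in> carrier (Ct k)"
  then have \<psi>: "B.precochain k \<psi>" by simp
  show "dform (dform \<psi>) = \<zero>\<^bsub>Ct (Suc (Suc k))\<^esub>"
  proof
    fix us
    have "dform (dform \<psi>) us = 0"
    proof (cases "length us = Suc (Suc k)")
      case True
      then show ?thesis using B.dform_dform[OF \<psi>] by (simp add: B.N_T add_map_zero[OF add_map_T])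
    qed (rule dform_zero_length[OF B.precochainD(1)[OF \<psi>]])
    then show "dform (dform \<psi>) us = \<zero>\<^bsub>Ct (Suc (Suc k))\<^esub> us" by simp
  qed
qed (rule module_Ct dt_linear)+

section \<open>Reduced cochains and their representatives\<close>

lemma VR_eq: "VR k = quotient_module (LP k) (TI k)"
  by (simp add: reduced_polys_def)

lemma cl_eq: "cl k = (\<lambda>q. TI k +>\<^bsub>LP k\<^esub> q)"
  by (simp add: fun_eq_iff reduced_class_def)

lemma module_VR: "Module.module F (VR k)"
  unfolding VR_eq by (rule module_quotient_module[OF module_LP submodule_TI])

lemma cl_linear: "linear_between F (LP k) (VR k) (cl k)"
  unfolding VR_eq cl_eq by (rule linear_between_class[OF module_LP submodule_TI])

lemma carrier_VR: "carrier (VR k) = cl k ` {q. below k q}"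
  unfolding VR_eq cl_eq carrier_quotient_module by simp

lemma cl_simps:
  "below k v \<Longrightarrow> cl k v \<in> carrier (VR k)"
  "below k v \<Longrightarrow> below k w \<Longrightarrow> cl k v \<oplus>\<^bsub>VR k\<^esub> cl k w = cl k (v + w)"
  "below k v \<Longrightarrow> c \<odot>\<^bsub>VR k\<^esub> cl k v = cl k (scalar c v)"
  "\<zero>\<^bsub>VR k\<^esub> = cl k 0"
  using linear_betweenD(1)[OF cl_linear, of v k] linear_betweenD(2)[OF cl_linear, of v k w]
    linear_betweenD(3)[OF cl_linear, of c v k] linear_between_zero[OF module_LP module_VR cl_linear, of k]
  by simp_all

lemmas coset_map_cl = coset_map_linear[OF module_LP submodule_TI module_LP submodule_TI, folded VR_eq reduced_class_def]

lemma module_C: "Module.module F (C k)"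
  unfolding reduced_cochains_def
  by (rule module_cochains[OF module_VR])
    (rule coset_map_cl(2)[OF twist_linear] coset_map_cl(2)[OF perm_linear]; assumption)+

lemma C_simps:
  "\<phi> \<oplus>\<^bsub>C k\<^esub> \<psi> = (\<lambda>us. \<phi> us \<oplus>\<^bsub>VR k\<^esub> \<psi> us)"
  "\<zero>\<^bsub>C k\<^esub> = (\<lambda>_. \<zero>\<^bsub>VR k\<^esub>)" "c \<odot>\<^bsub>C k\<^esub> \<psi> = (\<lambda>us. c \<odot>\<^bsub>VR k\<^esub> \<psi> us)"
  by (simp_all add: reduced_cochains_def fun_module_def)

lemma operator_below:
  assumes "below k q"
  shows "length as = k \<Longrightarrow> below k (multi_twist dA actM as q)"
    and "\<pi> permutes {..<k} \<Longrightarrow> below k (signed_perm k \<pi> q)"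
  using linear_betweenD(1)[OF twist_linear(1), of as k q] linear_betweenD(1)[OF perm_linear(1), of \<pi> k q] assms
  by simp_all

text \<open>Together with \<open>C_representative\<close> this reduces statements on reduced
  cochains to congruences between representing functions.\<close>

lemma projection_carrier:
  assumes zero: "\<And>us. length us \<noteq> k \<Longrightarrow> \<psi> us = 0" and below: "\<And>us. below k (\<psi> us)"
  shows "pr k \<psi> \<in> carrier (C k) \<longleftrightarrow> R.precochain k \<psi>"
proof -
  note below_ops = below_add[OF below below] below_scalar[OF below] operator_below[OF below]
  have 1: "(\<forall>us i u v. length us = k \<and> i < k \<longrightarrow>
        cl k (\<psi> (us[i := u + v])) = cl k (\<psi> (us[i := u])) \<oplus>\<^bsub>VR k\<^esub> cl k (\<psi> (us[i := v]))) \<longleftrightarrow>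
      (\<forall>us i u v. length us = k \<and> i < k \<longrightarrow>
        R.cg (sigma k) (\<psi> (us[i := u + v])) (\<psi> (us[i := u]) + \<psi> (us[i := v])))"
    by (simp only: cl_simps(2)[OF below below] cl_eq_iff[OF below below_ops(1)])
  have 2: "(\<forall>us i c u. length us = k \<and> i < k \<longrightarrow>
        cl k (\<psi> (us[i := fact_scale sA actE c u])) = c \<odot>\<^bsub>VR k\<^esub> cl k (\<psi> (us[i := u]))) \<longleftrightarrow>
      (\<forall>us i c u. length us = k \<and> i < k \<longrightarrow>
        R.cg (sigma k) (\<psi> (us[i := fact_scale sA actE c u])) (scalar c (\<psi> (us[i := u]))))"
    by (simp only: cl_simps(3)[OF below] cl_eq_iff[OF below below_ops(2)])
  have "coset_map (LP k) (TI k) (multi_twist dA actM as) (cl k (\<psi> us)) = cl k (multi_twist dA actM as (\<psi> us))"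
    if "length as = k" for as us
    using coset_map_cl(1)[OF twist_linear[OF that]] below by simp
  then have 3: "(\<forall>as us. length as = k \<and> length us = k \<longrightarrow>
        cl k (\<psi> (map2 actE as us)) = coset_map (LP k) (TI k) (multi_twist dA actM as) (cl k (\<psi> us))) \<longleftrightarrow>
      (\<forall>as us. length as = k \<and> length us = k \<longrightarrow>
        R.cg (sigma k) (\<psi> (map2 actE as us)) (multi_twist dA actM as (\<psi> us)))"
    using cl_eq_iff[OF below below_ops(3)] by metis
  have "coset_map (LP k) (TI k) (signed_perm k \<pi>) (cl k (\<psi> us)) = cl k (signed_perm k \<pi> (\<psi> us))"
    if "\<pi> permutes {..<k}" for \<pi> us
    using coset_map_cl(1)[OF perm_linear[OF that]] below by simp
  then have 4: "(\<forall>\<pi> us. \<pi> permutes {..<k} \<and> length us = k \<longrightarrow>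
        cl k (\<psi> us) = coset_map (LP k) (TI k) (signed_perm k \<pi>) (cl k (\<psi> (map (\<lambda>i. us ! \<pi> i) [0..<k])))) \<longleftrightarrow>
      (\<forall>\<pi> us. \<pi> permutes {..<k} \<and> length us = k \<longrightarrow>
        R.cg (sigma k) (\<psi> us) (signed_perm k \<pi> (\<psi> (map (\<lambda>i. us ! \<pi> i) [0..<k]))))"
    using cl_eq_iff[OF below below_ops(4)] by metis
  have 5: "\<forall>us. length us \<noteq> k \<longrightarrow> cl k (\<psi> us) = cl k 0" "\<forall>us. length us = k \<longrightarrow> cl k (\<psi> us) \<in> carrier (VR k)"
    "\<forall>us. length us \<noteq> k \<longrightarrow> \<psi> us = 0" "\<forall>us. below k (\<psi> us)"
    using zero below cl_simps(1)[OF below] by auto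
  have "pr k \<psi> \<in> carrier (C k) \<longleftrightarrow> R.cochain_mod k \<psi>"
    unfolding reduced_cochains_def fun_module_def partial_object.simps cochain_set_def R.cochain_mod_def
      mem_Collect_eq reduced_projection_def comp_def cl_simps(4) 1 2 3 4 scalar_def[symmetric]
    using 5 by blast
  then show ?thesis
    using R.cochain_mod_precochain R.precochain_cochain_mod by blast
qed

lemma precochain_projection: "R.precochain k \<psi> \<Longrightarrow> pr k \<psi> \<in> carrier (C k)"
  using projection_carrier[of k \<psi>] R.precochainD(1,2)[of k \<psi>] by blast

lemma projection_eq_iff:
  assumes "\<And>us. below k (\<psi> us)" "\<And>us. below k (\<psi>' us)"
  shows "pr k \<psi> = pr k \<psi>' \<longleftrightarrow> (\<forall>us. R.cg (sigma k) (\<psi> us) (\<psi>' us))"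
  by (simp add: fun_eq_iff reduced_projection_def cl_eq_iff assms)

lemma C_representative:
  assumes "\<phi> \<in> carrier (C k)"
  obtains \<psi> where "R.precochain k \<psi>" "\<phi> = pr k \<psi>"
proof -
  note c = assms[unfolded reduced_cochains_def fun_module_def partial_object.simps cochain_set_def mem_Collect_eq]
  have \<phi>: "length us \<noteq> k \<Longrightarrow> \<phi> us = cl k 0" "length us = k \<Longrightarrow> \<phi> us \<in> cl k ` {q. below k q}" for us
    using conjunct1[OF c] conjunct1[OF conjunct2[OF c]] by (simp_all add: cl_simps(4) carrier_VR)
  have "\<exists>q. below k q \<and> (length us \<noteq> k \<longrightarrow> q = 0) \<and> \<phi> us = cl k q" for us
    using \<phi>[of us] by (cases "length us = k") auto
  then have "\<exists>\<psi>. \<forall>us. below k (\<psi> us) \<and> (length us \<noteq> k \<longrightarrow> \<psi> us = 0) \<and> \<phi> us = cl k (\<psi> us)"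
    by (intro choice) blast
  then obtain \<psi> where \<psi>: "\<And>us. below k (\<psi> us)" "\<And>us. length us \<noteq> k \<Longrightarrow> \<psi> us = 0" "\<And>us. \<phi> us = cl k (\<psi> us)"
    by blast
  have \<phi>\<psi>: "\<phi> = pr k \<psi>" by (rule ext) (simp add: reduced_projection_def \<psi>(3))
  have "R.precochain k \<psi>" using assms projection_carrier[of k \<psi>, OF \<psi>(2,1)] unfolding \<phi>\<psi> by blast
  then show thesis using \<phi>\<psi> by (rule that)
qed

text \<open>The definition unites classes over all functions that represent the cochain value by
  value. Each of them is a precochain congruent to \<psi>, so by \<open>dform_cong\<close> all
  classes coincide and the union is a single class.\<close>

lemma reduced_differential_eq:
  assumes \<psi>: "R.precochain k \<psi>"
  shows "reduced_differential sA actM br lact k (pr k \<psi>) = pr (Suc k) (dform \<psi>)"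
proof
  fix us
  note c = R.precochainD(1,2)[OF \<psi>]
  have "cl (Suc k) (dform \<psi>' us) = cl (Suc k) (dform \<psi> us)"
    if eq: "pr k \<psi>' = pr k \<psi>" and zero: "\<And>vs. length vs \<noteq> k \<Longrightarrow> \<psi>' vs = 0" for \<psi>'
  proof -
    interpret N: abelian_subgroup "TI k" "LP k"
      by (rule abelian_subgroup_submodule[OF module_LP submodule_TI])
    \<comment> \<open>That values of a representative involve only the first k variables is not part
      of its definition. It holds because each value lies in its own class, which is the class of
      \<open>\<psi> vs\<close>.\<close>
    have below: "below k (\<psi>' vs)" for vs
    proof -
      have "TI k +>\<^bsub>LP k\<^esub> \<psi>' vs = TI k +>\<^bsub>LP k\<^esub> \<psi> vs"
        using fun_cong[OF eq, of vs] by (simp add: reduced_projection_def reduced_class_def)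
      moreover have "0 \<in> TI k" using additive_subgroup.zero_closed[OF N.is_additive_subgroup] unfolding LP_simps .
      then have "\<psi>' vs \<in> TI k +>\<^bsub>LP k\<^esub> \<psi>' vs"
        unfolding a_r_coset_def' by (intro UN_I[of 0]) simp_all
      ultimately show ?thesis
        using N.a_elemrcos_carrier[of "\<psi> vs" "\<psi>' vs"] c(2)[of vs] by simp
    qed
    have \<psi>': "R.precochain k \<psi>'"
      using projection_carrier[of k \<psi>', OF zero below] precochain_projection[OF \<psi>] eq by simp
    show ?thesis
    proof (cases "length us = Suc k")
      case True
      have "\<And>vs. R.cg (sigma k) (\<psi>' vs) (\<psi> vs)"
        using eq projection_eq_iff[of k \<psi>' \<psi>, OF below c(2)] by blast
      from R.dform_cong[OF \<psi>' \<psi> this True] show ?thesis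
        using cl_eq_iff[of "Suc k" "dform \<psi>' us" "dform \<psi> us"] below_dform[of k \<psi>' us, OF zero below]
          below_dform[of k \<psi> us, OF c] by blast
    qed (simp add: dform_length[of k] zero c(1))
  qed
  then have "(\<Union>\<psi>'\<in>{\<psi>'. pr k \<psi>' = pr k \<psi> \<and> (\<forall>vs. length vs \<noteq> k \<longrightarrow> \<psi>' vs = 0)}. cl (Suc k) (dform \<psi>' us)) =
      cl (Suc k) (dform \<psi> us)"
    using c(1) by blast
  then show "reduced_differential sA actM br lact k (pr k \<psi>) us = pr (Suc k) (dform \<psi>) us"
    by (simp add: reduced_differential_def reduced_projection_def)
qed

lemma pr_add:
  assumes "\<And>us. below k (\<psi> us)" "\<And>us. below k (\<psi>' us)"
  shows "pr k (\<lambda>us. \<psi> us + \<psi>' us) = pr k \<psi> \<oplus>\<^bsub>C k\<^esub> pr k \<psi>'"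
  by (simp add: fun_eq_iff C_simps reduced_projection_def cl_simps assms)

lemma pr_scalar:
  assumes "\<And>us. below k (\<psi> us)"
  shows "pr k (\<lambda>us. scalar c (\<psi> us)) = c \<odot>\<^bsub>C k\<^esub> pr k \<psi>"
  by (simp add: fun_eq_iff C_simps reduced_projection_def cl_simps assms)

lemma d_linear: "linear_between F (C k) (C (Suc k)) (reduced_differential sA actM br lact k)"
proof (rule linear_betweenI)
  interpret V: Module.module F "C k" by (rule module_C)
  fix \<phi> assume \<phi>: "\<phi> \<in> carrier (C k)"
  obtain \<psi> where \<psi>: "R.precochain k \<psi>" "\<phi> = pr k \<psi>" using C_representative[OF \<phi>] .
  note c = R.precochainD(1,2)[OF \<psi>(1)]
  show "reduced_differential sA actM br lact k \<phi> \<in> carrier (C (Suc k))"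
    unfolding \<psi>(2) reduced_differential_eq[OF \<psi>(1)] by (rule precochain_projection[OF R.precochain_dform[OF \<psi>(1)]])
  show "reduced_differential sA actM br lact k (e \<odot>\<^bsub>C k\<^esub> \<phi>) = e \<odot>\<^bsub>C (Suc k)\<^esub> reduced_differential sA actM br lact k \<phi>" for e
  proof -
    have eq: "pr k (\<lambda>us. scalar e (\<psi> us)) = e \<odot>\<^bsub>C k\<^esub> \<phi>"
      unfolding \<psi>(2) by (rule pr_scalar[OF c(2)])
    have "R.precochain k (\<lambda>us. scalar e (\<psi> us))"
      using projection_carrier[of k "\<lambda>us. scalar e (\<psi> us)"] c V.smult_closed[OF _ \<phi>, of e] below_scalar[OF c(2)]
      by (simp add: eq add_map_zero[OF add_map_scalar])
    from reduced_differential_eq[OF this]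
    have "reduced_differential sA actM br lact k (e \<odot>\<^bsub>C k\<^esub> \<phi>) = pr (Suc k) (dform (\<lambda>us. scalar e (\<psi> us)))"
      unfolding eq .
    also have "dform (\<lambda>us. scalar e (\<psi> us)) = (\<lambda>us. scalar e (dform \<psi> us))"
      by (rule ext, rule dform_scalar[OF c(2,1)])
    also have "pr (Suc k) \<dots> = e \<odot>\<^bsub>C (Suc k)\<^esub> pr (Suc k) (dform \<psi>)"
      by (rule pr_scalar[OF below_dform[OF c]])
    finally show ?thesis unfolding \<psi>(2) reduced_differential_eq[OF \<psi>(1)] .
  qed
  fix \<phi>' assume \<phi>': "\<phi>' \<in> carrier (C k)"
  obtain \<psi>' where \<psi>': "R.precochain k \<psi>'" "\<phi>' = pr k \<psi>'" using C_representative[OF \<phi>'] .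
  note c' = R.precochainD(1,2)[OF \<psi>'(1)]
  have eq: "pr k (\<lambda>us. \<psi> us + \<psi>' us) = \<phi> \<oplus>\<^bsub>C k\<^esub> \<phi>'"
    unfolding \<psi>(2) \<psi>'(2) by (rule pr_add[OF c(2) c'(2)])
  have "R.precochain k (\<lambda>us. \<psi> us + \<psi>' us)"
    using projection_carrier[of k "\<lambda>us. \<psi> us + \<psi>' us"] c(1) c'(1) V.M.a_closed[OF \<phi> \<phi>'] below_add[OF c(2) c'(2)]
    by (simp add: eq)
  from reduced_differential_eq[OF this]
  have "reduced_differential sA actM br lact k (\<phi> \<oplus>\<^bsub>C k\<^esub> \<phi>') = pr (Suc k) (dform (\<lambda>us. \<psi> us + \<psi>' us))"
    unfolding eq .
  also have "dform (\<lambda>us. \<psi> us + \<psi>' us) = (\<lambda>us. dform \<psi> us + dform \<psi>' us)"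
    by (rule ext, rule dform_add[OF c(2,1) c'(2,1)])
  also have "pr (Suc k) \<dots> = pr (Suc k) (dform \<psi>) \<oplus>\<^bsub>C (Suc k)\<^esub> pr (Suc k) (dform \<psi>')"
    by (rule pr_add[OF below_dform[OF c] below_dform[OF c']])
  finally show "reduced_differential sA actM br lact k (\<phi> \<oplus>\<^bsub>C k\<^esub> \<phi>') =
      reduced_differential sA actM br lact k \<phi> \<oplus>\<^bsub>C (Suc k)\<^esub> reduced_differential sA actM br lact k \<phi>'"
    unfolding \<psi>(2) \<psi>'(2) reduced_differential_eq[OF \<psi>(1)] reduced_differential_eq[OF \<psi>'(1)] .
qed

lemma projection_zero_iff:
  assumes "\<And>us. below k (\<psi> us)"
  shows "pr k \<psi> = \<zero>\<^bsub>C k\<^esub> \<longleftrightarrow> (\<forall>us. \<psi> us \<in> R.N (sigma k))"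
  by (simp add: fun_eq_iff C_simps reduced_projection_def cl_simps(4) cl_eq_iff assms R.cg_zero_iff)

lemma complex_C: "cochain_complex F C (reduced_differential sA actM br lact)"
  unfolding cochain_complex_def
proof (intro allI conjI ballI)
  fix k \<phi> assume \<phi>: "\<phi> \<in> carrier (C k)"
  obtain \<psi> where \<psi>: "R.precochain k \<psi>" "\<phi> = pr k \<psi>" using C_representative[OF \<phi>] .
  note d\<psi> = R.precochain_dform[OF \<psi>(1)]
  have "dform (dform \<psi>) us \<in> R.N (sigma (Suc (Suc k)))" for us
  proof (cases "length us = Suc (Suc k)")
    case False
    then show ?thesis
      by (simp add: dform_zero_length[OF R.precochainD(1)[OF \<psi>(1)]] R.N_zero)
  qed (rule R.dform_dform[OF \<psi>(1)])
  then show "reduced_differential sA actM br lact (Suc k) (reduced_differential sA actM br lact k \<phi>) = \<zero>\<^bsub>C (Suc (Suc k))\<^esub>"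
    unfolding \<psi>(2) reduced_differential_eq[OF \<psi>(1)] reduced_differential_eq[OF d\<psi>]
      projection_zero_iff[OF R.precochainD(2)[OF R.precochain_dform[OF d\<psi>]]] by blast
qed (rule module_C d_linear)+

section \<open>The comparison map: kernel, surjectivity, induced maps\<close>

theorem projection_morphism: "complex_morphism F Ct (basic_differential br lact) C (reduced_differential sA actM br lact) pr"
  unfolding complex_morphism_def
proof (intro conjI allI ballI)
  fix k
  show "linear_between F (Ct k) (C k) (pr k)"
  proof (rule linear_betweenI)
    fix \<psi> assume "\<psi> \<in> carrier (Ct k)"
    then have \<psi>: "B.precochain k \<psi>" by simp
    show "pr k \<psi> \<in> carrier (C k)"
      by (rule precochain_projection[OF R_precochain_of_B[OF \<psi>]])
    show "pr k (c \<odot>\<^bsub>Ct k\<^esub> \<psi>) = c \<odot>\<^bsub>C k\<^esub> pr k \<psi>" for c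
      unfolding Ct_simps by (rule pr_scalar[OF B.precochainD(2)[OF \<psi>]])
    fix \<psi>' assume "\<psi>' \<in> carrier (Ct k)"
    then have \<psi>': "B.precochain k \<psi>'" by simp
    show "pr k (\<psi> \<oplus>\<^bsub>Ct k\<^esub> \<psi>') = pr k \<psi> \<oplus>\<^bsub>C k\<^esub> pr k \<psi>'"
      unfolding Ct_simps by (rule pr_add[OF B.precochainD(2)[OF \<psi>] B.precochainD(2)[OF \<psi>']])
  qed
  fix \<psi> assume "\<psi> \<in> carrier (Ct k)"
  then have "R.precochain k \<psi>" by (simp add: R_precochain_of_B)
  from reduced_differential_eq[OF this]
  show "pr (Suc k) (basic_differential br lact k \<psi>) = reduced_differential sA actM br lact k (pr k \<psi>)"
    by (simp add: basic_differential_def)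
qed (rule complex_Ct complex_C)+

theorem projection_kernel: "{\<psi> \<in> carrier (Ct k). pr k \<psi> = \<zero>\<^bsub>C k\<^esub>} = cochain_deriv actM k ` carrier (Ct k)"
proof (intro equalityI subsetI)
  fix \<psi> assume "\<psi> \<in> {\<psi> \<in> carrier (Ct k). pr k \<psi> = \<zero>\<^bsub>C k\<^esub>}"
  then have \<psi>: "B.precochain k \<psi>" "pr k \<psi> = \<zero>\<^bsub>C k\<^esub>" by simp_all
  then have "\<And>us. \<psi> us \<in> R.N (sigma k)"
    using projection_zero_iff[of k \<psi>, OF B.precochainD(2)[OF \<psi>(1)]] by blast
  from B_precochain_in_image[OF \<psi>(1) this]
  show "\<psi> \<in> cochain_deriv actM k ` carrier (Ct k)"
    unfolding cochain_deriv_eq Ct_simps by blast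
next
  fix \<psi> assume "\<psi> \<in> cochain_deriv actM k ` carrier (Ct k)"
  then obtain \<chi> where \<chi>: "B.precochain k \<chi>" "\<psi> = (\<lambda>us. T (sigma k) (\<chi> us))"
    by (auto simp: cochain_deriv_eq)
  have \<psi>: "B.precochain k \<psi>" unfolding \<chi>(2) by (rule B_precochain_T[OF \<chi>(1)])
  moreover have "\<psi> us \<in> R.N (sigma k)" for us
    unfolding \<chi>(2) by (simp add: R.N_T)
  ultimately show "\<psi> \<in> {\<psi> \<in> carrier (Ct k). pr k \<psi> = \<zero>\<^bsub>C k\<^esub>}"
    using projection_zero_iff[of k \<psi>, OF B.precochainD(2)[OF \<psi>]] by simp
qed

theorem projection_surjective:
  assumes "free_dop_module actE"
  shows "pr k ` carrier (Ct k) = carrier (C k)"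
proof (intro equalityI subsetI)
  fix \<phi> assume "\<phi> \<in> pr k ` carrier (Ct k)"
  then show "\<phi> \<in> carrier (C k)"
    using precochain_projection[OF R_precochain_of_B] by auto
next
  fix \<phi> assume \<phi>: "\<phi> \<in> carrier (C k)"
  obtain \<psi> where \<psi>: "R.precochain k \<psi>" "\<phi> = pr k \<psi>" using C_representative[OF \<phi>] .
  obtain \<chi> where \<chi>: "B.precochain k \<chi>" "\<forall>us. length us = k \<longrightarrow> R.cg (sigma k) (\<chi> us) (\<psi> us)"
    using B_precochain_lift[OF assms R.precochain_cochain_mod[OF \<psi>(1)]] by blast
  have "R.cg (sigma k) (\<chi> us) (\<psi> us)" for us
    using \<chi>(2) B.precochainD(1)[OF \<chi>(1)] R.precochainD(1)[OF \<psi>(1)] by (cases "length us = k") auto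
  then have "pr k \<chi> = \<phi>"
    unfolding \<psi>(2) using projection_eq_iff[of k \<chi> \<psi>, OF B.precochainD(2)[OF \<chi>(1)] R.precochainD(2)[OF \<psi>(1)]] by blast
  then show "\<phi> \<in> pr k ` carrier (Ct k)" using \<chi>(1) by auto
qed

lemma submodule_deriv_image: "submodule (basic_deriv_image sA dA actE actM k) F (Ct k)"
  unfolding basic_deriv_image_def by (rule submodule_linear_image[OF module_Ct module_Ct D_linear])

lemma dt_deriv_image:
  "basic_differential br lact k ` basic_deriv_image sA dA actE actM k \<subseteq> basic_deriv_image sA dA actE actM (Suc k)"
  using linear_betweenD(1)[OF dt_linear, of _ k] dt_T
  by (auto simp: basic_deriv_image_def basic_differential_def)

lemmas deriv_image_kernel = projection_kernel[symmetric, folded basic_deriv_image_def]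

lemmas quotient_facts =
  quotient_complex[OF complex_Ct submodule_deriv_image dt_deriv_image]
  quotient_morphism[OF projection_morphism submodule_deriv_image dt_deriv_image deriv_image_kernel]

end

theorem proposition3p5:
  fixes sA :: "'f::field_char_0 \<Rightarrow> 'a::comm_ring_1 \<Rightarrow> 'a"
    and dA :: "'a \<Rightarrow> 'a"
    and actE :: "'a poly \<Rightarrow> 'e::ab_group_add \<Rightarrow> 'e"
    and br :: "'e \<Rightarrow> 'e \<Rightarrow> 'e poly"
    and anchor :: "'e \<Rightarrow> 'a \<Rightarrow> 'a poly"
    and actM :: "'a poly \<Rightarrow> 'm::ab_group_add \<Rightarrow> 'm"
    and lact :: "'e \<Rightarrow> 'm \<Rightarrow> 'm poly"
  defines "F \<equiv> ring_of_class :: 'f ring"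
    and "Ct \<equiv> basic_cochains sA dA actE actM"
    and "dt \<equiv> basic_differential br lact"
    and "D \<equiv> cochain_deriv actM"
    and "Cb \<equiv> quotient_cochains sA dA actE actM"
    and "db \<equiv> quotient_differential sA dA actE actM br lact"
    and "cls \<equiv> quotient_class sA dA actE actM"
    and "C \<equiv> reduced_cochains sA dA actE actM"
    and "d \<equiv> reduced_differential sA actM br lact"
    and "pr \<equiv> reduced_projection sA actM"
    and "prb \<equiv> induced_projection sA actM"
  assumes E: "lie_conformal_algebroid sA dA actE br anchor"
    and M: "lie_conformal_algebroid_module sA dA actE br anchor actM lact"
  shows
    "((\<forall>k. Module.module (ring_of_class :: 'f poly ring) (poly_module (Ct k) (D k))) \<and>
      (\<forall>k. \<forall>\<phi>\<in>carrier (Ct k). D k \<phi> \<in> carrier (Ct k) \<and> dt k (D k \<phi>) = D (Suc k) (dt k \<phi>)) \<and>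
      cochain_complex F Cb db \<and>
      (\<forall>k. \<forall>\<phi>\<in>carrier (Ct k). db k (cls k \<phi>) = cls (Suc k) (dt k \<phi>))) \<and>
     (complex_morphism F Ct dt C d pr \<and>
      (\<forall>k. {\<phi> \<in> carrier (Ct k). pr k \<phi> = \<zero>\<^bsub>C k\<^esub>} = D k ` carrier (Ct k)) \<and>
      complex_morphism F Cb db C d prb \<and>
      (\<forall>k. \<forall>\<phi>\<in>carrier (Ct k). prb k (cls k \<phi>) = pr k \<phi>) \<and>
      (\<forall>k. inj_on (prb k) (carrier (Cb k))) \<and>
      (free_dop_module actE \<longrightarrow> (\<forall>k. prb k ` carrier (Cb k) = carrier (C k))))"
proof -
  interpret lie_conformal_algebroid_module sA dA actE br anchor actM lact by (rule M)
  have Cb: "Cb k = quotient_module (Ct k) (basic_deriv_image sA dA actE actM k)" for k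
    by (simp add: Cb_def Ct_def quotient_cochains_def)
  have db: "db k = coset_map (Ct (Suc k)) (basic_deriv_image sA dA actE actM (Suc k)) (dt k)" for k
    by (simp add: db_def Ct_def dt_def quotient_differential_def)
  have cls: "cls k \<phi> = basic_deriv_image sA dA actE actM k +>\<^bsub>Ct k\<^esub> \<phi>" for k \<phi>
    by (simp add: cls_def Ct_def quotient_class_def)
  have prb: "prb k X = the_elem (pr k ` X)" for k X
    by (simp add: prb_def pr_def induced_projection_def)
  note q = quotient_facts[folded Ct_def dt_def C_def d_def pr_def F_def, folded Cb db prb cls]
  show ?thesis
  proof (intro conjI allI ballI impI)
    fix k
    show "Module.module (ring_of_class :: 'f poly ring) (poly_module (Ct k) (D k))"
      unfolding Ct_def D_def by (rule module_poly_module[OF module_Ct D_linear])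
    show "{\<phi> \<in> carrier (Ct k). pr k \<phi> = \<zero>\<^bsub>C k\<^esub>} = D k ` carrier (Ct k)"
      unfolding Ct_def C_def pr_def D_def by (rule projection_kernel)
    show "inj_on (prb k) (carrier (Cb k))" by (rule q(5))
    show "prb k ` carrier (Cb k) = carrier (C k)" if "free_dop_module actE"
      using q(6)[of k] projection_surjective[OF that, of k] unfolding Ct_def C_def pr_def by (rule trans)
    fix \<phi> assume \<phi>: "\<phi> \<in> carrier (Ct k)"
    show "D k \<phi> \<in> carrier (Ct k)"
      using linear_betweenD(1)[OF D_linear] \<phi> unfolding Ct_def D_def by blast
    show "dt k (D k \<phi>) = D (Suc k) (dt k \<phi>)"
      using dt_T \<phi> by (simp add: Ct_def D_def dt_def basic_differential_def)
    show "db k (cls k \<phi>) = cls (Suc k) (dt k \<phi>)" by (rule q(2)[OF \<phi>])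
    show "prb k (cls k \<phi>) = pr k \<phi>" by (rule q(4)[OF \<phi>])
  next
    show "cochain_complex F Cb db" by (rule q(1))
    show "complex_morphism F Ct dt C d pr"
      unfolding F_def Ct_def dt_def C_def d_def pr_def by (rule projection_morphism)
    show "complex_morphism F Cb db C d prb" by (rule q(3))
  qed
qed

end
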